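(* Let $G$ be a compact group and $G_0\le G$ its identity connected component. (1) Suppose that the abelianization $G_0/G_0'$ of $G_0$ is metrizable. Then the following conditions are equivalent: (a) $G$ is a Lie group. (b) Every free continuous action of $G$ on a Tychonoff space $X$ is principal, i.e. $X\to X/G$ is a locally trivial principal $G$-bundle. (c) Every free continuous action of $G$ on a compact Hausdorff space is principal. (2) Suppose that $G$ is connected. Then the following conditions are equivalent: (a) $G$ is a Lie group. (b) For every closed central subgroup $H\le Z(G)$ and every continuous action of $G$ on a Tychonoff space $X$ all of whose isotropy groups are equal to $H$, the action is $G/H$-principal, i.e. $X\to X/G$ is a locally trivial principal $G/H$-bundle. (c) For every closed central subgroup $H\le Z(G)$ and every continuous action of $G$ on a compact Hausdorff space $X$ all of whose isotropy groups are equal to $H$, the action is $G/H$-principal.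
   Context: Compact groups are compact Hausdorff topological groups; Tychonoff ($T_{3\frac12}$) spaces are completely regular Hausdorff spaces. For a compact connected group $G_0$, $G_0'$ denotes the algebraic commutator subgroup, which is automatically closed. The isotropy group of $x\in X$ is $G_x=\{g\in G: gx=x\}$; an action is free if all isotropy groups are trivial. If all isotropy groups equal a closed central subgroup $H$, then $G/H$ acts freely on $X$ and $X/G=X/(G/H)$. A free action of a group $K$ on $X$ gives a locally trivial principal $K$-bundle if every point of $X/K$ has an open neighborhood $U$ whose preimage in $X$ is $K$-equivariantly homeomorphic over $U$ to $K\times U$ (with $K$ acting by left translation on the first factor). *)

theory Defs
  imports "HOL-Analysis.Analysis" "HOL-Algebra.Group_Action" "HOL-Algebra.Generated_Groups"
begin

section \<open>Quotient topologies\<close>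

definition quotient_topology :: "'a topology \<Rightarrow> ('a \<Rightarrow> 'b) \<Rightarrow> 'b topology" where
  "quotient_topology X f =
     topology (\<lambda>V. V \<subseteq> f ` topspace X \<and> openin X {x \<in> topspace X. f x \<in> V})"

lemma openin_quotient_topology:
  "openin (quotient_topology X f) V \<longleftrightarrow>
     V \<subseteq> f ` topspace X \<and> openin X {x \<in> topspace X. f x \<in> V}"
proof -
  have "istopology (\<lambda>V. V \<subseteq> f ` topspace X \<and> openin X {x \<in> topspace X. f x \<in> V})"
    unfolding istopology_def
  proof (intro conjI allI impI)
    fix S T
    assume "S \<subseteq> f ` topspace X \<and> openin X {x \<in> topspace X. f x \<in> S}"
      and "T \<subseteq> f ` topspace X \<and> openin X {x \<in> topspace X. f x \<in> T}"
    moreover have "{x \<in> topspace X. f x \<in> S \<inter> T} =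
        {x \<in> topspace X. f x \<in> S} \<inter> {x \<in> topspace X. f x \<in> T}"
      by blast
    ultimately show "S \<inter> T \<subseteq> f ` topspace X" "openin X {x \<in> topspace X. f x \<in> S \<inter> T}"
      by (auto intro: openin_Int)
  next
    fix \<K>
    assume K: "\<forall>V\<in>\<K>. V \<subseteq> f ` topspace X \<and> openin X {x \<in> topspace X. f x \<in> V}"
    then show "\<Union>\<K> \<subseteq> f ` topspace X"
      by blast
    have "{x \<in> topspace X. f x \<in> \<Union>\<K>} = (\<Union>V\<in>\<K>. {x \<in> topspace X. f x \<in> V})"
      by blast
    then show "openin X {x \<in> topspace X. f x \<in> \<Union>\<K>}"
      using K by auto
  qed
  then show ?thesis
    by (simp add: quotient_topology_def topology_inverse')
qed

lemma topspace_quotient_topology [simp]: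
  "topspace (quotient_topology X f) = f ` topspace X"
proof -
  have "{x \<in> topspace X. f x \<in> f ` topspace X} = topspace X"
    by blast
  then have "openin (quotient_topology X f) (f ` topspace X)"
    by (simp add: openin_quotient_topology)
  then have "f ` topspace X \<subseteq> topspace (quotient_topology X f)"
    by (rule openin_subset)
  moreover have "topspace (quotient_topology X f) \<subseteq> f ` topspace X"
    using openin_topspace[of "quotient_topology X f"] unfolding openin_quotient_topology by blast
  ultimately show ?thesis
    by (rule subset_antisym[rotated])
qed

lemma quotient_map_quotient_topology: "quotient_map X (quotient_topology X f) f"
  unfolding quotient_map_def openin_quotient_topology topspace_quotient_topology by blast


section \<open>Topological groups\<close>

locale topological_group = group G for G :: "('a, 'm) monoid_scheme" (structure) +
  fixes T :: "'a topology"
  assumes topspace_eq_carrier: "topspace T = carrier G"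
    and continuous_mult: "continuous_map (prod_topology T T) T (\<lambda>(x, y). x \<otimes> y)"
    and continuous_inv: "continuous_map T T (\<lambda>x. inv x)"

locale compact_group = topological_group +
  assumes compact: "compact_space T"
    and Hausdorff: "Hausdorff_space T"

definition identity_component :: "('a, 'm) monoid_scheme \<Rightarrow> 'a topology \<Rightarrow> 'a set" where
  "identity_component G T = connected_component_of_set T \<one>\<^bsub>G\<^esub>"

text \<open>
  \<open>T\<close> is a topology on a subgroup of \<open>G\<close> containing \<open>H\<close>; the points of the quotient are
  the cosets of \<open>H\<close> in that subgroup.
\<close>

definition coset_topology ::
    "('a, 'm) monoid_scheme \<Rightarrow> 'a topology \<Rightarrow> 'a set \<Rightarrow> 'a set topology" where
  "coset_topology G T H = quotient_topology T (\<lambda>g. H #>\<^bsub>G\<^esub> g)"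

text \<open>The topology of \<open>G\<^sub>0/G\<^sub>0'\<close>; \<open>derived\<close> is the algebraic commutator subgroup.\<close>

definition abelianized_component_topology ::
    "('a, 'm) monoid_scheme \<Rightarrow> 'a topology \<Rightarrow> 'a set topology" where
  "abelianized_component_topology G T =
     (let G\<^sub>0 = identity_component G T
      in coset_topology G (subtopology T G\<^sub>0) (derived G G\<^sub>0))"

definition central_subgroup :: "'a set \<Rightarrow> ('a, 'm) monoid_scheme \<Rightarrow> bool" where
  "central_subgroup H G \<longleftrightarrow>
     subgroup H G \<and> (\<forall>h\<in>H. \<forall>g\<in>carrier G. h \<otimes>\<^bsub>G\<^esub> g = g \<otimes>\<^bsub>G\<^esub> h)"


section \<open>Smooth manifolds and Lie groups\<close>

text \<open>
  The dimension has to be a bound variable (and may be 0, as for finite groups), so \<open>\<real>\<^sup>n\<close> is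
  \<^const>\<open>Euclidean_space\<close> \<open>n\<close>: real sequences vanishing from index \<open>n\<close> on.
  \<open>C_k k n U f\<close> says that \<open>f\<close> is \<open>k\<close> times continuously differentiable on \<open>U\<close>, a set that
  is open in \<open>\<real>\<^sup>n\<close>: the function \<open>g\<close> below is the \<open>i\<close>-th partial derivative of \<open>f\<close>.
\<close>

primrec C_k :: "nat \<Rightarrow> nat \<Rightarrow> (nat \<Rightarrow> real) set \<Rightarrow> ((nat \<Rightarrow> real) \<Rightarrow> real) \<Rightarrow> bool" where
  "C_k 0 n U f \<longleftrightarrow> continuous_map (subtopology (Euclidean_space n) U) euclideanreal f"
| "C_k (Suc k) n U f \<longleftrightarrow>
     continuous_map (subtopology (Euclidean_space n) U) euclideanreal f \<and>
     (\<forall>i<n. \<exists>g. (\<forall>x\<in>U. ((\<lambda>t. f (x(i := t))) has_real_derivative g x) (at (x i))) \<and>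
                C_k k n U g)"

definition smooth_on ::
    "nat \<Rightarrow> nat \<Rightarrow> (nat \<Rightarrow> real) set \<Rightarrow> ((nat \<Rightarrow> real) \<Rightarrow> (nat \<Rightarrow> real)) \<Rightarrow> bool" where
  "smooth_on m n U f \<longleftrightarrow> (\<forall>j<n. \<forall>k. C_k k m U (\<lambda>x. f x j))"

type_synonym 'a chart = "'a set \<times> ('a \<Rightarrow> (nat \<Rightarrow> real))"

definition chart_on :: "nat \<Rightarrow> 'a topology \<Rightarrow> 'a chart \<Rightarrow> bool" where
  "chart_on n X = (\<lambda>(U, \<phi>). openin X U \<and> openin (Euclidean_space n) (\<phi> ` U) \<and>
     homeomorphic_map (subtopology X U) (subtopology (Euclidean_space n) (\<phi> ` U)) \<phi>)"

definition smooth_atlas :: "nat \<Rightarrow> 'a topology \<Rightarrow> 'a chart set \<Rightarrow> bool" where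
  "smooth_atlas n X A \<longleftrightarrow>
     (\<forall>c\<in>A. chart_on n X c) \<and> \<Union> (fst ` A) = topspace X \<and>
     (\<forall>(U, \<phi>)\<in>A. \<forall>(V, \<psi>)\<in>A. smooth_on n n (\<phi> ` (U \<inter> V)) (\<psi> \<circ> inv_into U \<phi>))"

definition smooth_manifold :: "nat \<Rightarrow> 'a topology \<Rightarrow> 'a chart set \<Rightarrow> bool" where
  "smooth_manifold n X A \<longleftrightarrow>
     Hausdorff_space X \<and> second_countable X \<and> smooth_atlas n X A"

definition smooth_map ::
    "nat \<Rightarrow> 'a topology \<Rightarrow> 'a chart set \<Rightarrow> nat \<Rightarrow> 'b topology \<Rightarrow> 'b chart set \<Rightarrow> ('a \<Rightarrow> 'b) \<Rightarrow> bool"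
  where
  "smooth_map m X A n Y B f \<longleftrightarrow>
     continuous_map X Y f \<and>
     (\<forall>(U, \<phi>)\<in>A. \<forall>(V, \<psi>)\<in>B.
        smooth_on m n (\<phi> ` {x \<in> U. f x \<in> V}) (\<psi> \<circ> f \<circ> inv_into U \<phi>))"

text \<open>The product atlas, with \<open>\<real>\<^sup>m \<times> \<real>\<^sup>n\<close> identified with \<open>\<real>\<^sup>m\<^sup>+\<^sup>n\<close> by concatenation.\<close>

definition prod_atlas :: "nat \<Rightarrow> 'a chart set \<Rightarrow> 'b chart set \<Rightarrow> ('a \<times> 'b) chart set" where
  "prod_atlas m A B =
     {(U \<times> V, \<lambda>(x, y) i. if i < m then \<phi> x i else \<psi> y (i - m)) | U \<phi> V \<psi>.
        (U, \<phi>) \<in> A \<and> (V, \<psi>) \<in> B}"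

definition Lie_group :: "('a, 'm) monoid_scheme \<Rightarrow> 'a topology \<Rightarrow> bool" where
  "Lie_group G T \<longleftrightarrow>
     topological_group G T \<and>
     (\<exists>n A. smooth_manifold n T A \<and>
        smooth_map (n + n) (prod_topology T T) (prod_atlas n A A) n T A (\<lambda>(x, y). x \<otimes>\<^bsub>G\<^esub> y) \<and>
        smooth_map n T A n T A (\<lambda>x. inv\<^bsub>G\<^esub> x))"


section \<open>Continuous actions and principal bundles\<close>

text \<open>
  Types cannot be quantified inside a formula. "Every space" on which a group over \<open>'a\<close> acts is
  therefore rendered as every topology, with an arbitrary set of points, on the type
  \<open>'a set set + 'x\<close> for an arbitrary type \<open>'x\<close>: this contains a copy of every type \<open>'x\<close>, and it
  is never too small compared with the group.
\<close>

definition continuous_action ::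
    "('a, 'm) monoid_scheme \<Rightarrow> 'a topology \<Rightarrow> 'x topology \<Rightarrow> ('a \<Rightarrow> 'x \<Rightarrow> 'x) \<Rightarrow> bool" where
  "continuous_action G T X \<phi> \<longleftrightarrow>
     group_action G (topspace X) \<phi> \<and>
     continuous_map (prod_topology T X) X (\<lambda>(g, x). \<phi> g x)"

definition free_action ::
    "('a, 'm) monoid_scheme \<Rightarrow> 'x topology \<Rightarrow> ('a \<Rightarrow> 'x \<Rightarrow> 'x) \<Rightarrow> bool" where
  "free_action G X \<phi> \<longleftrightarrow> (\<forall>x\<in>topspace X. stabilizer G \<phi> x = {\<one>\<^bsub>G\<^esub>})"

definition orbit_space ::
    "('a, 'm) monoid_scheme \<Rightarrow> 'x topology \<Rightarrow> ('a \<Rightarrow> 'x \<Rightarrow> 'x) \<Rightarrow> 'x set topology" where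
  "orbit_space G X \<phi> = quotient_topology X (orbit G \<phi>)"

definition locally_trivial_principal_bundle ::
    "('k, 'm) monoid_scheme \<Rightarrow> 'k topology \<Rightarrow> 'x topology \<Rightarrow> ('k \<Rightarrow> 'x \<Rightarrow> 'x) \<Rightarrow> bool" where
  "locally_trivial_principal_bundle K T X \<phi> \<longleftrightarrow>
     (\<forall>z \<in> topspace (orbit_space K X \<phi>).
        \<exists>U h. openin (orbit_space K X \<phi>) U \<and> z \<in> U \<and>
          (let P = {x \<in> topspace X. orbit K \<phi> x \<in> U} in
             homeomorphic_map (subtopology X P)
               (prod_topology T (subtopology (orbit_space K X \<phi>) U)) h \<and>
             (\<forall>x\<in>P. snd (h x) = orbit K \<phi> x) \<and>
             (\<forall>k\<in>carrier K. \<forall>x\<in>P. h (\<phi> k x) = (k \<otimes>\<^bsub>K\<^esub> fst (h x), snd (h x)))))"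

text \<open>
  The action of \<open>G/H\<close> induced by an action \<open>\<phi>\<close> of \<open>G\<close> in which \<open>H\<close> acts trivially; the choice
  of the representative is then immaterial.
\<close>

definition quotient_action :: "('a \<Rightarrow> 'x \<Rightarrow> 'x) \<Rightarrow> 'a set \<Rightarrow> 'x \<Rightarrow> 'x" where
  "quotient_action \<phi> C = \<phi> (SOME g. g \<in> C)"

lemma quotient_action_coset:
  assumes act: "group_action G E \<phi>" and H: "subgroup H G" and g: "g \<in> carrier G"
    and x: "x \<in> E" and stab: "\<And>y. y \<in> E \<Longrightarrow> stabilizer G \<phi> y = H"
  shows "quotient_action \<phi> (H #>\<^bsub>G\<^esub> g) x = \<phi> g x"
proof -
  interpret group_action G E \<phi> by (fact act)
  interpret group G
    using group_hom by (simp add: group_hom_def)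
  have "g \<in> H #>\<^bsub>G\<^esub> g"
    using H g by (rule rcos_self[rotated])
  then have "(SOME g'. g' \<in> H #>\<^bsub>G\<^esub> g) \<in> H #>\<^bsub>G\<^esub> g"
    by (rule someI)
  then obtain h where h: "h \<in> H" and eq: "(SOME g'. g' \<in> H #>\<^bsub>G\<^esub> g) = h \<otimes>\<^bsub>G\<^esub> g"
    by (auto simp: r_coset_def)
  have E: "\<phi> g x \<in> E"
    using g x by (rule element_image[OF _ _ refl])
  have "h \<in> carrier G"
    using subgroup.mem_carrier[OF H h] .
  then have "\<phi> (h \<otimes>\<^bsub>G\<^esub> g) x = \<phi> h (\<phi> g x)"
    using g x by (intro composition_rule)
  also have "\<dots> = \<phi> g x"
    using h unfolding stab[OF E, symmetric] stabilizer_def by simp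
  finally show ?thesis
    by (simp add: quotient_action_def eq)
qed

lemma orbit_quotient_action:
  assumes act: "group_action G E \<phi>" and H: "subgroup H G"
    and x: "x \<in> E" and stab: "\<And>y. y \<in> E \<Longrightarrow> stabilizer G \<phi> y = H"
  shows "orbit (G Mod H) (quotient_action \<phi>) x = orbit G \<phi> x"
proof -
  have *: "quotient_action \<phi> (H #>\<^bsub>G\<^esub> g) x = \<phi> g x" if "g \<in> carrier G" for g
    by (rule quotient_action_coset[OF act H that x stab])
  have "orbit (G Mod H) (quotient_action \<phi>) x =
      (\<lambda>g. quotient_action \<phi> (H #>\<^bsub>G\<^esub> g) x) ` carrier G"
    unfolding orbit_def carrier_FactGroup by blast
  also have "\<dots> = (\<lambda>g. \<phi> g x) ` carrier G"
    using * by (rule image_cong[OF refl])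
  also have "\<dots> = orbit G \<phi> x"
    unfolding orbit_def by blast
  finally show ?thesis .
qed

end

theory Submission
 imports Defs
begin

text \<open>
 Lie groups are linear: in a chart at \<open>1\<close> squaring expands distances, so there are no small
 subgroups, and by the Peter--Weyl theorem some representation \<open>rho\<close> is faithful. For a linear
 group, averaging \<open>rho g\<^sup>-\<^sup>1\<close> along the orbits against a bump function and retracting onto the matrix
 group \<open>rho G\<close> gives equivariant maps to \<open>G\<close> near every point of a free \<open>G\<close>-space (Gleason); the
 quotients of a linear group are linear, and closed matrix groups are Lie groups.

 Conversely, let \<open>G\<close> act on the product of the joins \<open>rho G * rho G\<close> over all representations \<open>rho\<close>. If
 this compact free \<open>G\<close>-space is locally trivial, then the kernel \<open>N\<close> of some representation can be
 contracted inside \<open>G\<close>. The means over \<open>N\<close> of the forms \<open>tr (X a)\<close> and \<open>tr a\<^sup>3\<close>, where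
 \<open>a = f\<^sup>-\<^sup>1 df\<close>, do not change under homotopies, so that all images of \<open>N\<close> under representations of \<open>G\<close>
 have Lie algebra \<open>0\<close>. Lifting paths through the covering homomorphisms between these matrix groups
 then shows that a neighbourhood of \<open>1\<close> in \<open>N\<close> lies in the kernel of every representation. So \<open>1\<close> is
 isolated in \<open>N\<close>, and one more representation makes \<open>G\<close> linear.
\<close>

text \<open>\<open>G\<close> carries no differential structure, and the contracted kernel
  \<open>N\<close> may be as wild as \<open>G\<close>; calculus is possible only on the images under
  representations. The obstruction to a contraction is classical: a compact connected Lie group of
  positive dimension has real cohomology in degree 1 or 3, represented by the invariant forms
  \<open>tr (X a)\<close> with \<open>X\<close> central and \<open>tr a\<^sup>3\<close>. Contracted
  with the structure constants of an orthonormal basis, the degree-3 form becomes, up to a negative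
  factor, the sum of the square norms of all brackets, so its vanishing makes the Lie algebra
  abelian; the degree-1 form then yields the square norm of \<open>X\<close>. Means replace de Rham
  theory: along a homotopy the form changes by a divergence, and divergences have mean 0. The
  contraction of \<open>N\<close> is only continuous and does not factor through the representation
  \<open>rho0\<close> under study. It is therefore approximated by polynomials on the image of a
  larger block sum \<open>dsum rho0 rho1\<close>, from which \<open>pr\<close> leads back to
  \<open>rho0\<close>.\<close>

no_notation matrix_matrix_mult (infixl "**" 70)
notation iff (infixr "<->" 25) and scaleR (infixr "*R" 75) and divideR (infixl "'/R" 70)
notation LIMSEQ ("((_)/ ----> (_))" [60, 60] 60) and tendsto (infixr "--->" 55)
abbreviation "ctm \<equiv> continuous_map"
abbreviation "ptop \<equiv> prod_topology"
abbreviation "tsp \<equiv> topspace"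
abbreviation "subtop \<equiv> subtopology"
abbreviation "cton \<equiv> continuous_on"
abbreviation "ltpb \<equiv> locally_trivial_principal_bundle"
abbreviation "S3 (d::nat) c F \<equiv> \<Sum>i<d. \<Sum>j<d. \<Sum>k<d. c i j k * F i j k"
abbreviation hvd (infix "hvd" 50) where "f hvd f' \<equiv> (f has_vector_derivative f')"
lemmas ctm_o = continuous_map_compose
lemmas ctm_into = continuous_map_in_subtopology
lemmas open_vim = openin_continuous_map_preimage
text \<open>Every function on the discrete space \<open>nat\<close> is continuous, so these are the
  bounded real sequences with the supremum norm.\<close>

type_synonym bseq = "nat \<Rightarrow>\<^sub>C real"

context topological_group
begin

abbreviation "cG \<equiv> carrier G"
abbreviation gmult (infixl "**" 70) where "x ** y \<equiv> x \<otimes> y"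

end

section \<open>Invariant means on compact groups\<close>

lemma continuous_map_dist_iff:
 fixes f :: "'a => 'b::metric_space"
 shows "ctm X euclidean f <->
  (ALL x:tsp X. ALL e>0. EX U. openin X U & x : U & (ALL y:U. dist (f y) (f x) < e))" using Met_TC.continuous_map_to_metric[of X f] by (simp add: dist_commute)

lemma continuous_map_binop:
 assumes "ctm X euclidean f" "ctm X euclidean g"
  and "cton UNIV (%z. h (fst z) (snd z))"
 shows "ctm X euclidean (%x. h (f x) (g x))"
proof -
 have "ctm X (ptop euclidean euclidean) (%x. (f x, g x))" using assms by (simp add: continuous_map_paired del: prod_topology_euclidean)
 moreover have "ctm (ptop euclidean euclidean) euclidean (%z. h (fst z) (snd z))" using assms(3) by simp
 ultimately have "ctm X euclidean ((%z. h (fst z) (snd z)) o (%x. (f x, g x)))" by (rule ctm_o)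
 thus ?thesis by (simp add: o_def)
qed

lemma continuous_map_unop:
 assumes "ctm X euclidean f" and "cton UNIV h"
 shows "ctm X euclidean (%x. h (f x))" using ctm_o[OF assms(1), of euclidean h] assms(2) by (simp add: o_def)

lemma continuous_map_bounded:
 fixes f :: "'a => 'b::real_normed_vector"
 assumes "compact_space X" "ctm X euclidean f"
 obtains b where "0 < b" "!!x. x : tsp X ==> norm (f x) <= b"
proof -
 have "compactin euclidean (f ` tsp X)" using assms image_compactin[of X "tsp X" euclidean f] by (simp add: compact_space_def)
 hence "bounded (f ` tsp X)" by (auto intro: compact_imp_bounded)
 thus ?thesis by (auto simp: bounded_pos intro: that)
qed

text \<open>The points where \<open>F\<close> differs by less than \<open>e\<close> from its value
  on the slice at \<open>p\<close> form an open set containing that slice; the tube lemma finds a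
  product neighbourhood inside it.\<close>

lemma compact_uniform:
 fixes F :: "'a \<times> 'b => 'c::metric_space"
 assumes X: "compact_space X" and F: "ctm (ptop X Y) euclidean F"
  and p: "p : tsp Y" and e: "0 < e"
 obtains V where "openin Y V" "p : V" "!!x v. x : tsp X ==> v : V ==> dist (F (x, v)) (F (x, p)) < e"
proof -
 have "ctm (ptop X Y) (ptop X Y) (%z. (fst z, p))" using p by (auto simp: continuous_map_paired intro: continuous_map_fst)
 from ctm_o[OF this F]
 have "ctm (ptop X Y) euclidean (%z. F (fst z, p))" by (simp add: o_def)
 hence "ctm (ptop X Y) euclideanreal (%z. dist (F z) (F (fst z, p)))" by (intro continuous_map_binop[OF F, of _ dist] continuous_intros)
 hence "openin (ptop X Y) {z : tsp (ptop X Y). dist (F z) (F (fst z, p)) : {..<e}}" by (rule open_vim) (auto simp: open_openin[symmetric])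
 moreover have "tsp X \<times> {p} <= {z : tsp (ptop X Y). dist (F z) (F (fst z, p)) : {..<e}}" using p e by auto
 ultimately have "EX U V. openin X U & openin Y V & tsp X <= U & p : V &
  U \<times> V <= {z : tsp (ptop X Y). dist (F z) (F (fst z, p)) : {..<e}}" by (rule tube_lemma_left[OF _ X[unfolded compact_space_def] p])
 then obtain U V where UV: "openin X U" "openin Y V" "tsp X <= U" "p : V"
  "U \<times> V <= {z : tsp (ptop X Y). dist (F z) (F (fst z, p)) : {..<e}}" by (elim exE conjE) (rule that)
 show ?thesis
 proof (rule that[OF UV(2,4)])
  fix x v assume "x : tsp X" "v : V"
  hence "(x, v) : U \<times> V" using UV by auto
  thus "dist (F (x, v)) (F (x, p)) < e" using UV(5) by auto
 qed
qed

section \<open>Finite averages of left translates\<close>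

context topological_group
begin

abbreviation "cont \<equiv> ctm T euclideanreal"

lemma topspace_T [simp]: "tsp T = cG" by (rule topspace_eq_carrier)

lemma continuous_map_mult:
 assumes "ctm X T f" "ctm X T g"
 shows "ctm X T (%x. f x ** g x)"
proof -
 have "ctm X (ptop T T) (%x. (f x, g x))" using assms by (simp add: continuous_map_paired)
 from ctm_o[OF this continuous_mult] show ?thesis by (simp add: o_def)
qed

lemma continuous_map_inverse:
 assumes "ctm X T f"
 shows "ctm X T (%x. inv f x)" using ctm_o[OF assms continuous_inv] by (simp add: o_def)

lemma continuous_map_const_T: "c : cG ==> ctm X T (%x. c)" by simp

lemma continuous_map_id_T: "ctm T T (%x. x)" using continuous_map_id[of T] by (simp add: id_def)

lemmas cont_T = continuous_map_mult continuous_map_inverse continuous_map_const_T continuous_map_id_T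

lemma continuous_map_pre:
 assumes "ctm T Y f" "ctm X T h"
 shows "ctm X Y (%x. f (h x))" using ctm_o[OF assms(2,1)] by (simp add: o_def)

definition lavg :: "'a set => ('a => real) => 'a => real" where
 "lavg Z f x = (\<Sum>y\<in>Z. f (y ** x)) / real (card Z)"

text \<open>The operators obtained by iterating averages over finite sets of left translations. They
  stand in for integration over the group; closure under composition and commutation with right
  translations (\<open>Lav_compose\<close>, \<open>Lav_translate\<close>) carry the theory.\<close>

inductive_set Lav :: "(('a => real) => 'a => real) set" where
 Lav_id: "(%f. f) : Lav"
| Lav_step: "A : Lav ==> finite Z ==> Z ~= {} ==> Z <= cG ==> (%f. lavg Z (A f)) : Lav"

lemma lavg_in_Lav: "finite Z ==> Z ~= {} ==> Z <= cG ==> lavg Z : Lav" using Lav_step[OF Lav_id] by simp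

lemma Lav_cont:
 assumes "A : Lav" "cont f"
 shows "cont (A f)" using assms(1)
proof induction
 case (Lav_step A Z)
 have "cont (%x. A f (y ** x))" if "y : Z" for y using Lav_step that by (intro continuous_map_pre[OF Lav_step.IH] cont_T) auto
 thus ?case unfolding lavg_def divide_inverse by (intro continuous_intros continuous_map_sum Lav_step.hyps) auto
qed (use assms in auto)

lemma Lav_cong:
 assumes "A : Lav" "!!x. x : cG ==> f x = g x" "x : cG"
 shows "A f x = A g x" using assms(1,3)
proof (induction arbitrary: x)
 case (Lav_step A Z)
 thus ?case unfolding lavg_def by (intro arg_cong2[where f="(/)"] sum.cong) (auto simp: subset_eq)
qed (use assms in auto)

lemma Lav_add: "A : Lav ==> A (%x. f x + g x) x = A f x + A g x"
proof (induction arbitrary: x rule: Lav.induct)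
 case (Lav_step A Z)
 thus ?case unfolding lavg_def by (simp add: sum.distrib add_divide_distrib)
qed simp

lemma Lav_scale: "A : Lav ==> A (%x. c * f x) x = c * A f x"
proof (induction arbitrary: x rule: Lav.induct)
 case (Lav_step A Z)
 thus ?case unfolding lavg_def by (simp add: sum_distrib_left)
qed simp

lemma Lav_const: "A : Lav ==> A (%x. c) x = c"
proof (induction arbitrary: x rule: Lav.induct)
 case (Lav_step A Z)
 thus ?case unfolding lavg_def by simp
qed simp

lemma Lav_mono:
 assumes "A : Lav" "!!x. x : cG ==> f x <= g x" "x : cG"
 shows "A f x <= A g x" using assms(1,3)
proof (induction arbitrary: x)
 case (Lav_step A Z)
 thus ?case unfolding lavg_def by (intro divide_right_mono sum_mono) (auto simp: subset_eq)
qed (use assms in auto)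

lemma Lav_compose: "A : Lav ==> B : Lav ==> (%f. A (B f)) : Lav"
proof (induction rule: Lav.induct)
 case (Lav_step A Z)
 thus ?case using Lav.Lav_step[of "%f. A (B f)" Z] by simp
qed simp

lemma Lav_translate:
 assumes "A : Lav" "x : cG" "y : cG"
 shows "A (%x. f (x ** y)) x = A f (x ** y)" using assms(1,2)
proof (induction arbitrary: x)
 case (Lav_step A Z)
 thus ?case unfolding lavg_def using assms(3) by (intro arg_cong2[where f="(/)"] sum.cong) (auto simp: subset_eq m_assoc)
qed auto

lemma Lav_sum:
 assumes "A : Lav" "finite I"
 shows "A (%x. (\<Sum>i\<in>I. f i x) / c) x = (\<Sum>i\<in>I. A (f i) x) / c" using assms(2)
proof induction
 case empty
 thus ?case using Lav_const[OF assms(1), of 0] by simp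
next
 case (insert i I)
 have "A (%x. (\<Sum>i\<in>insert i I. f i x) / c) x = A (%x. (1/c) * f i x + (\<Sum>i\<in>I. f i x) / c) x" using insert by (simp add: add_divide_distrib)
 thus ?case unfolding Lav_add[OF assms(1)] Lav_scale[OF assms(1)] using insert by (simp add: add_divide_distrib)
qed

text \<open>Right averages are the left averages conjugated by inversion; they commute with left ones.\<close>

lemma Lav_right_commute:
 assumes B: "B : Lav" and A: "A : Lav" and x: "x : cG"
 shows "A (%x. B (%z. f (inv z)) (inv x)) x = B (%z. A f (inv z)) (inv x)" using B x
proof (induction arbitrary: x)
 case Lav_id
 have "A (%x. f (inv (inv x))) x = A f x" by (rule Lav_cong[OF A]) (use Lav_id in auto)
 thus ?case using Lav_id by simp
next
 case (Lav_step B Z)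
 let ?R = "%g x. B (%z. g (inv z)) (inv x)"
 have *: "lavg Z (B (%z. g (inv z))) (inv x) = (\<Sum>y\<in>Z. ?R g (x ** inv y)) / card Z" if "x : cG" for g x unfolding lavg_def using that Lav_step.hyps
  by (intro arg_cong2[where f="(/)"] sum.cong) (auto simp: subset_eq inv_mult_group)
 have "A (%x. lavg Z (B (%z. f (inv z))) (inv x)) x = A (%x. (\<Sum>y\<in>Z. ?R f (x ** inv y)) / card Z) x" by (rule Lav_cong[OF A]) (use * Lav_step in auto)
 also have "... = (\<Sum>y\<in>Z. A (%x. ?R f (x ** inv y)) x) / card Z" by (rule Lav_sum[OF A]) (use Lav_step in auto)
 also have "... = (\<Sum>y\<in>Z. A (?R f) (x ** inv y)) / card Z"
  using Lav_step by (intro arg_cong2[where f="(/)"] sum.cong Lav_translate[OF A, of x _ "?R f"]) (auto simp: subset_eq)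
 also have "... = (\<Sum>y\<in>Z. ?R (A f) (x ** inv y)) / card Z" using Lav_step by (intro arg_cong2[where f="(/)"] sum.cong Lav_step.IH) (auto simp: subset_eq)
 also have "... = lavg Z (B (%z. A f (inv z))) (inv x)" using * Lav_step by simp
 finally show ?case .
qed

text \<open>Von Neumann's approach to the Haar integral: \<open>mean f\<close> will be the unique
  constant which averages of left translates of \<open>f\<close> approach uniformly.\<close>

definition approx_mean :: "('a => real) => real => real => bool" where
 "approx_mean f e c <-> (EX A:Lav. ALL x:cG. abs(A f x - c) <= e)"

definition mean :: "('a => real) => real" where
 "mean f = (THE c. ALL e>0. approx_mean f e c)"

lemma Lav_near_const:
 assumes "A : Lav" "!!x. x : cG ==> abs(f x - c) <= e" "x : cG"
 shows "abs(A f x - c) <= e"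
proof -
 have "A f x <= A (%_. c + e) x" "A (%_. c - e) x <= A f x" using assms(2) by (intro Lav_mono[OF assms(1) _ assms(3)]; fastforce simp: abs_le_iff)+
 thus ?thesis using Lav_const[OF assms(1)] by (auto simp: abs_le_iff)
qed

text \<open>A left average that brings \<open>f\<close> near \<open>c\<close> and a right average
  that brings it near \<open>d\<close> commute, so applying both produces one value near both
  constants. Uniqueness of the mean and its invariance under inversion come from here.\<close>

lemma approx_mean_cross:
 assumes "approx_mean f e c" "approx_mean (%x. f (inv x)) e' d"
 shows "abs(c - d) <= e + e'"
proof -
 obtain A B where A: "A : Lav" "!!x. x : cG ==> abs(A f x - c) <= e"
  and B: "B : Lav" "!!x. x : cG ==> abs(B (%x. f (inv x)) x - d) <= e'" using assms unfolding approx_mean_def by blast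
 have 1: "abs(A (%x. B (%z. f (inv z)) (inv x)) \<one> - d) <= e'" by (rule Lav_near_const[OF A(1)]) (use B in auto)
 have 2: "abs(B (%z. A f (inv z)) (inv \<one>) - c) <= e" by (rule Lav_near_const[OF B(1)]) (use A in auto)
 show ?thesis using 1 2 Lav_right_commute[OF B(1) A(1), of \<one> f] by (simp add: abs_le_iff)
qed

end

section \<open>Existence, uniqueness and invariance of the mean\<close>

context compact_group
begin

lemma finite_translates:
 assumes "openin T U" "U ~= {}"
 obtains Z where "finite Z" "Z ~= {}" "Z <= cG" "!!x. x : cG ==> EX z:Z. z ** x : U"
proof -
 obtain u where u: "u : U" using assms by blast
 have U: "U <= cG" using openin_subset[OF assms(1)] by simp
 define W where "W z = {x : tsp T. z ** x : U}" for z
 have W: "openin T (W z)" if "z : cG" for z unfolding W_def using that by (intro open_vim[OF _ assms(1)] cont_T)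
 have "tsp T <= \<Union> (W ` cG)"
 proof
  fix x assume x: "x : tsp T"
  hence "x : W (u ** inv x)" using u U by (auto simp: W_def m_assoc)
  thus "x : \<Union> (W ` cG)" using x u U by auto
 qed
 then obtain F where F: "finite F" "F <= W ` cG" "tsp T <= \<Union> F" using compact W unfolding compact_space_alt by (metis (no_types, lifting) imageE)
 then obtain Z where Z: "finite Z" "Z <= cG" "F = W ` Z" by (meson finite_subset_image)
 moreover have "EX z:Z. z ** x : U" if "x : cG" for x using that F(3) Z(3) by (auto simp: W_def)
 moreover have "Z ~= {}" using `!!x. x : cG ==> EX z:Z. z ** x : U`[of \<one>] by auto
 ultimately show ?thesis using that by blast
qed

lemma right_uniform:
 fixes f :: "'a => 'c::metric_space"
 assumes "ctm T euclidean f" "0 < e"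
 obtains V where "openin T V" "\<one> : V" "!!x v. x : cG ==> v : V ==> dist (f (x ** v)) (f x) < e"
proof -
 have "ctm (ptop T T) euclidean (%z. f (fst z ** snd z))" by (intro continuous_map_pre[OF assms(1)] cont_T continuous_map_fst continuous_map_snd)
 from compact_uniform[OF compact this, of \<one> e] assms(2)
 obtain V where "openin T V" "\<one> : V" "!!x v. x : cG ==> v : V ==> dist (f (x ** v)) (f (x ** \<one>)) < e" by auto
 thus ?thesis by (intro that[of V]) auto
qed

text \<open>Let \<open>s\<close> be the infimum of all upper bounds of averages of \<open>f\<close>.
  An average whose upper bound exceeds \<open>s\<close> only slightly cannot dip far below
  \<open>s\<close> anywhere: averaging it once more over translates that spread the dip over the
  whole group would push its upper bound beneath \<open>s\<close>.\<close>

lemma approx_mean_exists: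
 assumes f: "cont f"
 shows "EX c. ALL e>0. approx_mean f e c"
proof -
 obtain b where b: "!!x. x : cG ==> abs(f x) <= b" using continuous_map_bounded[OF compact f] by auto
 define S where "S = {u. EX A:Lav. ALL x:cG. A f x <= u}"
 define s where "s = Inf S"
 have "b : S" unfolding S_def using b by (auto simp: abs_le_iff intro!: bexI[OF _ Lav_id])
 have low: "- b <= u" if u: "u : S" for u
 proof -
  obtain A where A: "A : Lav" "A f \<one> <= u" using u by (auto simp: S_def)
  have "A (%_. - b) \<one> <= A f \<one>" by (rule Lav_mono[OF A(1)]) (use b in "auto simp: abs_le_iff minus_le_iff")
  thus ?thesis using A Lav_const[OF A(1)] by simp
 qed
 have bdd: "bdd_below S" using low unfolding bdd_below_def by blast
 have "approx_mean f e s" if e: "0 < e" for e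
 proof -
 obtain V where V: "openin T V" "\<one> : V" "!!x v. x : cG ==> v : V ==> abs(f (x ** v) - f x) < e/2"
  using right_uniform[OF f, of "e/2"] e by (auto simp: dist_real_def)
 obtain Z where Z: "finite Z" "Z ~= {}" "Z <= cG" "!!x. x : cG ==> EX z:Z. z ** x : V" using finite_translates[OF V(1)] V(2) by blast
 define n where "n = real (card Z)"
 have n: "1 <= n" using Z by (simp add: n_def card_gt_0_iff Suc_le_eq)
 \<comment> \<open>The excess is so small that one summand out of \<open>n\<close> lying below
   \<open>s - e/2\<close> brings the average of all \<open>n\<close> below \<open>s\<close>.\<close>
 have "s < s + e / (2*n)" using e n by simp
 then obtain u where "u : S" "u < s + e / (2*n)" using cInf_lessD[of S] `b : S` unfolding s_def by blast
 then obtain A where A: "A : Lav" "!!x. x : cG ==> A f x <= s + e/(2*n)" unfolding S_def by force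
 have lower: "s - e <= A f c" if c: "c : cG" for c
 proof (rule ccontr)
  assume "\<not> s - e <= A f c"
  have Vc: "V <= cG" using openin_subset[OF V(1)] by simp
  have near: "A f (c ** v) < s - e/2" if "v : V" for v
  proof -
   have v: "v : cG" using that Vc by auto
   have "A f (c ** v) = A (%x. f (x ** v)) c" using Lav_translate[OF A(1) c v] by simp
   also have "... <= A (%x. f x + e/2) c"
   proof (rule Lav_mono[OF A(1) _ c])
    show "f (x ** v) <= f x + e/2" if "x : cG" for x using V(3)[OF that `v : V`] by linarith
   qed
   also have "... = A f c + e/2" by (simp add: Lav_add[OF A(1)] Lav_const[OF A(1)])
   finally show ?thesis using `\<not> s - e <= A f c` by simp
  qed
  \<comment> \<open>For each \<open>x\<close> some \<open>z : Z\<close> moves \<open>x\<close> to a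
    point \<open>v\<close> of \<open>V\<close>, hence \<open>c ** z\<close> moves it to
    \<open>c ** v\<close>, close to the dip at \<open>c\<close>.\<close>
  define Y where "Y = (%z. c ** z) ` Z"
  have inj: "inj_on (%z. c ** z) Z" using Z c by (auto simp: inj_on_def subset_eq)
  have Y: "finite Y" "Y ~= {}" "Y <= cG" "real (card Y) = n" using Z c inj by (auto simp: Y_def n_def card_image)
  define u' where "u' = ((n - 1) * (s + e/(2*n)) + (s - e/2)) / n"
  have bound: "lavg Y (A f) x <= u'" if x: "x : cG" for x
  proof -
   obtain z where z: "z : Z" "z ** x : V" using Z(4)[OF x] by blast
   have zc: "z : cG" using z Z by auto
   have yY: "c ** z : Y" using z by (simp add: Y_def)
   have "(\<Sum>y\<in>Y. A f (y ** x)) = A f (c ** z ** x) + (\<Sum>y\<in>Y - {c ** z}. A f (y ** x))" using Y yY by (simp add: sum.remove)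
   also have "... <= (s - e/2) + (\<Sum>y\<in>Y - {c ** z}. s + e/(2*n))" using near[OF z(2)] zc c x Y by (intro add_mono sum_mono A(2)) (auto simp: m_assoc subset_eq)
   also have "... = (s - e/2) + (n - 1) * (s + e/(2*n))" using Y yY by (simp add: card_Diff_singleton of_nat_diff card_gt_0_iff Suc_le_eq)
   finally show ?thesis unfolding lavg_def u'_def using Y(4) n by (simp add: divide_right_mono add.commute)
  qed
  have "u' : S" unfolding S_def using bound by (auto intro!: bexI[OF _ Lav_step[OF A(1) Y(1-3)]])
  hence "s <= u'" unfolding s_def using bdd by (rule cInf_lower)
  moreover have "u' = s - e / (2 * n^2)" using n by (simp add: u'_def field_simps power2_eq_square)
  ultimately show False using e n by (simp add: field_simps)
 qed
 have "e / (2*n) <= e" using e n by (simp add: field_simps)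
 hence "abs(A f x - s) <= e" if "x : cG" for x using lower[OF that] A(2)[OF that] by linarith
 thus ?thesis unfolding approx_mean_def using A(1) by blast
 qed
 thus ?thesis by blast
qed

lemma cont_inv: "ctm T X f ==> ctm T X (%x. f (inv x))" by (erule continuous_map_pre) (rule continuous_inv)

lemma approx_mean_ex1:
 assumes f: "cont f"
 shows "EX! c. ALL e>0. approx_mean f e c"
proof -
 obtain d where d: "!!e. 0 < e ==> approx_mean (%x. f (inv x)) e d" using approx_mean_exists[OF cont_inv[OF f]] by blast
 have "u = d" if u: "ALL e>0. approx_mean f e u" for u
 proof -
  have "abs(u - d) <= 0 + t" if "0 < t" for t using approx_mean_cross[OF u[rule_format, of "t/2"] d[of "t/2"]] that by simp
  hence "abs(u - d) <= 0" by (rule field_le_epsilon)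
  thus ?thesis by simp
 qed
 thus ?thesis using approx_mean_exists[OF f] by metis
qed

lemma approx_mean_mean: "cont f ==> 0 < e ==> approx_mean f e (mean f)" using theI'[OF approx_mean_ex1] unfolding mean_def by blast

lemma mean_eqI:
 assumes "cont f" "!!e. 0 < e ==> approx_mean f e c"
 shows "mean f = c" unfolding mean_def using approx_mean_ex1[OF assms(1)] assms(2) by (intro the1_equality) auto

lemma mean_inv:
 assumes f: "cont f"
 shows "mean (%x. f (inv x)) = mean f"
proof -
 have "abs(mean f - mean (%x. f (inv x))) <= 0 + t" if "0 < t" for t
  using approx_mean_cross[OF approx_mean_mean[OF f, of "t/2"] approx_mean_mean[OF cont_inv[OF f], of "t/2"]] that by simp
 hence "abs(mean f - mean (%x. f (inv x))) <= 0" by (rule field_le_epsilon)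
 thus ?thesis by simp
qed

lemma mean_cong:
 assumes "!!x. x : cG ==> f x = g x"
 shows "mean f = mean g"
proof -
 have "approx_mean f = approx_mean g" unfolding approx_mean_def
 proof (intro ext bex_cong ball_cong refl)
  fix e c A x assume "A : Lav" "x : cG"
  hence "A f x = A g x" using Lav_cong[where A=A and f=f and g=g] assms by simp
  thus "(abs(A f x - c) <= e) = (abs(A g x - c) <= e)" by simp
 qed
 thus ?thesis by (simp add: mean_def)
qed

text \<open>Proved for the inverted function, where averages act as right averages: one that brings
  \<open>f\<close> near its mean commutes with \<open>A\<close>, and \<open>A\<close> does not
  enlarge the distance to a constant.\<close>

lemma mean_Lav:
 assumes f: "cont f" and A: "A : Lav"
 shows "mean (A f) = mean f"
proof -
 have "mean (%x. A f (inv x)) = mean f"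
 proof (rule mean_eqI)
  show "cont (%x. A f (inv x))" by (rule cont_inv[OF Lav_cont[OF A f]])
  fix e :: real assume "0 < e"
  then obtain B where B: "B : Lav" "!!x. x : cG ==> abs(B (%z. f (inv z)) x - mean f) <= e"
   using approx_mean_mean[OF cont_inv[OF f]] mean_inv[OF f] unfolding approx_mean_def by metis
  have "abs(B (%z. A f (inv z)) x - mean f) <= e" if "x : cG" for x
  proof -
   have "abs(A (%x. B (%z. f (inv z)) (inv x)) (inv x) - mean f) <= e" by (rule Lav_near_const[OF A]) (use B that in auto)
   thus ?thesis using Lav_right_commute[OF B(1) A, of "inv x" f] that by simp
  qed
  thus "approx_mean (%x. A f (inv x)) e (mean f)" unfolding approx_mean_def using B(1) by blast
 qed
 thus ?thesis using mean_inv[OF Lav_cont[OF A f]] by simp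
qed

text \<open>A single operator must flatten both summands: \<open>A\<close> flattens
  \<open>f\<close>, and \<open>B\<close> flattens \<open>A g\<close>, whose mean is still that of
  \<open>g\<close>.\<close>

lemma mean_add:
 assumes f: "cont f" and g: "cont g"
 shows "mean (%x. f x + g x) = mean f + mean g"
proof (rule mean_eqI)
 show "cont (%x. f x + g x)" by (intro continuous_intros f g)
 fix e :: real assume "0 < e"
 then obtain A where A: "A : Lav" "!!x. x : cG ==> abs(A f x - mean f) <= e/2" using approx_mean_mean[OF f, of "e/2"] unfolding approx_mean_def by auto
 obtain B where B: "B : Lav" "!!x. x : cG ==> abs(B (A g) x - mean g) <= e/2"
  using approx_mean_mean[OF Lav_cont[OF A(1) g], of "e/2"] `0 < e` mean_Lav[OF g A(1)] unfolding approx_mean_def by auto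
 have "abs(B (A (%x. f x + g x)) x - (mean f + mean g)) <= e" if x: "x : cG" for x
 proof -
  have "A (%x. f x + g x) = (%x. A f x + A g x)" using Lav_add[OF A(1)] by blast
  hence "B (A (%x. f x + g x)) x = B (A f) x + B (A g) x" using Lav_add[OF B(1)] by simp
  moreover have "abs(B (A f) x - mean f) <= e/2" by (rule Lav_near_const[OF B(1) A(2) x])
  ultimately show ?thesis using B(2)[OF x] by linarith
 qed
 thus "approx_mean (%x. f x + g x) e (mean f + mean g)" unfolding approx_mean_def by (intro bexI[OF _ Lav_compose[OF B(1) A(1)]]) simp
qed

lemma mean_scale:
 assumes f: "cont f"
 shows "mean (%x. c * f x) = c * mean f"
proof (rule mean_eqI)
 show "cont (%x. c * f x)" by (intro continuous_intros f continuous_map_real_mult_left)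
 fix e :: real assume "0 < e"
 then obtain A where A: "A : Lav" "!!x. x : cG ==> abs(A f x - mean f) <= e/(abs(c)+1)"
  using approx_mean_mean[OF f, of "e/(abs(c)+1)"] unfolding approx_mean_def by auto
 have "abs(A (%x. c * f x) x - c * mean f) <= e" if x: "x : cG" for x
 proof -
  have "abs(A (%x. c * f x) x - c * mean f) = abs(c) * abs(A f x - mean f)" by (simp add: Lav_scale[OF A(1)] abs_mult[symmetric] right_diff_distrib)
  also have "... <= (abs(c)+1) * (e/(abs(c)+1))" by (intro mult_mono A(2) x) auto
  finally show ?thesis by (simp add: add_nonneg_eq_0_iff split: if_splits)
 qed
 thus "approx_mean (%x. c * f x) e (c * mean f)" unfolding approx_mean_def using A(1) by blast
qed

lemma mean_const [simp]: "mean (%x. c) = c"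
proof (rule mean_eqI)
 show "approx_mean (%x. c) e c" if "0 < e" for e unfolding approx_mean_def using Lav_id that by (intro bexI[of _ "%f. f"]) auto
qed simp

lemma mean_diff:
 assumes f: "cont f" and g: "cont g"
 shows "mean (%x. f x - g x) = mean f - mean g"
proof -
 have "mean (%x. f x + (-1) * g x) = mean f - mean g" using mean_add[OF f, of "%x. (-1) * g x"] mean_scale[OF g, of "-1"] g by (simp add: continuous_map_minus)
 thus ?thesis by simp
qed

lemma mean_sum:
 assumes "finite I" "!!i. i : I ==> cont (f i)"
 shows "mean (%x. \<Sum>i\<in>I. f i x) = (\<Sum>i\<in>I. mean (f i))" using assms by (induction I) (auto simp: mean_add continuous_map_sum)

lemma mean_nonneg:
 assumes f: "cont f" and "!!x. x : cG ==> 0 <= f x"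
 shows "0 <= mean f"
proof (rule field_le_epsilon)
 fix e :: real assume "0 < e"
 then obtain A where A: "A : Lav" "!!x. x : cG ==> abs(A f x - mean f) <= e" using approx_mean_mean[OF f] unfolding approx_mean_def by metis
 have "A (%x. 0) \<one> <= A f \<one>" by (rule Lav_mono[OF A(1)]) (use assms in auto)
 thus "0 <= mean f + e" using Lav_const[OF A(1), of 0 \<one>] A(2)[of \<one>] by (simp add: abs_le_iff)
qed

lemma mean_mono:
 assumes f: "cont f" and g: "cont g"
  and "!!x. x : cG ==> f x <= g x"
 shows "mean f <= mean g" using mean_nonneg[of "%x. g x - f x"] assms mean_diff[OF g f] by (simp add: continuous_map_diff)

lemma mean_abs_le:
 assumes f: "cont f" and "!!x. x : cG ==> abs(f x) <= c"
 shows "abs(mean f) <= c" using mean_mono[OF f, of "%_. c"] mean_mono[of "%_. -c", OF _ f] assms(2) by (fastforce simp: abs_le_iff)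

lemma mean_right:
 assumes f: "cont f" and y: "y : cG"
 shows "mean (%x. f (x ** y)) = mean f"
proof (rule mean_eqI)
 show "cont (%x. f (x ** y))" by (intro continuous_map_pre[OF f] cont_T y)
 fix e :: real assume "0 < e"
 then obtain A where A: "A : Lav" "!!x. x : cG ==> abs(A f x - mean f) <= e" using approx_mean_mean[OF f] unfolding approx_mean_def by metis
 show "approx_mean (%x. f (x ** y)) e (mean f)" unfolding approx_mean_def using A y by (intro bexI[of _ A]) (auto simp: Lav_translate)
qed

lemma mean_left:
 assumes f: "cont f" and y: "y : cG"
 shows "mean (%x. f (y ** x)) = mean f" using mean_Lav[OF f lavg_in_Lav[of "{y}"]] y by (simp add: lavg_def[abs_def])

text \<open>Finitely many translates of the set where \<open>f\<close> exceeds half its value at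
  \<open>c\<close> cover the group, so some average of \<open>f\<close> is bounded below by a
  positive constant.\<close>

lemma mean_pos:
 assumes f: "cont f" and nn: "!!x. x : cG ==> 0 <= f x"
  and c: "c : cG" "0 < f c"
 shows "0 < mean f"
proof -
 define U where "U = {x : tsp T. f x : {f c / 2<..}}"
 have "openin T U" unfolding U_def by (rule open_vim[OF f]) (auto simp: open_openin[symmetric])
 moreover have "c : U" using c by (simp add: U_def)
 ultimately obtain Z where Z: "finite Z" "Z ~= {}" "Z <= cG" "!!x. x : cG ==> EX z:Z. z ** x : U" using finite_translates by blast
 define d where "d = (f c / 2) / card Z"
 have "0 < d" using c Z by (simp add: d_def card_gt_0_iff)
 have "d <= lavg Z f x" if x: "x : cG" for x
 proof -
  obtain z where z: "z : Z" "z ** x : U" using Z(4)[OF x] by blast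
  have "f c / 2 <= f (z ** x)" using z by (auto simp: U_def)
  also have "... <= (\<Sum>y\<in>Z. f (y ** x))" using Z x by (intro member_le_sum z) (auto intro!: nn)
  finally show ?thesis unfolding lavg_def d_def by (rule divide_right_mono) simp
 qed
 hence "mean (%_. d) <= mean (lavg Z f)" using Lav_cont[OF lavg_in_Lav[OF Z(1-3)] f] by (intro mean_mono) simp_all
 thus ?thesis using mean_Lav[OF f lavg_in_Lav[OF Z(1-3)]] `0 < d` by simp
qed

end

section \<open>Dependence on parameters and iterated means\<close>

context compact_group
begin

lemma continuous_map_mean:
 assumes F: "ctm (ptop X T) euclideanreal F"
 shows "ctm X euclideanreal (%x. mean (%y. F (x, y)))" unfolding continuous_map_dist_iff
proof (intro ballI allI impI)
 fix x and e :: real assume x: "x : tsp X" and e: "0 < e"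
 have "ctm (ptop T X) (ptop X T) (%z. (snd z, fst z))" by (simp add: continuous_map_paired continuous_map_fst continuous_map_snd)
 from ctm_o[OF this F]
 have F': "ctm (ptop T X) euclideanreal (%z. F (snd z, fst z))" by (simp add: o_def)
 obtain U where U: "openin X U" "x : U" "!!y u. y : cG ==> u : U ==> dist (F (u, y)) (F (x, y)) < e/2" using compact_uniform[OF compact F' x, of "e/2"] e by auto
 have F1: "cont (%y. F (u, y))" if "u : tsp X" for u
 proof -
  have "ctm T (ptop X T) (%y. (u, y))" using that by (simp add: continuous_map_paired continuous_map_id_T)
  from ctm_o[OF this F] show ?thesis by (simp add: o_def)
 qed
 have "dist (mean (%y. F (u, y))) (mean (%y. F (x, y))) < e" if u: "u : U" for u
 proof -
  have ux: "u : tsp X" using openin_subset[OF U(1)] u by auto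
  have "abs(mean (%y. F (u, y) - F (x, y))) <= e/2"
   using U(3) u F1[OF ux] F1[OF x] by (intro mean_abs_le) (auto intro!: continuous_intros less_imp_le simp: dist_real_def)
  thus ?thesis using mean_diff[OF F1[OF ux] F1[OF x]] e by (simp add: dist_real_def)
 qed
 thus "EX U. openin X U & x : U & (ALL u:U. dist (mean (%y. F (u, y))) (mean (%y. F (x, y))) < e)" using U by blast
qed

lemma mean_Lav_commute:
 assumes A: "A : Lav" and F: "!!x. x : cG ==> cont (%y. F (x, y))" and x: "x : cG"
 shows "cont (%y. A (%x. F (x, y)) x) & mean (%y. A (%x. F (x, y)) x) = A (%x. mean (%y. F (x, y))) x" using A x
proof (induction arbitrary: x)
 case (Lav_step A Z)
 have Zx: "z ** x : cG" if "z : Z" for z using Lav_step that by auto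
 have c: "cont (%y. \<Sum>z\<in>Z. A (%x. F (x, y)) (z ** x))" using Lav_step Zx by (intro continuous_map_sum) auto
 have "mean (%y. inverse (card Z) * (\<Sum>z\<in>Z. A (%x. F (x, y)) (z ** x))) = inverse (card Z) * (\<Sum>z\<in>Z. A (%x. mean (%y. F (x, y))) (z ** x))"
  using Lav_step Zx by (simp add: mean_scale[OF c] mean_sum)
 moreover have "cont (%y. inverse (card Z) * (\<Sum>z\<in>Z. A (%x. F (x, y)) (z ** x)))" by (rule continuous_map_real_mult_left[OF c])
 ultimately show ?case by (simp add: lavg_def divide_inverse mult.commute)
qed (use F in auto)

text \<open>Fubini: one averaging operator approximates the means of \<open>F (\<cdot>, y)\<close> for all \<open>y\<close> simultaneously.\<close>

lemma mean_swap:
 assumes F: "ctm (ptop T T) euclideanreal F"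
 shows "mean (%x. mean (%y. F (x, y))) = mean (%y. mean (%x. F (x, y)))"
proof (rule mean_eqI)
 have Fx: "cont (%x. F (x, y))" if "y : cG" for y using ctm_o[OF _ F, of T "%x. (x, y)"] that by (simp add: o_def continuous_map_paired continuous_map_id_T)
 have Fy: "cont (%y. F (x, y))" if "x : cG" for x using ctm_o[OF _ F, of T "%y. (x, y)"] that by (simp add: o_def continuous_map_paired continuous_map_id_T)
 show cm: "cont (%x. mean (%y. F (x, y)))" by (rule continuous_map_mean[OF F])
 define m where "m y = mean (%x. F (x, y))" for y
 have "ctm (ptop T T) euclideanreal (%z. F (snd z, fst z))" using ctm_o[OF _ F, of "ptop T T" "%z. (snd z, fst z)"]
  by (simp add: o_def continuous_map_paired continuous_map_fst continuous_map_snd)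
 from continuous_map_mean[OF this] have mc: "cont m" by (simp add: m_def[abs_def])
 fix e :: real assume e: "0 < e"
 have "EX A:Lav. ALL y:Y. ALL x:cG. abs(A (%x. F (x, y)) x - m y) <= e/3" if "finite Y" "Y <= cG" for Y using that
 proof induction
  case (insert y Y)
  then obtain A where A: "A : Lav" "!!y x. y : Y ==> x : cG ==> abs(A (%x. F (x, y)) x - m y) <= e/3" by auto
  have y: "cont (%x. F (x, y))" using insert Fx by simp
  obtain B where B: "B : Lav" "!!x. x : cG ==> abs(B (A (%x. F (x, y))) x - m y) <= e/3"
   using approx_mean_mean[OF Lav_cont[OF A(1) y], of "e/3"] e mean_Lav[OF y A(1)] unfolding approx_mean_def m_def by auto
  show ?case using B Lav_near_const[OF B(1) A(2)] by (intro bexI[OF _ Lav_compose[OF B(1) A(1)]]) auto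
 qed (use Lav_id in auto)
 note net = this
 have "EX V. openin T V & y : V & (ALL u:V. ALL x:cG. abs(F (x, u) - F (x, y)) <= e/3)" if y: "y : cG" for y
 proof -
  obtain V where "openin T V" "y : V" "!!x u. x : cG ==> u : V ==> dist (F (x, u)) (F (x, y)) < e/3" using compact_uniform[OF compact F, of y "e/3"] y e by auto
  thus ?thesis by (intro exI[of _ V]) (auto simp: dist_real_def less_imp_le)
 qed
 then obtain V where V: "!!y. y : cG ==> openin T (V y) & y : V y & (ALL u:V y. ALL x:cG. abs(F (x, u) - F (x, y)) <= e/3)" by metis
 hence "EX FF. finite FF & FF <= V ` cG & tsp T <= \<Union>FF" by (intro compact[unfolded compact_space_alt, rule_format]) auto
 then obtain Y where Y: "finite Y" "Y <= cG" "cG <= \<Union>(V ` Y)" by (metis finite_subset_image topspace_T)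
 obtain A where A: "A : Lav" "!!y x. y : Y ==> x : cG ==> abs(A (%x. F (x, y)) x - m y) <= e/3" using net[OF Y(1,2)] by blast
 have all: "abs(A (%x. F (x, u)) x - m u) <= e" if u: "u : cG" and x: "x : cG" for u x
 proof -
  obtain y where y: "y : Y" "u : V y" using Y u by blast
  have yc: "y : cG" using y Y by blast
  have d: "abs(F (x, u) - F (x, y)) <= e/3" if "x : cG" for x using V[OF yc] y that by blast
  have "A (%x. F (x, u)) x = A (%x. (F (x, u) - F (x, y)) + F (x, y)) x" by simp
  hence "abs(A (%x. F (x, u)) x - A (%x. F (x, y)) x) <= e/3"
   using Lav_near_const[OF A(1), of "%x. F (x, u) - F (x, y)" 0 "e/3" x] d x unfolding Lav_add[OF A(1)] by simp
  moreover have "abs(m u - m y) <= e/3"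
   using mean_abs_le[OF continuous_map_diff[OF Fx[OF u] Fx[OF yc]], of "e/3"] d mean_diff[OF Fx[OF u] Fx[OF yc]] by (simp add: m_def)
  ultimately show ?thesis using A(2)[OF y(1) x] by linarith
 qed
 have "abs(A (%x. mean (%y. F (x, y))) x - mean m) <= e" if x: "x : cG" for x
 proof -
  note c = mean_Lav_commute[OF A(1) Fy x]
  have "abs(mean (%y. A (%x. F (x, y)) x - m y)) <= e" using c mc all x by (intro mean_abs_le) (auto intro: continuous_map_diff)
  thus ?thesis using c mc by (simp add: mean_diff)
 qed
 thus "approx_mean (%x. mean (%y. F (x, y))) e (mean (%y. mean (%x. F (x, y))))" unfolding approx_mean_def m_def using A(1) by blast
qed

end

section \<open>A Banach algebra containing all finite matrices\<close>

text \<open>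
 The dimension of a representation has to be a bound variable, so matrices of all sizes live in one
 type: the bounded operators on \<open>l\<^sup>\<infinity>\<close>. An \<open>n\<close>-dimensional representation takes its values in
 \<open>1 + Mat n\<close>, where \<open>Mat n\<close> consists of the operators concentrated in the upper left corner.
\<close>

typedef op = "UNIV :: (bseq \<Rightarrow>\<^sub>L bseq) set" ..

lemmas op_simps [simp] = Rep_op_inverse Abs_op_inverse[OF UNIV_I]

instantiation op :: real_normed_algebra_1
begin

definition "0 = Abs_op 0"
definition "1 = Abs_op id_blinfun"
definition "a + b = Abs_op (Rep_op a + Rep_op b)"
definition "a - b = Abs_op (Rep_op a - Rep_op b)"
definition "- a = Abs_op (- Rep_op a)"
definition "a * b = Abs_op (Rep_op a o\<^sub>L Rep_op b)"
definition "r *R a = Abs_op (r *R Rep_op a)"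
definition "norm a = norm (Rep_op a)"
definition "dist a b = norm (a - b :: op)"
definition "sgn a = inverse (norm a) *R (a :: op)"
definition [code del]: "(uniformity :: (op \<times> op) filter) = (INF e\<in>{0<..}. principal {(x, y). dist x y < e})"
definition [code del]: "open (U :: op set) <-> (ALL x:U. eventually (%(x', y). x' = x --> y : U) uniformity)"

lemmas op_defs = zero_op_def one_op_def plus_op_def minus_op_def uminus_op_def times_op_def
 scaleR_op_def norm_op_def

lemma norm_id_lin: "norm (id_blinfun :: (bseq) \<Rightarrow>\<^sub>L _) = 1"
proof (rule antisym)
 show "norm (id_blinfun :: (bseq) \<Rightarrow>\<^sub>L _) <= 1" by (rule norm_blinfun_bound) auto
 have "(1::real) = norm (apply_bcontfun (const_bcontfun 1 :: bseq) 0)" by simp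
 also have "... <= norm (const_bcontfun 1 :: bseq)" by (rule norm_bounded)
 finally have 1: "1 <= norm (const_bcontfun 1 :: bseq)" .
 have "norm (const_bcontfun 1 :: bseq) <= norm (id_blinfun :: (bseq) \<Rightarrow>\<^sub>L _) * norm (const_bcontfun 1 :: bseq)"
  using norm_blinfun[of id_blinfun "const_bcontfun 1 :: bseq"] by simp
 thus "1 <= norm (id_blinfun :: (bseq) \<Rightarrow>\<^sub>L (bseq))"
  using 1 mult_right_mono[of _ 1 "norm (const_bcontfun 1 :: bseq)"] by (smt (verit) mult_le_cancel_right1)
qed

instance
proof
 fix a b c :: op and r s :: real
 have idl: "id_blinfun o\<^sub>L x = x" and idr: "x o\<^sub>L id_blinfun = x" for x :: "(bseq) \<Rightarrow>\<^sub>L (bseq)" by (rule blinfun_eqI, simp)+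
 show "a + b + c = a + (b + c)" "a + b = b + a" "0 + a = a" "- a + a = 0" "a - b = a + - b"
  "r *R (a + b) = r *R a + r *R b" "(r + s) *R a = r *R a + s *R a" "r *R s *R a = (r * s) *R a" "1 *R a = a" by (simp_all add: op_defs algebra_simps)
 show "a * b * c = a * (b * c)" "1 * a = a" "a * 1 = a" by (auto simp: op_defs idl idr intro!: arg_cong[of _ _ Abs_op] blinfun_eqI)
 show "(a + b) * c = a * c + b * c" "a * (b + c) = a * b + a * c" by (auto simp: op_defs blinfun.bilinear_simps intro!: arg_cong[of _ _ Abs_op] blinfun_eqI)
 show "r *R a * b = r *R (a * b)" "a * r *R b = r *R (a * b)" by (auto simp: op_defs blinfun.bilinear_simps intro!: arg_cong[of _ _ Abs_op] blinfun_eqI)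
 show "(0::op) ~= 1" using norm_id_lin by (auto simp: op_defs Abs_op_inject)
 show "dist a b = norm (a - b)" "sgn a = inverse (norm a) *R a" by (simp_all add: dist_op_def sgn_op_def divide_inverse)
 show "norm a = 0 <-> a = 0" by (metis Rep_op_inverse norm_eq_zero norm_op_def op_simps(2) zero_op_def)
 show "norm (a + b) <= norm a + norm b" "norm (r *R a) = abs(r) * norm a" by (simp_all add: op_defs norm_triangle_ineq)
 show "norm (a * b) <= norm a * norm b" "norm (1::op) = 1" by (simp_all add: op_defs norm_blinfun_compose norm_id_lin)
 show "(uniformity :: (op \<times> op) filter) = (INF e\<in>{0<..}. principal {(x, y). dist x y < e})" by (rule uniformity_op_def)
 fix U :: "op set"
 show "open U <-> (ALL x:U. eventually (%(x', y). x' = x --> y : U) uniformity)" by (rule open_op_def)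
qed

end

text \<open>The instance making \<open>bcontfun\<close> a Banach space asks for a metric domain; the
  distance inherited from the reals induces the discrete topology of \<open>nat\<close>.\<close>

instantiation nat :: metric_space
begin

definition "dist (m::nat) n = abs(real m - real n)"
definition [code del]: "(uniformity :: (nat \<times> nat) filter) = (INF e\<in>{0<..}. principal {(x, y). dist x y < e})"

instance
proof
 show "(uniformity :: (nat \<times> nat) filter) = (INF e\<in>{0<..}. principal {(x, y). dist x y < e})" by (rule uniformity_nat_def)
 show "open U <-> (ALL x:U. eventually (%(x', y). x' = x --> y : U) uniformity)" for U :: "nat set"
 proof -
  have eq: "x = b" if "abs(real x - real b) < 1" for x b :: nat using that by linarith
  have "eventually (%(x', y). x' = x --> y : U) uniformity" if "x : U" for x unfolding uniformity_nat_def
   by (rule eventually_INF1[of 1]) (use that eq in "auto simp: eventually_principal dist_nat_def")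
  thus ?thesis by (auto simp: open_discrete)
 qed
qed (auto simp: dist_nat_def)

end

instance bcontfun :: (metric_space, banach) banach ..

instance op :: banach
proof
 fix X :: "nat => op" assume X: "Cauchy X"
 have d: "dist (Rep_op a) (Rep_op b) = dist a b" for a b by (simp add: dist_op_def dist_norm op_defs)
 have "Cauchy (%n. Rep_op (X n))" using X unfolding Cauchy_def d .
 hence "convergent (%n. Rep_op (X n))" by (rule Cauchy_convergent)
 then obtain L where "(%n. Rep_op (X n)) ----> L" unfolding convergent_def by (elim exE) (rule that)
 hence "X ----> Abs_op L" unfolding lim_sequentially using d[of _ "Abs_op L"] by simp
 thus "convergent X" by (auto simp: convergent_def)
qed

section \<open>Matrix units, entries and the finite matrix blocks \<open>Mat n\<close>\<close>

definition act :: "op => (bseq) => nat => real" where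
 "act A f = apply_bcontfun (blinfun_apply (Rep_op A) f)"

lemma op_eqI: "(!!f i. act A f i = act B f i) ==> A = B" unfolding act_def by (metis Rep_op_inject apply_bcontfun_inject blinfun_eqI ext)

lemma act_simps:
 "act (A + B) f i = act A f i + act B f i" "act (A - B) f i = act A f i - act B f i"
 "act (r *R A) f i = r * act A f i" "act 0 f i = 0" "act 1 f i = apply_bcontfun f i"
 "act (- A) f i = - act A f i" by (simp_all add: act_def op_defs blinfun.bilinear_simps plus_bcontfun.rep_eq minus_bcontfun.rep_eq
   scaleR_bcontfun.rep_eq uminus_bcontfun.rep_eq zero_bcontfun.rep_eq const_bcontfun.rep_eq)

lemma bcont_nat: "bounded (range f) ==> (f :: nat => real) : bcontfun" by (auto simp: bcontfun_def)

lemma apply_Bcontfun: "bounded (range f) ==> apply_bcontfun (Bcontfun (f :: nat => real)) = f" by (simp add: Bcontfun_inverse bcont_nat)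

lemma abs_apply_le: "abs(apply_bcontfun (f :: bseq) i) <= norm f" using norm_bounded[of f i] by simp

text \<open>One coordinate-selecting construction covers the matrix units \<open>E\<close> and the
  interleaving maps \<open>VV\<close> and \<open>WW\<close>; it is bounded by 1 whatever
  \<open>h\<close> is.\<close>

definition sel :: "(nat => nat option) => op" where
 "sel h = Abs_op (Blinfun (%f. Bcontfun (%i. case h i of None => 0 | Some j => apply_bcontfun f j)))"

lemma sel_bounded: "bounded (range (%i. case h i of None => 0 | Some j => apply_bcontfun (f :: bseq) j))"
 by (rule boundedI[of _ "norm f"]) (auto simp: abs_apply_le split: option.split)

lemma act_sel: "act (sel h) f i = (case h i of None => 0 | Some j => apply_bcontfun f j)"
proof -
 let ?F = "%f. Bcontfun (%i. case h i of None => 0 | Some j => apply_bcontfun (f :: bseq) j)"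
 have a: "apply_bcontfun (?F f) = (%i. case h i of None => 0 | Some j => apply_bcontfun f j)" for f by (rule apply_Bcontfun[OF sel_bounded])
 have "bounded_linear ?F"
 proof (rule bounded_linear_intro[where K=1])
  fix f g :: "bseq" and r :: real
  show "?F (f + g) = ?F f + ?F g" "?F (r *R f) = r *R ?F f" by (rule bcontfun_eqI; simp add: a plus_bcontfun.rep_eq scaleR_bcontfun.rep_eq split: option.split)+
  show "norm (?F f) <= norm f * 1" by (rule norm_bound) (auto simp: a abs_apply_le split: option.split)
 qed
 thus ?thesis by (simp add: act_def sel_def bounded_linear_Blinfun_apply a)
qed

definition unitv :: "nat => bseq" where
 "unitv j = Bcontfun (%i. if i = j then 1 else 0)"

lemma unitv: "apply_bcontfun (unitv j) i = (if i = j then 1 else 0)" unfolding unitv_def by (subst apply_Bcontfun) (auto intro: boundedI[of _ 1])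

definition entry :: "op => nat => nat => real" where
 "entry A i j = act A (unitv j) i"

definition E :: "nat => nat => op" where
 "E i j = sel (%k. if k = i then Some j else None)"

lemma act_E: "act (E i j) f k = (if k = i then apply_bcontfun f j else 0)" by (simp add: E_def act_sel)

lemma act_mult: "act (A * B) f = act A (blinfun_apply (Rep_op B) f)" by (simp add: act_def op_defs)

lemma act_sel_mult: "act (sel h * A) f i = (case h i of None => 0 | Some j => act A f j)" by (simp add: act_mult act_sel) (simp add: act_def split: option.split)

lemma act_mult_E: "act (A * E k l) f i = apply_bcontfun f l * entry A i k"
proof -
 have "blinfun_apply (Rep_op (E k l)) f = apply_bcontfun f l *R unitv k" using act_E[of k l f] by (intro bcontfun_eqI) (simp add: act_def unitv scaleR_bcontfun.rep_eq)
 thus ?thesis by (simp add: act_mult entry_def) (simp add: act_def blinfun.bilinear_simps scaleR_bcontfun.rep_eq)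
qed

text \<open>Source of the multiplication rule of the matrix units, of the expansion of
  \<open>Pr n * A * Pr n\<close> and of \<open>entry_mult\<close>.\<close>

lemma E_sandwich: "E i j * A * E k l = entry A j k *R E i l" by (rule op_eqI) (simp add: act_mult_E act_simps act_E, simp add: entry_def E_def act_sel_mult)

lemma entry_simps [simp]:
 "entry (A + B) i j = entry A i j + entry B i j" "entry (A - B) i j = entry A i j - entry B i j"
 "entry (r *R A) i j = r * entry A i j" "entry 0 i j = 0" "entry 1 i j = (if i = j then 1 else 0)"
 "entry (- A) i j = - entry A i j" by (simp_all add: entry_def act_simps unitv)

lemma entry_sum [simp]: "entry (\<Sum>x\<in>I. f x) i j = (\<Sum>x\<in>I. entry (f x) i j)" by (induction I rule: infinite_finite_induct) auto

lemma entry_E: "entry (E i j) k l = (if k = i & j = l then 1 else 0)" by (simp add: entry_def act_E unitv)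

lemma norm_unitv: "norm (unitv j) <= 1" by (rule norm_bound) (simp add: unitv)

lemma abs_entry_le: "abs(entry A i j) <= norm A"
proof -
 have "abs(entry A i j) <= norm (blinfun_apply (Rep_op A) (unitv j))" using norm_bounded[of "blinfun_apply (Rep_op A) (unitv j)" i] by (simp add: entry_def act_def)
 also have "... <= norm A * 1" using norm_blinfun[of "Rep_op A" "unitv j"] norm_unitv[of j] mult_left_mono[OF norm_unitv[of j], of "norm A"] by (simp add: norm_op_def)
 finally show ?thesis by simp
qed

lemma bounded_linear_entry: "bounded_linear (%A. entry A i j)" by (rule bounded_linear_intro[where K=1]) (auto simp: abs_entry_le)

lemma continuous_on_entry [continuous_intros]:
 "cton S f ==> cton S (%x. entry (f x) i j)" by (rule bounded_linear.continuous_on[OF bounded_linear_entry])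

lemma E_mult: "E i j * E k l = (if j = k then E i l else 0)" using E_sandwich[of i j 1 k l] by simp

definition Pr :: "nat => op" where "Pr n = (\<Sum>i<n. E i i)"

definition Mat :: "nat => op set" where "Mat n = {A. Pr n * A = A & A * Pr n = A}"

lemma Pr_sandwich: "Pr n * A * Pr n = (\<Sum>i<n. \<Sum>j<n. entry A i j *R E i j)" by (simp add: Pr_def sum_distrib_left sum_distrib_right E_sandwich)
  (subst sum.swap, rule refl)

lemma Mat_expand: "A : Mat n ==> A = (\<Sum>i<n. \<Sum>j<n. entry A i j *R E i j)" using Pr_sandwich[of n A] by (simp add: Mat_def)

lemma E_in_Mat: "i < n ==> j < n ==> E i j : Mat n" by (simp add: Mat_def Pr_def sum_distrib_left sum_distrib_right E_mult)

lemma Mat_0 [simp]: "0 : Mat n" by (simp add: Mat_def)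
lemma Mat_add: "A : Mat n ==> B : Mat n ==> A + B : Mat n" by (simp add: Mat_def distrib_left distrib_right)
lemma Mat_diff: "A : Mat n ==> B : Mat n ==> A - B : Mat n" by (simp add: Mat_def left_diff_distrib right_diff_distrib)
lemma Mat_minus: "A : Mat n ==> - A : Mat n" by (simp add: Mat_def)
lemma Mat_scale: "A : Mat n ==> r *R A : Mat n" by (simp add: Mat_def)
lemma Mat_sandwich: "A : Mat n ==> B : Mat n ==> A * X * B : Mat n" unfolding Mat_def by (smt (verit, del_insts) mem_Collect_eq mult.assoc)
lemma Mat_mult: "A : Mat n ==> B : Mat n ==> A * B : Mat n" using Mat_sandwich[of A n B 1] by simp
lemma Mat_sum: "(!!x. x : I ==> f x : Mat n) ==> (\<Sum>x\<in>I. f x) : Mat n" by (induction I rule: infinite_finite_induct) (auto intro: Mat_add)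

lemmas Mat_intros = Mat_0 Mat_add Mat_diff Mat_minus Mat_scale Mat_mult Mat_sum

lemma Mat_comb: "(\<Sum>i<n. \<Sum>j<n. c i j *R E i j) : Mat n" by (intro Mat_sum Mat_scale E_in_Mat) auto

lemma Mat_mono: "A : Mat n ==> n <= m ==> A : Mat m" by (subst Mat_expand, assumption) (intro Mat_sum Mat_scale E_in_Mat; simp)

lemma subspace_Mat: "subspace (Mat n)" by (auto simp: subspace_def intro: Mat_intros)

lemma closed_Mat: "closed (Mat n)"
proof -
 have "Mat n = {A. Pr n * A = A} Int {A. A * Pr n = A}" by (auto simp: Mat_def)
 thus ?thesis by (auto intro!: closed_Int closed_Collect_eq continuous_intros)
qed

lemma Mat_eqI:
 assumes "A : Mat n" "B : Mat n" "!!i j. i < n ==> j < n ==> entry A i j = entry B i j"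
 shows "A = B" using Mat_expand[OF assms(1)] Mat_expand[OF assms(2)] assms(3) by simp

text \<open>One factor in \<open>Mat n\<close> allows \<open>Pr n\<close>, the sum of the first
  \<open>n\<close> diagonal units, to be inserted between the factors.\<close>

lemma entry_mult:
 assumes "A : Mat n \<or> B : Mat n"
 shows "entry (A * B) i j = (\<Sum>k<n. entry A i k * entry B k j)"
proof -
 have "A * B = A * Pr n * B"
 proof -
  have "A * Pr n = A \<or> Pr n * B = B" using assms by (auto simp: Mat_def)
  thus ?thesis by (metis mult.assoc)
 qed
 hence "entry (A * B) i j *R E i j = E i i * (A * Pr n * B) * E j j" by (simp add: E_sandwich)
 also have "... = (\<Sum>k<n. (E i i * A * E k k) * (E k k * B * E j j))" by (simp add: Pr_def sum_distrib_left sum_distrib_right mult.assoc)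
   (simp add: mult.assoc[symmetric] E_mult)
 also have "... = (\<Sum>k<n. (entry A i k * entry B k j) *R E i j)" by (simp add: E_sandwich E_mult mult.commute)
 also have "... = (\<Sum>k<n. entry A i k * entry B k j) *R E i j" by (rule scaleR_sum_left[symmetric])
 finally have "entry (entry (A * B) i j *R E i j) i j = entry ((\<Sum>k<n. entry A i k * entry B k j) *R E i j) i j" by (rule arg_cong)
 thus ?thesis by (simp add: entry_E del: entry_sum)
qed

lemma compact_span_box:
 fixes b :: "'i => 'b::real_normed_vector"
 assumes "finite I"
 shows "compact {\<Sum>i\<in>I. c i *R b i | c. ALL i:I. abs(c i) <= r}" using assms
proof induction
 case (insert i I)
 let ?S = "%I. {\<Sum>i\<in>I. c i *R b i | c. ALL i:I. abs(c i) <= r}"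
 have "compact ((%t. t *R b i) ` {-r..r})" by (intro compact_continuous_image continuous_intros compact_Icc)
 from compact_sums[OF this insert.IH]
 have "compact {x + y |x y. x : (%t. t *R b i) ` {-r..r} & y : ?S I}" .
 also have "{x + y |x y. x : (%t. t *R b i) ` {-r..r} & y : ?S I} = ?S (insert i I)"
 proof (intro equalityI subsetI)
  fix z assume "z : {x + y |x y. x : (%t. t *R b i) ` {-r..r} & y : ?S I}"
  then obtain t c where "t : {-r..r}" "ALL i:I. abs(c i) <= r" "z = t *R b i + (\<Sum>i\<in>I. c i *R b i)" by blast
  moreover have "abs(t) <= r" using `t : {-r..r}` by (auto simp: abs_le_iff)
  moreover have "(\<Sum>j\<in>I. (c(i:=t)) j *R b j) = (\<Sum>i\<in>I. c i *R b i)" by (rule sum.cong) (use insert in auto)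
  ultimately show "z : ?S (insert i I)" using insert by (auto intro!: exI[of _ "c(i:=t)"])
 next
  fix z assume "z : ?S (insert i I)"
  then obtain c where c: "ALL j:insert i I. abs(c j) <= r" "z = (\<Sum>j\<in>insert i I. c j *R b j)" by blast
  have "c i *R b i : (%t. t *R b i) ` {-r..r}" using c by (auto simp: abs_le_iff)
  moreover have "(\<Sum>j\<in>I. c j *R b j) : ?S I" using c by auto
  ultimately show "z : {x + y |x y. x : (%t. t *R b i) ` {-r..r} & y : ?S I}" using c insert by auto
 qed
 finally show ?case .
qed auto

text \<open>Heine-Borel for matrices: entries are bounded by the norm, so \<open>S\<close> is a
  closed subset of a compact box in the span of the matrix units.\<close>

lemma compact_Mat:
 assumes "S <= Mat n" "closed S" "bounded S"
 shows "compact S"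
proof -
 obtain r where r: "!!A. A : S ==> norm A <= r" using assms(3) by (auto simp: bounded_iff)
 let ?I = "{..<n} \<times> {..<n}"
 let ?B = "{\<Sum>p\<in>?I. c p *R E (fst p) (snd p) | c. ALL p:?I. abs(c p) <= r}"
 have "S <= ?B"
 proof
  fix A assume A: "A : S"
  have "A = (\<Sum>p\<in>?I. entry A (fst p) (snd p) *R E (fst p) (snd p))" using Mat_expand[of A n] A assms(1) by (auto simp: sum.cartesian_product case_prod_unfold)
  moreover have "abs(entry A i j) <= r" for i j using abs_entry_le[of A i j] r[OF A] by simp
  ultimately show "A : ?B" by (intro CollectI exI[of _ "%p. entry A (fst p) (snd p)"]) auto
 qed
 moreover have "compact ?B" by (rule compact_span_box) auto
 ultimately show ?thesis using assms(2) closed_Int_compact[of S ?B] by (simp add: Int_absorb2)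
qed

definition tr :: "nat => op => real" where "tr n A = (\<Sum>i<n. entry A i i)"

lemma tr_simps [simp]: "tr n (A + B) = tr n A + tr n B" "tr n (A - B) = tr n A - tr n B" "tr n (r *R A) = r * tr n A"
 "tr n 0 = 0" "tr n (- A) = - tr n A" by (simp_all add: tr_def sum.distrib sum_subtractf sum_distrib_left sum_negf)

lemma tr_sum [simp]: "tr n (\<Sum>x\<in>I. f x) = (\<Sum>x\<in>I. tr n (f x))" by (induction I rule: infinite_finite_induct) auto

lemma tr_commute:
 assumes "A : Mat n"
 shows "tr n (A * B) = tr n (B * A)"
proof -
 have "tr n (A * B) = (\<Sum>i<n. \<Sum>k<n. entry A i k * entry B k i)" unfolding tr_def using assms by (simp add: entry_mult[of A n B])
 also have "... = (\<Sum>k<n. \<Sum>i<n. entry B k i * entry A i k)" by (subst sum.swap) (simp add: mult.commute)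
 also have "... = tr n (B * A)" unfolding tr_def using assms by (simp add: entry_mult[of B n A])
 finally show ?thesis .
qed

lemma bounded_linear_tr: "bounded_linear (tr n)" unfolding tr_def[abs_def] by (intro bounded_linear_sum bounded_linear_entry)

text \<open>\<open>VV b\<close> embeds \<open>l\<^sup>\<infinity>\<close> as the even (odd) coordinates of \<open>l\<^sup>\<infinity>\<close>, and \<open>WW b\<close> is its adjoint.\<close>

definition VV :: "bool => op" where "VV b = sel (%i. if odd i = b then Some (i div 2) else None)"
definition WW :: "bool => op" where "WW b = sel (%i. Some (2 * i + of_bool b))"

lemma WW_VV: "WW b * VV c = (if b = c then 1 else 0)" by (rule op_eqI) (cases b; cases c; simp add: VV_def WW_def act_sel_mult act_sel act_simps)

lemma VV_WW: "VV False * WW False + VV True * WW True = 1" by (rule op_eqI) (auto simp: VV_def WW_def act_sel_mult act_sel act_simps)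

lemma VV_E_WW: "VV b * E i j * WW b = E (2 * i + of_bool b) (2 * j + of_bool b)"
proof -
 have "odd k = b & k div 2 = i <-> k = 2 * i + of_bool b" for k by (cases b) auto
 moreover have "act (VV b * E i j * WW b) f k = (if odd k = b & k div 2 = i then apply_bcontfun f (2 * j + of_bool b) else 0)" for f k
  by (simp add: mult.assoc VV_def E_def act_sel_mult) (simp add: WW_def act_sel)
 ultimately show ?thesis by (intro op_eqI) (simp add: act_E)
qed

section \<open>Representations and the Peter--Weyl theorem\<close>

context compact_group
begin

definition ip :: "('a => real) => ('a => real) => real" where
 "ip f g = mean (%x. f x * g x)"

definition ltr :: "'a => ('a => real) => 'a => real" where
 "ltr g f = (%x. f (inv g ** x))"

text \<open>Convolution with the kernel \<open>k\<close>. It commutes with left translations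
  (\<open>conv_ltr\<close>), so its eigenspaces are translation invariant, and it is self-adjoint
  for symmetric \<open>k\<close>.\<close>

definition conv :: "('a => real) => ('a => real) => 'a => real" where
 "conv k f x = mean (%y. k (inv y ** x) * f y)"

lemma cont_ltr: "cont f ==> g : cG ==> cont (ltr g f)" unfolding ltr_def by (rule continuous_map_pre) (auto intro!: cont_T)

lemma cont_lin: "cont f ==> cont g ==> cont (%x. a * f x + b * g x)" by (intro continuous_intros continuous_map_real_mult_left)

lemma cont_scale: "cont f ==> cont (%x. a * f x)" by (intro continuous_map_real_mult_left)

lemma cont_lin_sum: "finite I ==> (!!i. i : I ==> cont (e i)) ==> cont (%x. \<Sum>i\<in>I. c i * e i x)" by (intro continuous_map_sum) (auto intro: cont_scale)

lemma ip_commute: "ip f g = ip g f" by (simp add: ip_def mult.commute)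

lemma ip_cong: "(!!x. x : cG ==> f x = f' x) ==> (!!x. x : cG ==> g x = g' x) ==> ip f g = ip f' g'" unfolding ip_def by (intro mean_cong) auto

lemma ip_add: "cont f ==> cont f' ==> cont g ==> ip (%x. a * f x + b * f' x) g = a * ip f g + b * ip f' g"
 using mean_add[of "%x. a * (f x * g x)" "%x. b * (f' x * g x)"] mean_scale[of "%x. f x * g x" a] mean_scale[of "%x. f' x * g x" b]
 by (simp add: ip_def distrib_right mult.assoc continuous_map_real_mult cont_scale)

lemma ip_scale: "cont f ==> cont g ==> ip (%x. a * f x) g = a * ip f g" using ip_add[of f f g a 0] by simp

lemma ip_sum:
 assumes "finite I" "!!i. i : I ==> cont (e i)" "cont g"
 shows "ip (%x. \<Sum>i\<in>I. c i * e i x) g = (\<Sum>i\<in>I. c i * ip (e i) g)" using assms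
proof (induction I)
 case empty thus ?case by (simp add: ip_def)
next
 case (insert i I)
 have "ip (%x. c i * e i x + 1 * (\<Sum>i\<in>I. c i * e i x)) g = c i * ip (e i) g + 1 * ip (%x. \<Sum>i\<in>I. c i * e i x) g"
  using insert by (intro ip_add cont_lin_sum) auto
 thus ?case using insert by simp
qed

lemma ip_nonneg: "cont f ==> 0 <= ip f f" unfolding ip_def by (intro mean_nonneg) (auto intro: continuous_map_real_mult)

lemma ip_eq_0: "cont f ==> ip f f = 0 ==> x : cG ==> f x = 0" using mean_pos[of "%x. f x * f x" x] unfolding ip_def
 by (metis continuous_map_real_mult less_irrefl not_real_square_gt_zero zero_le_square)

lemma Cauchy_Schwarz:
 assumes "cont f" "cont g"
 shows "(ip f g)\<^sup>2 <= ip f f * ip g g"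
proof (cases "ip g g = 0")
 case True
 hence "ip f g = ip f (%_. 0)" using ip_eq_0[OF assms(2)] by (intro ip_cong) auto
 thus ?thesis using True by (simp add: ip_def)
next
 case False
 let ?a = "ip g g" and ?b = "ip f g"
 let ?h = "%x. ?a * f x + (- ?b) * g x"
 have h: "cont ?h" by (rule cont_lin) (use assms in auto)
 have "ip ?h ?h = ?a * ip f ?h + (- ?b) * ip g ?h" by (rule ip_add[OF assms h])
 also have "ip f ?h = ?a * ip f f + (- ?b) * ip g f" by (subst ip_commute) (rule ip_add[OF assms assms(1)])
 also have "ip g ?h = ?a * ip f g + (- ?b) * ip g g" by (subst ip_commute) (rule ip_add[OF assms assms(2)])
 finally have "ip ?h ?h = ?a * (?a * ip f f - ?b\<^sup>2)" by (simp add: ip_commute[of g f] algebra_simps power2_eq_square)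
 hence "0 <= ?a * (?a * ip f f - ?b\<^sup>2)" using ip_nonneg[OF h] by simp
 moreover have "0 < ?a" using ip_nonneg[OF assms(2)] False by simp
 ultimately show ?thesis by (simp add: zero_le_mult_iff mult.commute)
qed

lemma ip_le_sup:
 assumes "cont f" "!!x. x : cG ==> abs(f x) <= c"
 shows "ip f f <= c\<^sup>2"
proof -
 have "abs(ip f f) <= c\<^sup>2" unfolding ip_def
 proof (intro mean_abs_le continuous_map_real_mult assms(1))
  fix x assume "x : cG"
  hence "abs(f x) * abs(f x) <= c * c" using assms(2) by (intro mult_mono') auto
  thus "abs(f x * f x) <= c\<^sup>2" by (simp add: power2_eq_square)
 qed
 thus ?thesis by simp
qed

lemma ip_ltr:
 assumes "cont f" "cont h" "g : cG"
 shows "ip (ltr g f) (ltr g h) = ip f h" unfolding ip_def ltr_def using mean_left[of "%x. f x * h x" "inv g"] assms by (simp add: continuous_map_real_mult)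

lemma cont_kernel:
 assumes "cont k"
 shows "ctm (ptop T T) euclideanreal (%z. k (inv (snd z) ** fst z))" by (rule continuous_map_pre[OF assms]) (intro cont_T continuous_map_fst continuous_map_snd)

lemma cont_kernel1:
 assumes "cont k" "x : cG"
 shows "cont (%y. k (inv y ** x))" using continuous_map_pre[OF assms(1), of T "%y. inv y ** x"] assms by (simp add: cont_T)

lemma cont_conv:
 assumes "cont k" "cont f"
 shows "cont (conv k f)"
proof -
 have "ctm (ptop T T) euclideanreal (%z. k (inv (snd z) ** fst z) * f (snd z))"
  by (intro continuous_map_real_mult cont_kernel assms continuous_map_pre[OF assms(2)] continuous_map_snd)
 from continuous_map_mean[OF this] show ?thesis by (simp add: conv_def[abs_def])
qed

lemma conv_ip: "conv k f x = ip (%y. k (inv y ** x)) f" by (simp add: conv_def ip_def)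

lemma conv_lin:
 assumes "cont k" "cont f" "cont g" "x : cG"
 shows "conv k (%x. a * f x + b * g x) x = a * conv k f x + b * conv k g x" unfolding conv_ip using assms by (subst (1 2 3) ip_commute) (intro ip_add cont_kernel1)

lemma conv_cong: "(!!x. x : cG ==> f x = g x) ==> conv k f x = conv k g x" unfolding conv_def by (intro mean_cong) auto

lemma conv_self_adjoint:
 assumes k: "cont k" "!!x. x : cG ==> k (inv x) = k x" and f: "cont f" and g: "cont g"
 shows "ip (conv k f) g = ip f (conv k g)"
proof -
 have c1: "cont (%y. k (inv y ** x) * f y)" if "x : cG" for x using cont_kernel1[OF k(1) that] f by (rule continuous_map_real_mult)
 have c2: "cont (%x. k (inv x ** y) * g x)" if "y : cG" for y using cont_kernel1[OF k(1) that] g by (rule continuous_map_real_mult)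
 have sym: "k (inv y ** x) = k (inv x ** y)" if "x : cG" "y : cG" for x y using k(2)[of "inv y ** x"] that by (simp add: inv_mult_group)
 have "ip (conv k f) g = mean (%x. mean (%y. k (inv y ** x) * f y) * g x)" by (simp add: ip_def conv_def)
 also have "... = mean (%x. mean (%y. k (inv y ** x) * f y * g x))"
 proof (rule mean_cong)
  fix x assume "x : cG"
  from mean_scale[OF c1[OF this], of "g x"]
  show "mean (%y. k (inv y ** x) * f y) * g x = mean (%y. k (inv y ** x) * f y * g x)" by (simp add: mult.commute)
 qed
 also have "... = mean (%y. mean (%x. k (inv y ** x) * f y * g x))"
 proof -
  have "ctm (ptop T T) euclideanreal (%z. k (inv (snd z) ** fst z) * f (snd z) * g (fst z))"
   by (intro continuous_map_real_mult cont_kernel k continuous_map_pre[OF f] continuous_map_pre[OF g] continuous_map_snd continuous_map_fst)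
  from mean_swap[OF this] show ?thesis by simp
 qed
 also have "... = mean (%y. mean (%x. f y * (k (inv x ** y) * g x)))" using sym by (intro mean_cong) (simp add: mult.commute mult.left_commute)
 also have "... = mean (%y. f y * mean (%x. k (inv x ** y) * g x))" by (rule mean_cong) (rule mean_scale[OF c2])
 finally show ?thesis by (simp add: ip_def conv_def)
qed

lemma conv_ltr:
 assumes k: "cont k" and f: "cont f" and g: "g : cG" and x: "x : cG"
 shows "conv k (ltr g f) x = ltr g (conv k f) x"
proof -
 have gx: "inv g ** x : cG" using g x by simp
 have "conv k (ltr g f) x = mean (%y. k (inv (inv g ** y) ** (inv g ** x)) * f (inv g ** y))" unfolding conv_def ltr_def using g x
  by (intro mean_cong) (simp add: inv_mult_group m_assoc, simp add: m_assoc[symmetric])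
 also have "... = mean (%y. k (inv y ** (inv g ** x)) * f y)" using mean_left[OF continuous_map_real_mult[OF cont_kernel1[OF k gx] f], of "inv g"] g by simp
 finally show ?thesis by (simp add: conv_def ltr_def)
qed

lemma conv_bound:
 assumes k: "cont k" and kb: "!!x. x : cG ==> abs(k x) <= c" and f: "cont f" and x: "x : cG"
 shows "(conv k f x)\<^sup>2 <= c\<^sup>2 * ip f f"
proof -
 have "(conv k f x)\<^sup>2 <= ip (%y. k (inv y ** x)) (%y. k (inv y ** x)) * ip f f" unfolding conv_ip by (rule Cauchy_Schwarz[OF cont_kernel1[OF k x] f])
 also have "... <= c\<^sup>2 * ip f f" using x by (intro mult_right_mono ip_le_sup cont_kernel1 k kb ip_nonneg f) auto
 finally show ?thesis .
qed

text \<open>The bound depends on \<open>f\<close> only through \<open>ip f f\<close>: convolution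
  maps sets bounded in mean square to equicontinuous families, which is the compactness of the
  operator.\<close>

lemma conv_equicontinuous:
 assumes k: "cont k" and e: "0 < e"
 obtains V where "openin T V" "\<one> : V"
  "!!f x v. cont f ==> x : cG ==> v : V ==> (conv k f (x ** v) - conv k f x)\<^sup>2 <= e\<^sup>2 * ip f f"
proof -
 obtain V where V: "openin T V" "\<one> : V" "!!x v. x : cG ==> v : V ==> dist (k (x ** v)) (k x) < e" using right_uniform[OF k e] by blast
 have Vc: "v : cG" if "v : V" for v using openin_subset[OF V(1)] that by auto
 have "(conv k f (x ** v) - conv k f x)\<^sup>2 <= e\<^sup>2 * ip f f" if f: "cont f" and x: "x : cG" and v: "v : V" for f x v
 proof -
  let ?h = "%y. 1 * k (inv y ** (x ** v)) + (-1) * k (inv y ** x)"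
  have xv: "x ** v : cG" using x Vc[OF v] by simp
  have h: "cont ?h" by (rule cont_lin[OF cont_kernel1[OF k xv] cont_kernel1[OF k x]])
  have "conv k f (x ** v) - conv k f x = ip ?h f" unfolding conv_ip using ip_add[OF cont_kernel1[OF k xv] cont_kernel1[OF k x] f, of 1 "-1"] by simp
  hence "(conv k f (x ** v) - conv k f x)\<^sup>2 <= ip ?h ?h * ip f f" using Cauchy_Schwarz[OF h f] by simp
  also have "... <= e\<^sup>2 * ip f f"
  proof (intro mult_right_mono ip_le_sup[OF h] ip_nonneg f)
   fix y assume y: "y : cG"
   hence "dist (k ((inv y ** x) ** v)) (k (inv y ** x)) < e" using x v by (intro V(3)) auto
   thus "abs(?h y) <= e" using x y Vc[OF v] by (simp add: dist_real_def m_assoc)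
  qed
  finally show ?thesis .
 qed
 thus ?thesis using that V by blast
qed

text \<open>Arzela-Ascoli in a space without countable bases: Tychonoff's theorem gives a pointwise
  cluster point \<open>w\<close>, and equicontinuity over finitely many translates makes the
  approximation uniform.\<close>

lemma equicontinuous_cluster_point:
 fixes g :: "nat => 'a => real"
 assumes b: "!!m x. x : cG ==> abs(g m x) <= b"
  and eq: "!!e. 0 < e ==> EX V. openin T V & \<one> : V & (ALL m. ALL x:cG. ALL v:V. abs(g m (x ** v) - g m x) <= e)"
 obtains w where "cont w" "!!e N. 0 < e ==> EX m>=N. ALL x:cG. abs(g m x - w x) <= e"
proof -
 \<comment> \<open>The product ranges over the whole type, so the functions are set to 0 outside the
   carrier, where \<open>g\<close> is not controlled.\<close>
 define h where "h m x = (if x : cG then g m x else 0)" for m x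
 have "0 <= b" using b[of \<one> 0] by simp
 let ?K = "PiE UNIV (%x::'a. {-b..b})"
 have "compactin (product_topology (%x::'a. euclideanreal) UNIV) ?K" by (simp add: compactin_PiE)
 hence K: "compact ?K" by (simp add: euclidean_product_topology)
 have hK: "h m : ?K" for m using b `0 <= b` by (auto simp: h_def abs_le_iff minus_le_iff)
 have "filtermap h sequentially ~= bot" "eventually (%f. f : ?K) (filtermap h sequentially)" using hK by (simp_all add: filtermap_bot_iff eventually_filtermap)
 then obtain w where w: "w : ?K" "inf (nhds w) (filtermap h sequentially) ~= bot" using K unfolding compact_filter by metis
 have cl: "EX m>=N. ALL z:Z. abs(h m z - w z) < e" if Z: "finite Z" and e: "0 < e" for Z e N
 proof (rule ccontr)
  assume neg: "\<not> ?thesis"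
  have "open {f. ALL z:Z. abs(f z - w z) < e}"
   using Z by (simp add: Collect_ball_eq) (intro open_INT ballI open_Collect_less continuous_intros continuous_on_product_coordinates; simp)
  moreover have "w : {f. ALL z:Z. abs(f z - w z) < e}" using e by simp
  ultimately have 1: "eventually (%f. ALL z:Z. abs(f z - w z) < e) (nhds w)" unfolding eventually_nhds by blast
  have 2: "eventually (%f. \<not> (ALL z:Z. abs(f z - w z) < e)) (filtermap h sequentially)" unfolding eventually_filtermap eventually_sequentially using neg by blast
  have "eventually (%f. False) (inf (nhds w) (filtermap h sequentially))" unfolding eventually_inf using 1 2 by blast
  thus False using w(2) by (simp add: eventually_False)
 qed
 have weq: "abs(w (x ** v) - w x) <= e" if V: "ALL m. ALL x:cG. ALL v:V. abs(g m (x ** v) - g m x) <= e"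
  and x: "x : cG" "v : V" "v : cG" for V e x v
 proof (rule field_le_epsilon)
  fix d :: real assume d: "0 < d"
  then obtain m where m: "ALL z:{x, x ** v}. abs(h m z - w z) < d/2" using cl[of "{x, x ** v}" "d/2" 0] by auto
  have "abs(g m (x ** v) - g m x) <= e" using V x by blast
  moreover have "abs(g m x - w x) < d/2" "abs(g m (x ** v) - w (x ** v)) < d/2" using m x by (auto simp: h_def)
  ultimately show "abs(w (x ** v) - w x) <= e + d" by linarith
 qed
 have unif: "EX m>=N. ALL x:cG. abs(g m x - w x) <= e" if e: "0 < e" for e N
 proof -
  obtain V where V: "openin T V" "\<one> : V" "ALL m. ALL x:cG. ALL v:V. abs(g m (x ** v) - g m x) <= e/3" using eq[of "e/3"] e by auto
  have Vc: "v : cG" if "v : V" for v using openin_subset[OF V(1)] that by auto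
  obtain Z where Z: "finite Z" "Z <= cG" "!!x. x : cG ==> EX z:Z. z ** x : V" using finite_translates[OF V(1)] V(2) by (metis empty_iff)
  obtain m where m: "m >= N" "ALL z:(%z. inv z) ` Z. abs(h m z - w z) < e/3" using cl[of "(%z. inv z) ` Z" "e/3" N] Z e by auto
  have "abs(g m x - w x) <= e" if x: "x : cG" for x
  proof -
   obtain z where z: "z : Z" "z ** x : V" using Z(3)[OF x] by blast
   have zc: "z : cG" using z Z by auto
   have e1: "inv z ** (z ** x) = x" using zc x by (simp add: m_assoc[symmetric])
   have "abs(g m (inv z ** (z ** x)) - g m (inv z)) <= e/3" using V(3) zc z by blast
   moreover have "abs(w (inv z ** (z ** x)) - w (inv z)) <= e/3" by (rule weq[OF V(3)]) (use zc z Vc in auto)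
   moreover have "abs(g m (inv z) - w (inv z)) < e/3" using m z zc by (auto simp: h_def)
   ultimately show ?thesis unfolding e1 by linarith
  qed
  thus ?thesis using m by blast
 qed
 have "cont w" unfolding continuous_map_dist_iff
 proof (intro ballI allI impI)
  fix x and e :: real assume x: "x : tsp T" and e: "0 < e"
  obtain V where V: "openin T V" "\<one> : V" "ALL m. ALL x:cG. ALL v:V. abs(g m (x ** v) - g m x) <= e/2" using eq[of "e/2"] e by auto
  define U where "U = {y : tsp T. inv x ** y : V}"
  have "openin T U" unfolding U_def using x by (intro open_vim[OF _ V(1)] cont_T) auto
  moreover have "x : U" using x V by (simp add: U_def)
  moreover have "dist (w y) (w x) < e" if "y : U" for y
  proof -
   have y: "y : cG" "inv x ** y : V" using that by (auto simp: U_def)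
   have "abs(w (x ** (inv x ** y)) - w x) <= e/2" by (rule weq[OF V(3)]) (use x y in auto)
   thus ?thesis using x y e by (simp add: m_assoc[symmetric] dist_real_def)
  qed
  ultimately show "EX U. openin T U & x : U & (ALL y:U. dist (w y) (w x) < e)" by blast
 qed
 thus ?thesis using that unif by blast
qed

end

lemma mult_of_bool_simp: "(a::real) * (if P then 1 else 0) = (if P then a else 0)" by simp

text \<open>The block \<open>R\<close> in the upper left corner and the identity elsewhere, so that
  products of such operators stay in \<open>1 + Mat n\<close>.\<close>

definition mk :: "nat => (nat => nat => real) => op" where
 "mk n R = 1 + (\<Sum>i<n. \<Sum>j<n. (R i j - (if i = j then 1 else 0)) *R E i j)"

lemma entry_mk: "entry (mk n R) i j = (if i < n & j < n then R i j else if i = j then 1 else 0)"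
proof -
 have "entry (mk n R) i j = (if i = j then 1 else 0) + (\<Sum>k<n. if k = i then (\<Sum>l<n. if l = j then R i j - (if i = j then 1 else 0) else 0) else 0)"
  unfolding mk_def entry_simps entry_sum by (intro arg_cong2[where f="(+)"] sum.cong refl)
   (auto simp: entry_E mult_of_bool_simp intro!: sum.neutral sum.cong)
 thus ?thesis by (simp add: sum.delta)
qed

lemma mk_Mat: "mk n R - 1 : Mat n" unfolding mk_def by (simp add: Mat_comb)

lemma mk_eqI:
 assumes "A - 1 : Mat n" "!!i j. i < n ==> j < n ==> entry A i j = R i j"
 shows "A = mk n R"
proof -
 have "A - 1 = mk n R - 1" using assms by (intro Mat_eqI[OF assms(1) mk_Mat]) (simp add: entry_mk)
 thus ?thesis by simp
qed

lemma one_Mat_mult: "A - 1 : Mat n ==> B - 1 : Mat n ==> A * B - 1 : Mat n"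
proof -
 assume a: "A - 1 : Mat n" "B - 1 : Mat n"
 have eq: "A * B - 1 = (A - 1) * (B - 1) + (A - 1) + (B - 1)" by (simp add: algebra_simps)
 show ?thesis unfolding eq by (intro Mat_add Mat_mult a)
qed

lemma entry_one_mult:
 assumes "A - 1 : Mat n" "i < n" "j < n"
 shows "entry (A * B) i j = (\<Sum>k<n. entry A i k * entry B k j)"
proof -
 have "A * B = (A - 1) * B + B" by (simp add: algebra_simps)
 hence "entry (A * B) i j = (\<Sum>k<n. entry (A - 1) i k * entry B k j) + entry B i j" using entry_mult[of "A - 1" n B i j] assms by simp
 also have "... = (\<Sum>k<n. entry A i k * entry B k j)" using assms by (simp add: left_diff_distrib sum_subtractf if_distrib[of "%x. x * _"] cong: if_cong)
 finally show ?thesis .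
qed

context compact_group
begin

text \<open>Orthogonal representations: the last clause says that the inverse acts by the transpose.
  Apart from the values on the carrier, \<open>rho\<close> is arbitrary.\<close>

definition rep :: "nat => ('a => op) => bool" where
 "rep n rho <-> ctm T euclidean rho & rho \<one> = 1 &
  (ALL x:cG. ALL y:cG. rho (x ** y) = rho x * rho y) &
  (ALL x:cG. rho x - 1 : Mat n & (ALL i j. entry (rho (inv x)) i j = entry (rho x) j i))"

lemma conv_square_bound:
 assumes k: "cont k" "!!x. x : cG ==> abs(k x) <= c" and f: "cont f"
 shows "ip (conv k f) (conv k f) <= c\<^sup>2 * ip f f"
  "x : cG ==> abs(conv k (conv k f) x) <= c\<^sup>2 * sqrt (ip f f)"
proof -
 have b: "(conv k f x)\<^sup>2 <= c\<^sup>2 * ip f f" if "x : cG" for x by (rule conv_bound[OF k f that])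
 show 1: "ip (conv k f) (conv k f) <= c\<^sup>2 * ip f f" unfolding ip_def[of "conv k f"]
  using mean_mono[of "%x. conv k f x * conv k f x" "%_. c\<^sup>2 * ip f f"] b cont_conv[OF k(1) f] by (simp add: power2_eq_square continuous_map_real_mult)
 assume x: "x : cG"
 have "(conv k (conv k f) x)\<^sup>2 <= c\<^sup>2 * ip (conv k f) (conv k f)" by (rule conv_bound[OF k cont_conv[OF k(1) f] x])
 also have "... <= c\<^sup>2 * (c\<^sup>2 * ip f f)" using 1 by (intro mult_left_mono) auto
 also have "... = (c\<^sup>2 * sqrt (ip f f))\<^sup>2" using ip_nonneg[OF f] by (simp add: power_mult_distrib power2_eq_square)
 finally show "abs(conv k (conv k f) x) <= c\<^sup>2 * sqrt (ip f f)" using ip_nonneg[OF f] by (simp add: abs_le_square_iff[symmetric])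
qed

text \<open>
 Power iteration: the quotients \<open>r m\<close> below increase by the Cauchy--Schwarz inequality, and a
 cluster point of the normalized iterates is an eigenfunction for the limit of the \<open>r m\<close>.
\<close>

lemma eigenfunction_exists:
 assumes k: "cont k" "!!x. x : cG ==> k (inv x) = k x" "!!x. x : cG ==> abs(k x) <= c"
  and f: "cont f" and a: "a : cG" and u: "!!x. x : cG ==> u x = f x - ltr a f x"
  and uc: "cont u" and nz: "x0 : cG" "conv k u x0 ~= 0"
 obtains w mu where "cont w" "0 < mu" "!!x. x : cG ==> conv k (conv k w) x = mu * w x"
  "EX x:cG. ltr a w x ~= w x"
proof -
 define it where "it m = (conv k ^^ m) u" for m
 have it_Suc: "it (Suc m) = conv k (it m)" for m by (simp add: it_def)
 have itc: "cont (it m)" for m by (induction m) (auto simp: it_Suc cont_conv k uc it_def[of 0])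
 have c0: "0 <= c" using k(3)[OF one_closed] by linarith
 define s where "s m = ip (it m) (it m)" for m
 have s0: "0 <= s m" for m unfolding s_def by (rule ip_nonneg[OF itc])
 have adj: "ip (it (Suc (Suc m))) (it m) = s (Suc m)" for m unfolding s_def using conv_self_adjoint[OF k(1,2) itc itc, of "Suc m" m] by (simp add: it_Suc)
 have lc: "(s (Suc m))\<^sup>2 <= s m * s (Suc (Suc m))" for m using Cauchy_Schwarz[OF itc itc, of "Suc (Suc m)" m] adj[of m] by (simp add: s_def mult.commute)
 have s1: "s (Suc 0) > 0"
 proof (rule ccontr)
  assume "\<not> s (Suc 0) > 0"
  hence "s (Suc 0) = 0" using s0[of "Suc 0"] by simp
  thus False using ip_eq_0[OF itc _ nz(1), of "Suc 0"] nz(2) by (simp add: s_def it_Suc it_def[of 0])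
 qed
 have spos: "0 < s m & 0 < s (Suc m)" for m
 proof (induction m)
  case 0
  thus ?case using s1 lc[of 0] s0[of 0] s0[of "Suc (Suc 0)"] by (metis less_eq_real_def mult_zero_left not_le zero_less_power)
 next
  case (Suc m)
  thus ?case using lc[of m] s0[of "Suc (Suc m)"] by (metis less_eq_real_def mult_zero_right not_le zero_less_power)
 qed
 define r where "r m = s (Suc m) / s m" for m
 have rpos: "0 < r m" for m using spos[of m] by (simp add: r_def)
 have r_le: "r m <= r (Suc m)" for m using lc[of m] spos[of m] spos[of "Suc m"] by (simp add: r_def field_simps power2_eq_square)
 have r_bd: "r m <= c\<^sup>2" for m using conv_square_bound(1)[OF k(1,3) itc[of m]] spos[of m] by (simp add: r_def s_def it_Suc pos_divide_le_eq)
 have inc: "incseq r" by (rule incseq_SucI) (rule r_le)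
 then obtain mu where mu: "r ----> mu" "!!i. r i <= mu" using incseq_convergent[OF inc, of "c\<^sup>2"] r_bd by metis
 have mupos: "0 < mu" using rpos[of 0] mu(2)[of 0] by linarith
 define q where "q m = 1 / sqrt (s m)" for m
 have qq: "q m * q m = 1 / s m" for m using s0[of m] by (simp add: q_def)
 define v where "v m = (%x. q m * it m x)" for m
 define h where "h m = (%x. q m * it (Suc m) x)" for m
 define g where "g m = (%x. q m * it (Suc (Suc m)) x)" for m
 have vc: "cont (v m)" and hc: "cont (h m)" and gc: "cont (g m)" for m unfolding v_def h_def g_def by (rule cont_scale[OF itc])+
 have ipq: "ip (%x. q m * it i x) (%x. q m * it j x) = ip (it i) (it j) / s m" for m i j
 proof -
  have "ip (%x. q m * it i x) (%x. q m * it j x) = q m * (q m * ip (it i) (it j))" using ip_scale[OF itc cont_scale[OF itc]] ip_scale[OF itc itc] ip_commute by metis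
  thus ?thesis using qq[of m] by (simp add: mult.assoc[symmetric])
 qed
 have hh: "ip (h m) (h m) = r m" for m using ipq[of m "Suc m" "Suc m"] by (simp add: h_def r_def s_def)
 have vv: "ip (v m) (v m) = 1" for m using ipq[of m m m] spos[of m] by (simp add: v_def s_def)
 have gv: "ip (g m) (v m) = r m" for m using ipq[of m "Suc (Suc m)" m] adj[of m] by (simp add: g_def v_def r_def)
 have gg: "ip (g m) (g m) = r m * r (Suc m)" for m using ipq[of m "Suc (Suc m)" "Suc (Suc m)"] spos[of m] spos[of "Suc m"] by (simp add: g_def r_def s_def)
 have sc: "conv k (%x. b * j x) x = b * conv k j x" if "cont j" "x : cG" for b j x using conv_lin[OF k(1) that(1) that(1) that(2), of b 0] by simp
 have gh: "conv k (h m) x = g m x" if "x : cG" for m x using sc[OF itc that, of "q m" "Suc m"] by (simp add: h_def g_def it_Suc)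
 have hv: "conv k (v m) x = h m x" if "x : cG" for m x using sc[OF itc that] by (simp add: h_def v_def it_Suc)
 have gKK: "conv k (conv k (v m)) x = g m x" if "x : cG" for m x using conv_cong[of "conv k (v m)" "h m"] hv gh[OF that] by simp
 have gb: "abs(g m x) <= c\<^sup>2" if "x : cG" for m x using conv_square_bound(2)[OF k(1,3) vc that, of m] gKK[OF that] vv by simp
 have eq: "EX V. openin T V & \<one> : V & (ALL m. ALL x:cG. ALL v:V. abs(g m (x ** v) - g m x) <= e)" if e: "0 < e" for e
 proof -
  have "0 < e / (c + 1)" using e c0 by simp
  from conv_equicontinuous[OF k(1) this]
  obtain V where V: "openin T V" "\<one> : V"
   "!!f x v. cont f ==> x : cG ==> v : V ==> (conv k f (x ** v) - conv k f x)\<^sup>2 <= (e / (c + 1))\<^sup>2 * ip f f" by metis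
  have "abs(g m (x ** v) - g m x) <= e" if "x : cG" "v : V" for m x v
  proof -
   have xv: "x ** v : cG" using that openin_subset[OF V(1)] by auto
   have "(g m (x ** v) - g m x)\<^sup>2 <= (e / (c + 1))\<^sup>2 * r m" using V(3)[OF hc that, of m] gh[OF xv] gh[OF that(1)] hh by simp
   also have "... <= (e / (c + 1))\<^sup>2 * c\<^sup>2" by (rule mult_left_mono[OF r_bd]) simp
   also have "... = (e * (c / (c + 1)))\<^sup>2" by (simp add: power_mult_distrib power_divide)
   also have "... <= e\<^sup>2"
   proof (rule power_mono)
    show "e * (c / (c + 1)) <= e" using e c0 by (simp add: field_simps)
   qed (use e c0 in simp)
   finally show ?thesis using e by (simp add: abs_le_square_iff[symmetric])
  qed
  thus ?thesis using V by blast
 qed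
 obtain w where w: "cont w" "!!e N. 0 < e ==> EX m>=N. ALL x:cG. abs(g m x - w x) <= e" using equicontinuous_cluster_point[of g "c\<^sup>2"] gb eq by metis
 \<comment> \<open>The residual of \<open>v m\<close> as an eigenvector for \<open>mu\<close>; its
   square norm \<open>r m * r (Suc m) - 2 * mu * r m + mu\<^sup>2\<close> tends to 0.\<close>
 define d where "d m = (%x. 1 * g m x + (- mu) * v m x)" for m
 have dc: "cont (d m)" for m unfolding d_def by (rule cont_lin[OF gc vc])
 have dd: "ip (d m) (d m) = r m * r (Suc m) - 2 * mu * r m + mu\<^sup>2" for m
 proof -
  have "ip (d m) (d m) = 1 * ip (g m) (d m) + (- mu) * ip (v m) (d m)" unfolding d_def[of m] by (rule ip_add[OF gc vc]) (rule dc[unfolded d_def])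
  moreover have "ip (g m) (d m) = 1 * ip (g m) (g m) + (- mu) * ip (v m) (g m)" by (subst ip_commute) (simp only: d_def, rule ip_add[OF gc vc gc])
  moreover have "ip (v m) (d m) = 1 * ip (g m) (v m) + (- mu) * ip (v m) (v m)" by (subst ip_commute) (simp only: d_def, rule ip_add[OF gc vc vc])
  ultimately show ?thesis by (simp add: gg gv vv ip_commute[of "v m" "g m"] algebra_simps power2_eq_square)
 qed
 have "(%m. r m * r (Suc m) - 2 * mu * r m + mu\<^sup>2) ----> mu * mu - 2 * mu * mu + mu\<^sup>2" by (intro tendsto_intros mu LIMSEQ_Suc)
 hence dlim: "(%m. ip (d m) (d m)) ----> 0" by (simp add: dd power2_eq_square)
 have near: "EX m. (ALL x:cG. abs(g m x - w x) <= e) & ip (d m) (d m) <= e\<^sup>2" if e: "0 < e" for e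
 proof -
  have "eventually (%m. ip (d m) (d m) < e\<^sup>2) sequentially" using dlim e by (intro order_tendstoD) auto
  then obtain N where N: "!!m. m >= N ==> ip (d m) (d m) < e\<^sup>2" by (auto simp: eventually_sequentially)
  show ?thesis using w(2)[OF e, of N] N by (meson less_imp_le)
 qed
 define wg where "wg m = (%x. 1 * w x + (-1) * g m x)" for m
 have wgc: "cont (wg m)" for m unfolding wg_def by (rule cont_lin[OF w(1) gc])
 have wg_le: "ip (wg m) (wg m) <= e\<^sup>2" if "ALL x:cG. abs(g m x - w x) <= e" for m e by (rule ip_le_sup[OF wgc]) (use that in "simp add: wg_def abs_minus_commute")
 have eig: "conv k (conv k w) x = mu * w x" if x: "x : cG" for x
 proof -
  have lin2: "conv k (conv k (%x. alp * p x + bet * p' x)) x = alp * conv k (conv k p) x + bet * conv k (conv k p') x"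
   if "cont p" "cont p'" for p p' alp bet using conv_cong[of "conv k (%x. alp * p x + bet * p' x)" "%x. alp * conv k p x + bet * conv k p' x" k x]
    conv_lin[OF k(1) that] conv_lin[OF k(1) cont_conv[OF k(1) that(1)] cont_conv[OF k(1) that(2)] x] by simp
  have "abs(conv k (conv k w) x - mu * w x) <= 0 + t" if t: "0 < t" for t
  proof -
   define e where "e = t / (2 * c\<^sup>2 + mu)"
   have e: "0 < e" using t mupos by (simp add: e_def add_nonneg_pos)
   obtain m where m: "ALL x:cG. abs(g m x - w x) <= e" "ip (d m) (d m) <= e\<^sup>2" using near[OF e] by blast
   have sq: "sqrt (ip (d m) (d m)) <= e" "sqrt (ip (wg m) (wg m)) <= e" using real_sqrt_le_mono[OF m(2)] real_sqrt_le_mono[OF wg_le[OF m(1)]] e by simp_all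
   have "conv k (conv k w) x - mu * w x = conv k (conv k (wg m)) x + conv k (conv k (d m)) x + mu * (g m x - w x)"
    unfolding wg_def d_def lin2[OF w(1) gc] lin2[OF gc vc] gKK[OF x] by (simp add: algebra_simps)
   moreover have "abs(conv k (conv k (wg m)) x) <= c\<^sup>2 * e"
    using conv_square_bound(2)[OF k(1,3) wgc x] mult_left_mono[OF sq(2), of "c\<^sup>2"] order_trans by auto
   moreover have "abs(conv k (conv k (d m)) x) <= c\<^sup>2 * e" using conv_square_bound(2)[OF k(1,3) dc x] mult_left_mono[OF sq(1), of "c\<^sup>2"] order_trans by auto
   moreover have "abs(mu * (g m x - w x)) <= mu * e" using m(1) x mupos by (simp add: abs_mult)
   moreover have "t = c\<^sup>2 * e + c\<^sup>2 * e + mu * e" using mupos unfolding e_def by (simp add: field_simps add_nonneg_eq_0_iff)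
   ultimately show ?thesis by linarith
  qed
  hence "abs(conv k (conv k w) x - mu * w x) <= 0" by (rule field_le_epsilon)
  thus ?thesis by simp
 qed
 \<comment> \<open>Every iterate is a difference \<open>p - ltr a p\<close> and hence orthogonal to
   all functions fixed by \<open>ltr a\<close>. If \<open>w\<close> were fixed, it would be
   orthogonal to the \<open>g m\<close> that come close to it, against the lower bound on their
   norms.\<close>
 have it_a: "EX p. cont p & (ALL x:cG. it m x = 1 * p x + (-1) * ltr a p x)" for m
 proof (induction m)
  case 0
  thus ?case using f u by (auto simp: it_def)
 next
  case (Suc m)
  then obtain p where p: "cont p" "ALL x:cG. it m x = 1 * p x + (-1) * ltr a p x" by blast
  have "it (Suc m) x = 1 * conv k p x + (-1) * ltr a (conv k p) x" if x: "x : cG" for x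
  proof -
   have "it (Suc m) x = conv k (%x. 1 * p x + (-1) * ltr a p x) x" unfolding it_Suc by (rule conv_cong) (use p in blast)
   also have "... = 1 * conv k p x + (-1) * conv k (ltr a p) x" by (rule conv_lin[OF k(1) p(1) cont_ltr[OF p(1) a] x])
   also have "conv k (ltr a p) x = ltr a (conv k p) x" by (rule conv_ltr[OF k(1) p(1) a x])
   finally show ?thesis .
  qed
  thus ?case using cont_conv[OF k(1) p(1)] by blast
 qed
 have "EX x:cG. ltr a w x ~= w x"
 proof (rule ccontr)
  assume "\<not> ?thesis"
  hence fix_w: "!!x. x : cG ==> ltr a w x = w x" by blast
  have it_w: "ip (it m) w = 0" for m
  proof -
   obtain p where p: "cont p" "!!x. x : cG ==> it m x = 1 * p x + (-1) * ltr a p x" using it_a by blast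
   have "ip (it m) w = ip (%x. 1 * p x + (-1) * ltr a p x) w" by (rule ip_cong) (use p in auto)
   also have "... = 1 * ip p w + (-1) * ip (ltr a p) w" by (rule ip_add[OF p(1) cont_ltr[OF p(1) a] w(1)])
   also have "ip (ltr a p) w = ip (ltr a p) (ltr a w)" by (rule ip_cong) (use fix_w in auto)
   also have "... = ip p w" by (rule ip_ltr[OF p(1) w(1) a])
   finally show ?thesis by simp
  qed
  have gw: "ip (g m) w = 0" for m unfolding g_def ip_scale[OF itc w(1)] it_w by simp
  define e where "e = r 0 / 2"
  have e: "0 < e" using rpos[of 0] by (simp add: e_def)
  obtain m where m: "ALL x:cG. abs(g m x - w x) <= e" using near[OF e] by blast
  have "ip (g m) (wg m) = 1 * ip w (g m) + (-1) * ip (g m) (g m)" by (subst ip_commute) (simp only: wg_def, rule ip_add[OF w(1) gc gc])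
  hence "(ip (g m) (g m))\<^sup>2 = (ip (g m) (wg m))\<^sup>2" using gw[of m] by (simp add: ip_commute)
  also have "... <= ip (g m) (g m) * ip (wg m) (wg m)" by (rule Cauchy_Schwarz[OF gc wgc])
  also have "... <= ip (g m) (g m) * e\<^sup>2" by (intro mult_left_mono wg_le[OF m] ip_nonneg[OF gc])
  finally have "ip (g m) (g m) <= e\<^sup>2" using gg[of m] rpos[of m] rpos[of "Suc m"] by (simp add: power2_eq_square)
  moreover have "r 0 * r 0 <= ip (g m) (g m)" unfolding gg using inc rpos[of 0] rpos[of m] by (intro mult_mono) (auto simp: incseq_def)
  moreover have "e\<^sup>2 < r 0 * r 0" using rpos[of 0] by (simp add: e_def power2_eq_square)
  ultimately show False by linarith
 qed
 thus ?thesis using that[OF w(1) mupos eig] by blast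
qed

end

text \<open>The direct sum inside the same type: \<open>A\<close> acts on the even and
  \<open>B\<close> on the odd coordinates.\<close>

definition dsum :: "op => op => op" where
 "dsum A B = VV False * A * WW False + VV True * B * WW True"

lemma WW_VV_mult: "WW b * (VV c * X) = (if b = c then X else 0)" using WW_VV[of b c] by (simp add: mult.assoc[symmetric])

lemma dsum_mult: "dsum A B * dsum C D = dsum (A * C) (B * D)" by (simp add: dsum_def distrib_left distrib_right mult.assoc WW_VV_mult)

lemma dsum_1: "dsum 1 1 = 1" by (simp add: dsum_def VV_WW)

lemma dsum_VV: "dsum A B * VV False = VV False * A" "dsum A B * VV True = VV True * B" by (simp_all add: dsum_def distrib_right mult.assoc WW_VV)

lemma WW_dsum_VV: "WW False * dsum A B * VV False = A" "WW True * dsum A B * VV True = B" by (simp_all add: mult.assoc dsum_VV WW_VV_mult)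

lemma dsum_eq_1: "dsum A B = 1 <-> A = 1 & B = 1" using WW_dsum_VV[of A B] by (auto simp: dsum_1 WW_VV)

lemma VV_Mat_WW: "A : Mat n ==> VV b * A * WW b : Mat (2 * n)" by (subst Mat_expand, assumption)
  (auto simp: sum_distrib_left sum_distrib_right VV_E_WW intro!: Mat_sum Mat_scale E_in_Mat)

lemma dsum_Mat:
 assumes "A - 1 : Mat n" "B - 1 : Mat m"
 shows "dsum A B - 1 : Mat (2 * max n m)"
proof -
 have "dsum A B - 1 = dsum A B - dsum 1 1" by (simp add: dsum_1)
 also have "... = VV False * (A - 1) * WW False + VV True * (B - 1) * WW True" by (simp add: dsum_def algebra_simps)
 finally show ?thesis using assms by (auto intro!: Mat_add VV_Mat_WW intro: Mat_mono)
qed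

lemma entry_VV_WW:
 "entry (VV b * A * WW b) k l = (if odd k = b & odd l = b then entry A (k div 2) (l div 2) else 0)"
proof -
 have W: "blinfun_apply (Rep_op (WW b)) (unitv l) = (if odd l = b then unitv (l div 2) else 0)"
 proof (rule bcontfun_eqI)
  fix i
  have "2 * i + of_bool b = l <-> odd l = b & i = l div 2" by (cases b) auto
  thus "apply_bcontfun (blinfun_apply (Rep_op (WW b)) (unitv l)) i = apply_bcontfun (if odd l = b then unitv (l div 2) else 0) i"
   using act_sel[of "%i. Some (2 * i + of_bool b)" "unitv l" i] by (auto simp: WW_def act_def unitv zero_bcontfun.rep_eq const_bcontfun.rep_eq)
 qed
 have "entry (VV b * A * WW b) k l = act (VV b * A) (if odd l = b then unitv (l div 2) else 0) k" unfolding entry_def act_mult[of "VV b * A" "WW b"] W ..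
 also have "... = (if odd k = b then act A (if odd l = b then unitv (l div 2) else 0) (k div 2) else 0)" by (simp add: VV_def act_sel_mult)
 also have "... = (if odd k = b & odd l = b then entry A (k div 2) (l div 2) else 0)"
  by (auto simp: entry_def) (auto simp: act_def blinfun.bilinear_simps zero_bcontfun.rep_eq const_bcontfun.rep_eq)
 finally show ?thesis .
qed

lemma entry_dsum:
 "entry (dsum A B) k l = (if odd k = odd l then entry (if odd k then B else A) (k div 2) (l div 2) else 0)" by (simp add: dsum_def entry_VV_WW)

context compact_group
begin

definition ON :: "('a => real) set => nat => (nat => 'a => real) => bool" where
 "ON S d e <-> (ALL i<d. e i : S) & (ALL i<d. ALL j<d. ip (e i) (e j) = (if i = j then 1 else 0))"

text \<open>For fixed \<open>y\<close> the function \<open>f d\<close> reproduces values at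
  \<open>y\<close> on the span of the \<open>e i\<close>, so its value at \<open>y\<close> equals
  its square norm \<open>s\<close>. The pointwise bound for twice convolved functions gives
  \<open>mu * s <= c\<^sup>2 * sqrt s\<close>, and the mean of \<open>s\<close> over
  \<open>y\<close> is \<open>d\<close>.\<close>

lemma eigenspace_dim:
 assumes k: "cont k" "!!x. x : cG ==> abs(k x) <= c" and mu: "0 < mu"
  and ON: "ON {f. cont f & (ALL x:cG. conv k (conv k f) x = mu * f x)} d e"
 shows "real d <= (c\<^sup>2 / mu)\<^sup>2"
proof -
 have ec: "cont (e i)" and ee: "x : cG ==> conv k (conv k (e i)) x = mu * e i x" if "i < d" for i x using ON that by (auto simp: ON_def)
 have bnd: "(\<Sum>i<d. e i y * e i y) <= (c\<^sup>2 / mu)\<^sup>2" if y: "y : cG" for y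
 proof -
  define s where "s = (\<Sum>i<d. e i y * e i y)"
  have s0: "0 <= s" by (simp add: s_def sum_nonneg)
  define f where "f n x = (\<Sum>i<n. e i y * e i x)" for n x
  have fc: "cont (f n)" if "n <= d" for n unfolding f_def using that by (intro cont_lin_sum ec) auto
  have KK: "conv k (conv k (f n)) x = mu * f n x" if "n <= d" "x : cG" for n x using that
  proof (induction n arbitrary: x)
   case 0
   have "conv k (%x. 0) = (%x. 0)" "f 0 = (%x. 0)" by (simp_all add: conv_def f_def fun_eq_iff)
   thus ?case by simp
  next
   case (Suc n)
   have fS: "f (Suc n) = (%x. 1 * f n x + e n y * e n x)" by (auto simp: f_def)
   have n: "n < d" "cont (f n)" "cont (e n)" using Suc.prems fc[of n] ec[of n] by auto
   have "conv k (conv k (f (Suc n))) x = conv k (%x. 1 * conv k (f n) x + e n y * conv k (e n) x) x" unfolding fS by (rule conv_cong) (rule conv_lin[OF k(1) n(2,3)])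
   also have "... = 1 * conv k (conv k (f n)) x + e n y * conv k (conv k (e n)) x"
    by (rule conv_lin[OF k(1) cont_conv[OF k(1) n(2)] cont_conv[OF k(1) n(3)] Suc.prems(2)])
   also have "... = mu * f (Suc n) x" using Suc n ee[OF n(1)] by (simp add: fS algebra_simps)
   finally show ?case .
  qed
  have "ip (f d) (f d) = (\<Sum>i<d. e i y * ip (e i) (f d))" unfolding f_def[of d] by (rule ip_sum) (use ec fc[of d, unfolded f_def] in auto)
  also have "... = (\<Sum>i<d. e i y * e i y)"
  proof (rule sum.cong)
   fix i assume i: "i : {..<d}"
   have "ip (e i) (f d) = (\<Sum>j<d. e j y * ip (e j) (e i))" unfolding f_def[of d] by (subst ip_commute, rule ip_sum) (use ec i in auto)
   also have "... = (\<Sum>j<d. if j = i then e i y else 0)" by (rule sum.cong) (use ON i in "auto simp: ON_def")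
   finally show "e i y * ip (e i) (f d) = e i y * e i y" using i by simp
  qed simp
  finally have ff: "ip (f d) (f d) = s" by (simp add: s_def)
  have "mu * s <= c\<^sup>2 * sqrt s" using conv_square_bound(2)[OF k fc[of d] y] KK[of d y] y s0 mu ff by (simp add: f_def s_def abs_mult)
  hence "sqrt s * sqrt s <= (c\<^sup>2 / mu) * sqrt s" using mu s0 by (simp add: field_simps)
  hence "sqrt s <= c\<^sup>2 / mu" using s0 mu mult_right_le_imp_le[of "sqrt s" "sqrt s" "c\<^sup>2 / mu"] by (cases "s = 0") auto
  hence "(sqrt s)\<^sup>2 <= (c\<^sup>2 / mu)\<^sup>2" using s0 by (intro power_mono) auto
  thus ?thesis using s0 by (simp add: s_def)
 qed
 have sq: "cont (%x. e i x * e i x)" if "i < d" for i using ec[OF that] by (intro continuous_map_real_mult)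
 have "real d = (\<Sum>i<d. mean (%x. e i x * e i x))" using ON by (simp add: ON_def ip_def)
 also have "... = mean (%x. \<Sum>i<d. e i x * e i x)" by (rule mean_sum[symmetric]) (use sq in auto)
 also have "... <= mean (%_. (c\<^sup>2 / mu)\<^sup>2)" using sq bnd by (intro mean_mono continuous_map_sum) auto
 finally show ?thesis by simp
qed

lemma ltr_comp: "g : cG ==> h : cG ==> x : cG ==> ltr (g ** h) f x = ltr g (ltr h f) x" by (simp add: ltr_def inv_mult_group m_assoc)

text \<open>Orthonormal systems in \<open>S\<close> have bounded length, and a maximal one expands
  every element of \<open>S\<close>. The coefficients of the translated basis are the matrices of
  \<open>rho\<close>; if \<open>rho a\<close> were 1, translation by \<open>a\<close> would fix all
  of \<open>S\<close>.\<close>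

lemma rep_of_function_space:
 assumes Sc: "!!f. f : S ==> cont f"
  and lin: "!!f g a b. f : S ==> g : S ==> (%x. a * f x + b * g x) : S"
  and tr: "!!f g. f : S ==> g : cG ==> ltr g f : S"
  and bd: "!!d e. ON S d e ==> real d <= D"
  and w: "w : S" "a : cG" "x0 : cG" "ltr a w x0 ~= w x0"
 obtains n rho where "rep n rho" "rho a ~= 1"
proof -
 have "EX n. (EX e. ON S n e) & \<not> (EX e. ON S (Suc n) e)"
 proof (rule ccontr)
  assume neg: "\<not> ?thesis"
  have "EX e. ON S n e" for n
  proof (induction n)
   case 0
   show ?case by (simp add: ON_def)
  qed (use neg in blast)
  moreover obtain n where "D < real n" using reals_Archimedean2 by blast
  ultimately show False using bd[of n] by force
 qed
 then obtain n e where e: "ON S n e" and mx: "\<not> (EX e. ON S (Suc n) e)" by blast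
 have eS: "e i : S" and ec: "cont (e i)" if "i < n" for i using e that Sc by (auto simp: ON_def)
 have sumS: "(%x. \<Sum>i<m. c i * e i x) : S" if "m <= n" for c m using that
 proof (induction m)
  case 0 thus ?case using lin[OF w(1) w(1), of 0 0] by simp
 next
  case (Suc m)
  have "(%x. 1 * (\<Sum>i<m. c i * e i x) + c m * e m x) : S" by (rule lin) (use Suc eS in auto)
  thus ?case by simp
 qed
 have expand: "f x = (\<Sum>i<n. ip f (e i) * e i x)" if f: "f : S" and x: "x : cG" for f x
 proof (rule ccontr)
  assume ne: "f x ~= (\<Sum>i<n. ip f (e i) * e i x)"
  let ?p = "%x. \<Sum>i<n. ip f (e i) * e i x"
  define r where "r = (%x. 1 * f x + (-1) * ?p x)"
  have rS: "r : S" unfolding r_def by (rule lin[OF f sumS]) simp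
  have rc: "cont r" by (rule Sc[OF rS])
  have orth: "ip r (e j) = 0" if j: "j < n" for j
  proof -
   have "ip r (e j) = 1 * ip f (e j) + (-1) * ip ?p (e j)" unfolding r_def by (rule ip_add[OF Sc[OF f] Sc[OF sumS] ec[OF j]]) simp
   also have "ip ?p (e j) = (\<Sum>i<n. ip f (e i) * ip (e i) (e j))" by (rule ip_sum) (use ec j in auto)
   also have "... = (\<Sum>i<n. if i = j then ip f (e j) else 0)" by (rule sum.cong) (use e j in "auto simp: ON_def")
   finally show ?thesis using j by simp
  qed
  have N: "0 < ip r r" using ip_nonneg[OF rc] ip_eq_0[OF rc _ x] ne by (cases "ip r r = 0") (auto simp: r_def)
  define t where "t = 1 / sqrt (ip r r)"
  have tt: "t * t * ip r r = 1" using N by (simp add: t_def)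
  let ?h = "%x. t * r x"
  have hS: "?h : S" using lin[OF rS rS, of t 0] by simp
  have hh: "ip ?h ?h = 1" using ip_scale[OF rc cont_scale[OF rc], of t t] ip_scale[OF rc rc, of t] tt ip_commute[of r ?h] by simp
  have he: "ip ?h (e j) = 0" "ip (e j) ?h = 0" if "j < n" for j using ip_scale[OF rc ec[OF that], of t] orth[OF that] by (simp_all add: ip_commute[of "e j"])
  have "ON S (Suc n) (e(n := ?h))" unfolding ON_def using e eS hS hh he by (auto simp: ON_def less_Suc_eq)
  thus False using mx by blast
 qed
 define R where "R g i j = ip (ltr g (e j)) (e i)" for g i j
 define rho where "rho g = mk n (R g)" for g
 have R1: "R \<one> i j = (if i = j then 1 else 0)" if "i < n" "j < n" for i j
 proof -
  have "R \<one> i j = ip (e j) (e i)" unfolding R_def by (rule ip_cong) (auto simp: ltr_def)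
  thus ?thesis using e that by (auto simp: ON_def)
 qed
 have Rm: "R (g ** h) i j = (\<Sum>k<n. R g i k * R h k j)" if gh: "g : cG" "h : cG" and ij: "i < n" "j < n" for g h i j
 proof -
  have hx: "ltr h (e j) x = (\<Sum>k<n. R h k j * e k x)" if "x : cG" for x unfolding R_def by (rule expand[OF tr[OF eS[OF ij(2)] gh(2)] that])
  have "R (g ** h) i j = ip (%x. \<Sum>k<n. R h k j * ltr g (e k) x) (e i)" unfolding R_def[of "g ** h"]
  proof (rule ip_cong)
   fix x assume x: "x : cG"
   have "ltr (g ** h) (e j) x = ltr h (e j) (inv g ** x)" using ltr_comp[OF gh x] by (simp add: ltr_def)
   also have "... = (\<Sum>k<n. R h k j * ltr g (e k) x)" using hx[of "inv g ** x"] gh x by (simp add: ltr_def)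
   finally show "ltr (g ** h) (e j) x = (\<Sum>k<n. R h k j * ltr g (e k) x)" .
  qed simp
  also have "... = (\<Sum>k<n. R h k j * ip (ltr g (e k)) (e i))" by (rule ip_sum) (use ec cont_ltr gh ij in auto)
  finally show ?thesis by (simp add: R_def mult.commute)
 qed
 have Rt: "R (inv g) i j = R g j i" if g: "g : cG" and ij: "i < n" "j < n" for g i j
 proof -
  have "R (inv g) i j = ip (ltr g (ltr (inv g) (e j))) (ltr g (e i))" unfolding R_def using ip_ltr[OF cont_ltr[OF ec[OF ij(2)]] ec[OF ij(1)] g, of "inv g"] g by simp
  also have "... = ip (e j) (ltr g (e i))" by (rule ip_cong) (use g in "auto simp: ltr_def m_assoc[symmetric]")
  finally show ?thesis by (simp add: R_def ip_commute)
 qed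
 have Rc: "cont (%g. R g i j)" if ij: "i < n" "j < n" for i j
 proof -
  have "ctm (ptop T T) euclideanreal (%z. e j (inv (fst z) ** snd z) * e i (snd z))"
   by (intro continuous_map_real_mult continuous_map_pre[OF ec[OF ij(2)]] continuous_map_pre[OF ec[OF ij(1)]] cont_T
     continuous_map_fst continuous_map_snd)
  from continuous_map_mean[OF this] show ?thesis by (simp add: R_def ip_def ltr_def)
 qed
 have "rep n rho" unfolding rep_def
 proof (intro conjI ballI allI)
  show "ctm T euclidean rho" unfolding rho_def[abs_def] mk_def
   by (intro continuous_intros continuous_map_sum continuous_map_unop[of _ _ "%t. t *R _"] Rc continuous_map_diff) auto
  show "rho \<one> = 1" unfolding rho_def by (rule mk_eqI[symmetric]) (auto simp: R1)
  fix x assume x: "x : cG"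
  show "rho x - 1 : Mat n" by (simp add: rho_def mk_Mat)
  show "entry (rho (inv x)) i j = entry (rho x) j i" for i j by (auto simp: rho_def entry_mk Rt[OF x])
  fix y assume y: "y : cG"
  have "rho x * rho y = mk n (R (x ** y))"
  proof (rule mk_eqI)
   show "rho x * rho y - 1 : Mat n" by (simp add: rho_def mk_Mat one_Mat_mult)
   show "entry (rho x * rho y) i j = R (x ** y) i j" if "i < n" "j < n" for i j using that Rm[OF x y that] by (simp add: rho_def entry_one_mult[OF mk_Mat] entry_mk)
  qed
  thus "rho (x ** y) = rho x * rho y" by (simp add: rho_def)
 qed
 moreover have "rho a ~= 1"
 proof
  assume a1: "rho a = 1"
  have Ra: "R a i j = (if i = j then 1 else 0)" if "i < n" "j < n" for i j using a1 entry_mk[of n "R a" i j] that by (simp add: rho_def)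
  have la: "ltr a (e j) x = e j x" if j: "j < n" and x: "x : cG" for j x
  proof -
   have "ltr a (e j) x = (\<Sum>i<n. R a i j * e i x)" unfolding R_def by (rule expand[OF tr[OF eS[OF j] w(2)] x])
   also have "... = (\<Sum>i<n. if i = j then e j x else 0)" by (rule sum.cong) (use Ra j in auto)
   finally show ?thesis using j by simp
  qed
  have ax: "inv a ** x0 : cG" using w by simp
  have "ltr a w x0 = (\<Sum>i<n. ip w (e i) * ltr a (e i) x0)" unfolding ltr_def by (rule expand[OF w(1) ax])
  also have "... = w x0" using expand[OF w(1) w(3)] la w by simp
  finally show False using w by simp
 qed
 ultimately show ?thesis using that by blast
qed

end

lemma compact_Hausdorff_imp_completely_regular:
 "compact_space X ==> Hausdorff_space X ==> completely_regular_space X" by (simp add: compact_Hausdorff_or_regular_imp_normal_space normal_imp_completely_regular_space)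

context compact_group
begin

lemma separating_function:
 assumes "a : cG" "b : cG" "a ~= b"
 obtains f where "cont f" "f a = 1" "f b = 0"
proof -
 have cr: "completely_regular_space T" using compact Hausdorff by (rule compact_Hausdorff_imp_completely_regular)
 have "closedin T {a}" using Hausdorff assms(1) by (simp add: closedin_Hausdorff_singleton)
 moreover have "b : tsp T - {a}" using assms by simp
 ultimately obtain f where f: "ctm T (top_of_set {0..1::real}) f" "f b = 0" "f ` {a} <= {1}"
  using cr unfolding completely_regular_space_def by (metis image_subset_iff_subset_vimage)
 have "cont f" using f(1) by (simp add: ctm_into)
 thus ?thesis using that f by auto
qed

lemma bump_function:
 assumes "openin T U" "a : U"
 obtains f where "cont f" "f a = 1" "!!x. x : cG ==> 0 <= f x" "!!x. x : cG - U ==> f x = 0"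
proof -
 have cr: "completely_regular_space T" using compact Hausdorff by (rule compact_Hausdorff_imp_completely_regular)
 have aT: "a : tsp T" using openin_subset[OF assms(1)] assms(2) by auto
 have "closedin T (tsp T - U)" using assms(1) by blast
 moreover have "a : tsp T - (tsp T - U)" using assms(2) aT by blast
 ultimately obtain f where f: "ctm T (top_of_set {0..1::real}) f" "f a = 0" "f ` (tsp T - U) <= {1}" using cr unfolding completely_regular_space_def by metis
 have f1: "cont f" "!!x. x : cG ==> f x : {0..1}" using f(1) by (auto simp: ctm_into image_subset_iff)
 show ?thesis
 proof (rule that[of "%x. 1 - f x"])
  show "cont (%x. 1 - f x)" using f1(1) by (intro continuous_intros)
 qed (use f f1 in auto)
qed

text \<open>The function \<open>u\<close> has the value 1 at \<open>a\<close>, and convolution with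
  a narrow symmetric kernel keeps it positive there. This produces an eigenfunction not fixed by
  translation by \<open>a\<close>, whose eigenspace is translation invariant and of finite
  dimension.\<close>

theorem Peter_Weyl:
 assumes a: "a : cG" "a ~= \<one>"
 obtains n rho where "rep n rho" "rho a ~= 1"
proof -
 obtain f where f: "cont f" "f \<one> = 0" "f a = 1" using separating_function[of a \<one>] a by auto
 define u where "u = (%x. 1 * f x + (-1) * ltr a f x)"
 have uc: "cont u" unfolding u_def by (rule cont_lin[OF f(1) cont_ltr[OF f(1) a(1)]])
 have ua: "u a = 1" using f a by (simp add: u_def ltr_def)
 define W where "W = {v : tsp T. u (a ** v) : {1/2<..}}"
 have W: "openin T W" unfolding W_def by (rule open_vim[OF continuous_map_pre[OF uc]])
   (use a in "auto simp: open_openin[symmetric] intro!: cont_T")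
 have W1: "\<one> : W" using ua a by (simp add: W_def)
 obtain k0 where k0: "cont k0" "k0 \<one> = 1" "!!x. x : cG ==> 0 <= k0 x" "!!x. x : cG - W ==> k0 x = 0" using bump_function[OF W W1] by metis
 \<comment> \<open>Symmetrised so that the convolution is self-adjoint. The product vanishes unless
   \<open>x\<close> and \<open>inv x\<close> both lie in \<open>W\<close>; in the mean defining
   \<open>conv k u a\<close>, only points with \<open>u y > 1/2\<close> contribute.\<close>
 define k where "k x = k0 x * k0 (inv x)" for x
 have kc: "cont k" unfolding k_def[abs_def] by (intro continuous_map_real_mult k0(1) cont_inv)
 have ksym: "k (inv x) = k x" if "x : cG" for x using that by (simp add: k_def mult.commute)
 obtain c where c: "!!x. x : cG ==> abs(k x) <= c" using continuous_map_bounded[OF compact kc] by auto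
 have "0 < conv k u a" unfolding conv_def
 proof (rule mean_pos)
  show "cont (%y. k (inv y ** a) * u y)" by (rule continuous_map_real_mult[OF cont_kernel1[OF kc a(1)] uc])
  fix y assume y: "y : cG"
  show "0 <= k (inv y ** a) * u y"
  proof (cases "inv a ** y : W")
   case True
   hence "1/2 < u y" using a y by (simp add: W_def m_assoc[symmetric])
   moreover have "0 <= k (inv y ** a)" using a y k0(3) by (simp add: k_def)
   ultimately show ?thesis by simp
  next
   case False
   hence "k0 (inv (inv y ** a)) = 0" using k0(4) a y by (simp add: inv_mult_group)
   thus ?thesis by (simp add: k_def)
  qed
 next
  show "0 < k (inv a ** a) * u a" using a k0 ua by (simp add: k_def)
 qed (rule a(1))
 hence nz: "conv k u a ~= 0" by simp
 obtain w mu where w: "cont w" "0 < mu" "!!x. x : cG ==> conv k (conv k w) x = mu * w x" "EX x:cG. ltr a w x ~= w x"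
  using eigenfunction_exists[OF kc ksym c f(1) a(1) _ uc a(1) nz] by (auto simp: u_def)
 define S where "S = {f. cont f & (ALL x:cG. conv k (conv k f) x = mu * f x)}"
 obtain x0 where x0: "x0 : cG" "ltr a w x0 ~= w x0" using w(4) by blast
 show ?thesis
 proof (rule rep_of_function_space[of S "(c\<^sup>2 / mu)\<^sup>2" w a x0])
  show "cont f" if "f : S" for f using that by (simp add: S_def)
  show "(%x. s * f x + t * g x) : S" if "f : S" "g : S" for f g s t
  proof -
   have fg: "cont f" "cont g" using that by (auto simp: S_def)
   have "conv k (conv k (%x. s * f x + t * g x)) x = mu * (s * f x + t * g x)" if x: "x : cG" for x
   proof -
    have "conv k (conv k (%x. s * f x + t * g x)) x = conv k (%x. s * conv k f x + t * conv k g x) x" by (rule conv_cong) (rule conv_lin[OF kc fg])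
    also have "... = s * conv k (conv k f) x + t * conv k (conv k g) x" by (rule conv_lin[OF kc cont_conv[OF kc fg(1)] cont_conv[OF kc fg(2)] x])
    finally show ?thesis using `f : S` `g : S` x by (simp add: S_def algebra_simps)
   qed
   thus ?thesis using cont_lin[OF fg] by (simp add: S_def)
  qed
  show "ltr g f : S" if "f : S" "g : cG" for f g
  proof -
   have fc: "cont f" using that by (simp add: S_def)
   have "conv k (conv k (ltr g f)) x = mu * ltr g f x" if x: "x : cG" for x
   proof -
    have "conv k (conv k (ltr g f)) x = conv k (ltr g (conv k f)) x" by (rule conv_cong) (rule conv_ltr[OF kc fc `g : cG`])
    also have "... = ltr g (conv k (conv k f)) x" by (rule conv_ltr[OF kc cont_conv[OF kc fc] `g : cG` x])
    finally show ?thesis using `f : S` x `g : cG` by (simp add: S_def ltr_def)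
   qed
   thus ?thesis using cont_ltr[OF fc that(2)] by (simp add: S_def)
  qed
  show "real d <= (c\<^sup>2 / mu)\<^sup>2" if "ON S d e" for d e using eigenspace_dim[OF kc c w(2)] that unfolding S_def by blast
  show "w : S" using w by (simp add: S_def)
  show "!!n rho. rep n rho ==> rho a ~= 1 ==> thesis" by (rule that)
 qed (use a x0 in auto)
qed

lemma rep_trivial: "rep 0 (%_. 1)" by (simp add: rep_def)

lemma rep_dsum:
 assumes "rep n rho" "rep m sg"
 shows "rep (2 * max n m) (%x. dsum (rho x) (sg x))"
proof -
 have "ctm T euclidean (%x. dsum (rho x) (sg x))" unfolding dsum_def using assms
  by (intro continuous_map_binop[of _ "rho" "sg" "%a b. VV False * a * WW False + VV True * b * WW True"] continuous_intros)
   (auto simp: rep_def)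
 thus ?thesis using assms by (auto simp: rep_def dsum_1 dsum_mult dsum_Mat entry_dsum)
qed

text \<open>Each point of \<open>C\<close> is detected by some representation; by compactness
  finitely many suffice, and their block sum detects all points at once.\<close>

lemma rep_cover:
 assumes C: "closedin T C" "\<one> \<notin> C"
 obtains n rho where "rep n rho" "!!x. x : C ==> rho x ~= 1"
proof -
 have Cc: "C <= cG" using closedin_subset[OF C(1)] by simp
 have "EX n rho. rep n rho & rho a ~= 1" if "a : C" for a using Peter_Weyl[of a] that C Cc by blast
 then obtain n rho where rho: "!!a. a : C ==> rep (n a) (rho a) & rho a a ~= 1" by metis
 define W where "W a = {x : tsp T. rho a x : - {1}}" for a
 have W: "openin T (W a)" if "a : C" for a unfolding W_def by (rule open_vim[of T euclidean])
   (use rho[OF that] in "auto simp: rep_def open_openin[symmetric]")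
 have "compactin T C" using closedin_compact_space[OF compact C(1)] .
 moreover have "C <= \<Union> (W ` C)" using rho Cc by (auto simp: W_def)
 ultimately obtain F where F: "finite F" "F <= W ` C" "C <= \<Union> F" using W unfolding compactin_def by (metis (no_types, lifting) imageE)
 then obtain Z where Z: "finite Z" "Z <= C" "F = W ` Z" by (meson finite_subset_image)
 have "EX m sg. rep m sg & (ALL x:cG. sg x = 1 --> (ALL a:Z. rho a x = 1))" using Z(1,2)
 proof induction
  case empty
  thus ?case using rep_trivial by blast
 next
  case (insert a Z)
  then obtain m sg where s: "rep m sg" "ALL x:cG. sg x = 1 --> (ALL a:Z. rho a x = 1)" by auto
  have ra: "rep (n a) (rho a)" using rho insert by auto
  show ?case using rep_dsum[OF ra s(1)] s(2) dsum_eq_1 by (intro exI conjI) auto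
 qed
 then obtain m sg where s: "rep m sg" "ALL x:cG. sg x = 1 --> (ALL a:Z. rho a x = 1)" by blast
 have "sg x ~= 1" if x: "x : C" for x
 proof -
  obtain a where "a : Z" "x : W a" using x F Z by blast
  thus ?thesis using s(2) x Cc by (auto simp: W_def)
 qed
 thus ?thesis using that s(1) by blast
qed

end

section \<open>Compact matrix groups and their Lie algebras\<close>

lemma power_diff_bound:
 fixes U V :: "'b::real_normed_algebra_1"
 assumes "norm U <= r" "norm V <= r"
 shows "norm (U ^ Suc n - V ^ Suc n) <= real (Suc n) * r ^ n * norm (U - V)"
proof (induction n)
 case (Suc n)
 have r: "0 <= r" using assms(1) norm_ge_zero order_trans by blast
 have "U ^ Suc (Suc n) - V ^ Suc (Suc n) = U * (U ^ Suc n - V ^ Suc n) + (U - V) * V ^ Suc n" by (simp add: algebra_simps)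
 also have "norm ... <= norm U * norm (U ^ Suc n - V ^ Suc n) + norm (U - V) * norm V ^ Suc n"
  by (intro norm_triangle_le add_mono norm_mult_ineq order_trans[OF norm_mult_ineq] mult_left_mono norm_power_ineq) auto
 also have "... <= r * (real (Suc n) * r ^ n * norm (U - V)) + norm (U - V) * r ^ Suc n" using assms Suc r by (intro add_mono mult_mono power_mono) auto
 also have "... = real (Suc (Suc n)) * r ^ Suc n * norm (U - V)" by (simp add: algebra_simps)
 finally show ?case .
qed simp

text \<open>Near 0 the map \<open>exp U - U\<close> has a Lipschitz constant of order
  \<open>r\<close>, by termwise bounds on the series without its first two terms. Local injectivity
  of \<open>exp\<close>, the minimisation in \<open>exp_Lie_neighbourhood\<close> and the
  contraction in \<open>kap_open_at\<close> rest on it.\<close>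

lemma exp_lipschitz:
 fixes U V :: "'b::{real_normed_algebra_1,banach}"
 assumes "norm U <= r" "norm V <= r" "r <= 1"
 shows "norm (exp U - exp V - (U - V)) <= 2 * r * norm (U - V)"
proof -
 have r: "0 <= r" using assms(1) norm_ge_zero order_trans by blast
 have shift: "(%n. X ^ (n+2) /R fact (n+2)) sums (exp X - 1 - X)" for X :: 'b using exp_converges[of X] sums_iff_shift[of "%n. X ^ n /R fact n" 2 "exp X - 1 - X"]
  by (simp add: numeral_2_eq_2)
 have "(%n. (U ^ (n+2) - V ^ (n+2)) /R fact (n+2)) sums (exp U - exp V - (U - V))" using sums_diff[OF shift[of U] shift[of V]] by (simp add: algebra_simps)
 moreover have "(%n. r ^ Suc n /R fact (Suc n) * norm (U - V)) sums ((exp r - 1) * norm (U - V))"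
  using exp_converges[of r] sums_Suc_iff[of "%n. r ^ n /R fact n" "exp r - 1"] by (intro sums_mult2) simp
 moreover have "norm ((U ^ (n+2) - V ^ (n+2)) /R fact (n+2)) <= r ^ Suc n /R fact (Suc n) * norm (U - V)" for n
 proof -
  have "norm ((U ^ (n+2) - V ^ (n+2)) /R fact (n+2)) = norm (U ^ Suc (Suc n) - V ^ Suc (Suc n)) / fact (n+2)" by (simp add: divide_inverse mult.commute)
  also have "... <= (real (Suc (Suc n)) * r ^ Suc n * norm (U - V)) / fact (n+2)" by (intro divide_right_mono power_diff_bound assms) simp
  also have "... = r ^ Suc n /R fact (Suc n) * norm (U - V)" by (simp add: field_simps del: power_Suc of_nat_Suc)
  finally show ?thesis .
 qed
 ultimately have "norm (exp U - exp V - (U - V)) <= (exp r - 1) * norm (U - V)" by (rule norm_sums_le)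
 also have "... <= (2 * r) * norm (U - V)"
 proof (rule mult_right_mono)
  have "exp r <= 1 + r + r\<^sup>2" using exp_bound r assms by simp
  moreover have "r\<^sup>2 <= r" using r assms by (simp add: power2_eq_square mult_left_le)
  ultimately show "exp r - 1 <= 2 * r" by linarith
 qed simp
 finally show ?thesis .
qed

lemma exp_lipschitz_general:
 fixes U V :: "'b::{real_normed_algebra_1,banach}"
 assumes "norm U <= r" "norm V <= r"
 shows "norm (exp U - exp V) <= exp r * norm (U - V)"
proof -
 have shift: "(%n. X ^ Suc n /R fact (Suc n)) sums (exp X - 1)" for X :: 'b using exp_converges[of X] sums_Suc_iff[of "%n. X ^ n /R fact n" "exp X - 1"] by simp
 have "(%n. (U ^ Suc n - V ^ Suc n) /R fact (Suc n)) sums (exp U - exp V)" using sums_diff[OF shift[of U] shift[of V]] by (simp add: algebra_simps)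
 moreover have "(%n. r ^ n /R fact n * norm (U - V)) sums (exp r * norm (U - V))" by (intro sums_mult2 exp_converges)
 moreover have "norm ((U ^ Suc n - V ^ Suc n) /R fact (Suc n)) <= r ^ n /R fact n * norm (U - V)" for n
 proof -
  have "norm ((U ^ Suc n - V ^ Suc n) /R fact (Suc n)) = norm (U ^ Suc n - V ^ Suc n) / fact (Suc n)" by (simp add: divide_inverse mult.commute del: power_Suc)
  also have "... <= (real (Suc n) * r ^ n * norm (U - V)) / fact (Suc n)" by (intro divide_right_mono power_diff_bound assms) simp
  also have "... = r ^ n /R fact n * norm (U - V)" by (simp add: field_simps del: power_Suc of_nat_Suc)
  finally show ?thesis .
 qed
 ultimately show ?thesis by (rule norm_sums_le)
qed

lemma tendsto_exp_algebra:
 fixes f :: "'c => 'b::{real_normed_algebra_1,banach}"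
 assumes "(f ---> X) F"
 shows "((%x. exp (f x)) ---> exp X) F"
proof -
 have "((%x. norm (f x - X)) ---> 0) F" using assms by (simp add: tendsto_norm_zero LIM_zero)
 from tendsto_mult_left[OF this, of "exp (norm X + 1)"] order_tendstoD(2)[OF this, of 1]
 have lim: "((%x. exp (norm X + 1) * norm (f x - X)) ---> 0) F" and ev: "\<forall>\<^sub>F x in F. norm (f x - X) < 1" by simp_all
 have "((%x. exp (f x) - exp X) ---> 0) F"
 proof (rule Lim_null_comparison[OF _ lim])
  show "\<forall>\<^sub>F x in F. norm (exp (f x) - exp X) <= exp (norm X + 1) * norm (f x - X)" using ev
  proof eventually_elim
   case (elim x)
   have "norm (f x) <= norm X + norm (f x - X)" using norm_triangle_sub[of "f x" X] by simp
   thus ?case using elim by (intro exp_lipschitz_general) auto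
  qed
 qed
 thus ?thesis by (simp add: LIM_zero_iff)
qed

lemma continuous_on_exp_algebra [continuous_intros]:
 fixes f :: "'c::topological_space => 'b::{real_normed_algebra_1,banach}"
 shows "cton S f ==> cton S (%x. exp (f x))" by (simp add: continuous_on_def tendsto_exp_algebra)

lemma exp_minus_one_bound:
 fixes X :: "'b::{real_normed_algebra_1,banach}"
 assumes "norm X <= 1"
 shows "norm (exp X - 1 - X) <= 2 * norm X * norm X" using exp_lipschitz[of X "norm X" 0] assms by simp

lemma exp_inj_small:
 fixes U V :: "'b::{real_normed_algebra_1,banach}"
 assumes "norm U <= 1/4" "norm V <= 1/4"
 shows "norm (U - V) <= 2 * norm (exp U - exp V)"
proof -
 have "norm (exp U - exp V - (U - V)) <= 1/2 * norm (U - V)" using exp_lipschitz[OF assms] by simp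
 moreover have "norm (U - V) <= norm (exp U - exp V) + norm (exp U - exp V - (U - V))" by (metis norm_triangle_sub norm_minus_commute add.commute)
 ultimately show ?thesis by linarith
qed

text \<open>Stated for intertwiners instead of conjugations because it is also applied to the
  non-invertible \<open>VV False\<close>.\<close>

lemma exp_intertwine:
 fixes X :: "'b::{real_normed_algebra_1,banach}"
 assumes "X * S = S * Y"
 shows "exp X * S = S * exp Y"
proof -
 have pw: "X ^ n * S = S * Y ^ n" for n
 proof (induction n)
  case (Suc n)
  have "X ^ Suc n * S = X * (X ^ n * S)" by (simp add: mult.assoc)
  also have "... = (X * S) * Y ^ n" using Suc by (simp add: mult.assoc)
  finally show ?case by (simp add: assms mult.assoc)
 qed simp
 have "(%n. X ^ n /R fact n * S) sums (exp X * S)" by (rule sums_mult2[OF exp_converges])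
 moreover have "(%n. S * (Y ^ n /R fact n)) sums (S * exp Y)" by (rule sums_mult[OF exp_converges])
 ultimately show ?thesis using pw by (simp add: sums_unique2)
qed

lemma exp_scaleR_add: "exp ((s + t) *R X) = exp (s *R X) * exp (t *R (X::'b::{real_normed_algebra_1,banach}))"
 unfolding scaleR_add_left by (rule exp_add_commuting) simp

lemma exp_minus_cancel: "exp X * exp (- X) = 1" "exp (- X) * exp X = (1::'b::{real_normed_algebra_1,banach})"
 using exp_minus_inverse[of X] exp_minus_inverse[of "-X"] by simp_all

lemma exp_scaleR_nat: "exp (real k *R X) = exp X ^ k" for X :: "'b::{real_normed_algebra_1,banach}"
proof (induction k)
 case (Suc k)
 have "exp (real (Suc k) *R X) = exp (1 *R X) * exp (real k *R X)" by (subst exp_scaleR_add[symmetric]) simp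
 thus ?case using Suc by simp
qed simp

lemma norm_exp_le: "norm (exp X) <= exp (norm (X::'b::{real_normed_algebra_1,banach}))" by (rule norm_exp)

text \<open>A compact matrix group. As inverses are transposes, its elements are orthogonal, which
  makes the Lie algebra skew and the entrywise inner product invariant under left
  multiplication.\<close>

definition cmg :: "nat => op set => bool" where
 "cmg n K <-> compact K & 1 : K & (ALL A:K. ALL B:K. A * B : K) &
  (ALL A:K. A - 1 : Mat n & (EX B:K. A * B = 1 & B * A = 1 & (ALL i j. entry B i j = entry A j i)))"

definition Lie :: "op set => op set" where
 "Lie K = {X. ALL t. exp (t *R X) : K}"

lemma LieD: "X : Lie K ==> exp (t *R X) : K" by (simp add: Lie_def)
lemma LieD1: "X : Lie K ==> exp X : K" using LieD[of X K 1] by simp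
lemma Lie_scale: "X : Lie K ==> c *R X : Lie K" by (simp add: Lie_def)
lemma Lie_minus: "X : Lie K ==> - X : Lie K" using Lie_scale[of X K "-1"] by simp

context
 fixes n :: nat and K :: "op set"
 assumes K: "cmg n K"
begin

lemma cmg_closed: "closed K" and cmg_one: "1 : K"
 and cmg_mult: "A : K ==> B : K ==> A * B : K" and cmg_Mat: "A : K ==> A - 1 : Mat n" using K compact_imp_closed by (auto simp: cmg_def)

lemma cmg_power: "A : K ==> A ^ k : K" by (induction k) (auto intro: cmg_mult cmg_one)

lemma cmg_inverse:
 assumes "A : K" "A * B = 1"
 shows "B : K" "B * A = 1" "entry B i j = entry A j i"
proof -
 obtain C where C: "C : K" "A * C = 1" "C * A = 1" "!!i j. entry C i j = entry A j i" using K assms(1) unfolding cmg_def by blast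
 have "B = C * A * B" using C by simp
 also have "... = C" using assms by (simp add: mult.assoc)
 finally show "B : K" "B * A = 1" "entry B i j = entry A j i" using C by auto
qed

text \<open>Directions of approach to 1 belong to the Lie algebra: the powers
  \<open>(1 + a m) ^ k m\<close> with \<open>k m\<close> within 1 of \<open>t * s m\<close> stay in
  the closed group and converge to \<open>exp (t *R X)\<close>; negative \<open>t\<close> follows by
  inversion.\<close>

lemma Lie_limit:
 assumes a: "a ----> 0" "!!m. 1 + a m : K" and s: "!!m. 0 <= s m" "(%m. s m *R a m) ----> X"
 shows "X : Lie K"
proof -
 have pos: "exp (t *R X) : K" if t: "0 <= t" for t
 proof -
  define k where "k m = nat \<lfloor>t * s m\<rfloor>" for m
  have k: "abs(real (k m) - t * s m) <= 1" for m using t s(1)[of m] unfolding k_def by (simp add: abs_le_iff) linarith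
  have "(%m. (real (k m) - t * s m) *R a m) ----> 0"
  proof (rule tendsto_norm_zero_cancel, rule tendsto_sandwich[OF _ _ tendsto_const])
   show "(%m. norm (a m)) ----> 0" using tendsto_norm_zero[OF a(1)] .
   show "\<forall>\<^sub>F m in sequentially. norm ((real (k m) - t * s m) *R a m) <= norm (a m)" using k by (simp add: mult_left_le_one_le)
  qed simp
  from tendsto_add[OF this tendsto_scaleR[OF tendsto_const s(2), of t]]
  have ka: "(%m. real (k m) *R a m) ----> t *R X" by (simp add: algebra_simps)
  hence e: "(%m. exp (real (k m) *R a m)) ----> exp (t *R X)" by (rule tendsto_exp_algebra)
  have nka: "(%m. real (k m) * norm (a m)) ----> norm (t *R X)" using tendsto_norm[OF ka] by simp
  have "(%m. (1 + a m) ^ k m - exp (real (k m) *R a m)) ----> 0"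
  proof (rule tendsto_norm_zero_cancel, rule tendsto_sandwich[OF _ _ tendsto_const])
   show "(%m. 2 * (real (k m) * norm (a m)) * exp (real (k m) * norm (a m)) * norm (a m)) ----> 0"
    using tendsto_mult[OF tendsto_mult[OF tendsto_mult[OF tendsto_const nka] tendsto_exp[OF nka]] tendsto_norm_zero[OF a(1)], of 2] by simp
   have small: "\<forall>\<^sub>F m in sequentially. norm (a m) < 1" using order_tendstoD(2)[OF tendsto_norm_zero[OF a(1)], of 1] by simp
   show "\<forall>\<^sub>F m in sequentially. norm ((1 + a m) ^ k m - exp (real (k m) *R a m)) <=
    2 * (real (k m) * norm (a m)) * exp (real (k m) * norm (a m)) * norm (a m)" using small
   proof eventually_elim
    case (elim m)
    show ?case
    proof (cases "k m")
     case (Suc j)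
     let ?r = "exp (norm (a m))"
     have "norm (1 + a m) <= ?r" by (rule order_trans[OF norm_triangle_ineq]) simp
     from power_diff_bound[OF this norm_exp_le, of j]
     have "norm ((1 + a m) ^ k m - exp (real (k m) *R a m)) <= real (k m) * ?r ^ j * norm (1 + a m - exp (a m))" by (simp only: Suc exp_scaleR_nat)
     also have "norm (1 + a m - exp (a m)) = norm (exp (a m) - 1 - a m)" by (metis diff_diff_eq norm_minus_commute)
     also have "real (k m) * ?r ^ j * ... <= real (k m) * ?r ^ k m * (2 * norm (a m) * norm (a m))" using elim exp_minus_one_bound[of "a m"] Suc
      by (intro mult_mono power_increasing) auto
     also have "?r ^ k m = exp (real (k m) * norm (a m))" by (simp add: exp_of_nat_mult)
     finally show ?thesis by (simp add: mult_ac)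
    qed simp
   qed
  qed simp
  from tendsto_add[OF this e] have "(%m. (1 + a m) ^ k m) ----> exp (t *R X)" by simp
  show ?thesis by (rule closed_sequentially[OF cmg_closed _ `(%m. (1 + a m) ^ k m) ----> exp (t *R X)`]) (use a cmg_power in auto)
 qed
 have "exp (t *R X) : K" for t
 proof (cases "0 <= t")
  case False
  hence "exp ((- t) *R X) : K" using pos[of "- t"] by simp
  from cmg_inverse(1)[OF this, of "exp (t *R X)"] exp_minus_cancel(2)[of "t *R X"]
  show ?thesis by simp
 qed (rule pos)
 thus ?thesis by (simp add: Lie_def)
qed

end

lemma exp_derivative_seq:
 fixes X :: "'b::{real_normed_algebra_1,banach}"
 shows "(%m. real (Suc m) *R (exp (X /R real (Suc m)) - 1)) ----> X"
proof -
 have lim0: "(%m. 2 * norm X * norm X * inverse (real (Suc m))) ----> 2 * norm X * norm X * 0" by (intro tendsto_intros LIMSEQ_inverse_real_of_nat)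
 have "(%m. real (Suc m) *R (exp (X /R real (Suc m)) - 1) - X) ----> 0"
 proof (rule tendsto_norm_zero_cancel, rule tendsto_sandwich[OF _ _ tendsto_const])
  show "(%m. 2 * norm X * norm X * inverse (real (Suc m))) ----> 0" using lim0 by simp
  have "(%m. norm X * inverse (real (Suc m))) ----> norm X * 0" by (intro tendsto_intros LIMSEQ_inverse_real_of_nat)
  hence "\<forall>\<^sub>F m in sequentially. norm X * inverse (real (Suc m)) < 1" by (intro order_tendstoD(2)) auto
  thus "\<forall>\<^sub>F m in sequentially. norm (real (Suc m) *R (exp (X /R real (Suc m)) - 1) - X) <= 2 * norm X * norm X * inverse (real (Suc m))"
  proof eventually_elim
   case (elim m)
   let ?c = "real (Suc m)" and ?Z = "X /R real (Suc m)"
   have Z: "norm ?Z = norm X * inverse ?c" by simp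
   have "?c *R (exp ?Z - 1) - X = ?c *R (exp ?Z - 1 - ?Z)" by (simp add: scaleR_diff_right)
   hence "norm (?c *R (exp ?Z - 1) - X) = ?c * norm (exp ?Z - 1 - ?Z)" by simp
   also have "... <= ?c * (2 * norm ?Z * norm ?Z)" using elim unfolding Z[symmetric] by (intro mult_left_mono exp_minus_one_bound) simp_all
   also have "... = 2 * norm X * norm X * inverse ?c" unfolding Z by (simp add: field_simps del: of_nat_Suc)
   finally show ?case .
  qed
 qed simp
 from tendsto_add[OF this tendsto_const[of X]] show ?thesis by simp
qed

lemma exp_div_seq_tendsto_1: "(%m. exp (X /R real (Suc m))) ----> (1::'b::{real_normed_algebra_1,banach})"
proof -
 have "(%m. exp (inverse (real (Suc m)) *R X)) ----> exp (0 *R X)" by (intro tendsto_exp_algebra tendsto_intros LIMSEQ_inverse_real_of_nat)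
 thus ?thesis by simp
qed

context
 fixes n :: nat and K :: "op set"
 assumes K: "cmg n K"
begin

text \<open>The product of two short exponentials leaves 1 in the direction \<open>X + Y\<close>, so
  \<open>Lie_limit\<close> applies.\<close>

lemma Lie_add:
 assumes "X : Lie K" "Y : Lie K"
 shows "X + Y : Lie K"
proof (rule Lie_limit[OF K])
 let ?x = "%m. exp (X /R real (Suc m))" and ?y = "%m. exp (Y /R real (Suc m))"
 have "(%m. ?x m * ?y m - 1) ----> 1 * 1 - 1" by (intro tendsto_intros exp_div_seq_tendsto_1)
 thus "(%m. ?x m * ?y m - 1) ----> 0" by simp
 show "1 + (?x m * ?y m - 1) : K" for m using cmg_mult[OF K LieD[OF assms(1)] LieD[OF assms(2)]] by simp
 have "(%m. (real (Suc m) *R (?x m - 1)) * ?y m + real (Suc m) *R (?y m - 1)) ----> X * 1 + Y" by (intro tendsto_intros exp_div_seq_tendsto_1 exp_derivative_seq)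
 thus "(%m. real (Suc m) *R (?x m * ?y m - 1)) ----> X + Y" by (simp add: algebra_simps)
qed simp

lemma Lie_0: "0 : Lie K" using cmg_one[OF K] by (simp add: Lie_def)

lemma subspace_Lie: "subspace (Lie K)" by (auto simp: subspace_def Lie_0 Lie_add Lie_scale)

lemma Lie_diff: "X : Lie K ==> Y : Lie K ==> X - Y : Lie K" by (rule subspace_diff[OF subspace_Lie])

lemma closed_Lie: "closed (Lie K)"
proof -
 have "Lie K = (\<Inter>t. (%X. exp (t *R X)) -` K)" by (auto simp: Lie_def)
 thus ?thesis by (auto intro!: closed_INT closed_vimage cmg_closed[OF K] continuous_intros)
qed

lemma Lie_Mat: "X : Lie K ==> X : Mat n" by (rule closed_sequentially[OF closed_Mat _ exp_derivative_seq])
  (auto intro!: Mat_scale cmg_Mat[OF K] LieD)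

lemma Lie_Ad:
 assumes "A : K" "A * B = 1" "X : Lie K"
 shows "A * X * B : Lie K"
proof -
 have BA: "B * A = 1" and B: "B : K" using cmg_inverse[OF K assms(1,2)] by auto
 have "exp (t *R (A * X * B)) = A * exp (t *R X) * B" for t
 proof -
  have "exp (t *R (A * X * B)) * A = A * exp (t *R X)" by (rule exp_intertwine) (simp add: mult.assoc BA)
  hence "exp (t *R (A * X * B)) * A * B = A * exp (t *R X) * B" by simp
  thus ?thesis by (simp add: mult.assoc assms(2))
 qed
 thus ?thesis using assms B LieD[OF assms(3)] by (simp add: Lie_def cmg_mult[OF K])
qed

lemma Lie_bracket:
 assumes X: "X : Lie K" and Y: "Y : Lie K"
 shows "X * Y - Y * X : Lie K"
proof (rule closed_sequentially[OF closed_Lie])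
 let ?x = "%m. exp (X /R real (Suc m))" and ?y = "%m. exp ((- X) /R real (Suc m))"
 let ?f = "%m. real (Suc m) *R (?x m * Y * ?y m - Y)"
 show "?f m : Lie K" for m
 proof -
  have "?x m * ?y m = 1" using exp_minus_cancel(1)[of "X /R real (Suc m)"] by simp
  thus ?thesis using X Y by (intro Lie_scale Lie_diff Lie_Ad) (auto intro: LieD)
 qed
 have "(%m. (real (Suc m) *R (?x m - 1)) * Y * ?y m + Y * (real (Suc m) *R (?y m - 1))) ----> X * Y * 1 + Y * (- X)"
  by (intro tendsto_intros exp_div_seq_tendsto_1 exp_derivative_seq)
 thus "?f ----> X * Y - Y * X" by (simp add: algebra_simps)
qed

lemma Lie_skew:
 assumes X: "X : Lie K"
 shows "entry X j i = - entry X i j"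
proof -
 let ?x = "%m. exp (X /R real (Suc m))" and ?y = "%m. exp ((- X) /R real (Suc m))"
 have e: "entry (?y m) i j = entry (?x m) j i" for m
  using cmg_inverse(3)[OF K LieD[OF X], of "inverse (real (Suc m))" "?y m" i j] exp_minus_cancel(1)[of "X /R real (Suc m)"] by simp
 have 1: "(%m. entry (real (Suc m) *R (?y m - 1)) i j) ----> entry (- X) i j" by (intro bounded_linear.tendsto[OF bounded_linear_entry] exp_derivative_seq)
 have 2: "(%m. entry (real (Suc m) *R (?x m - 1)) j i) ----> entry X j i" by (intro bounded_linear.tendsto[OF bounded_linear_entry] exp_derivative_seq)
 have "(%m. entry (real (Suc m) *R (?y m - 1)) i j) = (%m. entry (real (Suc m) *R (?x m - 1)) j i)" using e by (auto simp: fun_eq_iff)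
 hence "entry (- X) i j = entry X j i" using LIMSEQ_unique[OF 1] 2 by simp
 thus ?thesis by simp
qed

text \<open>
 The element of \<open>exp (Lie K)\<close> closest to an element \<open>g\<close> of \<open>K\<close> near \<open>1\<close> is \<open>g\<close> itself: otherwise the
 directions of the differences accumulate at an element of the Lie algebra, along which the
 distance could be reduced.
\<close>

lemma exp_Lie_neighbourhood:
 assumes e: "0 < e"
 obtains d where "0 < d" "!!g. g : K ==> norm (g - 1) < d ==> EX X:Lie K. norm X < e & exp X = g"
proof (rule ccontr)
 assume "\<not> thesis"
 hence "EX g:K. norm (g - 1) < inverse (real (Suc m)) & \<not> (EX X:Lie K. norm X < e & exp X = g)" for m using that[of "inverse (real (Suc m))"] by force
 then obtain g where g: "!!m. g m : K" "!!m. norm (g m - 1) < inverse (real (Suc m))"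
  "!!m X. X : Lie K ==> norm X < e ==> exp X ~= g m" by metis
 have gl: "(%m. g m - 1) ----> 0" by (rule tendsto_norm_zero_cancel, rule tendsto_sandwich[OF _ _ tendsto_const LIMSEQ_inverse_real_of_nat])
   (use g(2) in "auto intro!: always_eventually less_imp_le")
 define r where "r = min (e/2) (1/4)"
 have r: "0 < r" "r < e" "r <= 1/4" using e by (auto simp: r_def)
 let ?L = "Lie K Int cball 0 r"
 have cL: "compact ?L" by (rule compact_Mat[of _ n]) (use closed_Lie Lie_Mat in auto)
 \<comment> \<open>Minimise over a compact ball of the Lie algebra; \<open>b m\<close> below is the
   remaining error, which is nonzero by the choice of \<open>g\<close>.\<close>
 have "EX X:?L. ALL Y:?L. norm (g m * exp (- X) - 1) <= norm (g m * exp (- Y) - 1)" for m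
  by (rule continuous_attains_inf[OF cL]) (use Lie_0 r in "auto intro!: continuous_intros")
 then obtain X where X: "!!m. X m : Lie K" "!!m. norm (X m) <= r"
  and mn: "!!m Y. Y : Lie K ==> norm Y <= r ==> norm (g m * exp (- X m) - 1) <= norm (g m * exp (- Y) - 1)" by (metis Int_iff mem_cball_0)
 define b where "b m = g m * exp (- X m) - 1" for m
 have bK: "1 + b m : K" for m using cmg_mult[OF K g(1) LieD1[OF Lie_minus[OF X(1)]]] by (simp add: b_def)
 have bexp: "g m - exp (X m) = b m * exp (X m)" for m by (simp add: b_def left_diff_distrib mult.assoc exp_minus_cancel)
 have b0: "b m ~= 0" for m using bexp[of m] g(3)[OF X(1), of m m] X(2)[of m] r by auto
 have bg: "norm (b m) <= norm (g m - 1)" for m using mn[OF Lie_0, of m] r by (simp add: b_def)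
 have bl: "b ----> 0" by (rule tendsto_norm_zero_cancel, rule tendsto_sandwich[OF _ _ tendsto_const tendsto_norm_zero[OF gl]])
   (use bg in "auto intro!: always_eventually")
 have "(%m. 2 * (norm (b m) * exp r + norm (g m - 1))) ----> 2 * (0 * exp r + 0)" by (intro tendsto_intros tendsto_norm_zero bl gl)
 hence lim0: "(%m. 2 * (norm (b m) * exp r + norm (g m - 1))) ----> 0" by simp
 have Xb: "norm (X m) <= 2 * (norm (b m) * exp r + norm (g m - 1))" for m
 proof -
  have "norm (X m - 0) <= 2 * norm (exp (X m) - exp 0)" using X(2)[of m] r by (intro exp_inj_small) auto
  moreover have "norm (exp (X m) - exp 0) <= norm (g m - exp (X m)) + norm (g m - 1)" using norm_triangle_ineq4[of "g m - 1" "g m - exp (X m)"] by simp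
  moreover have "norm (g m - exp (X m)) <= norm (b m) * exp r"
  proof -
   have "norm (g m - exp (X m)) <= norm (b m) * norm (exp (X m))" unfolding bexp by (rule norm_mult_ineq)
   also have "... <= norm (b m) * exp r" using norm_exp_le[of "X m"] X(2)[of m] by (intro mult_left_mono order_trans[OF norm_exp_le]) auto
   finally show ?thesis .
  qed
  ultimately show ?thesis by simp
 qed
 have Xl: "X ----> 0" by (rule tendsto_norm_zero_cancel, rule tendsto_sandwich[OF _ _ tendsto_const lim0])
   (use Xb in "auto intro!: always_eventually")
 have "compact (Mat n Int {x. norm x = 1})"
 proof (rule compact_Mat[OF Int_lower1])
  show "closed (Mat n Int {x. norm x = 1})" by (intro closed_Int closed_Mat closed_Collect_eq continuous_intros)
  show "bounded (Mat n Int {x. norm x = 1})" by (rule boundedI[of _ 1]) auto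
 qed
 moreover have "b m /R norm (b m) : Mat n Int {x. norm x = 1}" for m using b0[of m] cmg_Mat[OF K bK, of m] by (auto intro!: Mat_scale)
 ultimately obtain Y f where Y: "Y : Mat n Int {x. norm x = 1}" and f: "strict_mono f" "(%m. b (f m) /R norm (b (f m))) ----> Y"
  using seq_compactE[OF compact_imp_seq_compact, of "Mat n Int {x. norm x = 1}" "%m. b m /R norm (b m)"] unfolding o_def by metis
 have YL: "Y : Lie K" by (rule Lie_limit[OF K, of "%m. b (f m)" "%m. inverse (norm (b (f m)))"])
   (use f bK LIMSEQ_subseq_LIMSEQ[OF bl f(1)] in "auto simp: o_def")
 have Y1: "norm Y = 1" using Y by simp
 have l: "(%m. b (f m)) ----> 0" "(%m. X (f m)) ----> 0" "(%m. g (f m) - 1) ----> 0"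
  using LIMSEQ_subseq_LIMSEQ[OF bl f(1)] LIMSEQ_subseq_LIMSEQ[OF Xl f(1)] LIMSEQ_subseq_LIMSEQ[OF gl f(1)] by (auto simp: o_def)
 define q where "q m = norm (X (f m)) + norm (b (f m))" for m
 have ql: "q ----> 0 + 0" unfolding q_def by (intro tendsto_intros tendsto_norm_zero l)
 define p where "p m = norm (b (f m) /R norm (b (f m)) - Y) + norm (g (f m) - 1) + (1 + norm (g (f m) - 1)) * (2 * q m)" for m
 have "p ----> norm (Y - Y) + 0 + (1 + 0) * (2 * (0 + 0))" unfolding p_def by (intro tendsto_intros tendsto_norm_zero l ql f(2))
 hence "\<forall>\<^sub>F m in sequentially. p m < 1 & q m < r" using order_tendstoD(2)[of p _ _ 1] order_tendstoD(2)[OF ql, of r] r by (intro eventually_conj) auto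
 then obtain m where m: "p m < 1" "q m < r" using eventually_happens by fastforce
 let ?b = "b (f m)" and ?g = "g (f m)" and ?X = "X (f m)"
 \<comment> \<open>The competitor moves \<open>?X\<close> by the length of the error in the limit
   direction \<open>Y\<close>. To first order this cancels the error and leaves at most
   \<open>norm ?b * p m\<close> with \<open>p m < 1\<close>.\<close>
 let ?Z = "?X + norm ?b *R Y"
 have Zr: "norm ?Z <= q m" unfolding q_def by (rule norm_triangle_le) (simp add: Y1)
 have "?Z : Lie K" "norm ?Z <= r" using Zr m Lie_add[OF X(1) Lie_scale[OF YL]] by auto
 from mn[OF this, of "f m"] have mnZ: "norm ?b <= norm (?g * exp (- ?Z) - 1)" by (simp only: b_def)
 define D where "D = exp (- ?Z) - exp (- ?X) - (- ?Z - - ?X)"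
 have D: "norm D <= 2 * q m * norm ?b"
 proof -
  have "norm (- ?Z) <= q m" "norm (- ?X) <= q m" "q m <= 1" using Zr m r by (simp_all only: norm_minus_cancel) (simp_all add: q_def)
  from exp_lipschitz[OF this] have "norm D <= 2 * q m * norm (- ?Z - - ?X)" by (simp only: D_def)
  also have "norm (- ?Z - - ?X) = norm ?b" by (simp add: Y1)
  finally show ?thesis .
 qed
 have "?g * exp (- ?Z) - 1 = ?b - norm ?b *R (?g * Y) + ?g * D" by (simp add: b_def D_def algebra_simps)
 also have "... = norm ?b *R (?b /R norm ?b - Y) - norm ?b *R ((?g - 1) * Y) + ?g * D" using b0[of "f m"] by (simp add: algebra_simps)
 also have "norm ... <= norm ?b * norm (?b /R norm ?b - Y) + norm ?b * norm (?g - 1) + norm ?g * norm D"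
 proof (intro norm_triangle_le add_mono norm_mult_ineq norm_triangle_le_diff)
  show "norm (norm ?b *R ((?g - 1) * Y)) <= norm ?b * norm (?g - 1)" using norm_mult_ineq[of "?g - 1" Y] Y1 by (simp add: mult_left_mono)
 qed simp
 also have "... <= norm ?b * norm (?b /R norm ?b - Y) + norm ?b * norm (?g - 1) + (1 + norm (?g - 1)) * (2 * q m * norm ?b)"
  using norm_triangle_ineq[of "?g - 1" 1] D by (intro add_mono mult_mono) auto
 also have "... = norm ?b * p m" by (simp add: p_def algebra_simps)
 also have "... < norm ?b * 1" using m b0[of "f m"] by (intro mult_strict_left_mono) auto
 finally show False using mnZ by simp
qed

end

section \<open>The nearest point retraction onto a compact matrix group\<close>

text \<open>The Frobenius inner product. Left multiplication by elements of a compact matrix group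
  preserves it, whereas the norm of \<open>op\<close> need not be preserved; nearest points are
  therefore taken with respect to \<open>fip\<close>.\<close>

definition fip :: "nat => op => op => real" where
 "fip n A B = (\<Sum>p\<in>{..<n}\<times>{..<n}. entry A (fst p) (snd p) * entry B (fst p) (snd p))"

lemma fip_simps: "fip n (A + A') B = fip n A B + fip n A' B" "fip n (A - A') B = fip n A B - fip n A' B"
 "fip n (r *R A) B = r * fip n A B" "fip n (- A) B = - fip n A B"
 "fip n B (A + A') = fip n B A + fip n B A'" "fip n B (A - A') = fip n B A - fip n B A'"
 "fip n B (r *R A) = r * fip n B A" "fip n B (- A) = - fip n B A"
 by (simp_all add: fip_def distrib_left distrib_right sum.distrib left_diff_distrib right_diff_distrib sum_subtractf
   sum_distrib_left sum_negf mult_ac)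

lemma fip_alt: "fip n A B = (\<Sum>i<n. \<Sum>j<n. entry A i j * entry B i j)" by (simp add: fip_def sum.cartesian_product case_prod_unfold)

lemma fip_commute: "fip n A B = fip n B A" by (simp add: fip_def mult.commute)

lemma fip_nonneg: "0 <= fip n A A" unfolding fip_def by (intro sum_nonneg) simp

lemma continuous_on_fip [continuous_intros]:
 "cton S f ==> cton S g ==> cton S (%x. fip n (f x) (g x))" unfolding fip_def by (intro continuous_intros)

lemma fip_Cauchy_Schwarz: "(fip n A B)\<^sup>2 <= fip n A A * fip n B B"
 using Cauchy_Schwarz_ineq_sum[of "%p. entry A (fst p) (snd p)" "%p. entry B (fst p) (snd p)" "{..<n}\<times>{..<n}"] by (simp add: fip_def power2_eq_square)

lemma fip_le_norm: "fip n A A <= (real n * norm A)\<^sup>2"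
proof -
 have "fip n A A <= (\<Sum>p\<in>{..<n}\<times>{..<n}. norm A * norm A)" unfolding fip_def
 proof (rule sum_mono)
  fix p :: "nat \<times> nat"
  have "abs(entry A (fst p) (snd p)) * abs(entry A (fst p) (snd p)) <= norm A * norm A" by (intro mult_mono abs_entry_le) auto
  thus "entry A (fst p) (snd p) * entry A (fst p) (snd p) <= norm A * norm A" by simp
 qed
 thus ?thesis by (simp add: power2_eq_square card_cartesian_product mult_ac)
qed

lemma norm_le_fip:
 obtains M where "0 < M" "!!A. A : Mat n ==> (norm A)\<^sup>2 <= M * fip n A A"
proof -
 define S where "S = (\<Sum>p\<in>{..<n}\<times>{..<n}. (norm (E (fst p) (snd p)))\<^sup>2)"
 have S: "0 <= S" unfolding S_def by (intro sum_nonneg) simp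
 have "(norm A)\<^sup>2 <= (1 + S) * fip n A A" if A: "A : Mat n" for A
 proof -
  have "norm A = norm (\<Sum>p\<in>{..<n}\<times>{..<n}. entry A (fst p) (snd p) *R E (fst p) (snd p))"
   using Mat_expand[OF A] by (simp add: sum.cartesian_product case_prod_unfold)
  also have "... <= (\<Sum>p\<in>{..<n}\<times>{..<n}. norm (entry A (fst p) (snd p) *R E (fst p) (snd p)))" by (rule norm_sum)
  finally have "(norm A)\<^sup>2 <= (\<Sum>p\<in>{..<n}\<times>{..<n}. abs(entry A (fst p) (snd p)) * norm (E (fst p) (snd p)))\<^sup>2" by (intro power_mono) simp_all
  also have "... <= (\<Sum>p\<in>{..<n}\<times>{..<n}. (abs(entry A (fst p) (snd p)))\<^sup>2) * S" unfolding S_def by (rule Cauchy_Schwarz_ineq_sum)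
  also have "... = fip n A A * S" by (simp add: fip_def power2_eq_square)
  also have "... <= (1 + S) * fip n A A" using fip_nonneg[of n A] by (simp add: algebra_simps)
  finally show ?thesis .
 qed
 thus ?thesis using that[of "1 + S"] S by simp
qed

context
 fixes n :: nat and K :: "op set"
 assumes K: "cmg n K"
begin

lemma fip_isometry:
 assumes k: "k : K" and C: "C : Mat n"
 shows "fip n (k * C) (k * C) = fip n C C"
proof -
 obtain B where B: "B : K" "B * k = 1" "!!i j. entry B i j = entry k j i" using K k unfolding cmg_def by blast
 have kk: "(\<Sum>i<n. entry k i a * entry k i b) = (if a = b then 1 else 0)" if "a < n" "b < n" for a b
  using entry_one_mult[OF cmg_Mat[OF K B(1)] that, of k] B by simp
 have e: "entry (k * C) i j = (\<Sum>a<n. entry k i a * entry C a j)" if "i < n" "j < n" for i j by (rule entry_one_mult[OF cmg_Mat[OF K k] that])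
 have "fip n (k * C) (k * C) = (\<Sum>j<n. \<Sum>i<n. entry (k * C) i j * entry (k * C) i j)" unfolding fip_alt by (rule sum.swap)
 also have "... = (\<Sum>j<n. \<Sum>i<n. \<Sum>a<n. \<Sum>b<n. (entry k i a * entry k i b) * (entry C a j * entry C b j))"
  by (intro sum.cong refl) (simp add: e sum_product mult_ac)
 also have "... = (\<Sum>j<n. \<Sum>a<n. \<Sum>b<n. (\<Sum>i<n. entry k i a * entry k i b) * (entry C a j * entry C b j))"
  unfolding sum_distrib_right by (rule sum.cong[OF refl], subst sum.swap, rule sum.cong[OF refl], rule sum.swap)
 also have "... = (\<Sum>j<n. \<Sum>a<n. \<Sum>b<n. if a = b then entry C a j * entry C a j else 0)" by (intro sum.cong refl) (auto simp: kk)
 also have "... = (\<Sum>j<n. \<Sum>a<n. entry C a j * entry C a j)" by simp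
 also have "... = fip n C C" unfolding fip_alt by (rule sum.swap)
 finally show ?thesis .
qed

lemma fip_dist_left:
 assumes "k : K" "A - 1 : Mat n" "B - 1 : Mat n"
 shows "fip n (k * A - k * B) (k * A - k * B) = fip n (A - B) (A - B)"
 using fip_isometry[OF assms(1), of "A - B"] Mat_diff[OF assms(2,3)] by (simp add: right_diff_distrib)

definition nearest :: "op => op => bool" where
 "nearest A k <-> k : K & (\<forall>k'\<in>K. fip n (A - k) (A - k) <= fip n (A - k') (A - k'))"

lemma nearest_exists: "EX k. nearest A k"
proof -
 have "compact K" "K ~= {}" using K by (auto simp: cmg_def)
 moreover have "cton K (%k. fip n (A - k) (A - k))" by (intro continuous_intros)
 ultimately show ?thesis using continuous_attains_inf unfolding nearest_def by blast
qed

lemma nearest_mult: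
 assumes h: "h : K" and A: "A - 1 : Mat n" and k: "nearest A k"
 shows "nearest (h * A) (h * k)" unfolding nearest_def
proof (intro conjI ballI)
 have kK: "k : K" using k by (simp add: nearest_def)
 show "h * k : K" using cmg_mult[OF K h kK] .
 obtain B where B: "B : K" "h * B = 1" using K h unfolding cmg_def by blast
 fix k' assume k': "k' : K"
 have Bk: "B * k' : K" using cmg_mult[OF K B(1) k'] .
 have "fip n (h * A - h * k) (h * A - h * k) = fip n (A - k) (A - k)" by (rule fip_dist_left[OF h A cmg_Mat[OF K kK]])
 also have "... <= fip n (A - B * k') (A - B * k')" using k Bk by (simp add: nearest_def)
 also have "... = fip n (h * A - h * (B * k')) (h * A - h * (B * k'))" by (rule fip_dist_left[OF h A cmg_Mat[OF K Bk], symmetric])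
 also have "h * (B * k') = k'" using B by (simp add: mult.assoc[symmetric])
 finally show "fip n (h * A - h * k) (h * A - h * k) <= fip n (h * A - k') (h * A - k')" .
qed

lemma nearest_critical:
 assumes "nearest A 1" "X : Lie K"
 shows "fip n (A - 1) X = 0"
proof -
 have le: "fip n (A - 1) Y <= 0" if Y: "Y : Lie K" for Y
 proof -
  let ?x = "%m. exp (Y /R real (Suc m))" and ?d = "%m. real (Suc m) *R (exp (Y /R real (Suc m)) - 1)"
  have a: "2 * fip n (A - 1) (?d m) <= fip n (?x m - 1) (?d m)" for m
  proof -
   have "fip n (A - 1) (A - 1) <= fip n (A - ?x m) (A - ?x m)" using assms(1) LieD[OF Y] by (simp add: nearest_def)
   also have "A - ?x m = (A - 1) - (?x m - 1)" by simp
   finally have "2 * fip n (A - 1) (?x m - 1) <= fip n (?x m - 1) (?x m - 1)" unfolding fip_simps(2)[of n "A - 1" "?x m - 1"] fip_simps(6)[of n _ "A - 1" "?x m - 1"]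
    using fip_commute[of n "?x m - 1" "A - 1"] by linarith
   hence "real (Suc m) * (2 * fip n (A - 1) (?x m - 1)) <= real (Suc m) * fip n (?x m - 1) (?x m - 1)" by (rule mult_left_mono) simp
   thus ?thesis by (simp only: fip_simps mult_ac)
  qed
  have b: "(%m. 2 * fip n (A - 1) (?d m)) ----> 2 * fip n (A - 1) Y"
   unfolding fip_def by (intro tendsto_intros bounded_linear.tendsto[OF bounded_linear_entry] exp_derivative_seq)
  have c: "(%m. fip n (?x m - 1) (?d m)) ----> fip n (1 - 1) Y"
   unfolding fip_def by (intro tendsto_intros bounded_linear.tendsto[OF bounded_linear_entry] exp_derivative_seq exp_div_seq_tendsto_1)
  have "2 * fip n (A - 1) Y <= fip n (1 - 1) Y" by (rule LIMSEQ_le[OF b c]) (use a in blast)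
  thus ?thesis by (simp add: fip_def)
 qed
 show ?thesis using le[OF assms(2)] le[OF Lie_minus[OF assms(2)]] by (simp add: fip_simps)
qed

text \<open>If 1 and \<open>g\<close> are both nearest to \<open>A\<close>, then
  \<open>fip n ?g ?g = 2 * fip n ?C ?g\<close>, while \<open>?C\<close> is orthogonal to the Lie
  algebra. With \<open>g = exp X\<close> only the quadratic remainder of \<open>exp\<close>
  contributes, and the fourth power of \<open>norm X\<close> is bounded by itself times a factor
  below 1.\<close>

lemma nearest_unique:
 obtains d where "0 < d"
  "!!A k k'. A - 1 : Mat n ==> nearest A k ==> nearest A k' ==> fip n (A - k) (A - k) < d ==> k = k'"
proof -
 obtain M where M: "0 < M" "!!A. A : Mat n ==> (norm A)\<^sup>2 <= M * fip n A A" using norm_le_fip[of n] by blast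
 obtain e where e: "0 < e" "!!g. g : K ==> norm (g - 1) < e ==> EX X:Lie K. norm X < 1/4 & exp X = g" using exp_Lie_neighbourhood[OF K, of "1/4"] by auto
 define N where "N = 16 * M * (real n + 1)"
 have N: "0 < N" using M by (simp add: N_def add_nonneg_pos)
 \<comment> \<open>The first bound puts \<open>g\<close> into the range of the logarithm; the second
   makes the final factor \<open>(real n / (real n + 1))\<^sup>2\<close>.\<close>
 define d where "d = min (e\<^sup>2 / (4 * M)) (1 / N\<^sup>2)"
 have d: "0 < d" using e M N by (simp add: d_def)
 have one: "g = 1" if A: "A - 1 : Mat n" and n1: "nearest A 1" and ng: "nearest A g" and lt: "fip n (A - 1) (A - 1) < d" for A g
 proof -
  let ?C = "A - 1" and ?g = "g - 1"
  have gK: "g : K" using ng by (simp add: nearest_def)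
  have "fip n (A - g) (A - g) = fip n ?C ?C" using n1 ng cmg_one[OF K] gK by (intro antisym) (auto simp: nearest_def)
  moreover have "A - g = ?C - ?g" by simp
  ultimately have "fip n (?C - ?g) (?C - ?g) = fip n ?C ?C" by (simp only:)
  hence eq: "fip n ?g ?g = 2 * fip n ?C ?g" unfolding fip_simps(2)[of n ?C] fip_simps(6)[of n _ ?C] using fip_commute[of n ?g ?C] by linarith
  have "(fip n ?g ?g)\<^sup>2 <= 4 * (fip n ?C ?C * fip n ?g ?g)" using fip_Cauchy_Schwarz[of n ?C ?g] by (simp add: eq power_mult_distrib)
  hence gle: "fip n ?g ?g <= 4 * fip n ?C ?C" using fip_nonneg[of n ?g] fip_nonneg[of n ?C] by (cases "fip n ?g ?g = 0") (auto simp: power2_eq_square mult_ac)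
  have "(norm ?g)\<^sup>2 <= M * fip n ?g ?g" using M(2)[OF cmg_Mat[OF K gK]] .
  also have "... < M * (4 * d)" using gle lt M by (intro mult_strict_left_mono) auto
  also have "... <= M * (4 * (e\<^sup>2 / (4 * M)))" using M by (intro mult_left_mono) (auto simp: d_def)
  also have "... = e\<^sup>2" using M by simp
  finally have "norm ?g < e" using e by (simp add: power_less_imp_less_base)
  from e(2)[OF gK this] obtain X where X: "X : Lie K" "norm X < 1/4" "exp X = g" by blast
  let ?R = "exp X - 1 - X"
  have R: "norm ?R <= 2 * norm X * norm X" using X by (intro exp_minus_one_bound) simp
  have "fip n ?C ?g = fip n ?C ?R" using nearest_critical[OF n1 X(1)] X(3) by (simp add: fip_simps)
  hence "(fip n ?g ?g)\<^sup>2 <= 4 * (fip n ?C ?C * fip n ?R ?R)" using fip_Cauchy_Schwarz[of n ?C ?R] eq by (simp add: power_mult_distrib)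
  also have "... <= 4 * (d * (real n * (2 * norm X * norm X))\<^sup>2)"
  proof (intro mult_left_mono mult_mono)
   have "fip n ?R ?R <= (real n * norm ?R)\<^sup>2" by (rule fip_le_norm)
   also have "... <= (real n * (2 * norm X * norm X))\<^sup>2" using R by (intro power_mono mult_left_mono) auto
   finally show "fip n ?R ?R <= (real n * (2 * norm X * norm X))\<^sup>2" .
  qed (use lt d in "auto simp: fip_nonneg")
  finally have 1: "(fip n ?g ?g)\<^sup>2 <= 16 * d * (real n)\<^sup>2 * (norm X)^4" by (simp add: power_mult_distrib power2_eq_square power4_eq_xxxx mult_ac)
  have "norm (X - 0) <= 2 * norm (exp X - exp 0)" using X by (intro exp_inj_small) auto
  hence "(norm X)\<^sup>2 <= (2 * norm ?g)\<^sup>2" using X(3) by (intro power_mono) auto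
  also have "... <= 4 * (M * fip n ?g ?g)" using M(2)[OF cmg_Mat[OF K gK]] by (simp add: power_mult_distrib)
  finally have "((norm X)\<^sup>2)\<^sup>2 <= (4 * (M * fip n ?g ?g))\<^sup>2" by (intro power_mono) auto
  also have "... <= 16 * M\<^sup>2 * (16 * d * (real n)\<^sup>2 * (norm X)^4)" using 1 M(1) by (simp add: power_mult_distrib)
  also have "... <= 16 * M\<^sup>2 * (16 * (1 / N\<^sup>2) * (real n)\<^sup>2 * (norm X)^4)" using M(1) by (intro mult_left_mono mult_right_mono) (auto simp: d_def)
  also have "... = (real n / (real n + 1))\<^sup>2 * (norm X)^4"
  proof -
   have "N\<^sup>2 = 256 * M\<^sup>2 * (real n + 1)\<^sup>2" by (simp add: N_def power_mult_distrib)
   thus ?thesis using M(1) by (simp add: power_divide)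
  qed
  finally have le: "(norm X)^4 <= (real n / (real n + 1))\<^sup>2 * (norm X)^4" by simp
  have lt1: "(real n / (real n + 1))\<^sup>2 < 1" by (simp add: power_less_one_iff abs_square_less_1)
  have "norm X = 0"
  proof (rule ccontr)
   assume "norm X ~= 0"
   hence "0 < (norm X)^4" by simp
   from mult_strict_right_mono[OF lt1 this] le show False by simp
  qed
  thus ?thesis using X(3) by simp
 qed
 have "k = k'" if A: "A - 1 : Mat n" and k: "nearest A k" "nearest A k'" and lt: "fip n (A - k) (A - k) < d" for A k k'
 proof -
  have kK: "k : K" using k by (simp add: nearest_def)
  \<comment> \<open>Left translation by the inverse of \<open>k\<close> reduces to the case where
    one of the nearest points is 1.\<close>
  then obtain B where B: "B : K" "k * B = 1" "B * k = 1" using K unfolding cmg_def by blast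
  have "fip n (B * A - B * k) (B * A - B * k) < d" using lt fip_dist_left[OF B(1) A cmg_Mat[OF K kK]] by simp
  hence "B * k' = 1" using nearest_mult[OF B(1) A k(1)] nearest_mult[OF B(1) A k(2)] B one_Mat_mult[OF cmg_Mat[OF K B(1)] A] by (intro one[of "B * A"]) auto
  thus "k = k'" using B by (metis mult.assoc mult_1 mult_1_right)
 qed
 thus ?thesis using that d by blast
qed

text \<open>Uniqueness of the nearest point gives equivariance, and with the compactness of
  \<open>K\<close> it gives continuity: limits of nearest points are nearest points of the
  limit.\<close>

lemma equivariant_retraction:
 obtains d r where "0 < d" "cton {A. A - 1 : Mat n & (EX k:K. fip n (A - k) (A - k) < d)} r"
  "!!A. r A : K"
  "!!A h. A - 1 : Mat n ==> EX k:K. fip n (A - k) (A - k) < d ==> h : K ==> r (h * A) = h * r A"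
proof -
 obtain d where d: "0 < d"
  "!!A k k'. A - 1 : Mat n ==> nearest A k ==> nearest A k' ==> fip n (A - k) (A - k) < d ==> k = k'" using nearest_unique by blast
 define N where "N = {A. A - 1 : Mat n & (EX k:K. fip n (A - k) (A - k) < d)}"
 define r where "r A = (SOME k. nearest A k)" for A
 have r: "nearest A (r A)" for A unfolding r_def by (rule someI_ex[OF nearest_exists])
 have uniq: "k = r A" if A: "A : N" and k: "nearest A k" for A k
 proof -
  obtain k' where "k' : K" "fip n (A - k') (A - k') < d" using A by (auto simp: N_def)
  hence "fip n (A - k) (A - k) < d" using k by (force simp: nearest_def)
  thus ?thesis using d(2)[OF _ k r] A by (simp add: N_def)
 qed
 have rK: "r A : K" for A using r by (simp add: nearest_def)
 have "cton N r" unfolding continuous_on_sequentially comp_def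
 proof (intro allI ballI impI, elim conjE)
  fix u a assume a: "a : N" and u: "ALL m. u m : N" "u ----> a"
  show "(%m. r (u m)) ----> r a"
  proof (rule ccontr)
   assume "\<not> ?thesis"
   then obtain e where e: "0 < e" "ALL M. EX m>=M. e <= dist (r (u m)) (r a)" unfolding lim_sequentially by (auto simp: not_less)
   hence "infinite {m. e <= dist (r (u m)) (r a)}" by (simp add: infinite_nat_iff_unbounded_le)
   from infinite_enumerate[OF this] obtain f :: "nat => nat" where f: "strict_mono f" "!!m. e <= dist (r (u (f m))) (r a)" by auto
   have "compact K" using K by (simp add: cmg_def)
   then obtain k g where k: "k : K" "strict_mono g" "(%m. r (u (f (g m)))) ----> k"
    using seq_compactE[OF compact_imp_seq_compact, of K "%m. r (u (f m))"] rK unfolding o_def by metis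
   have ul: "(%m. u (f (g m))) ----> a" using LIMSEQ_subseq_LIMSEQ[OF LIMSEQ_subseq_LIMSEQ[OF u(2) f(1)] k(2)] by (simp add: o_def)
   have "fip n (a - k) (a - k) <= fip n (a - k') (a - k')" if k': "k' : K" for k'
   proof (rule LIMSEQ_le)
    show "(%m. fip n (u (f (g m)) - r (u (f (g m)))) (u (f (g m)) - r (u (f (g m))))) ----> fip n (a - k) (a - k)"
     unfolding fip_def by (intro tendsto_intros bounded_linear.tendsto[OF bounded_linear_entry] ul k(3))
    show "(%m. fip n (u (f (g m)) - k') (u (f (g m)) - k')) ----> fip n (a - k') (a - k')"
     unfolding fip_def by (intro tendsto_intros bounded_linear.tendsto[OF bounded_linear_entry] ul)
   qed (use r k' in "auto simp: nearest_def")
   hence keq: "k = r a" using uniq[OF a] k(1) by (simp add: nearest_def)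
   have "(%m. dist (r (u (f (g m)))) (r a)) ----> 0" using k(3) unfolding keq by (rule tendsto_dist_iff[THEN iffD1])
   hence "\<forall>\<^sub>F m in sequentially. dist (r (u (f (g m)))) (r a) < e" using e(1) by (rule order_tendstoD)
   then obtain m where "dist (r (u (f (g m)))) (r a) < e" using eventually_happens by fastforce
   thus False using f(2)[of "g m"] by simp
  qed
 qed
 moreover have "r (h * A) = h * r A" if A: "A - 1 : Mat n" and k: "EX k:K. fip n (A - k) (A - k) < d" and h: "h : K" for A h
 proof -
  obtain k where k: "k : K" "fip n (A - k) (A - k) < d" using k by blast
  have "h * A - 1 : Mat n" by (rule one_Mat_mult[OF cmg_Mat[OF K h] A])
  moreover have "h * k : K" using cmg_mult[OF K h k(1)] .
  moreover have "fip n (h * A - h * k) (h * A - h * k) < d" using fip_dist_left[OF h A cmg_Mat[OF K k(1)]] k(2) by simp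
  ultimately have "h * A : N" by (auto simp: N_def)
  from uniq[OF this nearest_mult[OF h A r]] show ?thesis by simp
 qed
 ultimately show ?thesis using that[of d r] d(1) rK unfolding N_def by blast
qed

end

section \<open>Slices and principal bundles\<close>

lemma openin_prodE:
 assumes "openin (ptop X Y) S" "(x, y) : S"
 obtains U V where "openin X U" "openin Y V" "x : U" "y : V" "U \<times> V <= S" using assms unfolding openin_prod_topology_alt by (elim allE impE exE conjE) auto

context compact_group
begin

lemma rep_inverse:
 assumes "rep n rho" "x : cG"
 shows "rho (inv x) * rho x = 1" "rho x * rho (inv x) = 1" using assms by (auto simp: rep_def) (metis inv_closed l_inv r_inv)+

lemma cmg_rep_image:
 assumes rho: "rep n rho" and J: "subgroup J G" "closedin T J"
 shows "cmg n (rho ` J)" unfolding cmg_def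
proof (intro conjI ballI)
 have Jc: "x : J ==> x : cG" for x using subgroup.mem_carrier[OF J(1)] by simp
 have "compactin T J" by (rule closedin_compact_space[OF compact J(2)])
 thus "compact (rho ` J)" using image_compactin[of T J euclidean rho] rho by (simp add: rep_def)
 show "1 : rho ` J" using rho subgroup.one_closed[OF J(1)] by (force simp: rep_def)
 fix A assume "A : rho ` J"
 then obtain x where x: "x : J" "A = rho x" by blast
 show "A - 1 : Mat n" using rho x Jc by (simp add: rep_def)
 show "EX B:rho ` J. A * B = 1 & B * A = 1 & (ALL i j. entry B i j = entry A j i)"
  using rho x Jc[OF x(1)] rep_inverse[OF rho Jc[OF x(1)]] subgroup.m_inv_closed[OF J(1) x(1)] by (intro bexI[of _ "rho (inv x)"]) (auto simp: rep_def)
 fix B assume "B : rho ` J"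
 then obtain y where y: "y : J" "B = rho y" by blast
 have "A * B = rho (x ** y)" using rho x y Jc by (simp add: rep_def)
 thus "A * B : rho ` J" using subgroup.m_closed[OF J(1) x(1) y(1)] by blast
qed

lemma cmg_rep: "rep n rho ==> cmg n (rho ` cG)" using cmg_rep_image[of n rho "cG"] subgroup_self closedin_topspace[of T] by simp

definition faithful :: "('a => op) => bool" where
 "faithful rho <-> (ALL x:cG. rho x = 1 --> x = \<one>)"

lemma faithful_inj:
 assumes "rep n rho" "faithful rho"
 shows "inj_on rho cG"
proof (rule inj_onI)
 fix x y assume x: "x : cG" and y: "y : cG" and e: "rho x = rho y"
 have "rho (x ** inv y) = 1" using assms(1) x y e rep_inverse[OF assms(1) y] by (simp add: rep_def)
 hence "x ** inv y = \<one>" using assms(2) x y by (auto simp: faithful_def)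
 thus "x = y" using x y by (metis inv_equality inv_inv inv_closed)
qed

lemma faithful_homeomorphic:
 assumes "rep n rho" "faithful rho"
 obtains rho' where "ctm (subtop euclidean (rho ` cG)) T rho'" "!!x. x : cG ==> rho' (rho x) = x"
proof -
 have "homeomorphic_map T (subtop euclidean (rho ` cG)) rho" by (rule continuous_imp_homeomorphic_map)
   (use assms faithful_inj[OF assms] compact in "auto simp: rep_def ctm_into Hausdorff_space_subtopology")
 thus ?thesis using that unfolding homeomorphic_map_maps homeomorphic_maps_def by auto
qed

end

section \<open>Equivariant maps to the group and local triviality\<close>

locale compact_action = compact_group G T + group_action G "tsp X" phi
 for G :: "('a, 'm) monoid_scheme" (structure) and T :: "'a topology" and X :: "'x topology" and phi +
 assumes cont_action: "ctm (ptop T X) X (%(g, x). phi g x)"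
begin

lemma act_closed: "g : cG ==> x : tsp X ==> phi g x : tsp X" using element_image by blast

lemma act_comp: "g : cG ==> h : cG ==> x : tsp X ==> phi g (phi h x) = phi (g ** h) x" by (rule composition_rule[symmetric])

lemma act_one: "x : tsp X ==> phi \<one> x = x" using id_eq_one by (metis restrict_apply')

lemma continuous_map_act:
 assumes "ctm Y T f" "ctm Y X u"
 shows "ctm Y X (%y. phi (f y) (u y))"
proof -
 have "ctm Y (ptop T X) (%y. (f y, u y))" using assms by (simp add: continuous_map_paired)
 from ctm_o[OF this cont_action] show ?thesis by (simp add: o_def)
qed

lemma orbit_eq_iff:
 assumes "x : tsp X" "y : tsp X"
 shows "orbit G phi x = orbit G phi y <-> (EX g:cG. y = phi g x)"
proof
 assume "orbit G phi x = orbit G phi y"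
 moreover have "y : orbit G phi y" using act_one[OF assms(2)] by (force simp: orbit_def)
 ultimately show "EX g:cG. y = phi g x" by (auto simp: orbit_def)
next
 assume "EX g:cG. y = phi g x"
 then obtain g where g: "g : cG" "y = phi g x" by blast
 have "phi h x = phi (h ** inv g) y" "phi h y = phi (h ** g) x" if "h : cG" for h using g that assms by (simp_all add: act_comp m_assoc)
 thus "orbit G phi x = orbit G phi y" using g(1) unfolding orbit_def by blast
qed

lemma orbit_act: "x : tsp X ==> g : cG ==> orbit G phi (phi g x) = orbit G phi x" using orbit_eq_iff[of x "phi g x"] act_closed by auto

lemma openin_orbit_image:
 assumes B: "openin X B"
 shows "openin (orbit_space G X phi) (orbit G phi ` B)"
proof -
 have BX: "B <= tsp X" using openin_subset[OF B] .
 have "{x : tsp X. orbit G phi x : orbit G phi ` B} = (\<Union>g\<in>cG. {x : tsp X. phi g x : B})" (is "?L = ?R")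
 proof (intro equalityI subsetI)
  fix x assume "x : ?L"
  then obtain b where b: "b : B" "orbit G phi x = orbit G phi b" "x : tsp X" by auto
  hence "EX g:cG. b = phi g x" using orbit_eq_iff[of x b] BX by auto
  thus "x : ?R" using b by auto
 next
  fix x assume "x : ?R"
  then obtain g where g: "g : cG" "x : tsp X" "phi g x : B" by blast
  thus "x : ?L" using orbit_act[of x g] by (auto intro!: image_eqI[of _ _ "phi g x"])
 qed
 moreover have "openin X {x : tsp X. phi g x : B}" if "g : cG" for g
 proof (rule open_vim[OF _ B])
  show "ctm X X (phi g)" using continuous_map_act[of X "%_. g" "%x. x"] that continuous_map_id[of X] by (simp add: id_def)
 qed
 ultimately show ?thesis using BX by (auto simp: orbit_space_def openin_quotient_topology)
qed

lemma continuous_map_orbit: "ctm X (orbit_space G X phi) (orbit G phi)"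
 unfolding orbit_space_def by (rule quotient_imp_continuous_map[OF quotient_map_quotient_topology])

text \<open>The trivialisation sends \<open>x\<close> to \<open>kap x\<close> together with its
  orbit. It is injective because \<open>g ** kap x = kap x\<close> forces \<open>g = \<one>\<close>,
  and every pair is attained since each orbit contains a point with any prescribed value of
  \<open>kap\<close>.\<close>

lemma locally_trivial_if_equivariant_maps:
 assumes free: "free_action G X phi"
  and ex: "!!x. x : tsp X ==> EX P kap. openin X P & x : P & ctm (subtop X P) T kap &
   (ALL g:cG. ALL y:P. phi g y : P & kap (phi g y) = g ** kap y)"
 shows "ltpb G T X phi" unfolding locally_trivial_principal_bundle_def
proof
 let ?Q = "orbit_space G X phi" and ?o = "orbit G phi"
 fix z assume "z : tsp ?Q"
 then obtain x0 where x0: "x0 : tsp X" "z = ?o x0" by (auto simp: orbit_space_def)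
 obtain P kap where P: "openin X P" "x0 : P" and kapc: "ctm (subtop X P) T kap"
  and eq: "!!g y. g : cG ==> y : P ==> phi g y : P" "!!g y. g : cG ==> y : P ==> kap (phi g y) = g ** kap y" using ex[OF x0(1)] by blast
 have PX: "P <= tsp X" using openin_subset[OF P(1)] .
 have tP: "tsp (subtop X P) = P" using PX by auto
 have kapG: "kap y : cG" if "y : P" for y using kapc that tP by (metis continuous_map_image_subset_topspace image_subset_iff topspace_T)
 define U where "U = ?o ` P"
 have U: "openin ?Q U" unfolding U_def by (rule openin_orbit_image[OF P(1)])
 have Psat: "{x : tsp X. ?o x : U} = P"
 proof (intro equalityI subsetI)
  fix x assume "x : {x : tsp X. ?o x : U}"
  then obtain p where p: "p : P" "?o x = ?o p" "x : tsp X" by (auto simp: U_def)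
  hence "EX g:cG. x = phi g p" using orbit_eq_iff[of p x] PX by auto
  thus "x : P" using eq(1) p by auto
 qed (use PX in "auto simp: U_def")
 define h where "h x = (kap x, ?o x)" for x
 have UQ: "U <= tsp ?Q" using openin_subset[OF U] .
 have tY: "tsp (ptop T (subtop ?Q U)) = cG \<times> U" using UQ by auto
 \<comment> \<open>\<open>s (g, p)\<close> is the point of the orbit of \<open>p\<close> at which
   \<open>kap\<close> has the value \<open>g\<close>. It inverts \<open>h\<close> up to the choice
   of \<open>p\<close> in its orbit, and its continuity yields the openness of
   \<open>h\<close>.\<close>
 define s where "s = (%z. phi (fst z ** inv (kap (snd z))) (snd z))"
 have sP: "s (g, p) : P" "h (s (g, p)) = (g, ?o p)" if "g : cG" "p : P" for g p using that eq kapG PX by (auto simp: s_def h_def m_assoc intro!: orbit_act)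
 have sc: "ctm (ptop T (subtop X P)) (subtop X P) s" unfolding ctm_into
 proof (intro conjI)
  have c2: "ctm (ptop T (subtop X P)) X snd" using continuous_map_snd ctm_into by blast
  have c3: "ctm (ptop T (subtop X P)) T (%z. kap (snd z))" using ctm_o[OF continuous_map_snd kapc, of T] by (simp add: o_def)
  show "ctm (ptop T (subtop X P)) X s" unfolding s_def by (intro continuous_map_act continuous_map_mult continuous_map_inverse c3 c2 continuous_map_fst)
  show "s : tsp (ptop T (subtop X P)) \<rightarrow> P" using sP PX by auto
 qed
 have "homeomorphic_map (subtop X P) (ptop T (subtop ?Q U)) h"
 proof (rule bijective_open_imp_homeomorphic_map)
  show "ctm (subtop X P) (ptop T (subtop ?Q U)) h" unfolding h_def continuous_map_paired ctm_into
   using kapc continuous_map_from_subtopology[OF continuous_map_orbit] by (auto simp: U_def)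
  show "h ` tsp (subtop X P) = tsp (ptop T (subtop ?Q U))" unfolding tP tY
  proof (intro equalityI subsetI)
   fix w assume "w : cG \<times> U"
   then obtain g p where "g : cG" "p : P" "w = (g, ?o p)" by (auto simp: U_def)
   thus "w : h ` P" using sP[of g p] by (metis imageI)
  qed (use kapG in "auto simp: h_def U_def")
  show "inj_on h (tsp (subtop X P))" unfolding tP
  proof (rule inj_onI)
   fix x y assume xy: "x : P" "y : P" "h x = h y"
   hence "EX g:cG. y = phi g x" using orbit_eq_iff[of x y] PX by (auto simp: h_def)
   then obtain g where g: "g : cG" "y = phi g x" by blast
   have "g ** kap x = kap x" using eq(2)[OF g(1) xy(1)] g xy by (simp add: h_def)
   hence "g = \<one>" using kapG[OF xy(1)] g(1) by (simp add: r_cancel_one')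
   thus "x = y" using g act_one xy PX by auto
  qed
  show "open_map (subtop X P) (ptop T (subtop ?Q U)) h" unfolding open_map_def
  proof (intro allI impI)
   fix W assume W: "openin (subtop X P) W"
   have WP: "W <= P" using openin_subset[OF W] by simp
   show "openin (ptop T (subtop ?Q U)) (h ` W)"
   proof (subst openin_subopen, intro ballI)
    fix w assume "w : h ` W"
    then obtain x where x: "x : W" "w = h x" by blast
    have xP: "x : P" using x WP by auto
    have xX: "x : tsp X" using xP PX by auto
    have sx: "s (kap x, x) = x" using kapG[OF xP] act_one[OF xX] by (simp add: s_def)
    have "openin (ptop T (subtop X P)) {z : tsp (ptop T (subtop X P)). s z : W}" by (rule open_vim[OF sc W])
    moreover have "(kap x, x) : {z : tsp (ptop T (subtop X P)). s z : W}" using x sx kapG[OF xP] xP xX by simp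
    ultimately obtain A B where AB: "openin T A" "openin (subtop X P) B" "kap x : A" "x : B"
     "A \<times> B <= {z : tsp (ptop T (subtop X P)). s z : W}" by (rule openin_prodE) (rule that)
    have B: "openin X B" using AB(2) P(1) openin_open_subtopology by blast
    have BP: "B <= P" using openin_subset[OF AB(2)] by simp
    have AG: "A <= cG" using openin_subset[OF AB(1)] by simp
    have "openin (subtop ?Q U) (?o ` B)" using openin_orbit_image[OF B] U BP by (auto simp: openin_open_subtopology U_def)
    hence "openin (ptop T (subtop ?Q U)) (A \<times> ?o ` B)" using AB(1) by (simp add: openin_prod_Times_iff)
    moreover have "w : A \<times> ?o ` B" using x AB by (auto simp: h_def)
    moreover have "A \<times> ?o ` B <= h ` W"
    proof
     fix v assume "v : A \<times> ?o ` B"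
     then obtain g b where gb: "g : A" "b : B" "v = (g, ?o b)" by auto
     hence "s (g, b) : W" using AB(5) by auto
     thus "v : h ` W" using sP(2)[of g b] gb AG BP by (metis imageI subsetD)
    qed
    ultimately show "EX V. openin (ptop T (subtop ?Q U)) V & w : V & V <= h ` W" by blast
   qed
  qed
 qed
 moreover have "z : U" using x0 P by (auto simp: U_def)
 moreover have "h (phi k x) = (k ** fst (h x), snd (h x))" if "k : cG" "x : P" for k x using that eq PX by (auto simp: h_def intro!: orbit_act)
 ultimately show "EX U h. openin ?Q U & z : U &
     (let P = {x : tsp X. orbit G phi x : U} in
      homeomorphic_map (subtop X P) (ptop T (subtop ?Q U)) h &
      (ALL x:P. snd (h x) = orbit G phi x) &
      (ALL k:cG. ALL x:P. h (phi k x) = (k ** fst (h x), snd (h x))))" using U by (intro exI[of _ U] exI[of _ h]) (simp add: Psat Let_def h_def)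
qed

lemma equivariant_map_if_locally_trivial:
 assumes lt: "ltpb G T X phi" and x0: "x0 : tsp X"
 obtains P kap where "openin X P" "x0 : P" "ctm (subtop X P) T kap"
  "!!g y. g : cG ==> y : P ==> phi g y : P & kap (phi g y) = g ** kap y"
proof -
 let ?Q = "orbit_space G X phi"
 have "orbit G phi x0 : tsp ?Q" using x0 by (simp add: orbit_space_def)
 from bspec[OF lt[unfolded locally_trivial_principal_bundle_def Let_def] this]
 obtain U h where *: "openin ?Q U" "orbit G phi x0 : U"
  "homeomorphic_map (subtop X {x : tsp X. orbit G phi x : U}) (ptop T (subtop ?Q U)) h"
  "ALL k:cG. ALL x:{x : tsp X. orbit G phi x : U}. h (phi k x) = (k ** fst (h x), snd (h x))" by (elim exE conjE) (rule that)
 note U = *(1,2) and h = *(3) *(4)[rule_format]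
 show ?thesis
 proof (rule that[of "{x : tsp X. orbit G phi x : U}" "%x. fst (h x)"])
  show "openin X {x : tsp X. orbit G phi x : U}" by (rule open_vim[OF continuous_map_orbit U(1)])
  show "ctm (subtop X {x : tsp X. orbit G phi x : U}) T (%x. fst (h x))"
   using ctm_o[OF homeomorphic_imp_continuous_map[OF h(1)] continuous_map_fst] by (simp add: o_def)
 qed (use x0 U h(2) act_closed orbit_act in auto)
qed

end

context compact_action
begin

text \<open>Gleason's slice: average \<open>rho g\<^sup>-\<^sup>1\<close> along the orbit against a bump function and retract.\<close>

lemma slice_exists:
 assumes rho: "rep n rho" "faithful rho" and free: "free_action G X phi"
  and X: "completely_regular_space X" "Hausdorff_space X" and x0: "x0 : tsp X"
 shows "EX P kap. openin X P & x0 : P & ctm (subtop X P) T kap &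
   (ALL g:cG. ALL y:P. phi g y : P & kap (phi g y) = g ** kap y)"
proof -
 let ?K = "rho ` cG"
 have K: "cmg n ?K" by (rule cmg_rep[OF rho(1)])
 have rhoc: "ctm T euclidean rho" and rho1: "rho \<one> = 1" using rho(1) by (auto simp: rep_def)
 have rhom: "rho (x ** y) = rho x * rho y" if "x : cG" "y : cG" for x y using rho(1) that by (simp add: rep_def)
 have rhoM: "rho x - 1 : Mat n" if "x : cG" for x using rho(1) that by (simp add: rep_def)
 obtain d r where d: "0 < d" and r: "cton {A. A - 1 : Mat n & (EX k:?K. fip n (A - k) (A - k) < d)} r"
  "!!A. r A : ?K" "!!A h. A - 1 : Mat n ==> EX k:?K. fip n (A - k) (A - k) < d ==> h : ?K ==> r (h * A) = h * r A" using equivariant_retraction[OF K] by blast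
 define N where "N = {A. A - 1 : Mat n & (EX k:?K. fip n (A - k) (A - k) < d)}"
 \<comment> \<open>Errors of at most \<open>e\<close> in all entries give a squared Frobenius
   distance of at most \<open>(real n * e)\<^sup>2 < d\<close>; the added 1 makes the inequality
   strict and covers \<open>n = 0\<close>.\<close>
 define e where "e = sqrt d / (real n + 1)"
 have e: "0 < e" "(real n * e)\<^sup>2 < d"
 proof -
  show "0 < e" using d by (simp add: e_def)
  have "real n * e < sqrt d" using d by (simp add: e_def field_simps)
  hence "(real n * e)\<^sup>2 < (sqrt d)\<^sup>2" using d `0 < e` by (intro power_strict_mono) auto
  thus "(real n * e)\<^sup>2 < d" using d by simp
 qed
 \<comment> \<open>Group elements whose inverses are represented far from 1. By freeness
   \<open>x0\<close> is not among its translates by \<open>D\<close>, which form a compact set, so a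
   bump function at \<open>x0\<close> can vanish on them.\<close>
 define D where "D = {g : tsp T. norm (rho (inv g) - 1) : {e..}}"
 have rhoic: "ctm T euclidean (%g. rho (inv g))" by (rule cont_inv[OF rhoc])
 have "closedin T D" unfolding D_def by (rule closedin_continuous_map_preimage[of T euclideanreal])
   (auto intro!: continuous_intros rhoic simp: closed_closedin[symmetric])
 hence "compactin T D" by (rule closedin_compact_space[OF compact])
 have cx: "ctm T X (%g. phi g x)" if "x : tsp X" for x by (rule continuous_map_act[OF continuous_map_id_T]) (use that in simp)
 have "compactin X ((%g. phi g x0) ` D)" by (rule image_compactin[OF `compactin T D` cx[OF x0]])
 hence "closedin X ((%g. phi g x0) ` D)" by (rule compactin_imp_closedin[OF X(2)])
 moreover have "x0 \<notin> (%g. phi g x0) ` D"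
 proof
  assume "x0 : (%g. phi g x0) ` D"
  then obtain g where g: "g : cG" "phi g x0 = x0" "e <= norm (rho (inv g) - 1)" by (auto simp: D_def)
  hence "g : stabilizer G phi x0" by (simp add: stabilizer_def)
  hence "g = \<one>" using free x0 by (simp add: free_action_def)
  thus False using g(3) e(1) rho1 by simp
 qed
 ultimately have "EX f. ctm X (top_of_set {0..1::real}) f & f x0 = 0 & f ` ((%g. phi g x0) ` D) <= {1}"
  using X(1) x0 unfolding completely_regular_space_def by (simp only: Diff_iff simp_thms)
 then obtain f where f: "ctm X (top_of_set {0..1::real}) f" "f x0 = 0" "f ` ((%g. phi g x0) ` D) <= {1}" by blast
 define tht where "tht x = 1 - f x" for x
 have fc: "ctm X euclideanreal f" and f01: "!!x. x : tsp X ==> f x : {0..1}" using f(1) by (auto simp: ctm_into image_subset_iff)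
 have thtc: "ctm X euclideanreal tht" unfolding tht_def[abs_def] by (intro continuous_intros fc)
 have tht0: "0 <= tht x" if "x : tsp X" for x using f01[OF that] by (simp add: tht_def)
 have thtD: "tht (phi g x0) = 0" if "g : cG" "e <= norm (rho (inv g) - 1)" for g using f(3) that by (auto simp: tht_def D_def)
 define m where "m x = mean (%g. tht (phi g x))" for x
 define F where "F x i j = mean (%g. tht (phi g x) * entry (rho (inv g)) i j)" for x i j
 have c1: "ctm (ptop X T) euclideanreal (%z. tht (phi (snd z) (fst z)))"
 proof -
  have "ctm (ptop X T) X (%z. phi (snd z) (fst z))" by (rule continuous_map_act[OF continuous_map_snd continuous_map_fst])
  from ctm_o[OF this thtc] show ?thesis by (simp add: o_def)
 qed
 have ec: "cont (%g. entry (rho (inv g)) i j)" for i j by (rule continuous_map_unop[OF rhoic]) (intro continuous_intros)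
 have c2: "ctm (ptop X T) euclideanreal (%z. tht (phi (snd z) (fst z)) * entry (rho (inv (snd z))) i j)" for i j
  by (intro continuous_map_real_mult c1 continuous_map_pre[OF ec] continuous_map_snd)
 have mc: "ctm X euclideanreal m" unfolding m_def[abs_def] using continuous_map_mean[OF c1] by simp
 have Fc: "ctm X euclideanreal (%x. F x i j)" for i j unfolding F_def using continuous_map_mean[OF c2] by simp
 have thtgc: "cont (%g. tht (phi g x))" if "x : tsp X" for x using ctm_o[OF cx[OF that] thtc] by (simp add: o_def)
 have thtec: "cont (%g. tht (phi g x) * entry (rho (inv g)) i j)" if "x : tsp X" for x i j by (intro continuous_map_real_mult thtgc[OF that] ec)
 \<comment> \<open>The weighted mean of \<open>rho (inv g)\<close> divided by the total weight
   \<open>m x\<close>. Passing from \<open>x\<close> to \<open>phi h x\<close> shifts the variable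
   of the mean and produces the factor \<open>rho h\<close> on the left.\<close>
 define Q where "Q x = mk n (%i j. F x i j / m x)" for x
 define P0 where "P0 = {x : tsp X. m x : - {0}}"
 have P0: "openin X P0" unfolding P0_def by (rule open_vim[OF mc]) (simp add: open_openin[symmetric] open_Compl)
 have Qc: "ctm (subtop X P0) euclidean Q" unfolding Q_def[abs_def] mk_def
  by (intro continuous_intros continuous_map_unop[of _ _ "%t. t *R _"] continuous_map_real_divide
    continuous_map_from_subtopology[OF mc] continuous_map_from_subtopology[OF Fc]) (auto simp: P0_def)
 have QM: "Q x - 1 : Mat n" for x by (simp add: Q_def mk_Mat)
 have m_inv: "m (phi h x) = m x" if h: "h : cG" and x: "x : tsp X" for h x
 proof -
  have "m (phi h x) = mean (%g. tht (phi (g ** h) x))" unfolding m_def by (rule mean_cong) (use h x in "simp add: act_comp")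
  thus ?thesis using mean_right[OF thtgc[OF x] h] by (simp add: m_def)
 qed
 have Q_eq: "Q (phi h x) = rho h * Q x" if h: "h : cG" and x: "x : tsp X" for h x unfolding Q_def[of "phi h x"]
 proof (rule mk_eqI[symmetric])
  show "rho h * Q x - 1 : Mat n" by (rule one_Mat_mult[OF rhoM[OF h] QM])
  fix i j assume ij: "i < n" "j < n"
  have "F (phi h x) i j = mean (%g. (%g. tht (phi g x) * entry (rho (h ** inv g)) i j) (g ** h))"
   unfolding F_def by (rule mean_cong) (use h x in "simp add: act_comp inv_mult_group m_assoc[symmetric]")
  also have "... = mean (%g. tht (phi g x) * entry (rho (h ** inv g)) i j)"
  proof (rule mean_right[OF _ h])
   have "cont (%g. entry (rho (h ** inv g)) i j)" by (rule continuous_map_unop[of _ "%g. rho (h ** inv g)"])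
     (use h in "auto intro!: continuous_intros continuous_map_pre[OF rhoc] cont_T")
   thus "cont (%g. tht (phi g x) * entry (rho (h ** inv g)) i j)" by (intro continuous_map_real_mult thtgc[OF x])
  qed
  also have "... = mean (%g. \<Sum>k<n. entry (rho h) i k * (tht (phi g x) * entry (rho (inv g)) k j))"
   by (rule mean_cong) (use h in "simp add: rhom entry_one_mult[OF rhoM[OF h] ij] sum_distrib_left mult_ac")
  also have "... = (\<Sum>k<n. mean (%g. entry (rho h) i k * (tht (phi g x) * entry (rho (inv g)) k j)))" by (rule mean_sum) (auto intro!: cont_scale thtec[OF x])
  also have "... = (\<Sum>k<n. entry (rho h) i k * F x k j)" unfolding F_def by (simp only: mean_scale[OF thtec[OF x]])
  finally show "entry (rho h * Q x) i j = F (phi h x) i j / m (phi h x)"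
   using ij by (simp add: entry_one_mult[OF rhoM[OF h] ij] Q_def entry_mk m_inv[OF h x] sum_divide_distrib)
 qed
 have m0: "0 < m x0" unfolding m_def by (rule mean_pos[OF thtgc[OF x0] _ one_closed]) (use tht0 x0 act_closed act_one f(2) in "auto simp: tht_def")
 have near: "fip n (Q x0 - 1) (Q x0 - 1) < d"
 proof -
  have "abs(entry (Q x0 - 1) i j) <= e" if ij: "i < n" "j < n" for i j
  proof -
   let ?dlt = "if i = j then 1 else 0 :: real"
   have cc: "cont (%g. tht (phi g x0) * entry (rho (inv g)) i j - ?dlt * tht (phi g x0))" by (intro continuous_map_diff thtec[OF x0] cont_scale thtgc[OF x0])
   have "m x0 * entry (Q x0 - 1) i j = F x0 i j - ?dlt * m x0" using ij m0 by (simp add: Q_def entry_mk right_diff_distrib)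
   also have "... = mean (%g. tht (phi g x0) * entry (rho (inv g)) i j - ?dlt * tht (phi g x0))"
    using mean_diff[OF thtec[OF x0] cont_scale[OF thtgc[OF x0]]] mean_scale[OF thtgc[OF x0]] by (simp add: F_def m_def)
   finally have eq: "m x0 * entry (Q x0 - 1) i j = ..." .
   have b: "abs(tht (phi g x0) * entry (rho (inv g)) i j - ?dlt * tht (phi g x0)) <= e * tht (phi g x0)" if g: "g : cG" for g
   proof (cases "e <= norm (rho (inv g) - 1)")
    case True
    thus ?thesis using thtD[OF g] by simp
   next
    case False
    have "abs(entry (rho (inv g) - 1) i j) <= e" using abs_entry_le[of "rho (inv g) - 1" i j] False by linarith
    hence "abs(tht (phi g x0) * entry (rho (inv g) - 1) i j) <= tht (phi g x0) * e" using tht0[OF act_closed[OF g x0]] by (simp add: abs_mult mult_left_mono)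
    thus ?thesis by (simp add: right_diff_distrib mult.commute)
   qed
   have ec': "cont (%g. e * tht (phi g x0))" by (rule cont_scale[OF thtgc[OF x0]])
   have "mean (%g. tht (phi g x0) * entry (rho (inv g)) i j - ?dlt * tht (phi g x0)) <= e * m x0"
    using mean_mono[OF cc ec'] b mean_scale[OF thtgc[OF x0], of e] by (force simp: abs_le_iff m_def)
   moreover have "- (e * m x0) <= mean (%g. tht (phi g x0) * entry (rho (inv g)) i j - ?dlt * tht (phi g x0))"
    using mean_mono[OF cont_scale[OF thtgc[OF x0], of "- e"] cc] b mean_scale[OF thtgc[OF x0], of "- e"] by (force simp: abs_le_iff m_def)
   ultimately have "abs(m x0 * entry (Q x0 - 1) i j) <= m x0 * e" unfolding eq by (simp add: abs_le_iff mult.commute)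
   thus ?thesis using m0 by (simp add: abs_mult)
  qed
  hence "fip n (Q x0 - 1) (Q x0 - 1) <= (\<Sum>p\<in>{..<n}\<times>{..<n}. e\<^sup>2)"
   unfolding fip_def power2_eq_square[symmetric] by (intro sum_mono) (auto intro!: abs_le_square_iff[THEN iffD1] order_trans[OF _ abs_ge_self] simp del: entry_simps)
  also have "... = (real n * e)\<^sup>2" by (simp add: card_cartesian_product power2_eq_square mult_ac)
  finally show ?thesis using e(2) by simp
 qed
 define B0 where "B0 = (\<Union>k\<in>?K. {A. fip n (A - k) (A - k) < d})"
 have "open B0" unfolding B0_def by (intro open_UN ballI open_Collect_less continuous_intros)
 define P where "P = {x : tsp (subtop X P0). Q x : B0}"
 have "openin (subtop X P0) P" unfolding P_def by (rule open_vim[OF Qc]) (use `open B0` in "simp add: open_openin[symmetric]")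
 hence P: "openin X P" using P0 openin_open_subtopology by blast
 have PN: "Q x : N" if "x : P" for x using that QM by (auto simp: P_def N_def B0_def)
 have P_iff: "x : P <-> x : tsp X & m x ~= 0 & Q x : N" for x using QM by (auto simp: P_def P0_def N_def B0_def)
 have KN: "rho h * A : N" if "A : N" "h : cG" for h A
 proof -
  obtain k where k: "k : ?K" "fip n (A - k) (A - k) < d" and A: "A - 1 : Mat n" using `A : N` by (auto simp: N_def)
  have hK: "rho h : ?K" using that by simp
  have "fip n (rho h * A - rho h * k) (rho h * A - rho h * k) < d" using fip_dist_left[OF K hK A cmg_Mat[OF K k(1)]] k(2) by simp
  thus ?thesis using one_Mat_mult[OF rhoM[OF that(2)] A] cmg_mult[OF K hK k(1)] by (auto simp: N_def)
 qed
 obtain rho' where rho': "ctm (subtop euclidean ?K) T rho'" "!!x. x : cG ==> rho' (rho x) = x" using faithful_homeomorphic[OF rho] by blast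
 define kap where "kap x = rho' (r (Q x))" for x
 have "ctm (subtop X P) (subtop euclidean N) Q" unfolding ctm_into
 proof
  have "subtop X P = subtop (subtop X P0) P" by (simp add: subtopology_subtopology P_def Int_absorb1 subset_iff)
  thus "ctm (subtop X P) euclidean Q" using continuous_map_from_subtopology[OF Qc] by simp
 qed (use PN in auto)
 moreover have "ctm (subtop euclidean N) (subtop euclidean ?K) r" using r(1,2) unfolding N_def ctm_into by auto
 ultimately have "ctm (subtop X P) (subtop euclidean ?K) (r o Q)" by (rule ctm_o)
 hence "ctm (subtop X P) T (rho' o (r o Q))" using rho'(1) by (rule ctm_o)
 hence kapc: "ctm (subtop X P) T kap" by (simp add: kap_def[abs_def] o_def)
 have "phi g y : P & kap (phi g y) = g ** kap y" if g: "g : cG" and y: "y : P" for g y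
 proof
  have yX: "y : tsp X" "Q y : N" "m y ~= 0" using y by (auto simp: P_iff)
  show "phi g y : P" using act_closed[OF g yX(1)] m_inv[OF g yX(1)] Q_eq[OF g yX(1)] KN[OF yX(2) g] yX(3) by (simp add: P_iff)
  obtain u where u: "u : cG" "r (Q y) = rho u" using r(2) by blast
  have "r (Q (phi g y)) = rho g * r (Q y)" unfolding Q_eq[OF g yX(1)] by (rule r(3)) (use yX(2) g in "auto simp: N_def")
  also have "... = rho (g ** u)" using u g by (simp add: rhom)
  finally show "kap (phi g y) = g ** kap y" using u g by (simp add: kap_def rho'(2))
 qed
 moreover have "x0 : P" using x0 m0 near QM rho1 by (auto simp: P_iff N_def intro!: bexI[of _ \<one>])
 ultimately show ?thesis using P kapc by blast
qed

theorem faithful_rep_imp_principal: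
 assumes "rep n rho" "faithful rho" "free_action G X phi" "completely_regular_space X" "Hausdorff_space X"
 shows "ltpb G T X phi" using assms slice_exists by (intro locally_trivial_if_equivariant_maps) auto

end

section \<open>Quotient groups\<close>

lemma image_pair: "(%z. (p (fst z), q (snd z))) ` (A \<times> B) = p ` A \<times> q ` B" by (auto simp: image_iff)

context compact_group
begin

lemma openin_left_translate:
 assumes "openin T U" "h : cG"
 shows "openin T {x : cG. h ** x : U}" using open_vim[of T T "%x. h ** x" U] assms by (simp add: cont_T)

context
 fixes H
 assumes nH: "normal H G" and cH: "closedin T H"
begin

lemma subH: "subgroup H G" using nH by (rule normal_imp_subgroup)

lemma coset_eq_iff:
 assumes "x : cG" "y : cG"
 shows "H #> x = H #> y <-> x ** inv y : H"
proof
 assume "H #> x = H #> y"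
 hence "x : H #> y" using rcos_self[OF assms(1) subH] by simp
 then obtain h where "h : H" "x = h ** y" by (auto simp: r_coset_def)
 thus "x ** inv y : H" using assms subgroup.mem_carrier[OF subH] by (simp add: m_assoc)
next
 assume "x ** inv y : H"
 moreover have "x = (x ** inv y) ** y" using assms by (simp add: m_assoc)
 ultimately have "x : H #> y" unfolding r_coset_def by blast
 thus "H #> x = H #> y" using repr_independence[OF _ assms(2) subH] by simp
qed

lemma carrier_quotient: "carrier (G Mod H) = (%g. H #> g) ` cG" by (auto simp: carrier_FactGroup)

lemma continuous_map_coset: "ctm T (coset_topology G T H) (%g. H #> g)"
 unfolding coset_topology_def by (rule quotient_imp_continuous_map[OF quotient_map_quotient_topology])

lemma openin_coset_image:
 assumes U: "openin T U"
 shows "openin (coset_topology G T H) ((%g. H #> g) ` U)"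
proof -
 have UG: "U <= cG" using openin_subset[OF U] by simp
 have "{x : cG. H #> x : (%g. H #> g) ` U} = (\<Union>h\<in>H. {x : cG. h ** x : U})"
 proof (intro equalityI subsetI)
  fix x assume "x : {x : cG. H #> x : (%g. H #> g) ` U}"
  then obtain u where u: "x : cG" "u : U" "H #> x = H #> u" by blast
  hence "u ** inv x : H" using coset_eq_iff[of u x] UG by auto
  moreover have "(u ** inv x) ** x = u" using u UG by (auto simp: m_assoc)
  ultimately show "x : (\<Union>h\<in>H. {x : cG. h ** x : U})" using u by force
 next
  fix x assume "x : (\<Union>h\<in>H. {x : cG. h ** x : U})"
  then obtain h where h: "h : H" "x : cG" "h ** x : U" by blast
  have "h : cG" using h subgroup.mem_carrier[OF subH] by simp
  hence "H #> (h ** x) = H #> x" using h coset_eq_iff[of "h ** x" x] by (simp add: m_assoc)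
  thus "x : {x : cG. H #> x : (%g. H #> g) ` U}" using h by (intro CollectI conjI image_eqI[of _ _ "h ** x"]) auto
 qed
 moreover have "openin T (\<Union>h\<in>H. {x : cG. h ** x : U})" using openin_left_translate[OF U] subgroup.mem_carrier[OF subH] by (intro openin_Union) auto
 ultimately show ?thesis using UG by (auto simp: coset_topology_def openin_quotient_topology)
qed

text \<open>Products of quotient maps need not be quotient maps; here the coset map is open, and
  products of open maps are open.\<close>

lemma quotient_map_times:
 "quotient_map (ptop T Y) (ptop (coset_topology G T H) Y) (%z. (H #> fst z, snd z))"
 "quotient_map (ptop T T) (ptop (coset_topology G T H) (coset_topology G T H)) (%z. (H #> fst z, H #> snd z))"
proof -
 let ?C = "coset_topology G T H"
 have gen: "quotient_map (ptop T Y') (ptop ?C Z) (%z. (H #> fst z, f (snd z)))"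
  if f: "ctm Y' Z f" "!!U. openin Y' U ==> openin Z (f ` U)" "f ` tsp Y' = tsp Z" for Y' :: "'d topology" and Z :: "'e topology" and f
 proof (rule continuous_open_imp_quotient_map)
  show "ctm (ptop T Y') (ptop ?C Z) (%z. (H #> fst z, f (snd z)))" unfolding continuous_map_paired
   using ctm_o[OF continuous_map_fst continuous_map_coset, of Y'] ctm_o[OF continuous_map_snd f(1), of T] by (simp add: o_def)
  show "open_map (ptop T Y') (ptop ?C Z) (%z. (H #> fst z, f (snd z)))" unfolding open_map_def
  proof (intro allI impI, subst openin_subopen, intro ballI)
   fix U w assume U: "openin (ptop T Y') U" and "w : (%z. (H #> fst z, f (snd z))) ` U"
   then obtain x y where xy: "(x, y) : U" "w = (H #> x, f y)" by auto
   obtain A B where AB: "openin T A" "openin Y' B" "x : A" "y : B" "A \<times> B <= U" using U xy(1) by (rule openin_prodE) (rule that)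
   have "openin (ptop ?C Z) ((%g. H #> g) ` A \<times> f ` B)" using openin_coset_image[OF AB(1)] f(2)[OF AB(2)] by (simp add: openin_prod_Times_iff)
   moreover have "w : (%g. H #> g) ` A \<times> f ` B" using xy AB by auto
   moreover have "(%g. H #> g) ` A \<times> f ` B <= (%z. (H #> fst z, f (snd z))) ` U" using AB(5) by force
   ultimately show "EX V. openin (ptop ?C Z) V & w : V & V <= (%z. (H #> fst z, f (snd z))) ` U" by blast
  qed
  show "(%z. (H #> fst z, f (snd z))) ` tsp (ptop T Y') = tsp (ptop ?C Z)" using image_pair[of "%g. H #> g" f "cG" "tsp Y'"] f(3) by (simp add: coset_topology_def)
 qed
 show "quotient_map (ptop T Y) (ptop ?C Y) (%z. (H #> fst z, snd z))" using gen[of Y Y "%x. x"] continuous_map_id[of Y] by (simp add: id_def)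
 show "quotient_map (ptop T T) (ptop ?C ?C) (%z. (H #> fst z, H #> snd z))" using gen[OF continuous_map_coset openin_coset_image] by (simp add: coset_topology_def)
qed

lemma compact_group_quotient: "compact_group (G Mod H) (coset_topology G T H)"
proof -
 let ?C = "coset_topology G T H" and ?\<pi> = "%g. H #> g"
 interpret Q: group "G Mod H" by (rule normal.factorgroup_is_group[OF nH])
 have tC: "tsp ?C = ?\<pi> ` cG" by (simp add: coset_topology_def)
 have mult: "?\<pi> x <#> ?\<pi> y = ?\<pi> (x ** y)" if "x : cG" "y : cG" for x y by (rule normal.rcos_sum[OF nH that])
 have invq: "inv\<^bsub>G Mod H\<^esub> (?\<pi> x) = ?\<pi> (inv x)" if "x : cG" for x
  by (rule Q.inv_equality) (use that mult[of "inv x" x] carrier_quotient in "auto simp: coset_mult_one subgroup.subset[OF subH]")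
 have cm: "ctm (ptop ?C ?C) ?C (%z. fst z \<otimes>\<^bsub>G Mod H\<^esub> snd z)"
 proof (rule continuous_compose_quotient_map[OF quotient_map_times(2)])
  have "ctm (ptop T T) ?C (%z. ?\<pi> (fst z ** snd z))"
   using ctm_o[OF continuous_map_mult[OF continuous_map_fst continuous_map_snd] continuous_map_coset] by (simp add: o_def)
  thus "ctm (ptop T T) ?C ((%z. fst z \<otimes>\<^bsub>G Mod H\<^esub> snd z) o (%z. (?\<pi> (fst z), ?\<pi> (snd z))))" by (rule continuous_map_eq) (auto simp: mult)
 qed
 have ci: "ctm ?C ?C (%z. inv\<^bsub>G Mod H\<^esub> z)"
 proof (rule continuous_compose_quotient_map[of T _ ?\<pi>])
  show "quotient_map T ?C ?\<pi>" unfolding coset_topology_def by (rule quotient_map_quotient_topology)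
  have "ctm T ?C (%z. ?\<pi> (inv z))" using cont_inv[OF continuous_map_coset] .
  thus "ctm T ?C ((%z. inv\<^bsub>G Mod H\<^esub> z) o ?\<pi>)" by (rule continuous_map_eq) (auto simp: invq)
 qed
 have cs: "compact_space ?C" using image_compactin[OF _ continuous_map_coset, of "tsp T"] compact tC by (simp add: compact_space_def)
 have hs: "Hausdorff_space ?C" unfolding Hausdorff_space_def tC
 proof (intro allI impI, elim conjE)
  fix a b assume "a : ?\<pi> ` cG" "b : ?\<pi> ` cG" "a ~= b"
  then obtain x y where xy0: "x : cG" "y : cG" "a = ?\<pi> x" "b = ?\<pi> y" by blast
  hence "x ** inv y \<notin> H" using coset_eq_iff[of x y] `a ~= b` by simp
  note xy = xy0 this
  have "openin (ptop T T) {z : tsp (ptop T T). fst z ** inv (snd z) : tsp T - H}" by (rule open_vim[of _ T])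
    (use openin_diff[OF openin_topspace cH] in "auto intro!: cont_T continuous_map_fst continuous_map_snd")
  moreover have "(x, y) : {z : tsp (ptop T T). fst z ** inv (snd z) : tsp T - H}" using xy by simp
  ultimately obtain U V where UV: "openin T U" "openin T V" "x : U" "y : V"
   "U \<times> V <= {z : tsp (ptop T T). fst z ** inv (snd z) : tsp T - H}" by (rule openin_prodE) (rule that)
  have "disjnt (?\<pi> ` U) (?\<pi> ` V)"
  proof (rule ccontr)
   assume "\<not> disjnt (?\<pi> ` U) (?\<pi> ` V)"
   then obtain u v where uv: "u : U" "v : V" "?\<pi> u = ?\<pi> v" by (auto simp: disjnt_def)
   hence "(u, v) : U \<times> V" by simp
   hence "u : cG" "v : cG" "u ** inv v \<notin> H" using UV(5) by auto
   thus False using coset_eq_iff uv by blast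
  qed
  thus "EX U V. openin ?C U & openin ?C V & a : U & b : V & disjnt U V" using openin_coset_image UV xy by blast
 qed
 show ?thesis using cm ci cs hs tC carrier_quotient by unfold_locales (auto simp: case_prod_unfold)
qed

lemma compact_action_quotient:
 assumes act: "continuous_action G T X phi" and stab: "!!x. x : tsp X ==> stabilizer G phi x = H"
 shows "compact_action (G Mod H) (coset_topology G T H) X (quotient_action phi)"
  and "free_action (G Mod H) X (quotient_action phi)"
proof -
 let ?C = "coset_topology G T H" and ?\<pi> = "%g. H #> g"
 have ga: "group_action G (tsp X) phi"
  and ca: "ctm (ptop T X) X (%(g, x). phi g x)" using act by (auto simp: continuous_action_def)
 interpret A: compact_action G T X phi using ga ca by (simp add: compact_action_def compact_action_axioms_def compact_group_axioms)
 interpret Q: compact_group "G Mod H" ?C by (rule compact_group_quotient)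
 have q: "quotient_action phi (?\<pi> g) x = phi g x" if "g : cG" "x : tsp X" for g x by (rule quotient_action_coset[OF ga subH that stab])
 have mult: "?\<pi> x <#> ?\<pi> y = ?\<pi> (x ** y)" if "x : cG" "y : cG" for x y by (rule normal.rcos_sum[OF nH that])
 have bij: "quotient_action phi (?\<pi> g) : Bij (tsp X)" if g: "g : cG" for g
 proof -
  have "(SOME g'. g' : ?\<pi> g) : ?\<pi> g" by (rule someI[where P="%g'. g' : ?\<pi> g", OF rcos_self[OF g subH]])
  hence "(SOME g'. g' : ?\<pi> g) : cG" using g subgroup.subset[OF subH] by (auto simp: r_coset_def)
  thus ?thesis unfolding quotient_action_def by (rule A.bij_prop0)
 qed
 have hom: "quotient_action phi : hom (G Mod H) (BijGroup (tsp X))"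
 proof (rule homI)
  fix c assume "c : carrier (G Mod H)"
  thus "quotient_action phi c : carrier (BijGroup (tsp X))" using bij by (auto simp: carrier_quotient BijGroup_def)
  fix c' assume "c : carrier (G Mod H)" "c' : carrier (G Mod H)"
  then obtain g g' where g: "g : cG" "c = ?\<pi> g" "g' : cG" "c' = ?\<pi> g'" by (auto simp: carrier_quotient)
  have "quotient_action phi (?\<pi> (g ** g')) = compose (tsp X) (quotient_action phi (?\<pi> g)) (quotient_action phi (?\<pi> g'))"
  proof (rule extensionalityI[of _ "tsp X"])
   show "quotient_action phi (?\<pi> (g ** g')) : extensional (tsp X)" using bij[of "g ** g'"] g by (simp add: Bij_def)
   fix x assume "x : tsp X"
   thus "quotient_action phi (?\<pi> (g ** g')) x = compose (tsp X) (quotient_action phi (?\<pi> g)) (quotient_action phi (?\<pi> g')) x"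
    using g by (simp add: compose_eq q A.act_closed A.act_comp)
  qed simp
  thus "quotient_action phi (c \<otimes>\<^bsub>G Mod H\<^esub> c') = quotient_action phi c \<otimes>\<^bsub>BijGroup (tsp X)\<^esub> quotient_action phi c'"
   using g bij by (simp add: mult BijGroup_def)
 qed
 have "group_action (G Mod H) (tsp X) (quotient_action phi)" using hom by (simp add: group_action_def group_hom_def group_hom_axioms_def Q.is_group group_BijGroup)
 moreover have "ctm (ptop ?C X) X (%z. quotient_action phi (fst z) (snd z))"
 proof (rule continuous_compose_quotient_map[OF quotient_map_times(1)])
  show "ctm (ptop T X) X ((%z. quotient_action phi (fst z) (snd z)) o (%z. (?\<pi> (fst z), snd z)))" by (rule continuous_map_eq[OF ca]) (auto simp: q)
 qed
 ultimately show "compact_action (G Mod H) ?C X (quotient_action phi)"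
  by (simp add: compact_action_def compact_action_axioms_def Q.compact_group_axioms case_prod_unfold)
 show "free_action (G Mod H) X (quotient_action phi)" unfolding free_action_def
 proof
  fix x assume x: "x : tsp X"
  have fixH: "?\<pi> g = H <-> phi g x = x" if g: "g : cG" for g
  proof -
   have "?\<pi> g = H <-> g : H" using coset_eq_iff[OF g one_closed] g coset_mult_one[OF subgroup.subset[OF subH]] by simp
   thus ?thesis using stab[OF x] g by (auto simp: stabilizer_def)
  qed
  have "c = H" if c: "c : carrier (G Mod H)" "quotient_action phi c x = x" for c
  proof -
   obtain g where "g : cG" "c = ?\<pi> g" using c(1) unfolding carrier_quotient by blast
   thus ?thesis using fixH c(2) q[OF _ x] by simp
  qed
  moreover have "H = ?\<pi> \<one>" using coset_mult_one[OF subgroup.subset[OF subH]] by simp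
  hence "H : carrier (G Mod H)" "quotient_action phi H x = x" using q[OF one_closed x] A.act_one[OF x] unfolding carrier_quotient by (blast, simp)
  ultimately show "stabilizer (G Mod H) (quotient_action phi) x = {\<one>\<^bsub>G Mod H\<^esub>}" unfolding stabilizer_def by auto
 qed
qed

end

end

section \<open>Linearity of quotients of linear groups\<close>

lemma Lie_mono: "K <= K' ==> Lie K <= Lie K'" by (auto simp: Lie_def)

context compact_group
begin

lemma closedin_subset_preimage:
 assumes "ctm T euclidean f" "closed S"
 shows "closedin T {x : cG. f x : S}" using closedin_continuous_map_preimage[OF assms(1), of S] assms(2) by simp

text \<open>
 First find a representation of \<open>G/H\<close> whose kernel \<open>J\<close> has the same Lie algebra as \<open>H\<close>; then
 \<open>J - H\<close> is closed, hence removed by another representation.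
\<close>

lemma faithful_rep_quotient:
 assumes rho: "rep n rho" "faithful rho" and nH: "normal H G" and cH: "closedin T H"
 shows "EX m sg. compact_group.rep (G Mod H) (coset_topology G T H) m sg & compact_group.faithful (G Mod H) sg"
proof -
 let ?C = "coset_topology G T H" and ?\<pi> = "%g. H #> g"
 interpret Q: compact_group "G Mod H" ?C by (rule compact_group_quotient[OF nH cH])
 have sH: "subgroup H G" by (rule normal_imp_subgroup[OF nH])
 have Hc: "h : cG" if "h : H" for h using subgroup.mem_carrier[OF sH that] .
 have rhoc: "ctm T euclidean rho" and rhom: "!!x y. x : cG ==> y : cG ==> rho (x ** y) = rho x * rho y" using rho(1) by (auto simp: rep_def)
 note inj = faithful_inj[OF rho]
 let ?K = "rho ` cG" and ?KH = "rho ` H"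
 have K: "cmg n ?K" by (rule cmg_rep[OF rho(1)])
 have KH: "cmg n ?KH" by (rule cmg_rep_image[OF rho(1) sH cH])
 have \<pi>1: "?\<pi> g = \<one>\<^bsub>G Mod H\<^esub> <-> g : H" if g: "g : cG" for g
  using coset_eq_iff[OF nH cH g one_closed] g coset_mult_one[OF subgroup.subset[OF sH]] by (simp add: FactGroup_def)
 have cover: "EX m sg. Q.rep m sg & (ALL g:C. sg (?\<pi> g) ~= 1)" if C: "closedin T C" "C Int H = {}" for C
 proof -
  have "compactin T C" by (rule closedin_compact_space[OF compact C(1)])
  hence "compactin ?C (?\<pi> ` C)" by (rule image_compactin[OF _ continuous_map_coset[OF nH cH]])
  hence "closedin ?C (?\<pi> ` C)" by (rule compactin_imp_closedin[OF Q.Hausdorff])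
  moreover have "\<one>\<^bsub>G Mod H\<^esub> \<notin> ?\<pi> ` C"
  proof
   assume "\<one>\<^bsub>G Mod H\<^esub> : ?\<pi> ` C"
   then obtain g where "g : C" "?\<pi> g = \<one>\<^bsub>G Mod H\<^esub>" by (elim imageE) (rule that, auto)
   thus False using \<pi>1[of g] C(2) closedin_subset[OF C(1)] by auto
  qed
  ultimately obtain m sg where "Q.rep m sg" "!!x. x : ?\<pi> ` C ==> sg x ~= 1" using Q.rep_cover by blast
  thus ?thesis by blast
 qed
 obtain dlt where dlt: "0 < dlt" "!!g. g : ?KH ==> norm (g - 1) < dlt ==> EX X:Lie ?KH. norm X < 1/4 & exp X = g" using exp_Lie_neighbourhood[OF KH, of "1/4"] by auto
 \<comment> \<open>Vectors of length \<open>r\<close> have exponentials within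
   \<open>3 * r < dlt\<close> of 1, where elements of \<open>?KH\<close> have logarithms;
   \<open>1/4\<close> is the range of \<open>exp_inj_small\<close>.\<close>
 define r where "r = min (1/4) (dlt/4)"
 have r: "0 < r" "r <= 1/4" "3 * r < dlt" using dlt(1) by (auto simp: r_def)
 \<comment> \<open>Vectors of length \<open>r\<close> whose distance to \<open>Lie ?KH\<close> is
   attained at 0: a substitute for a sphere in the orthogonal complement, suited to an arbitrary
   norm. Their exponentials avoid \<open>?KH\<close>.\<close>
 define D where "D = {Z : Lie ?K. norm Z = r & (ALL W:Lie ?KH. r <= norm (Z - W))}"
 have "compact D"
 proof (rule compact_Mat[of _ n])
  show "D <= Mat n" using Lie_Mat[OF K] by (auto simp: D_def)
  have "D = Lie ?K Int {Z. norm Z = r} Int (\<Inter>W\<in>Lie ?KH. {Z. r <= norm (Z - W)})" by (auto simp: D_def)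
  thus "closed D" by (auto intro!: closed_Int closed_INT closed_Lie[OF K] closed_Collect_eq closed_Collect_le continuous_intros)
  show "bounded D" by (rule boundedI[of _ r]) (simp add: D_def)
 qed
 define C where "C = {g : cG. rho g : exp ` D}"
 have "compact (exp ` D)" by (intro compact_continuous_image continuous_intros `compact D`)
 hence C1: "closedin T C" unfolding C_def by (intro closedin_subset_preimage[OF rhoc] compact_imp_closed)
 have C0: "C Int H = {}"
 proof (rule ccontr)
  assume "C Int H ~= {}"
  then obtain h Z where h: "h : H" "Z : D" "rho h = exp Z" by (auto simp: C_def)
  have nZ: "norm Z = r" using h by (simp add: D_def)
  have "norm (exp Z - 1) <= norm (exp Z - 1 - Z) + norm Z" using norm_triangle_ineq[of "exp Z - 1 - Z" Z] by simp
  also have "... <= 2 * r * r + r" using exp_minus_one_bound[of Z] nZ r by simp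
  also have "... <= 3 * r" using r by (simp add: mult_left_le)
  finally have "norm (rho h - 1) < dlt" using r h by simp
  then obtain W where W: "W : Lie ?KH" "norm W < 1/4" "exp W = rho h" using dlt(2)[of "rho h"] h by blast
  have "norm (Z - W) <= 2 * norm (exp Z - exp W)" using W nZ r by (intro exp_inj_small) auto
  moreover have "r <= norm (Z - W)" using h W by (simp add: D_def)
  ultimately show False using W h r by simp
 qed
 from cover[OF C1 C0] obtain m1 sg1 where s1: "Q.rep m1 sg1" "!!g. g : C ==> sg1 (?\<pi> g) ~= 1" by blast
 define J where "J = {g : cG. sg1 (?\<pi> g) : {1}}"
 have \<pi>m: "?\<pi> (x ** y) = ?\<pi> x \<otimes>\<^bsub>G Mod H\<^esub> ?\<pi> y" "?\<pi> x : carrier (G Mod H)" if "x : cG" "y : cG" for x y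
  using normal.rcos_sum[OF nH that] that unfolding carrier_quotient[OF nH cH] by auto
 have s1m: "sg1 (?\<pi> (x ** y)) = sg1 (?\<pi> x) * sg1 (?\<pi> y)" if "x : cG" "y : cG" for x y
  using s1(1) \<pi>m[OF that] \<pi>m(2)[OF that(2) that(2)] by (simp add: Q.rep_def)
 have s11: "sg1 (?\<pi> g) = 1" if "g : H" for g using \<pi>1[OF Hc[OF that]] that s1(1) by (simp add: Q.rep_def)
 have HJ: "H <= J" using s11 Hc by (auto simp: J_def)
 have sJ: "subgroup J G"
 proof (rule subgroupI)
  show "J ~= {}" using HJ subgroup.one_closed[OF sH] by blast
  fix a assume a: "a : J"
  have "sg1 (?\<pi> (inv a ** a)) = sg1 (?\<pi> (inv a)) * sg1 (?\<pi> a)" using a by (intro s1m) (auto simp: J_def)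
  thus "inv a : J" using a s11[OF subgroup.one_closed[OF sH]] by (simp add: J_def)
 qed (auto simp: J_def s1m)
 have "ctm T euclidean (%g. sg1 (?\<pi> g))" using ctm_o[OF continuous_map_coset[OF nH cH], of euclidean sg1] s1(1) by (simp add: Q.rep_def o_def)
 hence cJ: "closedin T J" unfolding J_def by (rule closedin_subset_preimage) simp
 let ?KJ = "rho ` J"
 have KJ: "cmg n ?KJ" by (rule cmg_rep_image[OF rho(1) sJ cJ])
 have Jc: "J <= cG" by (auto simp: J_def)
 have LHJ: "Lie ?KH <= Lie ?KJ" and LJK: "Lie ?KJ <= Lie ?K" by (rule Lie_mono[OF image_mono[OF HJ]], rule Lie_mono[OF image_mono[OF Jc]])
 have LieJ: "X : Lie ?KH" if X: "X : Lie ?KJ" for X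
 proof (rule ccontr)
  assume XH: "X \<notin> Lie ?KH"
  have "compact (Lie ?KH Int cball X (norm X))" by (rule compact_Mat[of _ n]) (use Lie_Mat[OF KH] closed_Lie[OF KH] in "auto intro: closed_Int")
  moreover have "Lie ?KH Int cball X (norm X) ~= {}" using Lie_0[OF KH] by force
  moreover have "cton (Lie ?KH Int cball X (norm X)) (%q. norm (X - q))" by (intro continuous_intros)
  ultimately obtain p where p: "p : Lie ?KH Int cball X (norm X)" "!!q. q : Lie ?KH Int cball X (norm X) ==> norm (X - p) <= norm (X - q)"
   using continuous_attains_inf by metis
  have p2: "norm (X - p) <= norm (X - q)" if "q : Lie ?KH" for q using p(1) p(2)[of q] that by (cases "norm (X - q) <= norm X") (auto simp: dist_norm)
  \<comment> \<open>Subtracting a nearest point of \<open>Lie ?KH\<close> and rescaling gives an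
    element of \<open>D\<close> tangent to \<open>?KJ\<close>. Its exponential comes from a point of
    both \<open>C\<close> and \<open>J\<close>, but \<open>sg1\<close> is nontrivial on all of
    \<open>C\<close>.\<close>
  define Y where "Y = X - p"
  have Y: "Y ~= 0" "Y : Lie ?KJ" using XH p(1) LHJ X Lie_diff[OF KJ] by (auto simp: Y_def)
  define Z where "Z = (r / norm Y) *R Y"
  have "r <= norm (Z - W)" if W: "W : Lie ?KH" for W
  proof -
   have "norm Y <= norm (X - (p + (norm Y / r) *R W))" unfolding Y_def by (rule p2) (use p(1) W in "auto intro: Lie_add[OF KH] Lie_scale")
   also have "X - (p + (norm Y / r) *R W) = (norm Y / r) *R (Z - W)" using Y(1) r(1) by (simp add: Z_def Y_def[symmetric] scaleR_diff_right algebra_simps flip: Y_def)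
   finally have "norm Y <= (norm Y / r) * norm (Z - W)" using r(1) unfolding norm_scaleR by simp
   thus ?thesis using Y(1) r(1) by (simp add: field_simps)
  qed
  hence "Z : D" using Y r(1) LJK by (auto simp: D_def Z_def intro: Lie_scale)
  moreover have "exp Z : ?KJ" unfolding Z_def by (rule LieD[OF Y(2)])
  ultimately obtain g where g: "g : J" "rho g = exp Z" by force
  hence "g : C" using `Z : D` Jc by (auto simp: C_def)
  thus False using s1(2) g by (auto simp: J_def)
 qed
 obtain dlt' where dlt': "0 < dlt'" "!!g. g : ?KJ ==> norm (g - 1) < dlt' ==> EX X:Lie ?KJ. norm X < 1 & exp X = g" using exp_Lie_neighbourhood[OF KJ, of 1] by auto
 have near: "g : H" if g: "g : J" "norm (rho g - 1) < dlt'" for g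
 proof -
  obtain X where "X : Lie ?KJ" "exp X = rho g" using dlt'(2)[of "rho g"] g by blast
  hence "rho g : ?KH" using LieJ LieD1 by metis
  then obtain h where "h : H" "rho h = rho g" by auto
  thus ?thesis using inj g Jc Hc by (metis inj_onD subsetD)
 qed
 \<comment> \<open>This writes \<open>J - H\<close> as an intersection of closed sets: near 1 the
   groups \<open>J\<close> and \<open>H\<close> agree, so elements of \<open>J\<close> outside
   \<open>H\<close> keep the distance \<open>dlt'\<close> from 1 after translation by
   \<open>H\<close>.\<close>
 define C2 where "C2 = J Int (\<Inter>h\<in>H. {g : cG. rho (inv h ** g) : {A. dlt' <= norm (A - 1)}})"
 have C2: "C2 = J - H"
 proof (intro equalityI subsetI)
  fix g assume g: "g : C2"
  hence "g : H ==> dlt' <= norm (rho (inv g ** g) - 1)" unfolding C2_def by blast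
  thus "g : J - H" using g dlt'(1) rho(1) Hc by (auto simp: C2_def rep_def)
 next
  fix g assume g: "g : J - H"
  have "dlt' <= norm (rho (inv h ** g) - 1)" if h: "h : H" for h
  proof (rule ccontr)
   assume "\<not> ?thesis"
   moreover have "inv h ** g : J" using h g HJ subgroup.m_closed[OF sJ] subgroup.m_inv_closed[OF sJ] by blast
   ultimately have "inv h ** g : H" using near by simp
   hence "h ** (inv h ** g) : H" by (rule subgroup.m_closed[OF sH h])
   thus False using g h Hc Jc by (auto simp: m_assoc[symmetric])
  qed
  thus "g : C2" using g Jc by (auto simp: C2_def)
 qed
 have "closedin T C2" unfolding C2_def
 proof (intro closedin_Int cJ closedin_INT)
  show "H ~= {}" using subgroup.one_closed[OF sH] by blast
  fix h assume h: "h : H"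
  show "closedin T {g : cG. rho (inv h ** g) : {A. dlt' <= norm (A - 1)}}" by (rule closedin_subset_preimage)
    (use h Hc in "auto intro!: continuous_map_pre[OF rhoc] cont_T closed_Collect_le continuous_intros")
 qed
 then obtain m2 sg2 where s2: "Q.rep m2 sg2" "!!g. g : C2 ==> sg2 (?\<pi> g) ~= 1" using cover[of C2] C2 by auto
 have "Q.faithful (%x. dsum (sg1 x) (sg2 x))" unfolding Q.faithful_def
 proof (intro ballI impI)
  fix x assume "x : carrier (G Mod H)" and x1: "dsum (sg1 x) (sg2 x) = 1"
  then obtain g where g: "g : cG" "x = ?\<pi> g" by (auto simp: carrier_FactGroup)
  hence "g : J" "g \<notin> C2" using x1 s2(2) by (auto simp: dsum_eq_1 J_def)
  thus "x = \<one>\<^bsub>G Mod H\<^esub>" using C2 \<pi>1[OF g(1)] g(2) by simp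
 qed
 thus ?thesis using Q.rep_dsum[OF s1(1) s2(1)] by blast
qed

lemma central_imp_normal:
 assumes "central_subgroup H G"
 shows "normal H G"
proof -
 have s: "subgroup H G" and c: "!!h g. h : H ==> g : cG ==> h ** g = g ** h" using assms by (auto simp: central_subgroup_def)
 have "g ** h ** inv g = h" if "h : H" "g : cG" for g h using c[OF that] that subgroup.mem_carrier[OF s that(1)] by (metis inv_closed m_assoc r_inv r_one)
 thus ?thesis using s by (simp add: normal_inv_iff)
qed

theorem faithful_rep_imp_quotient_principal:
 assumes rho: "rep n rho" "faithful rho" and H: "closedin T H" "central_subgroup H G"
  and X: "completely_regular_space X" "Hausdorff_space X" and act: "continuous_action G T X phi"
  and stab: "!!x. x : tsp X ==> stabilizer G phi x = H"
 shows "ltpb (G Mod H) (coset_topology G T H) X (quotient_action phi)"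
proof -
 have nH: "normal H G" by (rule central_imp_normal[OF H(2)])
 have fr: "free_action (G Mod H) X (quotient_action phi)" by (rule compact_action_quotient(2)[OF nH H(1) act]) (rule stab)
 interpret A: compact_action "G Mod H" "coset_topology G T H" X "quotient_action phi" by (rule compact_action_quotient(1)[OF nH H(1) act]) (rule stab)
 obtain m sg where "A.rep m sg" "A.faithful sg" using faithful_rep_quotient[OF rho nH H(1)] by blast
 thus ?thesis using fr X by (intro A.faithful_rep_imp_principal)
qed

end

section \<open>Inverses and derivatives in a Banach algebra\<close>

lemma neumann_inverse:
 fixes a :: "'b::{real_normed_algebra_1,banach}"
 assumes "norm a <= 1/2"
 obtains b where "(1 - a) * b = 1" "b * (1 - a) = 1" "norm b <= 2"
proof -
 have g: "summable (%n. norm a ^ n)" "(%n. norm a ^ n) sums (1 / (1 - norm a))" using assms by (auto intro!: summable_geometric geometric_sums)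
 have s: "summable (%n. a ^ n)" by (rule summable_comparison_test'[OF g(1), of 0]) (simp add: norm_power_ineq)
 define b where "b = (\<Sum>n. a ^ n)"
 have sb: "(%n. a ^ n) sums b" unfolding b_def by (rule summable_sums[OF s])
 have sS: "(%n. a ^ Suc n) sums (b - 1)" using sb sums_Suc_iff[of "%n. a ^ n" "b - 1"] by simp
 have "(%n. a * a ^ n) sums (a * b)" "(%n. a ^ n * a) sums (b * a)" using sb by (auto intro: sums_mult sums_mult2)
 hence "a * b = b - 1" "b * a = b - 1" using sS sums_unique2 by (simp_all add: power_commutes) blast+
 moreover have "norm b <= 1 / (1 - norm a)" by (rule norm_sums_le[OF sb g(2)]) (rule norm_power_ineq)
 moreover have "1 / (1 - norm a) <= 2" using assms by (simp add: field_simps)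
 ultimately show ?thesis by (intro that[of b]) (auto simp: algebra_simps)
qed

text \<open>The uniform bound on the inverse is built in because \<open>Inv_perturb\<close> and the
  continuity estimate for \<open>ainv\<close> consume it.\<close>

definition Inv :: "real => op set" where
 "Inv bet = {a. EX b. a * b = 1 & b * a = 1 & norm b <= bet}"

definition ainv :: "op => op" where
 "ainv a = (SOME b. a * b = 1 & b * a = 1)"

lemma ainv_eqI:
 assumes "a * b = 1" "b * a = 1"
 shows "ainv a = b"
proof -
 have "a * ainv a = 1 & ainv a * a = 1" unfolding ainv_def by (rule someI[of _ b]) (use assms in simp)
 thus ?thesis by (metis assms(2) mult.assoc mult_1_left mult_1_right)
qed

lemma Inv_ainv: "a : Inv bet ==> a * ainv a = 1" "a : Inv bet ==> ainv a * a = 1" "a : Inv bet ==> norm (ainv a) <= bet" using ainv_eqI by (auto simp: Inv_def)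

lemma Inv_perturb:
 assumes a: "a : Inv bet" and d: "norm (a' - a) * bet <= 1/2" "0 <= bet"
 shows "a' : Inv (2 * bet)"
proof -
 let ?b = "ainv a"
 have ab: "a * ?b = 1" "?b * a = 1" "norm ?b <= bet" using Inv_ainv[OF a] by auto
 have "norm (?b * (a - a')) <= norm ?b * norm (a - a')" by (rule norm_mult_ineq)
 also have "... <= bet * norm (a - a')" using ab by (intro mult_right_mono) auto
 finally have "norm (?b * (a - a')) <= 1/2" using d by (simp add: norm_minus_commute mult.commute)
 from neumann_inverse[OF this] obtain c where c: "(1 - ?b * (a - a')) * c = 1" "c * (1 - ?b * (a - a')) = 1" "norm c <= 2" by blast
 have e: "1 - ?b * (a - a') = ?b * a'" using ab by (simp add: right_diff_distrib)
 have "a' * (c * ?b) = a * (?b * a') * (c * ?b)" using ab by (simp add: mult.assoc[symmetric])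
 also have "... = a * ((?b * a') * c) * ?b" by (simp add: mult.assoc)
 also have "... = 1" using c e ab by simp
 finally have "a' * (c * ?b) = 1" .
 moreover have "(c * ?b) * a' = 1" using c e by (simp add: mult.assoc)
 moreover have "norm (c * ?b) <= 2 * bet" using c ab by (intro order_trans[OF norm_mult_ineq] mult_mono) auto
 ultimately show ?thesis unfolding Inv_def by blast
qed

lemma ainv_diff:
 assumes "a : Inv bet" "a' : Inv gam"
 shows "ainv a - ainv a' = ainv a * (a' - a) * ainv a'"
proof -
 have "ainv a * (a' - a) * ainv a' = ainv a * (a' * ainv a') - (ainv a * a) * ainv a'" by (simp add: algebra_simps)
 thus ?thesis using Inv_ainv[OF assms(1)] Inv_ainv[OF assms(2)] by simp
qed

lemma continuous_on_ainv: "cton (Inv bet) ainv"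
proof (rule continuous_on_iff[THEN iffD2], intro ballI allI impI)
 fix a and e :: real assume a: "a : Inv bet" and e: "0 < e"
 have bet: "0 <= bet" using Inv_ainv(3)[OF a] norm_ge_zero order_trans by blast
 define d where "d = e / (bet * bet + 1)"
 have d: "0 < d" using e bet by (simp add: d_def add_nonneg_pos)
 have "dist (ainv x) (ainv a) < e" if x: "x : Inv bet" "dist x a < d" for x
 proof -
  have "norm (ainv x - ainv a) <= norm (ainv x) * norm (a - x) * norm (ainv a)"
   unfolding ainv_diff[OF x(1) a] by (intro order_trans[OF norm_mult_ineq] mult_right_mono norm_mult_ineq) simp
  also have "... <= bet * norm (a - x) * bet" using Inv_ainv(3)[OF a] Inv_ainv(3)[OF x(1)] bet by (intro mult_mono) auto
  also have "... <= (bet * bet + 1) * norm (a - x)" by (simp add: algebra_simps)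
  also have "... < (bet * bet + 1) * d" using x(2) bet by (intro mult_strict_left_mono) (auto simp: dist_norm norm_minus_commute add_nonneg_pos)
  also have "... = e" using bet by (simp add: d_def add_nonneg_eq_0_iff)
  finally show ?thesis by (simp add: dist_norm)
 qed
 thus "EX d>0. ALL x:Inv bet. dist x a < d --> dist (ainv x) (ainv a) < e" using d by blast
qed

lemma continuous_on_ainv_comp: "cton S f ==> (!!x. x : S ==> f x : Inv bet) ==> cton S (%x. ainv (f x))" by (rule continuous_on_compose2[OF continuous_on_ainv]) auto

lemma has_vector_derivative_iff_quotient:
 "(f hvd D) (at t within S) <-> ((%x. (f x - f t) /R (x - t)) ---> D) (at t within S)"
proof -
 have "norm (f x - f t - (x - t) *R D) / norm (x - t) = norm ((f x - f t) /R (x - t) - D)" if "x ~= t" for x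
 proof -
  have "f x - f t - (x - t) *R D = (x - t) *R ((f x - f t) /R (x - t) - D)" using that by (simp add: scaleR_diff_right)
  hence "norm (f x - f t - (x - t) *R D) = abs(x - t) * norm ((f x - f t) /R (x - t) - D)" by (simp only: norm_scaleR)
  thus ?thesis using that by simp
 qed
 hence "((%x. norm (f x - f t - (x - t) *R D) / norm (x - t)) ---> 0) (at t within S) <->
   ((%x. norm ((f x - f t) /R (x - t) - D)) ---> 0) (at t within S)" by (intro tendsto_cong) (auto simp: eventually_at_filter)
 thus ?thesis unfolding has_vector_derivative_def has_derivative_iff_norm tendsto_norm_zero_iff LIM_zero_iff by (simp add: bounded_linear_scaleR_left)
qed

lemma has_vector_derivative_ainv:
 assumes f: "(f hvd f') (at t within S)" and I: "!!x. x : S ==> f x : Inv bet" and t: "t : S"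
 shows "((%x. ainv (f x)) hvd - (ainv (f t) * f' * ainv (f t))) (at t within S)"
proof -
 have quot: "((%x. (f x - f t) /R (x - t)) ---> f') (at t within S)" using f by (simp only: has_vector_derivative_iff_quotient)
 have "continuous (at t within S) f" using f has_vector_derivative_continuous by blast
 hence fl: "(f ---> f t) (at t within S)" by (simp add: continuous_within)
 have al: "((%x. ainv (f x)) ---> ainv (f t)) (at t within S)"
 proof (rule continuous_on_tendsto_compose[OF continuous_on_ainv fl I[OF t]])
  show "\<forall>\<^sub>F x in at t within S. f x : Inv bet" using I by (auto simp: eventually_at_filter)
 qed
 have "((%x. - (ainv (f x) * ((f x - f t) /R (x - t)) * ainv (f t))) ---> - (ainv (f t) * f' * ainv (f t))) (at t within S)" by (intro tendsto_intros al quot)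
 moreover have "\<forall>\<^sub>F x in at t within S. - (ainv (f x) * ((f x - f t) /R (x - t)) * ainv (f t)) = (ainv (f x) - ainv (f t)) /R (x - t)"
 proof -
  have "- (ainv (f x) * ((f x - f t) /R (x - t)) * ainv (f t)) = (ainv (f x) - ainv (f t)) /R (x - t)" if "x : S" for x
   unfolding ainv_diff[OF I[OF that] I[OF t]] by (simp add: algebra_simps)
  thus ?thesis by (auto simp: eventually_at_filter)
 qed
 ultimately have "((%x. (ainv (f x) - ainv (f t)) /R (x - t)) ---> - (ainv (f t) * f' * ainv (f t))) (at t within S)" by (rule Lim_transform_eventually)
 thus ?thesis by (simp only: has_vector_derivative_iff_quotient)
qed

section \<open>Differentiation under the mean\<close>

context compact_group
begin

text \<open>Near \<open>t\<close> the derivatives are close to \<open>w' t\<close> uniformly in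
  \<open>x\<close> by compactness; the mean value inequality carries this over to the increments of
  \<open>w\<close>, to which the mean is applied.\<close>

lemma mean_derivative:
 fixes w :: "real => 'a => real"
 assumes t: "t : {a..b}"
  and w: "!!t. t : {a..b} ==> cont (w t)"
  and d: "!!t x. t : {a..b} ==> x : cG ==> ((%t. w t x) has_real_derivative w' t x) (at t within {a..b})"
  and c: "ctm (ptop T (top_of_set {a..b})) euclideanreal (%z. w' (snd z) (fst z))"
 shows "((%t. mean (w t)) has_real_derivative mean (w' t)) (at t within {a..b})" unfolding has_field_derivative_def has_derivative_within_alt
proof (intro conjI allI impI)
 show "bounded_linear ((*) (mean (w' t)))" by (rule bounded_linear_mult_right)
 fix e :: real assume e: "0 < e"
 have w'c: "cont (w' s)" if "s : {a..b}" for s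
 proof -
  have "ctm T (ptop T (top_of_set {a..b})) (%x. (x, s))" using that by (simp add: continuous_map_paired continuous_map_id_T)
  from ctm_o[OF this c] show ?thesis by (simp add: o_def)
 qed
 have tt: "t : tsp (top_of_set {a..b})" using t by simp
 obtain V where V: "openin (top_of_set {a..b}) V" "t : V" "!!x v. x : cG ==> v : V ==> dist (w' v x) (w' t x) < e" using compact_uniform[OF compact c tt e] by auto
 obtain r where r: "0 < r" "ball t r Int {a..b} <= V" using bspec[OF conjunct2[OF V(1)[unfolded openin_contains_ball]] V(2)] by (elim exE conjE) (rule that)
 have "norm (mean (w y) - mean (w t) - mean (w' t) * (y - t)) <= e * norm (y - t)" if y: "y : {a..b}" "norm (y - t) < r" for y
 proof -
  have pt: "abs(w y x - w t x - (y - t) * w' t x) <= e * abs(y - t)" if x: "x : cG" for x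
  proof -
   let ?S = "closed_segment t y"
   have S: "?S <= {a..b}" "?S <= ball t r"
    using t y convex_contains_segment[of "{a..b}"] convex_contains_segment[of "ball t r"] r(1) by (auto simp: dist_norm norm_minus_commute)
   have "norm ((%s. w s x - s * w' t x) y - (%s. w s x - s * w' t x) t) <= e * norm (y - t)"
   proof (rule field_differentiable_bound[of ?S])
    fix s assume s: "s : ?S"
    thus "((%s. w s x - s * w' t x) has_field_derivative w' s x - w' t x) (at s within ?S)" using S(1) by (auto intro!: derivative_eq_intros DERIV_subset[OF d[OF _ x]])
    have "dist (w' s x) (w' t x) < e" using V(3)[OF x, of s] r(2) S s by blast
    thus "norm (w' s x - w' t x) <= e" by (simp add: dist_norm)
   qed auto
   thus ?thesis by (simp add: algebra_simps)
  qed
  have c1: "cont (%x. w y x - w t x - (y - t) * w' t x)" by (intro continuous_map_diff w y t cont_scale w'c)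
  have "mean (%x. w y x - w t x - (y - t) * w' t x) = mean (w y) - mean (w t) - (y - t) * mean (w' t)"
   using mean_diff[OF continuous_map_diff[OF w[OF y(1)] w[OF t]] cont_scale[OF w'c[OF t]]] mean_diff[OF w[OF y(1)] w[OF t]]
    mean_scale[OF w'c[OF t]] by simp
  moreover have "abs(mean (%x. w y x - w t x - (y - t) * w' t x)) <= e * abs(y - t)" by (rule mean_abs_le[OF c1 pt])
  ultimately show ?thesis by (simp add: mult.commute)
 qed
 thus "EX d>0. ALL y:{a..b}. norm (y - t) < d --> norm (mean (w y) - mean (w t) - mean (w' t) * (y - t)) <= e * norm (y - t)" using r(1) by blast
qed

end

text \<open>Derivatives along the left invariant vector fields of a matrix group \<open>K\<close>.\<close>

definition rd :: "op set => (op => 'v::real_normed_vector) => op => (op => 'v) => bool" where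
 "rd K u Y u' <-> cton K u & cton K u' &
  (ALL x:K. ((%t. u (x * exp (t *R Y))) hvd u' x) (at 0))"

lemma exp_shift_derivative: "((%t. x * exp (t *R Y)) hvd x * (Y::op)) (at 0)"
 using has_vector_derivative_mult_right[OF exp_scaleR_has_vector_derivative_right[of Y 0 UNIV], of x] by simp

lemma rd_const: "rd K (%_. c) Y (%_. 0)" by (simp add: rd_def)

lemma rd_linear:
 assumes "bounded_linear L" "rd K u Y u'"
 shows "rd K (%x. L (u x)) Y (%x. L (u' x))" using assms by (auto simp: rd_def intro: bounded_linear.has_vector_derivative bounded_linear.continuous_on)

lemma rd_id: "rd K (%x. x) Y (%x. x * Y)" unfolding rd_def by (auto intro!: continuous_intros exp_shift_derivative)

lemma rd_add: "rd K u Y u' ==> rd K v Y v' ==> rd K (%x. u x + v x) Y (%x. u' x + v' x)" unfolding rd_def by (auto intro!: continuous_intros has_vector_derivative_add)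

lemma rd_sum: "(!!i. i : I ==> rd K (u i) Y (u' i)) ==> rd K (%x. \<Sum>i\<in>I. u i x) Y (%x. \<Sum>i\<in>I. u' i x)"
 unfolding rd_def by (auto intro!: continuous_intros has_vector_derivative_sum)

lemma rd_mult:
 fixes u v :: "op => 'v::real_normed_algebra"
 shows "rd K u Y u' ==> rd K v Y v' ==> rd K (%x. u x * v x) Y (%x. u x * v' x + u' x * v x)" unfolding rd_def
proof (intro conjI ballI)
 fix x assume a: "cton K u & cton K u' & (ALL x:K. ((%t. u (x * exp (t *R Y))) hvd u' x) (at 0))"
  "cton K v & cton K v' & (ALL x:K. ((%t. v (x * exp (t *R Y))) hvd v' x) (at 0))" "x : K"
 thus "((%t. u (x * exp (t *R Y)) * v (x * exp (t *R Y))) hvd u x * v' x + u' x * v x) (at 0)"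
  using has_vector_derivative_mult[of "%t. u (x * exp (t *R Y))" "u' x" 0 UNIV "%t. v (x * exp (t *R Y))" "v' x"] by simp
qed (auto intro!: continuous_intros)

lemma rd_ainv:
 assumes u: "rd K u Y u'" and I: "!!x. x : K ==> u x : Inv bet" and Y: "!!x t. x : K ==> x * exp (t *R Y) : K"
 shows "rd K (%x. ainv (u x)) Y (%x. - (ainv (u x) * u' x * ainv (u x)))" unfolding rd_def
proof (intro conjI ballI)
 have c: "cton K (%x. ainv (u x))" using u I by (intro continuous_on_ainv_comp) (auto simp: rd_def)
 show "cton K (%x. ainv (u x))" by (rule c)
 show "cton K (%x. - (ainv (u x) * u' x * ainv (u x)))" using u by (intro continuous_intros c) (simp add: rd_def)
 fix x assume x: "x : K"
 have "((%t. u (x * exp (t *R Y))) hvd u' x) (at 0 within UNIV)" using u x by (simp add: rd_def)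
 from has_vector_derivative_ainv[OF this, of bet] I Y[OF x]
 show "((%t. ainv (u (x * exp (t *R Y)))) hvd - (ainv (u x) * u' x * ainv (u x))) (at 0)" by simp
qed

context compact_group
begin

text \<open>The divergence theorem in this setting: \<open>exp (t *R Y)\<close> is the image of a
  group element, so right translation by it leaves the mean of \<open>u\<close> unchanged, and the
  derivative at 0 has mean 0.\<close>

lemma mean_rd_zero:
 assumes rho: "rep n rho" and Y: "Y : Lie (rho ` cG)" and u: "rd (rho ` cG) u Y u'"
 shows "mean (%g. u' (rho g)) = (0::real)"
proof -
 let ?K = "rho ` cG"
 have rhoc: "ctm T (subtop euclidean ?K) rho" using rho by (auto simp: rep_def ctm_into)
 have uc: "ctm (subtop euclidean ?K) euclidean u" "ctm (subtop euclidean ?K) euclidean u'" using u by (auto simp: rd_def)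
 have KY: "x * exp (t *R Y) : ?K" if "x : ?K" for x t using cmg_mult[OF cmg_rep[OF rho] that LieD[OF Y]] .
 have cc: "ctm (ptop T (top_of_set {-1..1::real})) euclideanreal (%z. v (rho (fst z) * exp (snd z *R Y)))"
  if v: "ctm (subtop euclidean ?K) euclidean v" for v
 proof -
  have "ctm (ptop T (top_of_set {-1..1::real})) (subtop euclidean ?K) (%z. rho (fst z) * exp (snd z *R Y))" unfolding ctm_into
  proof
   have "ctm (ptop T (top_of_set {-1..1::real})) euclidean (%z. rho (fst z))"
    "ctm (ptop T (top_of_set {-1..1::real})) euclidean snd" using ctm_o[OF continuous_map_fst rhoc] continuous_map_snd[of T "top_of_set {-1..1::real}"]
    by (auto simp: o_def ctm_into)
   thus "ctm (ptop T (top_of_set {-1..1::real})) euclidean (%z. rho (fst z) * exp (snd z *R Y))"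
    by (rule continuous_map_binop[of _ _ _ "%a t. a * exp (t *R Y)"]) (intro continuous_intros)
  qed (use KY in auto)
  from ctm_o[OF this v] show ?thesis by (simp add: o_def)
 qed
 define w where "w t g = u (rho g * exp (t *R Y))" for t g
 define w' where "w' t g = u' (rho g * exp (t *R Y))" for t g
 have wc: "cont (w t)" if "t : {-1..1}" for t
 proof -
  have "ctm T (ptop T (top_of_set {-1..1::real})) (%x. (x, t))" using that by (simp add: continuous_map_paired continuous_map_id_T)
  from ctm_o[OF this cc[OF uc(1)]] show ?thesis by (simp add: o_def w_def[abs_def])
 qed
 have "((%t. mean (w t)) has_real_derivative mean (w' 0)) (at 0 within {-1..1})"
 proof (rule mean_derivative[OF _ wc])
  show "ctm (ptop T (top_of_set {-1..1})) euclideanreal (%z. w' (snd z) (fst z))" unfolding w'_def by (rule cc[OF uc(2)])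
  fix t :: real and g assume "t : {-1..1}" and g: "g : cG"
  have "((%s. u (rho g * exp (t *R Y) * exp (s *R Y))) hvd u' (rho g * exp (t *R Y))) (at 0)"
  proof -
   have "rho g * exp (t *R Y) : ?K" using KY g by blast
   thus ?thesis using u unfolding rd_def by blast
  qed
  hence "((%s. w (t + s) g) has_real_derivative w' t g) (at 0)" by (simp add: has_real_derivative_iff_has_vector_derivative w_def w'_def exp_scaleR_add mult.assoc)
  hence "((%s. w s g) has_real_derivative w' t g) (at t)" using DERIV_shift[of "%s. w s g" "w' t g" 0 t] by (simp add: add.commute)
  thus "((%s. w s g) has_real_derivative w' t g) (at t within {-1..1})" by (rule DERIV_subset) simp
 qed auto
 moreover have "mean (w t) = mean (w 0)" for t
 proof -
  obtain y where y: "y : cG" "rho y = exp (t *R Y)" using LieD[OF Y, of t] by force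
  have "mean (w t) = mean (%g. (w 0) (g ** y))" by (rule mean_cong) (use y rho in "simp add: w_def rep_def")
  also have "... = mean (w 0)" by (rule mean_right[OF wc y(1)]) simp
  finally show ?thesis .
 qed
 hence "(%t. mean (w t)) = (%t. mean (w 0))" by (rule ext)
 ultimately have "((%t. mean (w 0)) has_real_derivative mean (w' 0)) (at (0::real) within {-1..1})" by simp
 moreover have "((%t. mean (w 0)) has_real_derivative 0) (at (0::real) within {-1..1})" by simp
 moreover have "at (0::real) within {-1..1} = at 0" by (rule at_within_interior) simp
 ultimately have "mean (w' 0) = 0" using DERIV_unique by metis
 thus ?thesis by (simp add: w'_def[abs_def])
qed

end

section \<open>Orthonormal bases of Lie algebras and polynomial approximation\<close>

lemma fip_E: "p < n ==> q < n ==> fip n A (E p q) = entry A p q"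
proof -
 assume pq: "p < n" "q < n"
 have "fip n A (E p q) = (\<Sum>i<n. \<Sum>j<n. if j = q then (if i = p then entry A p q else 0) else 0)"
  unfolding fip_alt by (intro sum.cong refl) (auto simp: entry_E)
 thus ?thesis using pq by simp
qed

lemma fip_sum_left: "fip n (\<Sum>i\<in>I. f i) A = (\<Sum>i\<in>I. fip n (f i) A)" unfolding fip_def by (simp add: sum_distrib_right) (rule sum.swap)

lemma fip_eq_0: "A : Mat n ==> fip n A A = 0 ==> A = 0"
proof -
 assume A: "A : Mat n" "fip n A A = 0"
 obtain M where "0 < M" "!!A. A : Mat n ==> (norm A)\<^sup>2 <= M * fip n A A" using norm_le_fip[of n] by blast
 from this(2)[OF A(1)] A(2) show "A = 0" by simp
qed

lemma orthonormal_basis_exists: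
 assumes L: "subspace L" "L <= Mat n"
 obtains d :: nat and Y :: "nat => op" where "!!i. i < d ==> Y i : L" "!!i j. i < d ==> j < d ==> fip n (Y i) (Y j) = (if i = j then 1 else 0)"
  "!!X. X : L ==> X = (\<Sum>i<d. fip n X (Y i) *R Y i)"
proof -
 define ON where "ON d Y <-> (ALL i<d. Y i : L) & (ALL i<d. ALL j<d. fip n (Y i) (Y j) = (if i = j then 1 else 0))" for d and Y :: "nat => op"
 define R where "R d Y X = X - (\<Sum>i<d. fip n X (Y i) *R Y i)" for d and Y :: "nat => op" and X
 have orth: "fip n (R d Y X) (Y j) = 0" if Y: "ON d Y" "j < d" for d Y X j
 proof -
  have "fip n (\<Sum>i<d. fip n X (Y i) *R Y i) (Y j) = (\<Sum>i<d. if i = j then fip n X (Y j) else 0)"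
   unfolding fip_sum_left by (intro sum.cong refl) (use Y in "auto simp: ON_def fip_simps")
  thus ?thesis using Y by (simp add: R_def fip_simps)
 qed
 have RR: "fip n (R d Y X) (R d Y X) = fip n X X - (\<Sum>i<d. (fip n X (Y i))\<^sup>2)" if Y: "ON d Y" for d Y X
 proof -
  have "fip n (\<Sum>i<d. fip n X (Y i) *R Y i) (R d Y X) = 0"
   unfolding fip_sum_left by (intro sum.neutral) (use orth[OF Y] in \<open>auto simp: fip_simps fip_commute[of n _ "R d Y X"]\<close>)
  hence "fip n (R d Y X) (R d Y X) = fip n (R d Y X) X"
   using fip_simps(2)[of n X "\<Sum>i<d. fip n X (Y i) *R Y i" "R d Y X"] by (simp add: R_def[symmetric] fip_commute)
  also have "... = fip n X X - (\<Sum>i<d. (fip n X (Y i))\<^sup>2)"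
  proof -
   have "fip n (Y i) X = fip n X (Y i)" for i by (rule fip_commute)
   thus ?thesis unfolding R_def fip_simps(2) fip_sum_left by (simp add: fip_simps power2_eq_square)
  qed
  finally show ?thesis .
 qed
 \<comment> \<open>Bessel's inequality for each matrix unit, summed over all \<open>n * n\<close> of
   them, bounds the sum \<open>d\<close> of the square norms of an orthonormal system.\<close>
 have bound: "d <= n * n" if Y: "ON d Y" for d Y
 proof -
  have "(\<Sum>i<d. (entry (Y i) p q)\<^sup>2) <= 1" if pq: "p < n" "q < n" for p q
   using fip_nonneg[of n "R d Y (E p q)"] RR[OF Y, of "E p q"] fip_E[OF pq] fip_commute[of n "E p q"] by (simp add: entry_E)
  hence "(\<Sum>p<n. \<Sum>q<n. \<Sum>i<d. (entry (Y i) p q)\<^sup>2) <= (\<Sum>p<n. \<Sum>q<n. 1)" by (intro sum_mono) auto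
  moreover have "(\<Sum>p<n. \<Sum>q<n. \<Sum>i<d. (entry (Y i) p q)\<^sup>2) = (\<Sum>i<d. fip n (Y i) (Y i))"
   unfolding fip_alt power2_eq_square by (simp add: sum.swap[of _ "{..<d}"])
  moreover have "(\<Sum>i<d. fip n (Y i) (Y i)) = real d" using Y by (simp add: ON_def)
  ultimately have "real d <= real (n * n)" by simp
  thus ?thesis by linarith
 qed
 have "EX d. (EX Y. ON d Y) & \<not> (EX Y. ON (Suc d) Y)"
 proof (rule ccontr)
  assume neg: "\<not> ?thesis"
  have "EX Y. ON d Y" for d
  proof (induction d)
   case 0
   show ?case by (simp add: ON_def)
  qed (use neg in blast)
  thus False using bound[of "Suc (n * n)"] by force
 qed
 then obtain d Y where Y: "ON d Y" and mx: "\<not> (EX Y. ON (Suc d) Y)" by blast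
 have "X = (\<Sum>i<d. fip n X (Y i) *R Y i)" if X: "X : L" for X
 proof (rule ccontr)
  assume ne: "X ~= (\<Sum>i<d. fip n X (Y i) *R Y i)"
  let ?R = "R d Y X"
  have RL: "?R : L" unfolding R_def by (intro subspace_diff L(1) X subspace_sum subspace_scale) (use Y in "auto simp: ON_def")
  have N: "0 < fip n ?R ?R" using ne fip_eq_0[of ?R n] RL L(2) fip_nonneg[of n ?R] by (cases "fip n ?R ?R = 0") (auto simp: R_def)
  define t where "t = 1 / sqrt (fip n ?R ?R)"
  have tt: "t * (t * fip n ?R ?R) = 1" using N by (simp add: t_def)
  have "fip n (t *R ?R) (Y j) = 0" "fip n (Y j) (t *R ?R) = 0" if "j < d" for j using orth[OF Y that, of X] fip_commute[of n "Y j" ?R] by (simp_all add: fip_simps)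
  moreover have "fip n (t *R ?R) (t *R ?R) = 1" using tt by (simp add: fip_simps)
  moreover have "t *R ?R : L" by (rule subspace_scale[OF L(1) RL])
  ultimately have "ON (Suc d) (Y(d := t *R ?R))" using Y by (auto simp: ON_def less_Suc_eq)
  thus False using mx by blast
 qed
 thus ?thesis using that[of d Y] Y by (auto simp: ON_def)
qed

lemma fip_skew:
 assumes "A : Mat n" "!!i j. entry B j i = - entry B i j"
 shows "fip n A B = - tr n (A * B)"
proof -
 have "entry A i j * entry B i j = - (entry A i j * entry B j i)" for i j using assms(2)[of i j] by simp
 thus ?thesis unfolding fip_alt tr_def using assms(1) by (simp add: entry_mult[of A n B] sum_negf)
qed

text \<open>The basis is orthonormal for \<open>fip\<close>, which on skew matrices is minus the
  trace form. Cyclicity of the trace then makes the structure constants antisymmetric in all three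
  indices.\<close>

lemma Lie_basis:
 assumes K: "cmg n K"
 obtains d :: nat and Y :: "nat => op" and c :: "nat => nat => nat => real" where "!!i. i < d ==> Y i : Lie K"
  "!!X. X : Lie K ==> X = (\<Sum>i<d. fip n X (Y i) *R Y i)"
  "!!i j. i < d ==> j < d ==> Y i * Y j - Y j * Y i = (\<Sum>k<d. c i j k *R Y k)"
  "!!i j k. c j i k = - c i j k" "!!i j k. i < d ==> j < d ==> k < d ==> c i k j = - c i j k"
proof -
 have LM: "Lie K <= Mat n" using Lie_Mat[OF K] by blast
 obtain d :: nat and Y where Y0: "!!i. i < d ==> Y i : Lie K" "!!i j. i < d ==> j < d ==> fip n (Y i) (Y j) = (if i = j then 1 else 0)"
  "!!X. X : Lie K ==> X = (\<Sum>i<d. fip n X (Y i) *R Y i)" using orthonormal_basis_exists[OF subspace_Lie[OF K] LM] by blast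
 note Y = Y0(1,3)
 define c where "c i j k = fip n (Y i * Y j - Y j * Y i) (Y k)" for i j k
 have "c i k j = - c i j k" if ijk: "i < d" "j < d" "k < d" for i j k
 proof -
  note M = Lie_Mat[OF K Y(1)] Lie_Mat[OF K Lie_bracket[OF K Y(1) Y(1)]]
  have e: "c i j k = - tr n ((Y i * Y j - Y j * Y i) * Y k)" if "i < d" "j < d" "k < d" for i j k
   unfolding c_def by (rule fip_skew[OF M(2)[OF that(1,2)]]) (rule Lie_skew[OF K Y(1)[OF that(3)]])
  have "tr n (Y k * Y i * Y j) = tr n (Y i * Y j * Y k)" "tr n (Y j * Y i * Y k) = tr n (Y i * Y k * Y j)"
   using tr_commute[OF M(1)[OF ijk(3)], of "Y i * Y j"] tr_commute[OF M(1)[OF ijk(2)], of "Y i * Y k"] by (simp_all add: mult.assoc)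
  thus ?thesis using e[OF ijk] e[OF ijk(1,3,2)] by (simp add: left_diff_distrib)
 qed
 moreover have "c j i k = - c i j k" for i j k unfolding c_def using fip_simps(4)[of n "Y i * Y j - Y j * Y i" "Y k"] by simp
 moreover have "Y i * Y j - Y j * Y i = (\<Sum>k<d. c i j k *R Y k)" if "i < d" "j < d" for i j
  unfolding c_def by (rule Y(2)[OF Lie_bracket[OF K Y(1) Y(1)]]) (use that in auto)
 ultimately show ?thesis using that[of d Y c] Y by blast
qed

text \<open>Derivatives are carried as explicit functions: \<open>u1 i\<close> along
  \<open>Y i\<close>, and \<open>u2 i j\<close> along \<open>Y i\<close> of \<open>u1 j\<close>. The
  commutation rule in the last clause is part of the notion; it holds for the coordinates and
  survives sums, products and linear maps.\<close>

definition C2 :: "op set => nat => (nat => op) => (nat => nat => nat => real) => (op => 'v::real_normed_vector) =>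
  (nat => op => 'v) => (nat => nat => op => 'v) => bool" where
 "C2 K d Y c u u1 u2 <-> cton K u & (ALL i<d. rd K u (Y i) (u1 i)) & (ALL i<d. ALL j<d. rd K (u1 j) (Y i) (u2 i j)) &
  (ALL i<d. ALL j<d. ALL x:K. u2 i j x - u2 j i x = (\<Sum>k<d. c i j k *R u1 k x))"

lemma C2_const: "C2 K d Y c (%_. a) (%_ _. 0) (%_ _ _. 0)" by (simp add: C2_def rd_const)

lemma C2_add: "C2 K d Y c u u1 u2 ==> C2 K d Y c v v1 v2 ==>
  C2 K d Y c (%x. u x + v x) (%i x. u1 i x + v1 i x) (%i j x. u2 i j x + v2 i j x)"
 unfolding C2_def by (auto intro!: rd_add continuous_intros simp: scaleR_add_right sum.distrib add_diff_add)

lemma C2_linear: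
 assumes L: "bounded_linear L" and u: "C2 K d Y c u u1 u2"
 shows "C2 K d Y c (%x. L (u x)) (%i x. L (u1 i x)) (%i j x. L (u2 i j x))"
proof -
 interpret L: bounded_linear L by (rule L)
 have "L (u2 i j x) - L (u2 j i x) = (\<Sum>k<d. c i j k *R L (u1 k x))" if "i < d" "j < d" "x : K" for i j x
 proof -
  have "u2 i j x - u2 j i x = (\<Sum>k<d. c i j k *R u1 k x)" using u that by (simp add: C2_def)
  from arg_cong[OF this, of L] show ?thesis by (simp add: L.diff L.sum L.scaleR)
 qed
 moreover have "cton K (%x. L (u x))" using u by (intro L.continuous_on) (simp add: C2_def)
 ultimately show ?thesis using u unfolding C2_def by (simp add: rd_linear[OF L])
qed

lemma C2_mult:
 fixes u v :: "op => real"
 assumes u: "C2 K d Y c u u1 u2" and v: "C2 K d Y c v v1 v2"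
 shows "C2 K d Y c (%x. u x * v x) (%i x. u x * v1 i x + u1 i x * v x)
  (%i j x. (u x * v2 i j x + u1 i x * v1 j x) + (u1 j x * v1 i x + u2 i j x * v x))"
proof -
 have "(\<Sum>k<d. c i j k *R (u x * v1 k x + u1 k x * v x)) = u x * (\<Sum>k<d. c i j k *R v1 k x) + (\<Sum>k<d. c i j k *R u1 k x) * v x" for i j x
  by (simp add: distrib_left sum.distrib sum_distrib_left sum_distrib_right mult_ac)
 moreover have "u2 i j x - u2 j i x = (\<Sum>k<d. c i j k *R u1 k x)" "v2 i j x - v2 j i x = (\<Sum>k<d. c i j k *R v1 k x)"
  if "i < d" "j < d" "x : K" for i j x using u v that by (auto simp: C2_def)
 moreover have "(u x * v2 i j x + u1 i x * v1 j x) + (u1 j x * v1 i x + u2 i j x * v x) -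
   ((u x * v2 j i x + u1 j x * v1 i x) + (u1 i x * v1 j x + u2 j i x * v x)) =
   u x * (v2 i j x - v2 j i x) + (u2 i j x - u2 j i x) * v x" for i j x by (simp add: algebra_simps)
 ultimately have "(u x * v2 i j x + u1 i x * v1 j x) + (u1 j x * v1 i x + u2 i j x * v x) -
   ((u x * v2 j i x + u1 j x * v1 i x) + (u1 i x * v1 j x + u2 j i x * v x)) =
   (\<Sum>k<d. c i j k *R (u x * v1 k x + u1 k x * v x))" if "i < d" "j < d" "x : K" for i j x using that by simp
 thus ?thesis using u v unfolding C2_def by (auto intro!: rd_add rd_mult continuous_intros)
qed

lemma C2_id:
 assumes "!!i j. i < d ==> j < d ==> Y i * Y j - Y j * Y i = (\<Sum>k<d. c i j k *R Y k)"
 shows "C2 K d Y c (%x. x) (%i x. x * Y i) (%i j x. x * Y i * Y j)"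
proof -
 have "x * Y i * Y j - x * Y j * Y i = (\<Sum>k<d. c i j k *R (x * Y k))" if "i < d" "j < d" for i j x
 proof -
  have "x * Y i * Y j - x * Y j * Y i = x * (Y i * Y j - Y j * Y i)" by (simp add: right_diff_distrib mult.assoc)
  thus ?thesis unfolding assms[OF that] by (simp add: sum_distrib_left)
 qed
 thus ?thesis unfolding C2_def by (auto intro!: rd_id rd_linear[OF bounded_linear_mult_left] continuous_intros)
qed

lemma C2_sum:
 assumes "finite I" "!!i. i : I ==> EX u1 u2. C2 K d Y c (u i) u1 u2"
 shows "EX u1 u2. C2 K d Y c (%x. \<Sum>i\<in>I. u i x) u1 u2" using assms
proof induction
 case empty
 show ?case using C2_const[of K d Y c 0] by auto
next
 case (insert i I)
 then obtain u1 u2 v1 v2 where "C2 K d Y c (u i) u1 u2" "C2 K d Y c (%x. \<Sum>i\<in>I. u i x) v1 v2" by (metis insertCI)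
 from C2_add[OF this] show ?case using insert by auto
qed

context compact_group
begin

text \<open>Interpolation between finitely many values, followed by the Stone--Weierstrass theorem.\<close>

lemma polynomial_approximation_real:
 assumes rho: "rep n rho" and br: "!!i j. i < d ==> j < d ==> Y i * Y j - Y j * Y i = (\<Sum>k<d. c i j k *R Y k)"
  and h: "cont h" and e: "0 < e"
  and ker: "!!g v. g : cG ==> v : cG ==> rho v = 1 ==> abs(h (g ** v) - h g) < e"
 shows "EX u u1 u2. C2 (rho ` cG) d Y c u u1 u2 & (ALL g:cG. abs(u (rho g) - h g) < 2 * e)"
proof -
 let ?K = "rho ` cG"
 have K: "cmg n ?K" by (rule cmg_rep[OF rho])
 have Kc: "compact ?K" using K by (simp add: cmg_def)
 have rhoc: "ctm T euclidean rho" using rho by (simp add: rep_def)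
 \<comment> \<open>By \<open>ker\<close>, \<open>h\<close> varies by less than \<open>e\<close> on
   fibres of \<open>rho\<close>. Compactness of the set of pairs where it varies by at least
   \<open>e\<close> turns this into a modulus in terms of
   \<open>norm (rho g - rho g')\<close>.\<close>
 have near: "EX dlt>0. ALL g:cG. \<forall>g'\<in>cG. norm (rho g - rho g') < dlt --> abs(h g - h g') < e"
 proof -
  let ?P = "ptop T T"
  let ?B = "{z : tsp ?P. abs(h (fst z) - h (snd z)) : {e..}}"
  have hc: "ctm ?P euclideanreal (%z. abs(h (fst z) - h (snd z)))"
   by (intro continuous_map_real_abs continuous_map_diff continuous_map_pre[OF h] continuous_map_fst continuous_map_snd)
  have "closedin ?P ?B" by (rule closedin_continuous_map_preimage[OF hc]) (simp add: closed_closedin[symmetric])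
  moreover have "compact_space ?P" using compact by (simp add: compact_space_prod_topology)
  ultimately have "compactin ?P ?B" by (intro closedin_compact_space)
  moreover have dc: "ctm ?P euclideanreal (%z. norm (rho (fst z) - rho (snd z)))"
   by (intro continuous_map_norm continuous_map_diff continuous_map_pre[OF rhoc] continuous_map_fst continuous_map_snd)
  ultimately have "compact ((%z. norm (rho (fst z) - rho (snd z))) ` ?B)" using image_compactin by fastforce
  moreover have "0 \<notin> (%z. norm (rho (fst z) - rho (snd z))) ` ?B"
  proof
   assume "0 : (%z. norm (rho (fst z) - rho (snd z))) ` ?B"
   then obtain x y where xy: "x : cG" "y : cG" "rho x = rho y" "e <= abs(h x - h y)" by auto
   have "rho (inv y ** x) = 1" using rho xy rep_inverse[OF rho xy(2)] by (simp add: rep_def)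
   hence "abs(h (y ** (inv y ** x)) - h y) < e" using ker[of y "inv y ** x"] xy by simp
   thus False using xy by (simp add: m_assoc[symmetric])
  qed
  ultimately have "EX dlt>0. ALL t:(%z. norm (rho (fst z) - rho (snd z))) ` ?B. dlt <= dist 0 t" by (intro separate_point_closed compact_imp_closed)
  then obtain dlt where dlt: "0 < dlt" "!!z. z : ?B ==> dlt <= norm (rho (fst z) - rho (snd z))" by auto
  have "abs(h g - h g') < e" if "g : cG" "g' : cG" "norm (rho g - rho g') < dlt" for g g' using dlt(2)[of "(g, g')"] that by force
  thus ?thesis using dlt(1) by blast
 qed
 then obtain dlt where dlt: "0 < dlt" "!!g g'. g : cG ==> g' : cG ==> norm (rho g - rho g') < dlt ==> abs(h g - h g') < e" by blast
 have "?K <= \<Union> ((%g. ball (rho g) dlt) ` cG)" using dlt(1) by auto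
 from compactE_image[OF Kc _ this] obtain Z where Z: "Z <= cG" "finite Z" "?K <= (\<Union>z\<in>Z. ball (rho z) dlt)" by auto
 \<comment> \<open>Tent functions around the points of a finite net. Their normalised combination
   \<open>F\<close> is continuous on the matrix group and within \<open>e\<close> of
   \<open>h\<close>, so it can be approximated further by polynomials.\<close>
 define w where "w z x = max 0 (dlt - norm (x - rho z))" for z x
 define W where "W x = (\<Sum>z\<in>Z. w z x)" for x
 have wc: "cton ?K (w z)" for z unfolding w_def by (intro continuous_intros)
 have Wc: "cton ?K W" unfolding W_def by (intro continuous_intros wc)
 have w0: "0 <= w z x" for z x by (simp add: w_def)
 have Wp: "0 < W x" if x: "x : ?K" for x
 proof -
  obtain z where "z : Z" "dist (rho z) x < dlt" using Z(3) x by auto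
  thus ?thesis unfolding W_def using Z(2) w0 by (intro sum_pos2[of _ z]) (auto simp: w_def dist_norm norm_minus_commute)
 qed
 define F where "F x = (\<Sum>z\<in>Z. w z x * h z) / W x" for x
 have Fc: "cton ?K F" unfolding F_def using Wp by (intro continuous_intros wc Wc) force
 have Fh: "abs(F (rho g) - h g) <= e" if g: "g : cG" for g
 proof -
  have W: "0 < W (rho g)" using Wp g by auto
  have "F (rho g) - h g = (\<Sum>z\<in>Z. w z (rho g) * (h z - h g)) / W (rho g)"
   using W by (simp add: F_def right_diff_distrib sum_subtractf diff_divide_distrib sum_distrib_right[symmetric] W_def[symmetric])
  also have "abs(...) <= (\<Sum>z\<in>Z. w z (rho g) * e) / W (rho g)" unfolding abs_divide abs_of_pos[OF W]
  proof (intro divide_right_mono order_trans[OF sum_abs] sum_mono)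
   fix z assume z: "z : Z"
   show "abs(w z (rho g) * (h z - h g)) <= w z (rho g) * e"
   proof (cases "norm (rho g - rho z) < dlt")
    case True
    hence "abs(h z - h g) <= e" using dlt(2)[of z g] z Z g by (force simp: norm_minus_commute)
    thus ?thesis using w0 by (simp add: abs_mult mult_left_mono)
   qed (simp add: w_def)
  qed (use W in simp)
  also have "... = e" using W by (simp add: sum_distrib_right[symmetric] W_def[symmetric])
  finally show ?thesis .
 qed
 define R where "R = {u :: op => real. EX u1 u2. C2 ?K d Y c u u1 u2}"
 interpret SW: function_ring_on R ?K
 proof
  show "compact ?K" by (rule Kc)
  show "cton ?K f" if "f : R" for f using that by (auto simp: R_def C2_def)
  show "(%x. f x + g x) : R" "(%x. f x * g x) : R" if fg: "f : R" "g : R" for f g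
  proof -
   obtain u1 u2 v1 v2 where "C2 ?K d Y c f u1 u2" "C2 ?K d Y c g v1 v2" using fg by (auto simp: R_def)
   from C2_add[OF this] C2_mult[OF this] show "(%x. f x + g x) : R" "(%x. f x * g x) : R" unfolding R_def by (simp, blast)+
  qed
  show "(%_. c) : R" for c using C2_const unfolding R_def by blast
  show "EX f:R. f x ~= f y" if xy: "x : ?K" "y : ?K" "x ~= y" for x y
  proof -
   have "EX i j. entry x i j ~= entry y i j"
   proof (rule ccontr)
    assume "\<not> ?thesis"
    hence "x - 1 = y - 1" by (intro Mat_eqI[OF cmg_Mat[OF K xy(1)] cmg_Mat[OF K xy(2)]]) simp
    thus False using xy(3) by simp
   qed
   then obtain i j where ij: "entry x i j ~= entry y i j" by blast
   have "(%x. entry x i j) : R" unfolding R_def using C2_linear[OF bounded_linear_entry C2_id[OF br]] by blast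
   thus ?thesis by (rule bexI[of _ "%x. entry x i j", rotated]) (rule ij)
  qed
 qed
 obtain u where u: "u : R" "!!x. x : ?K ==> abs(F x - u x) < e" using SW.Stone_Weierstrass_basic[OF Fc e] by blast
 have "abs(u (rho g) - h g) < 2 * e" if g: "g : cG" for g using u(2)[of "rho g"] Fh[OF g] g by force
 thus ?thesis using u(1) unfolding R_def by blast
qed

end

section \<open>Homotopy invariance of the Maurer--Cartan forms\<close>

lemma S3_swap12: "(\<Sum>i<d. \<Sum>j<d. \<Sum>k<d. F j i k) = (\<Sum>i<(d::nat). \<Sum>j<(d::nat). \<Sum>k<(d::nat). F i j k :: real)" by (rule sum.swap)

lemma S3_swap23: "(\<Sum>i<d. \<Sum>j<d. \<Sum>k<d. F i k j) = (\<Sum>i<(d::nat). \<Sum>j<(d::nat). \<Sum>k<(d::nat). F i j k :: real)"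
 by (rule sum.cong[OF refl]) (rule sum.swap)

lemma S3_cycle: "(\<Sum>i<d. \<Sum>j<d. \<Sum>k<d. F j k i) = (\<Sum>i<(d::nat). \<Sum>j<(d::nat). \<Sum>k<(d::nat). F i j k :: real)"
 using S3_swap12[of "%i j k. F i k j" d] S3_swap23[of F d] by simp

text \<open>Pointwise algebra. For a homotopy of maps into matrices, \<open>a i\<close> and
  \<open>b\<close> are the logarithmic derivatives along the i-th invariant field and along the
  homotopy parameter, \<open>alp i j\<close> and \<open>bet i\<close> the derivatives of
  \<open>a j\<close> and \<open>b\<close> along the i-th field; the last assumption is the
  Maurer-Cartan equation.\<close>

context
 fixes d m :: nat and c :: "nat => nat => nat => real" and a bet :: "nat => op" and alp :: "nat => nat => op" and b :: op
 assumes aM: "!!i. i < d ==> a i : Mat m"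
  and c12: "!!i j k. c j i k = - c i j k" and c23: "!!i j k. i < d ==> j < d ==> k < d ==> c i k j = - c i j k"
  and alp: "!!i j. i < d ==> j < d ==> alp i j - alp j i = (\<Sum>l<d. c i j l *R a l) - (a i * a j - a j * a i)"
begin

lemma c_cycle: "i < d ==> j < d ==> k < d ==> c j k i = c i j k" using c23[of j i k] c12[of i j k] by simp

lemma cyclic_form:
 assumes "!!i j k. i < d ==> j < d ==> k < d ==> F i j k = F' j k i"
 shows "S3 d c (%i j k. F i j k) = S3 d c (%i j k. F' i j k)"
proof -
 have "S3 d c (%i j k. F i j k) = (\<Sum>i<d. \<Sum>j<d. \<Sum>k<d. c j k i * F' j k i)" by (intro sum.cong refl) (use assms c_cycle in auto)
 thus ?thesis using S3_cycle[of "%i j k. c i j k * F' i j k" d] by simp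
qed

text \<open>
 The three-form \<open>tr a\<^sup>3\<close> is closed: by the Maurer--Cartan equation \<open>alp\<close> its derivative along a
 homotopy is a divergence.
\<close>

lemma maurer_cartan_divergence:
 defines "a' \<equiv> %i. bet i + a i * b - b * a i"
 shows "S3 d c (%i j k. tr m (a' i * a j * a k + a i * a' j * a k + a i * a j * a' k)) =
  (\<Sum>i<d. 3 * (\<Sum>j<d. \<Sum>k<d. c i j k * tr m (bet i * a j * a k + b * alp i j * a k + b * a j * alp i k)))"
proof -
 let ?S = "%F. \<Sum>i<d. \<Sum>j<d. \<Sum>k<d. c i j k * tr m (F i j k)"
 have add: "?S (%i j k. F i j k + H i j k) = ?S F + ?S H" for F H by (simp add: distrib_left sum.distrib)
 have diff: "?S (%i j k. F i j k - H i j k) = ?S F - ?S H" for F H by (simp add: right_diff_distrib sum_subtractf)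
 have trc: "tr m (X * a k) = tr m (a k * X)" if "k < d" for X k using tr_commute[OF aM[OF that]] by simp
 have m12: "c i j k * t = - (c j i k * t)" for i j k and t :: real using c12[of i j k] by simp
 have m23: "c i j k * t = - (c i k j * t)" if "i < d" "j < d" "k < d" for i j k and t :: real using c23[OF that] by simp
 have swap: "?S (%i j k. F j i k) = - ?S F" for F
 proof -
  have "?S (%i j k. F j i k) = (\<Sum>i<d. \<Sum>j<d. \<Sum>k<d. - (c j i k * tr m (F j i k)))" by (intro sum.cong refl m12)
  thus ?thesis using S3_swap12[of "%i j k. c i j k * tr m (F i j k)" d] by (simp add: sum_negf)
 qed
 have swap23: "?S (%i j k. F i k j) = - ?S F" for F
 proof -
  have "?S (%i j k. F i k j) = (\<Sum>i<d. \<Sum>j<d. \<Sum>k<d. - (c i k j * tr m (F i k j)))" by (intro sum.cong refl m23) auto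
  thus ?thesis using S3_swap23[of "%i j k. c i j k * tr m (F i j k)" d] by (simp add: sum_negf)
 qed
 have cyc: "?S F = ?S F'" if "!!i j k. i < d ==> j < d ==> k < d ==> tr m (F i j k) = tr m (F' j k i)" for F F'
  by (rule cyclic_form[of "%i j k. tr m (F i j k)" "%i j k. tr m (F' i j k)"]) (rule that)
 \<comment> \<open>\<open>T\<close> is the contribution of the commutator with \<open>b\<close>,
   which cancels by cyclicity; \<open>A\<close> and \<open>B\<close> collect the derivatives of
   \<open>a\<close> and turn out to have sum 0.\<close>
 define T where "T = ?S (%i j k. b * a i * a j * a k)"
 define A where "A = ?S (%i j k. b * alp i j * a k)"
 define B where "B = ?S (%i j k. b * a j * alp i k)"
 have 1: "?S (%i j k. a i * a' j * a k) = ?S (%i j k. a' i * a j * a k)"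
 proof (rule cyc)
  show "tr m (a i * a' j * a k) = tr m (a' j * a k * a i)" if "i < d" for i j k using trc[OF that, of "a' j * a k"] by (simp only: mult.assoc)
 qed
 have 2: "?S (%i j k. a i * a j * a' k) = ?S (%i j k. a i * a' j * a k)"
 proof (rule cyc)
  show "tr m (a i * a j * a' k) = tr m (a j * a' k * a i)" if "i < d" for i j k using trc[OF that, of "a j * a' k"] by (simp only: mult.assoc)
 qed
 have ab: "?S (%i j k. a i * b * a j * a k) = T" unfolding T_def
 proof (rule cyc)
  show "tr m (a i * b * a j * a k) = tr m (b * a j * a k * a i)" if "i < d" for i j k using trc[OF that, of "b * a j * a k"] by (simp only: mult.assoc)
 qed
 have 3: "?S (%i j k. a' i * a j * a k) = ?S (%i j k. bet i * a j * a k)"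
 proof -
  have "?S (%i j k. a' i * a j * a k) = ?S (%i j k. (bet i * a j * a k + a i * b * a j * a k) - b * a i * a j * a k)" by (simp add: a'_def algebra_simps)
  also have "... = ?S (%i j k. bet i * a j * a k) + T - T" unfolding diff add ab T_def ..
  finally show ?thesis by simp
 qed
 define P where "P = S3 d c (%i j k. (\<Sum>l<d. c i j l * tr m (b * a l * a k)))"
 have "2 * A = ?S (%i j k. b * alp i j * a k - b * alp j i * a k)" unfolding diff swap[of "%i j k. b * alp i j * a k"] by (simp add: A_def)
 also have "... = S3 d c (%i j k. ((\<Sum>l<d. c i j l * tr m (b * a l * a k)) - tr m (b * a i * a j * a k - b * a j * a i * a k)))"
 proof (intro sum.cong refl)
  fix i j k assume "i : {..<d}" "j : {..<d}" "k : {..<d}"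
  have "b * alp i j * a k - b * alp j i * a k = b * (alp i j - alp j i) * a k" by (simp add: algebra_simps)
  also have "... = (\<Sum>l<d. c i j l *R (b * a l * a k)) - (b * a i * a j * a k - b * a j * a i * a k)" using alp[of i j] `i : {..<d}` `j : {..<d}`
   by (simp add: right_diff_distrib left_diff_distrib sum_distrib_left sum_distrib_right mult.assoc)
  finally show "c i j k * tr m (b * alp i j * a k - b * alp j i * a k) =
    c i j k * ((\<Sum>l<d. c i j l * tr m (b * a l * a k)) - tr m (b * a i * a j * a k - b * a j * a i * a k))" by (simp only: tr_simps tr_sum)
 qed
 also have "... = P - ?S (%i j k. b * a i * a j * a k - b * a j * a i * a k)" by (simp only: right_diff_distrib sum_subtractf P_def)
 also have "?S (%i j k. b * a i * a j * a k - b * a j * a i * a k) = 2 * T" unfolding diff swap[of "%i j k. b * a i * a j * a k"] by (simp add: T_def)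
 finally have A2: "2 * A = P - 2 * T" .
 define P2 where "P2 = S3 d c (%i j k. (\<Sum>l<d. c i k l * tr m (b * a j * a l)))"
 have sw13: "?S (%i j k. b * a j * alp k i) = - B"
 proof -
  have "?S (%i j k. b * a j * alp k i) = - ?S (%i j k. b * a k * alp j i)" using swap23[of "%i j k. b * a k * alp j i"] by simp
  also have "?S (%i j k. b * a k * alp j i) = - ?S (%i j k. b * a k * alp i j)" by (rule swap)
  also have "?S (%i j k. b * a k * alp i j) = - B" unfolding B_def by (rule swap23)
  finally show ?thesis by simp
 qed
 have "2 * B = ?S (%i j k. b * a j * alp i k - b * a j * alp k i)" unfolding diff sw13 by (simp add: B_def)
 also have "... = S3 d c (%i j k. ((\<Sum>l<d. c i k l * tr m (b * a j * a l)) - tr m (b * a j * a i * a k - b * a j * a k * a i)))"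
 proof (intro sum.cong refl)
  fix i j k assume "i : {..<d}" "j : {..<d}" "k : {..<d}"
  have "b * a j * alp i k - b * a j * alp k i = b * a j * (alp i k - alp k i)" by (simp add: algebra_simps)
  also have "... = (\<Sum>l<d. c i k l *R (b * a j * a l)) - (b * a j * a i * a k - b * a j * a k * a i)" using alp[of i k] `i : {..<d}` `k : {..<d}`
   by (simp add: right_diff_distrib left_diff_distrib sum_distrib_left sum_distrib_right mult.assoc)
  finally show "c i j k * tr m (b * a j * alp i k - b * a j * alp k i) =
    c i j k * ((\<Sum>l<d. c i k l * tr m (b * a j * a l)) - tr m (b * a j * a i * a k - b * a j * a k * a i))" by (simp only: tr_simps tr_sum)
 qed
 also have "... = P2 - ?S (%i j k. b * a j * a i * a k - b * a j * a k * a i)" by (simp only: right_diff_distrib sum_subtractf P2_def)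
 also have "?S (%i j k. b * a j * a i * a k - b * a j * a k * a i) = - T - T"
 proof -
  have "?S (%i j k. b * a j * a k * a i) = T" unfolding T_def by (rule cyc) simp
  thus ?thesis unfolding diff swap[of "%i j k. b * a i * a j * a k"] by (simp add: T_def)
 qed
 finally have B2: "2 * B = P2 + 2 * T" by simp
 have "P2 = (\<Sum>i<d. \<Sum>k<d. \<Sum>j<d. \<Sum>l<d. c i j k * c i k l * tr m (b * a j * a l))"
  unfolding P2_def by (rule sum.cong[OF refl], subst sum.swap) (simp add: sum_distrib_left mult.assoc)
 also have "... = (\<Sum>i<d. \<Sum>j<d. \<Sum>l<d. \<Sum>k<d. - (c i j l * c i j k * tr m (b * a l * a k)))"
 proof (intro sum.cong refl)
  fix i j l k assume "i : {..<d}" "j : {..<d}" "l : {..<d}"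
  thus "c i l j * c i j k * tr m (b * a l * a k) = - (c i j l * c i j k * tr m (b * a l * a k))" using c23[of i j l] by simp
 qed
 also have "... = - P" unfolding P_def sum_negf
  by (rule arg_cong[of _ _ uminus], rule sum.cong[OF refl], rule sum.cong[OF refl], subst sum.swap) (simp add: sum_distrib_left mult_ac)
 \<comment> \<open>Hence the terms with \<open>alp\<close>, which complete
   \<open>bet i * a j * a k\<close> to the derivative of \<open>b * a j * a k\<close>, may be added
   freely.\<close>
 finally have AB: "A + B = 0" using A2 B2 by simp
 have "?S (%i j k. a' i * a j * a k + a i * a' j * a k + a i * a j * a' k) = 3 * ?S (%i j k. bet i * a j * a k)" unfolding add 2 1 3 by simp
 also have "... = 3 * ?S (%i j k. bet i * a j * a k + b * alp i j * a k + b * a j * alp i k)" unfolding add A_def[symmetric] B_def[symmetric] using AB by simp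
 finally show ?thesis by (simp only: sum_distrib_left)
qed

end

lemma ainv_Mat:
 assumes "g - 1 : Mat m" "g : Inv gam"
 shows "ainv g - 1 : Mat m"
proof -
 have "ainv g - 1 = - ((g - 1) * ainv g)" "ainv g - 1 = - (ainv g * (g - 1))" using Inv_ainv[OF assms(2)] by (simp_all add: algebra_simps)
 thus ?thesis
 proof -
  let ?X = "ainv g - 1"
  have "Pr m * (g - 1) = g - 1" "(g - 1) * Pr m = g - 1" using assms(1) by (auto simp: Mat_def)
  hence "Pr m * - ((g - 1) * ainv g) = - ((g - 1) * ainv g)" "- (ainv g * (g - 1)) * Pr m = - (ainv g * (g - 1))"
   by (simp_all add: mult.assoc[symmetric]) (simp add: mult.assoc)
  hence "Pr m * ?X = ?X" "?X * Pr m = ?X" by (simp_all only: flip: `ainv g - 1 = - ((g - 1) * ainv g)` `ainv g - 1 = - (ainv g * (g - 1))`)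
  thus ?thesis by (simp add: Mat_def)
 qed
qed

lemma Mat_one_mult: "A - 1 : Mat m ==> B : Mat m ==> A * B : Mat m" using Mat_add[OF Mat_mult[of "A - 1" m B], of B] by (simp add: left_diff_distrib)

lemma rd_closed_subspace:
 assumes u: "rd K u Y u'" and V: "subspace V" "closed V" and uV: "!!x. x : K ==> u x - a : V"
  and KY: "!!x t. x : K ==> x * exp (t *R Y) : K" and x: "x : K"
 shows "u' x : V"
proof (rule Lim_in_closed_set[OF V(2)])
 show "((%t. (u (x * exp (t *R Y)) - u (x * exp (0 *R Y))) /R (t - 0)) ---> u' x) (at 0)" using u x unfolding rd_def has_vector_derivative_iff_quotient by simp
 have "(u y - u z) /R t : V" if "y : K" "z : K" for y z and t :: real using subspace_scale[OF V(1) subspace_diff[OF V(1) uV[OF that(1)] uV[OF that(2)]]] by simp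
 thus "\<forall>\<^sub>F t in at 0. (u (x * exp (t *R Y)) - u (x * exp (0 *R Y))) /R (t - 0) : V" using KY[OF x] by (intro always_eventually) blast
qed simp

lemma rd_eq: "rd K u Y u' ==> (!!x. u' x = u'' x) ==> rd K u Y u''" by (metis ext)

text \<open>The straight line from \<open>g\<close> to \<open>h\<close> and its Maurer--Cartan form \<open>a = G\<^sup>-\<^sup>1 dG\<close>.\<close>

locale segment =
 fixes n :: nat and K :: "op set" and d :: nat and Y c m V g g1 g2 h h1 h2 gam
 assumes K: "cmg n K" and Y: "!!i. i < d ==> Y i : Lie K"
  and gC: "C2 K d Y c g g1 g2" and hC: "C2 K d Y c h h1 h2"
  and V: "subspace V" "closed V" "V <= Mat m"
  and gV: "!!x. x : K ==> g x - 1 : V" and hV: "!!x. x : K ==> h x - 1 : V"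
  and inv: "!!x s. x : K ==> s : {0..1} ==> (1 - s) *R g x + s *R h x : Inv gam"
begin

definition "line s x = (1 - s) *R g x + s *R h x" for s :: real
definition "G1 s i x = (1 - s) *R g1 i x + s *R h1 i x" for s :: real
definition "G2 s i j x = (1 - s) *R g2 i j x + s *R h2 i j x" for s :: real
definition "Del x = h x - g x"
definition "Del1 i x = h1 i x - g1 i x"
definition "U s x = ainv (line s x)"
definition "a s i x = U s x * G1 s i x"
definition "b s x = U s x * Del x"
definition "bet s i x = U s x * Del1 i x - a s i x * b s x"
definition "alp s i j x = U s x * G2 s i j x - a s i x * a s j x"

lemma GI: "x : K ==> s : {0..1} ==> line s x : Inv gam" unfolding line_def by (rule inv)

lemma KY: "i < d ==> x : K ==> x * exp (t *R Y i) : K" using cmg_mult[OF K _ LieD[OF Y]] by blast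

lemma rd_lin: "rd K u Z u' ==> rd K v Z v' ==> rd K (%x. s *R u x + t *R v x) Z (%x. s *R u' x + t *R v' x)" by (intro rd_add rd_linear[OF bounded_linear_scaleR_right])

lemma rd_G:
 assumes "i < d"
 shows "rd K (line s) (Y i) (G1 s i)" "j < d ==> rd K (G1 s j) (Y i) (G2 s i j)" "rd K Del (Y i) (Del1 i)"
proof -
 have r: "rd K g (Y i) (g1 i)" "rd K h (Y i) (h1 i)" using gC hC assms by (auto simp: C2_def)
 thus "rd K (line s) (Y i) (G1 s i)" unfolding line_def[abs_def] G1_def[abs_def] by (rule rd_lin)
 show "rd K Del (Y i) (Del1 i)" using rd_lin[OF r(2,1), of 1 "-1"] by (simp add: Del_def[abs_def] Del1_def[abs_def])
 show "rd K (G1 s j) (Y i) (G2 s i j)" if "j < d" unfolding G1_def[abs_def] G2_def[abs_def] using gC hC assms that by (intro rd_lin) (auto simp: C2_def)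
qed

lemma rd_U: "i < d ==> s : {0..1} ==> rd K (U s) (Y i) (%x. - (U s x * G1 s i x * U s x))" unfolding U_def[abs_def] by (rule rd_ainv[OF rd_G(1)]) (auto intro: GI KY)

lemma rd_a:
 assumes "i < d" "j < d" "s : {0..1}"
 shows "rd K (a s j) (Y i) (alp s i j)" unfolding a_def[abs_def]
 by (rule rd_eq[OF rd_mult[OF rd_U[OF assms(1,3)] rd_G(2)[OF assms(1,2)]]]) (simp add: alp_def a_def mult.assoc)

lemma rd_b:
 assumes "i < d" "s : {0..1}"
 shows "rd K (b s) (Y i) (bet s i)" unfolding b_def[abs_def]
 by (rule rd_eq[OF rd_mult[OF rd_U[OF assms] rd_G(3)[OF assms(1)]]]) (simp add: bet_def a_def b_def mult.assoc)

text \<open>The zero-curvature relation between the homotopy parameter and the i-th field: mixed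
  derivatives of the line agree, and the commutator comes from differentiating the inverse.\<close>

lemma deriv_s:
 assumes x: "x : K" and s: "s : {0..1}"
 shows "((%s. a s i x) hvd (bet s i x + a s i x * b s x - b s x * a s i x)) (at s within {0..1})"
proof -
 have line: "((%s. line s x) hvd Del x) (at s within {0..1})"
  "((%s. G1 s i x) hvd Del1 i x) (at s within {0..1})" unfolding line_def G1_def Del_def Del1_def by (auto intro!: derivative_eq_intros)
 have U: "((%s. U s x) hvd - (U s x * Del x * U s x)) (at s within {0..1})" unfolding U_def by (rule has_vector_derivative_ainv[OF line(1) _ s]) (rule GI[OF x])
 from has_vector_derivative_mult[OF U line(2)] show ?thesis by (simp add: a_def b_def bet_def mult.assoc algebra_simps)
qed

lemma cont_K:
 "cton (K \<times> {0..1}) (%z. U (snd z) (fst z))"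
 "i < d ==> cton (K \<times> {0..1}) (%z. a (snd z) i (fst z))"
 "cton (K \<times> {0..1}) (%z. b (snd z) (fst z))"
 "i < d ==> cton (K \<times> {0..1}) (%z. bet (snd z) i (fst z))"
proof -
 let ?S = "K \<times> {0..1::real}"
 have lift: "cton ?S (%z. u (fst z))" if "cton K u" for u :: "op => op" by (rule continuous_on_compose2[OF that continuous_on_fst[OF continuous_on_id]]) auto
 have gh: "cton ?S (%z. g (fst z))" "cton ?S (%z. h (fst z))" using gC hC by (auto simp: C2_def intro: lift)
 have gh1: "cton ?S (%z. g1 i (fst z))" "cton ?S (%z. h1 i (fst z))" if "i < d" for i using gC hC that by (auto simp: C2_def rd_def intro: lift)
 have s: "cton ?S (%z. snd z)" by (intro continuous_intros)
 show U: "cton ?S (%z. U (snd z) (fst z))" unfolding U_def by (rule continuous_on_ainv_comp[of _ _ gam]) (auto simp: line_def intro!: continuous_intros gh inv)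
 show b: "cton ?S (%z. b (snd z) (fst z))" unfolding b_def Del_def by (intro continuous_intros U gh)
 show a: "cton ?S (%z. a (snd z) i (fst z))" if "i < d" unfolding a_def G1_def by (intro continuous_intros U gh1 that)
 show "cton ?S (%z. bet (snd z) i (fst z))" if "i < d" unfolding bet_def Del1_def by (intro continuous_intros U gh1 a b that)
qed

lemma G_V: "x : K ==> line s x - 1 : V"
proof -
 assume x: "x : K"
 have "line s x - 1 = (1 - s) *R (g x - 1) + s *R (h x - 1)" by (simp add: line_def algebra_simps)
 thus ?thesis using gV[OF x] hV[OF x] V(1) by (simp add: subspace_add subspace_scale)
qed

lemma G1_V:
 assumes "i < d" "x : K"
 shows "G1 s i x : V" by (rule rd_closed_subspace[OF rd_G(1)[OF assms(1)] V(1,2) G_V KY[OF assms(1)] assms(2)])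

lemma a_Mat: "i < d ==> x : K ==> s : {0..1} ==> a s i x : Mat m" unfolding a_def U_def using G1_V G_V V(3) by (intro Mat_one_mult ainv_Mat[OF _ GI]) auto

text \<open>The Maurer-Cartan equation for the line; the structure constants enter through the last
  clause of \<open>C2\<close>.\<close>

lemma alp_antisym:
 assumes "i < d" "j < d" "x : K"
 shows "alp s i j x - alp s j i x = (\<Sum>l<d. c i j l *R a s l x) - (a s i x * a s j x - a s j x * a s i x)"
proof -
 have "G2 s i j x - G2 s j i x = (1 - s) *R (g2 i j x - g2 j i x) + s *R (h2 i j x - h2 j i x)" by (simp add: G2_def algebra_simps)
 also have "... = (\<Sum>l<d. c i j l *R G1 s l x)" using gC hC assms by (simp add: C2_def G1_def scaleR_sum_right scaleR_add_right sum.distrib mult.commute)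
 finally have "U s x * (G2 s i j x - G2 s j i x) = (\<Sum>l<d. c i j l *R a s l x)" by (simp add: a_def sum_distrib_left)
 thus ?thesis by (simp add: alp_def right_diff_distrib)
qed

end

section \<open>Invariance of the means along a segment\<close>

context compact_group
begin

lemma mean_constant_if_divergence:
 fixes omg omg' :: "real => op => real" and eta eta' :: "nat => real => op => real"
 assumes rho: "rep n rho" and Y: "!!i. i < d ==> Y i : Lie (rho ` cG)"
  and omgc: "!!s. s : {0..1} ==> cton (rho ` cG) (omg s)"
  and omgd: "!!s x. s : {0..1} ==> x : rho ` cG ==> ((%s. omg s x) hvd omg' s x) (at s within {0..1})"
  and omg'c: "cton (rho ` cG \<times> {0..1}) (%z. omg' (snd z) (fst z))"
  and div: "!!s x. s : {0..1} ==> x : rho ` cG ==> omg' s x = (\<Sum>i<d. eta' i s x)"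
  and eta: "!!i s. i < d ==> s : {0..1} ==> rd (rho ` cG) (eta i s) (Y i) (eta' i s)"
 shows "mean (%x. omg 0 (rho x)) = mean (%x. omg 1 (rho x))"
proof -
 let ?K = "rho ` cG"
 have rhoc: "ctm T (subtop euclidean ?K) rho" using rho by (auto simp: rep_def ctm_into)
 have comp: "cont (%x. u (rho x))" if "cton ?K u" for u :: "op => real" using ctm_o[OF rhoc, of euclideanreal u] that by (simp add: o_def)
 have "((%s. mean (%x. omg s (rho x))) has_real_derivative mean (%x. omg' s (rho x))) (at s within {0..1})" if s: "s : {0..1}" for s
 proof (rule mean_derivative[OF s])
  show "cont (%x. omg t (rho x))" if "t : {0..1}" for t by (rule comp[OF omgc[OF that]])
  show "((%t. omg t (rho x)) has_real_derivative omg' t (rho x)) (at t within {0..1})" if "t : {0..1}" "x : cG" for t x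
   using omgd[OF that(1), of "rho x"] that by (simp add: has_real_derivative_iff_has_vector_derivative)
  have "ctm (ptop T (top_of_set {0..1::real})) (subtop euclidean (?K \<times> {0..1})) (%z. (rho (fst z), snd z))"
  proof -
   have eq: "subtop euclidean (?K \<times> {0..1::real}) = ptop (subtop euclidean ?K) (top_of_set {0..1})"
    using subtopology_Times[of euclidean euclidean ?K "{0..1::real}"] by simp
   show ?thesis unfolding eq continuous_map_paired
    using ctm_o[OF continuous_map_fst rhoc, of "top_of_set {0..1::real}"] continuous_map_snd[of T "top_of_set {0..1::real}"] by (simp add: o_def)
  qed
  from ctm_o[OF this, of euclideanreal "%z. omg' (snd z) (fst z)"] omg'c
  show "ctm (ptop T (top_of_set {0..1})) euclideanreal (%z. omg' (snd z) (rho (fst z)))" by (simp add: o_def)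
 qed
 moreover have "mean (%x. omg' s (rho x)) = 0" if s: "s : {0..1}" for s
 proof -
  have "mean (%x. omg' s (rho x)) = mean (%x. \<Sum>i<d. eta' i s (rho x))" by (rule mean_cong) (use div s in auto)
  also have "... = (\<Sum>i<d. mean (%x. eta' i s (rho x)))" by (rule mean_sum) (use eta s in "auto intro!: comp simp: rd_def")
  also have "... = 0" by (rule sum.neutral) (use mean_rd_zero[OF rho Y eta] s in auto)
  finally show ?thesis .
 qed
 ultimately have "((%s. mean (%x. omg s (rho x))) has_real_derivative 0) (at s within {0..1})" if "s : {0..1}" for s using that by simp
 from has_field_derivative_zero_constant[OF _ this] show ?thesis by force
qed

end

context compact_group
begin

lemma form3_invariant:
 assumes rho: "rep n rho" and S: "segment n (rho ` cG) d Y c m V g g1 g2 h h1 h2 gam"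
  and c: "!!i j k. c j i k = - c i j k" "!!i j k. i < d ==> j < d ==> k < d ==> c i k j = - c i j k"
 defines "Omg \<equiv> %g g1 x. \<Sum>i<d. \<Sum>j<d. \<Sum>k<d. c i j k * tr m ((ainv (g x) * g1 i x) * (ainv (g x) * g1 j x) * (ainv (g x) * g1 k x))"
 shows "mean (%x. Omg g g1 (rho x)) = mean (%x. Omg h h1 (rho x))"
proof -
 let ?K = "rho ` cG"
 interpret segment n ?K d Y c m V g g1 g2 h h1 h2 gam by (rule S)
 define omg where "omg s x = S3 d c (%i j k. tr m (a s i x * a s j x * a s k x))" for s x
 define a' where "a' s i x = bet s i x + a s i x * b s x - b s x * a s i x" for s i x
 define omg' where "omg' s x = S3 d c (%i j k. tr m (a' s i x * a s j x * a s k x + a s i x * a' s j x * a s k x + a s i x * a s j x * a' s k x))" for s x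
 define eta' where "eta' i s x = 3 * (\<Sum>j<d. \<Sum>k<d. c i j k * tr m (bet s i x * a s j x * a s k x + b s x * alp s i j x * a s k x + b s x * a s j x * alp s i k x))" for i s x
 have trc: "cton A (%x. tr m (u x))" if "cton A u" for A and u :: "'z::topological_space => op" by (rule bounded_linear.continuous_on[OF bounded_linear_tr that])
 have "mean (%x. omg 0 (rho x)) = mean (%x. omg 1 (rho x))"
 proof (rule mean_constant_if_divergence[OF rho Y, where omg' = omg' and eta' = eta'
    and eta = "%i s x. 3 * (\<Sum>j<d. \<Sum>k<d. c i j k * tr m (b s x * a s j x * a s k x))"])
  show "cton ?K (omg s)" if s: "s : {0..1}" for s
  proof -
   have "cton ?K (a s i)" if "i < d" for i using continuous_on_compose2[OF cont_K(2)[OF that], of ?K "%x. (x, s)"] s by (force intro: continuous_intros)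
   thus ?thesis unfolding omg_def[abs_def] by (intro continuous_intros trc) auto
  qed
  show "((%s. omg s x) hvd omg' s x) (at s within {0..1})" if s: "s : {0..1}" and x: "x : ?K" for s x
  proof -
   have A: "((%s. a s i x) hvd a' s i x) (at s within {0..1})" for i unfolding a'_def by (rule deriv_s[OF x s])
   have "((%s. a s i x * a s j x * a s k x) hvd
     a' s i x * a s j x * a s k x + a s i x * a' s j x * a s k x + a s i x * a s j x * a' s k x) (at s within {0..1})" for i j k
    using has_vector_derivative_mult[OF has_vector_derivative_mult[OF A A] A, of i j k] by (simp add: algebra_simps)
   from bounded_linear.has_vector_derivative[OF bounded_linear_tr this]
   have "((%s. c i j k * tr m (a s i x * a s j x * a s k x)) hvd
     c i j k * tr m (a' s i x * a s j x * a s k x + a s i x * a' s j x * a s k x + a s i x * a s j x * a' s k x)) (at s within {0..1})" for i j k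
    by (rule has_vector_derivative_mult_right)
   thus ?thesis unfolding omg_def omg'_def by (intro has_vector_derivative_sum) fast
  qed
  show "cton (?K \<times> {0..1}) (%z. omg' (snd z) (fst z))" unfolding omg'_def a'_def by (intro continuous_intros trc cont_K) auto
  show "omg' s x = (\<Sum>i<d. eta' i s x)" if s: "s : {0..1}" and x: "x : ?K" for s x unfolding omg'_def eta'_def a'_def
   by (rule maurer_cartan_divergence[of d "%i. a s i x" m c "%i j. alp s i j x"])
    (rule a_Mat[OF _ x s] c alp_antisym[OF _ _ x]; assumption)+
  fix i :: nat and s :: real assume i: "i < d" and s: "s : {0..1}"
  show "rd ?K (%x. 3 * (\<Sum>j<d. \<Sum>k<d. c i j k * tr m (b s x * a s j x * a s k x))) (Y i) (eta' i s)" unfolding eta'_def[abs_def]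
  proof (intro rd_linear[OF bounded_linear_mult_right] rd_sum)
   fix j k assume "j : {..<d}" "k : {..<d}"
   hence jk: "j < d" "k < d" by auto
   have "rd ?K (%x. b s x * a s j x * a s k x) (Y i)
     (%x. bet s i x * a s j x * a s k x + b s x * alp s i j x * a s k x + b s x * a s j x * alp s i k x)"
    by (rule rd_eq[OF rd_mult[OF rd_mult[OF rd_b[OF i s] rd_a[OF i jk(1) s]] rd_a[OF i jk(2) s]]]) (simp add: algebra_simps)
   thus "rd ?K (%x. tr m (b s x * a s j x * a s k x)) (Y i)
     (%x. tr m (bet s i x * a s j x * a s k x + b s x * alp s i j x * a s k x + b s x * a s j x * alp s i k x))" by (rule rd_linear[OF bounded_linear_tr])
  qed
 qed
 thus ?thesis by (simp add: omg_def Omg_def a_def U_def line_def G1_def)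
qed

text \<open>Since \<open>X\<close> commutes with the line and its derivatives, the commutator in
  \<open>deriv_s\<close> has trace 0 against \<open>X\<close>; what remains is the derivative of
  \<open>tr m (X * b s x)\<close> along \<open>Y l\<close>.\<close>

lemma form1_invariant:
 assumes rho: "rep n rho" and S: "segment n (rho ` cG) d Y c m V g g1 g2 h h1 h2 gam"
  and l: "l < d" and X: "X : Mat m" and XV: "!!A. A : V ==> A * X = X * A"
 shows "mean (%x. tr m (X * (ainv (g (rho x)) * g1 l (rho x)))) = mean (%x. tr m (X * (ainv (h (rho x)) * h1 l (rho x))))"
proof -
 let ?K = "rho ` cG"
 interpret segment n ?K d Y c m V g g1 g2 h h1 h2 gam by (rule S)
 have trc: "cton A (%x. tr m (u x))" if "cton A u" for A and u :: "'z::topological_space => op" by (rule bounded_linear.continuous_on[OF bounded_linear_tr that])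
 let ?eta' = "%i s x. if i = l then tr m (X * bet s l x) else 0"
 have Xb: "bounded_linear (%A. tr m (X * A))" by (rule bounded_linear_compose[OF bounded_linear_tr bounded_linear_mult_right])
 have "mean (%x. (%s x. tr m (X * a s l x)) 0 (rho x)) = mean (%x. (%s x. tr m (X * a s l x)) 1 (rho x))"
 proof (rule mean_constant_if_divergence[OF rho Y, where omg' = "%s x. tr m (X * bet s l x)" and eta' = ?eta'
    and eta = "%i s x. if i = l then tr m (X * b s x) else 0"])
  show "cton ?K (%x. tr m (X * a s l x))" if s: "s : {0..1}" for s
   using continuous_on_compose2[OF cont_K(2)[OF l], of ?K "%x. (x, s)"] s by (force intro: continuous_intros trc)
  show "((%s. tr m (X * a s l x)) hvd tr m (X * bet s l x)) (at s within {0..1})" if s: "s : {0..1}" and x: "x : ?K" for s x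
  proof -
   have XG: "X * line s x = line s x * X" using XV[OF G_V[OF x, of s]] by (simp add: algebra_simps)
   have "X * U s x = U s x * (line s x * X) * U s x" using Inv_ainv[OF GI[OF x s]] by (simp add: U_def mult.assoc[symmetric])
   also have "... = U s x * X" unfolding XG[symmetric] using Inv_ainv[OF GI[OF x s]] by (simp add: U_def mult.assoc)
   finally have XU: "X * U s x = U s x * X" .
   have Xa: "X * a s l x = a s l x * X" using XU XV[OF G1_V[OF l x, of s]] unfolding a_def by (metis mult.assoc)
   have "tr m (X * (b s x * a s l x)) = tr m (b s x * a s l x * X)" by (rule tr_commute[OF X])
   also have "... = tr m (b s x * X * a s l x)" using Xa by (simp add: mult.assoc)
   also have "... = tr m (a s l x * (b s x * X))" by (rule tr_commute[OF a_Mat[OF l x s], symmetric])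
   also have "... = tr m (X * (a s l x * b s x))" by (simp add: tr_commute[OF X] mult.assoc)
   finally have "tr m (X * (bet s l x + a s l x * b s x - b s x * a s l x)) = tr m (X * bet s l x)" by (simp add: distrib_left right_diff_distrib)
   thus ?thesis using bounded_linear.has_vector_derivative[OF Xb deriv_s[OF x s, of l]] by simp
  qed
  show "cton (?K \<times> {0..1}) (%z. tr m (X * bet (snd z) l (fst z)))" by (intro continuous_intros trc cont_K l)
  show "rd ?K (%x. if i = l then tr m (X * b s x) else 0) (Y i) (?eta' i s)" if "i < d" "s : {0..1}" for i s
   using rd_linear[OF Xb rd_b[OF that]] by (cases "i = l") (auto simp: rd_const)
 qed (use l in auto)
 thus ?thesis by (simp add: a_def U_def line_def G1_def)
qed

text \<open>A linear retraction onto \<open>V\<close> is applied to the matrix units. Approximating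
  entries one by one then keeps the approximants inside \<open>V\<close>, as the degree-one form
  requires.\<close>

lemma subspace_coordinates:
 assumes "subspace V" "V <= Mat m"
 obtains B where "!!p q. B p q : V" "!!A. A : V ==> A = (\<Sum>p<m. \<Sum>q<m. entry A p q *R B p q)"
proof -
 have "inj_on (%x. x) V" "linear (%x::op. x)" by (auto simp: linear_ident)
 from linear_exists_left_inverse_on[OF this(2) assms(1) this(1)]
 obtain g where g: "range g <= V" "linear g" "ALL v:V. g v = v" by (elim exE conjE) (rule that)
 show ?thesis
 proof (rule that[of "%p q. g (E p q)"])
  fix A assume A: "A : V"
  hence "A : Mat m" using assms by blast
  have "A = g A" using g A by simp
  also have "g A = g (\<Sum>p<m. \<Sum>q<m. entry A p q *R E p q)" using Mat_expand[OF `A : Mat m`] by simp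
  finally show "A = (\<Sum>p<m. \<Sum>q<m. entry A p q *R g (E p q))" using g(2) by (simp add: linear_sum linear_scale)
 qed (use g in auto)
qed

lemma polynomial_approximation:
 assumes rho: "rep n rho" and br: "!!i j. i < d ==> j < d ==> Y i * Y j - Y j * Y i = (\<Sum>k<d. c i j k *R Y k)"
  and f: "ctm T euclidean f" and V: "!!x. x : cG ==> f x - 1 : V"
  and B: "!!p q. B p q : V" "!!A. A : V ==> A = (\<Sum>p<m. \<Sum>q<m. entry A p q *R B p q)" and sV: "subspace V"
  and e: "0 < e"
  and ker: "!!g v. g : cG ==> v : cG ==> rho v = 1 ==>
   norm (f (g ** v) - f g) < e / (2 * (1 + (\<Sum>p<m. \<Sum>q<m. norm (B p q))))"
 shows "EX P P1 P2. C2 (rho ` cG) d Y c P P1 P2 & (ALL x. P x - 1 : V) & (ALL x:cG. norm (P (rho x) - f x) < e)"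
proof -
 let ?K = "rho ` cG"
 define M where "M = 1 + (\<Sum>p<m. \<Sum>q<m. norm (B p q))"
 have M: "1 <= M" by (simp add: M_def sum_nonneg)
 define e' where "e' = e / (2 * M)"
 have e': "0 < e'" using e M by (simp add: e'_def)
 have "EX u u1 u2. C2 ?K d Y c u u1 u2 & (ALL g:cG. abs(u (rho g) - entry (f g - 1) p q) < 2 * e')" for p q
 proof (rule polynomial_approximation_real[OF rho br _ e'])
  show "cont (%g. entry (f g - 1) p q)" by (rule continuous_map_unop[OF continuous_map_diff[OF f]]) (auto intro!: continuous_intros)
  show "abs(entry (f (g ** v) - 1) p q - entry (f g - 1) p q) < e'" if "g : cG" "v : cG" "rho v = 1" for g v
   using abs_entry_le[of "f (g ** v) - f g" p q] ker[OF that] by (simp add: e'_def M_def)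
 qed
 then obtain u u1 u2 where u: "!!p q. C2 ?K d Y c (u p q) (u1 p q) (u2 p q)"
  "!!p q g. g : cG ==> abs(u p q (rho g) - entry (f g - 1) p q) < 2 * e'" by metis
 define P where "P x = 1 + (\<Sum>p<m. \<Sum>q<m. u p q x *R B p q)" for x
 have "EX v1 v2. C2 ?K d Y c (%x. u p q x *R B p q) v1 v2" for p q using C2_linear[OF bounded_linear_scaleR_left u(1)] by blast
 hence "EX v1 v2. C2 ?K d Y c (%x. \<Sum>p<m. \<Sum>q<m. u p q x *R B p q) v1 v2" by (intro C2_sum) auto
 then obtain P1 P2 where "C2 ?K d Y c P P1 P2" using C2_add[OF C2_const] unfolding P_def[abs_def] by blast
 moreover have "P x - 1 : V" for x unfolding P_def by (simp add: subspace_sum subspace_scale sV B(1))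
 moreover have "norm (P (rho x) - f x) < e" if x: "x : cG" for x
 proof -
  have "P (rho x) - f x = (\<Sum>p<m. \<Sum>q<m. u p q (rho x) *R B p q) - (f x - 1)" by (simp add: P_def)
  also have "f x - 1 = (\<Sum>p<m. \<Sum>q<m. entry (f x - 1) p q *R B p q)" by (rule B(2)[OF V[OF x]])
  finally have "P (rho x) - f x = (\<Sum>p<m. \<Sum>q<m. (u p q (rho x) - entry (f x - 1) p q) *R B p q)" by (simp add: sum_subtractf scaleR_diff_left)
  also have "norm ... <= (\<Sum>p<m. \<Sum>q<m. 2 * e' * norm (B p q))"
  proof (intro sum_norm_le)
   show "norm ((u p q (rho x) - entry (f x - 1) p q) *R B p q) <= 2 * e' * norm (B p q)" for p q
    unfolding norm_scaleR real_norm_def by (rule mult_right_mono[OF less_imp_le[OF u(2)[OF x]] norm_ge_zero])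
  qed
  also have "... = 2 * e' * (M - 1)" by (simp add: M_def sum_distrib_left)
  also have "... < 2 * e' * M" using e' by simp
  also have "... = e" using M by (simp add: e'_def)
  finally show ?thesis .
 qed
 ultimately show ?thesis by blast
qed

end

section \<open>Projection to the first block\<close>

definition pr :: "op => op" where "pr A = WW False * A * VV False"

lemma pr_dsum [simp]: "pr (dsum A B) = A" by (simp add: pr_def WW_dsum_VV)

lemma bounded_linear_pr: "bounded_linear pr" unfolding pr_def[abs_def] by (rule bounded_linear_compose[OF bounded_linear_mult_left bounded_linear_mult_right])

lemma pr_dsum_mult: "pr (dsum A B * C) = A * pr C"
proof -
 have "WW False * dsum A B = A * WW False" by (simp add: dsum_def distrib_left mult.assoc WW_VV_mult)
 thus ?thesis unfolding pr_def by (metis mult.assoc)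
qed

text \<open>Operators that preserve the range of \<open>VV False\<close>; \<open>pr\<close> is their
  action on it and is multiplicative there.\<close>

definition bd :: "op set" where "bd = {A. A * VV False = VV False * pr A}"

lemma dsum_bd: "dsum A B : bd" by (simp add: bd_def dsum_VV)

lemma pr_mult: "B : bd ==> pr (A * B) = pr A * pr B" unfolding bd_def pr_def by (simp add: mult.assoc)

text \<open>Homotopy of \<open>pr\<close> to the constant map 1, expressed through invariants:
  whatever \<open>Phi\<close> does not change along segments agrees on both. Quantifying over
  \<open>Phi\<close> lets one construction serve the forms of degree 1 and 3.\<close>

definition joined :: "nat => op set => nat => op set => real => bool" where
 "joined n K m V gam <-> (ALL d Y c (Phi :: (op => op) => (nat => op => op) => real). (ALL i<d. Y i : Lie K) -->
   (ALL i<d. ALL j<d. Y i * Y j - Y j * Y i = (\<Sum>k<d. c i j k *R Y k)) -->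
   (ALL g g1 g2 h h1 h2. segment n K d Y c m V g g1 g2 h h1 h2 gam --> Phi g g1 = Phi h h1) -->
   Phi pr (%i x. pr (x * Y i)) = Phi (%_. 1) (%_ _. 0))"

lemma joinedD:
 fixes Phi :: "(op => op) => (nat => op => op) => real"
 assumes "joined n K m V gam" and "!!i. i < d ==> Y i : Lie K"
  and "!!i j. i < d ==> j < d ==> Y i * Y j - Y j * Y i = (\<Sum>k<d. c i j k *R Y k)"
  and "!!g g1 g2 h h1 h2. segment n K d Y c m V g g1 g2 h h1 h2 gam ==> Phi g g1 = Phi h h1"
 shows "Phi pr (%i x. pr (x * Y i)) = Phi (%_. 1) (%_ _. 0)" by (rule assms(1)[unfolded joined_def, rule_format]) (rule assms(2-4); assumption)+

context compact_group
begin

lemma dsum_pr: "x : (%g. dsum (rho0 g) (rho1 g)) ` cG ==> pr x : rho0 ` cG" by auto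

lemma Lie_pr:
 assumes rho: "rep n0 rho0" "rep n1 rho1" and Y: "Y : Lie ((%g. dsum (rho0 g) (rho1 g)) ` cG)"
 shows "Y : bd" "exp (pr Y) = pr (exp Y)" "pr Y : Lie (rho0 ` cG)"
proof -
 have sub: "subspace bd" unfolding bd_def pr_def by (auto simp: subspace_def algebra_simps)
 have cl: "closed bd" unfolding bd_def by (intro closed_Collect_eq) (auto simp: pr_def intro!: continuous_intros)
 have one: "1 : bd" by (simp add: bd_def pr_def WW_VV)
 have "exp (Y /R real (Suc m)) : bd" for m using LieD[OF Y, of "inverse (real (Suc m))"] by (auto simp: dsum_bd)
 hence "real (Suc m) *R (exp (Y /R real (Suc m)) - 1) : bd" for m by (rule subspace_scale[OF sub subspace_diff[OF sub _ one]])
 thus Yb: "Y : bd" by (rule closed_sequentially[OF cl _ exp_derivative_seq])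
 have e: "exp (t *R pr Y) = pr (exp (t *R Y))" for t
 proof -
  have "(t *R Y) * VV False = VV False * (t *R pr Y)" using Yb by (simp add: bd_def)
  from exp_intertwine[OF this] show ?thesis by (simp add: pr_def mult.assoc WW_VV_mult)
 qed
 show "exp (pr Y) = pr (exp Y)" using e[of 1] by simp
 show "pr Y : Lie (rho0 ` cG)" unfolding Lie_def mem_Collect_eq e by (rule allI, rule dsum_pr[OF LieD[OF Y]])
qed

text \<open>Preimages \<open>g k\<close> of short exponentials of \<open>X\<close> need not tend to
  1, but along a subsequence their images converge to that of some \<open>l\<close> in the kernel of
  \<open>rho0\<close>. Dividing by \<open>l\<close> gives elements tending to 1 in the block sum,
  whose logarithms project to multiples of \<open>X\<close>.\<close>

lemma Lie_pr_surjective: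
 assumes rho: "rep n0 rho0" "rep n1 rho1" and X: "X : Lie (rho0 ` cG)"
 obtains Y where "Y : Lie ((%g. dsum (rho0 g) (rho1 g)) ` cG)" "pr Y = X"
proof -
 let ?rho = "%g. dsum (rho0 g) (rho1 g)"
 let ?K = "?rho ` cG"
 have r: "rep (2 * max n0 n1) ?rho" by (rule rep_dsum[OF rho])
 note K = cmg_rep[OF r]
 have "EX g:cG. exp (X /R real (Suc k)) = rho0 g" for k using LieD[OF X, of "inverse (real (Suc k))"] by auto
 then obtain g where g: "!!k. g k : cG" "!!k. rho0 (g k) = exp (X /R real (Suc k))" by metis
 have "ALL k. ?rho (g k) : ?K" using g by blast
 moreover have "seq_compact ?K" using K by (simp add: cmg_def compact_eq_seq_compact_metric)
 ultimately obtain L r where L: "L : ?K" "strict_mono (r :: nat => nat)" "((%k. ?rho (g k)) o r) ----> L"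
  unfolding seq_compact_def by (elim allE[of _ "%k. ?rho (g k)"] impE bexE exE conjE) (assumption, rule that)
 obtain l where l: "l : cG" "L = ?rho l" using L(1) by blast
 have sub: "(%k. rho0 (g (r k))) ----> 1" using LIMSEQ_subseq_LIMSEQ[OF exp_div_seq_tendsto_1[of X] L(2)] by (simp add: g o_def)
 moreover have "(%k. pr (?rho (g (r k)))) ----> pr L" using bounded_linear.tendsto[OF bounded_linear_pr L(3)] by (simp add: o_def)
 ultimately have L1: "rho0 l = 1" using l by (simp add: LIMSEQ_unique)
 define a where "a k = g (r k) ** inv l" for k
 have a: "a k : cG" for k using g l by (simp add: a_def)
 have rho0a: "rho0 (a k) = exp (X /R real (Suc (r k)))" for k using rho(1) g l L1 rep_inverse[OF rho(1) l(1)] by (simp add: a_def rep_def)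
 have rhoa: "?rho (a k) = ?rho (g (r k)) * ?rho (inv l)" for k using r g l unfolding a_def rep_def by blast
 have "(%k. ?rho (a k)) ----> L * ?rho (inv l)" unfolding rhoa by (intro tendsto_intros) (use L(3) in "simp add: o_def")
 also have "L * ?rho (inv l) = 1" using rep_inverse[OF r l(1)] l by simp
 finally have lim: "(%k. ?rho (a k)) ----> 1" .
 define C where "C = 1 + norm (WW False) * norm (VV False)"
 have C: "1 <= C" by (simp add: C_def)
 obtain dlt where dlt: "0 < dlt" "!!x. x : ?K ==> norm (x - 1) < dlt ==> EX Z:Lie ?K. norm Z < 1 / (4 * C) & exp Z = x"
  using exp_Lie_neighbourhood[OF K, of "1 / (4 * C)"] C by auto
 have "\<forall>\<^sub>F k in sequentially. norm (?rho (a k) - 1) < dlt" using tendstoD[OF lim dlt(1)] by (simp add: dist_norm)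
 moreover have "(%k. X /R real (Suc (r k))) ----> 0 *R X" using LIMSEQ_subseq_LIMSEQ[OF LIMSEQ_inverse_real_of_nat L(2)] by (intro tendsto_intros) (simp add: o_def)
 hence "\<forall>\<^sub>F k in sequentially. norm (X /R real (Suc (r k))) < 1/4" using tendstoD[of "%k. X /R real (Suc (r k))" 0 _ "1/4"] by simp
 ultimately have "\<forall>\<^sub>F k in sequentially. norm (?rho (a k) - 1) < dlt & norm (X /R real (Suc (r k))) < 1/4" by (rule eventually_conj)
 then obtain k where k: "norm (?rho (a k) - 1) < dlt" "norm (X /R real (Suc (r k))) < 1/4" using eventually_happens'[OF sequentially_bot] by blast
 obtain Z where Z: "Z : Lie ?K" "norm Z < 1 / (4 * C)" "exp Z = ?rho (a k)" using dlt(2)[OF _ k(1)] a by blast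
 have "norm (pr Z) <= C * norm Z"
 proof -
  have "norm (pr Z) <= norm (WW False) * norm Z * norm (VV False)"
   unfolding pr_def by (intro order_trans[OF norm_mult_ineq] mult_right_mono norm_mult_ineq norm_ge_zero)
  also have "... <= C * norm Z" by (simp add: C_def algebra_simps)
  finally show ?thesis .
 qed
 also have "... <= 1/4" using Z(2) C by (simp add: field_simps)
 finally have "norm (pr Z) <= 1/4" .
 moreover have "exp (pr Z) = exp (X /R real (Suc (r k)))" unfolding Lie_pr(2)[OF rho Z(1)] Z(3) by (simp add: rho0a)
 ultimately have "pr Z = X /R real (Suc (r k))" using exp_inj_small[of "pr Z" "X /R real (Suc (r k))"] k(2) by simp
 hence "pr (real (Suc (r k)) *R Z) = X" by (simp add: linear_scale[OF bounded_linear.linear[OF bounded_linear_pr]])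
 with Lie_scale[OF Z(1)] show ?thesis by (rule that)
qed

text \<open>
 Polynomial approximants of the maps \<open>f \<cdot> s\<close> join the projection to the constant map \<open>1\<close> by
 finitely many straight segments of invertible maps.
\<close>

lemma null_homotopy_chain:
 assumes rho0: "rep m rho0" and fc: "ctm (ptop T (top_of_set {0..1})) euclidean (%z. f (fst z) (snd z))"
  and f0: "!!g. g : cG ==> f g 0 = rho0 g" and f1: "!!g. g : cG ==> f g (1::real) = 1"
  and V: "subspace V" "closed V" "V <= Mat m"
  and fV: "!!g s. g : cG ==> s : {0..1} ==> f g s - 1 : V"
  and fI: "!!g s. g : cG ==> s : {0..1} ==> f g s : Inv bet" and bet: "0 < bet"
 obtains n1 rho1 where "rep n1 rho1" "joined (2 * max m n1) ((%g. dsum (rho0 g) (rho1 g)) ` cG) m V (2 * bet)"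
proof -
 let ?I = "top_of_set {0..1::real}"
 \<comment> \<open>An error of \<open>2 * eps\<close> times the bound \<open>bet\<close> on the
   inverses is then 1/2, the threshold of \<open>Inv_perturb\<close>.\<close>
 define eps where "eps = 1 / (4 * bet)"
 have eps: "0 < eps" using bet by (simp add: eps_def)
 obtain B where B: "!!p q. B p q : V" "!!A. A : V ==> A = (\<Sum>p<m. \<Sum>q<m. entry A p q *R B p q)" by (rule subspace_coordinates[OF V(1,3)]) blast
 define e' where "e' = eps / (2 * (1 + (\<Sum>p<m. \<Sum>q<m. norm (B p q))))"
 have e': "0 < e'" unfolding e'_def using eps by (intro divide_pos_pos mult_pos_pos add_pos_nonneg sum_nonneg) auto
 have mult: "ctm (ptop T T) T (%z. fst z ** snd z)" using continuous_mult by (simp add: case_prod_unfold)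
 have "ctm (ptop (ptop T ?I) T) (ptop T ?I) (%z. (fst (fst z) ** snd z, snd (fst z)))" unfolding continuous_map_paired
 proof
  have "ctm (ptop (ptop T ?I) T) (ptop T T) (%z. (fst (fst z), snd z))" unfolding continuous_map_paired
   using ctm_o[OF continuous_map_fst[of "ptop T ?I" T] continuous_map_fst[of T ?I]]
    continuous_map_snd[of "ptop T ?I" T] by (simp add: o_def)
  from ctm_o[OF this mult]
  show "ctm (ptop (ptop T ?I) T) T (%z. fst (fst z) ** snd z)" by (simp add: o_def)
  show "ctm (ptop (ptop T ?I) T) ?I (%z. snd (fst z))" using ctm_o[OF continuous_map_fst[of "ptop T ?I" T] continuous_map_snd[of T ?I]] by (simp add: o_def)
 qed
 from ctm_o[OF this fc]
 have F: "ctm (ptop (ptop T ?I) T) euclidean (%z. f (fst (fst z) ** snd z) (snd (fst z)))" (is "ctm _ _ ?F") by (simp add: o_def)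
 have cI: "compact_space ?I" by (simp add: compact_space_subtopology)
 have c2: "compact_space (ptop T ?I)" using compact cI by (simp add: compact_space_prod_topology)
 have "\<one> : tsp T" by simp
 obtain U where U: "openin T U" "\<one> : U"
  "!!x v. x : tsp (ptop T ?I) ==> v : U ==>
   dist (?F (x, v)) (?F (x, \<one>)) < e'" by (rule compact_uniform[OF c2 F `\<one> : tsp T` e']) blast
 \<comment> \<open>The kernel of \<open>rho1\<close> lies in \<open>U\<close>, and right translation
   by elements of \<open>U\<close> changes \<open>f\<close> by less than \<open>e'\<close> for all
   parameters; so \<open>f\<close> nearly factors through the block sum, uniformly along the
   homotopy.\<close>
 obtain n1 rho1 where rho1: "rep n1 rho1" "!!x. x : cG - U ==> rho1 x ~= 1" by (rule rep_cover[of "cG - U"]) (use U closedin_diff[OF closedin_topspace U(1)] in auto)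
 let ?rho = "%g. dsum (rho0 g) (rho1 g)"
 let ?K = "?rho ` cG"
 have r: "rep (2 * max m n1) ?rho" by (rule rep_dsum[OF rho0 rho1(1)])
 show ?thesis
 proof (rule that[OF rho1(1)], unfold joined_def, intro allI impI)
  fix d Y c and Phi :: "(op => op) => (nat => op => op) => real"
  assume a: "ALL i<d. Y i : Lie ?K" "ALL i<d. ALL j<d. Y i * Y j - Y j * Y i = (\<Sum>k<d. c i j k *R Y k)"
   "ALL g g1 g2 h h1 h2. segment (2 * max m n1) ?K d Y c m V g g1 g2 h h1 h2 (2 * bet) --> Phi g g1 = Phi h h1"
  note Y = a(1)[rule_format] and br = a(2)[rule_format] and Phi = a(3)[rule_format]
  define app where "app dlt s P P1 <-> (EX P2. C2 ?K d Y c P P1 P2) & (ALL x:?K. P x - 1 : V) &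
   (ALL g:cG. norm (P (?rho g) - f g s) <= dlt)" for dlt s P P1
  have app_mono: "app dlt s P P1 ==> dlt <= dlt' ==> app dlt' s P P1" for dlt dlt' s P P1 unfolding app_def by force
  have same: "Phi P P1 = Phi Q Q1" if s: "s : {0..1}" and P: "app (2 * eps) s P P1" and Q: "app (2 * eps) s Q Q1" for s P P1 Q Q1
  proof -
   obtain P2 Q2 where PQ: "C2 ?K d Y c P P1 P2" "C2 ?K d Y c Q Q1 Q2" using P Q by (auto simp: app_def)
   have "(1 - t) *R P x + t *R Q x : Inv (2 * bet)" if x: "x : ?K" and t: "t : {0..1}" for x t
   proof -
    obtain g where g: "g : cG" "x = ?rho g" using x by blast
    have "(1 - t) *R P x + t *R Q x - f g s = (1 - t) *R (P x - f g s) + t *R (Q x - f g s)" by (simp add: algebra_simps)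
    also have "norm ... <= (1 - t) * norm (P x - f g s) + t * norm (Q x - f g s)" using norm_triangle_ineq[of "(1 - t) *R (P x - f g s)" "t *R (Q x - f g s)"] t by simp
    also have "... <= (1 - t) * (2 * eps) + t * (2 * eps)" using P Q g t by (intro add_mono mult_left_mono) (auto simp: app_def)
    finally have "norm ((1 - t) *R P x + t *R Q x - f g s) <= 2 * eps" by (simp add: algebra_simps)
    hence "norm ((1 - t) *R P x + t *R Q x - f g s) * bet <= 2 * eps * bet" using bet by (simp add: mult_right_mono)
    also have "... = 1/2" using bet by (simp add: eps_def)
    finally show ?thesis using Inv_perturb[OF fI[OF g(1) s]] bet by simp
   qed
   hence "segment (2 * max m n1) ?K d Y c m V P P1 P2 Q Q1 Q2 (2 * bet)" using P Q by (intro segment.intro cmg_rep[OF r] Y PQ V) (auto simp: app_def)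
   thus ?thesis by (rule Phi)
  qed
  have "EX P P1. app eps s P P1" if s: "s : {0..1}" for s
  proof -
   have "ctm T (ptop T ?I) (%g. (g, s))" using s by (simp add: continuous_map_paired)
   from ctm_o[OF this fc] have fs: "ctm T euclidean (%g. f g s)" by (simp add: o_def)
   have "norm (f (g ** v) s - f g s) < eps / (2 * (1 + (\<Sum>p<m. \<Sum>q<m. norm (B p q))))"
    if gv: "g : cG" "v : cG" "?rho v = 1" for g v
   proof -
    have "rho1 v = 1" using gv(3) by (simp add: dsum_eq_1)
    hence "v : U" using rho1(2)[of v] gv by blast
    thus ?thesis using U(3)[of "(g, s)" v] gv s by (simp add: dist_norm e'_def)
   qed
   from polynomial_approximation[OF r br fs fV[OF _ s] B V(1) eps this]
   show ?thesis unfolding app_def using less_imp_le by blast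
  qed
  then obtain P P1 where P: "!!s. s : {0..1} ==> app eps s (P s) (P1 s)" by metis
  \<comment> \<open>The approximants \<open>P s\<close> are chosen independently of each other;
    their value under \<open>Phi\<close> is locally constant in \<open>s\<close>, hence constant on
    the connected interval.\<close>
  have "Phi (P 0) (P1 0) = Phi (P 1) (P1 1)"
  proof (rule connected_local_const[of "{0..1::real}" 0 1 "%s. Phi (P s) (P1 s)"])
   show "ALL s:{0..1}. \<forall>\<^sub>F t in at s within {0..1}. Phi (P s) (P1 s) = Phi (P t) (P1 t)"
   proof
    fix s :: real assume s: "s : {0..1}"
    hence "s : tsp ?I" by simp
    obtain W where W: "openin ?I W" "s : W" "!!x v. x : tsp T ==> v : W ==> dist ((%z. f (fst z) (snd z)) (x, v)) ((%z. f (fst z) (snd z)) (x, s)) < eps"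
     by (rule compact_uniform[OF compact fc `s : tsp ?I` eps]) blast
    have "Phi (P s) (P1 s) = Phi (P t) (P1 t)" if t: "t : W" for t
    proof (rule same[OF s])
     show "app (2 * eps) s (P s) (P1 s)" by (rule app_mono[OF P[OF s]]) (use eps in simp)
     have t1: "t : {0..1}" using openin_subset[OF W(1)] t by auto
     have "norm (P t (?rho g) - f g s) <= 2 * eps" if g: "g : cG" for g
     proof -
      have "norm (P t (?rho g) - f g t) <= eps" using P[OF t1] g by (simp add: app_def)
      moreover have "norm (f g t - f g s) < eps" using W(3)[OF _ t, of g] g by (simp add: dist_norm)
      ultimately show ?thesis using norm_triangle_ineq[of "P t (?rho g) - f g t" "f g t - f g s"] by simp
     qed
     thus "app (2 * eps) s (P t) (P1 t)" using P[OF t1] by (simp add: app_def)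
    qed
    moreover have "\<forall>\<^sub>F t in at s within {0..1}. t : W"
    proof -
     obtain S where "open S" "W = {0..1} Int S" using W(1) unfolding openin_open by blast
     thus ?thesis unfolding eventually_at_topological by (intro exI[of _ S]) (use W(2) in auto)
    qed
    ultimately show "\<forall>\<^sub>F t in at s within {0..1}. Phi (P s) (P1 s) = Phi (P t) (P1 t)" by (auto elim: eventually_mono)
   qed
  qed auto
  moreover have "Phi pr (%i x. pr (x * Y i)) = Phi (P 0) (P1 0)"
  proof (rule same[of 0])
   have "C2 ?K d Y c (%x. pr x) (%i x. pr (x * Y i)) (%i j x. pr (x * Y i * Y j))" by (rule C2_linear[OF bounded_linear_pr C2_id[OF br]])
   thus "app (2 * eps) 0 pr (%i x. pr (x * Y i))" unfolding app_def using eps fV[of _ 0] by (auto simp: f0)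
   show "app (2 * eps) 0 (P 0) (P1 0)" by (rule app_mono[OF P]) (use eps in auto)
  qed simp
  moreover have "Phi (P 1) (P1 1) = Phi (%_. 1) (%_ _. 0)"
  proof (rule same[of 1])
   show "app (2 * eps) 1 (%_. 1) (%_ _. 0)" unfolding app_def using eps subspace_0[OF V(1)] by (auto simp: f1 intro: C2_const)
   show "app (2 * eps) 1 (P 1) (P1 1)" by (rule app_mono[OF P]) (use eps in auto)
  qed simp
  ultimately show "Phi pr (%i x. pr (x * Y i)) = Phi (%_. 1) (%_ _. 0)" by simp
 qed
qed

end

section \<open>Vanishing of the Lie algebra of a contracted kernel\<close>

lemma bracket_in_closed_subspace:
 assumes S: "subspace S" "closed S" and Y: "(Y::op) : S" and Ad: "!!t. exp (t *R X) * Y * exp (- (t *R X)) : S"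
 shows "X * Y - Y * X : S"
proof (rule closed_sequentially[OF S(2)])
 let ?x = "%m. exp (X /R real (Suc m))" and ?y = "%m. exp ((- X) /R real (Suc m))"
 let ?f = "%m. real (Suc m) *R (?x m * Y * ?y m - Y)"
 show "?f m : S" for m using Ad[of "inverse (real (Suc m))"] by (intro subspace_scale[OF S(1)] subspace_diff[OF S(1)] Y) simp
 have "(%m. (real (Suc m) *R (?x m - 1)) * Y * ?y m + Y * (real (Suc m) *R (?y m - 1))) ----> X * Y * 1 + Y * (- X)"
  by (intro tendsto_intros exp_div_seq_tendsto_1 exp_derivative_seq)
 thus "?f ----> X * Y - Y * X" by (simp add: algebra_simps)
qed

context compact_group
begin

lemma ainv_rep: "rep n rho ==> x : cG ==> ainv (rho x) = rho (inv x)" by (rule ainv_eqI) (auto dest: rep_inverse)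

context
 fixes m rho0 and f :: "'a => real => op" and bet :: real
 assumes rho0: "rep m rho0" and fc: "ctm (ptop T (top_of_set {0..1})) euclidean (%z. f (fst z) (snd z))"
  and f0: "!!g. g : cG ==> f g 0 = rho0 g" and f1: "!!g. g : cG ==> f g 1 = 1"
  and fM: "!!g s. g : cG ==> s : {0..1} ==> f g s - 1 : Mat m"
  and fI: "!!g s. g : cG ==> s : {0..1} ==> f g s : Inv bet" and bet: "0 < bet"
begin

lemma pr_logarithmic_derivative:
 assumes "w : cG"
 shows "ainv (pr (dsum (rho0 w) (rho1 w))) * pr (dsum (rho0 w) (rho1 w) * Y) = pr Y"
 using assms by (simp add: pr_dsum_mult ainv_rep[OF rho0] mult.assoc[symmetric] rep_inverse[OF rho0])

lemma Lie_pr_span: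
 fixes Y :: "nat => op"
 assumes rho1: "rep n1 rho1" and X: "X : Lie (rho0 ` cG)"
  and Y: "!!X. X : Lie ((%g. dsum (rho0 g) (rho1 g)) ` cG) ==> X = (\<Sum>i<d. fip n X (Y i) *R Y i)"
 obtains a where "X = (\<Sum>i<d. a i *R pr (Y i))"
proof -
 obtain Z where Z: "Z : Lie ((%g. dsum (rho0 g) (rho1 g)) ` cG)" "pr Z = X" using Lie_pr_surjective[OF rho0 rho1 X] by blast
 interpret pr: bounded_linear pr by (rule bounded_linear_pr)
 have "X = (\<Sum>i<d. fip n Z (Y i) *R pr (Y i))" using arg_cong[OF Y[OF Z(1)], of pr] Z(2) by (simp add: pr.sum pr.scaleR)
 thus ?thesis by (rule that)
qed

text \<open>On the projection the mean of the degree-three form is the constant sum of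
  \<open>c i j k * tr m (x i * x j * x k)\<close>. This is half the sum of
  \<open>tr m (b i j * b i j)\<close>, that is, minus half the sum of the square norms of all
  brackets; on the constant map the mean is 0.\<close>

lemma Lie_abelian_if_null_homotopic:
 assumes X: "X : Lie (rho0 ` cG)" and Z: "Z : Lie (rho0 ` cG)"
 shows "X * Z = Z * X"
proof -
 obtain n1 rho1 where rho1: "rep n1 rho1"
  and chain: "joined (2 * max m n1) ((%g. dsum (rho0 g) (rho1 g)) ` cG) m (Mat m) (2 * bet)"
  using null_homotopy_chain[OF rho0 fc f0 f1 subspace_Mat closed_Mat order_refl fM fI bet] by blast
 let ?rho = "%g. dsum (rho0 g) (rho1 g)" and ?K = "(%g. dsum (rho0 g) (rho1 g)) ` cG"
 have r: "rep (2 * max m n1) ?rho" by (rule rep_dsum[OF rho0 rho1])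
 obtain d :: nat and Y :: "nat => op" and c :: "nat => nat => nat => real" where Y: "!!i. i < d ==> Y i : Lie ?K"
  and span: "!!X. X : Lie ?K ==> X = (\<Sum>i<d. fip (2 * max m n1) X (Y i) *R Y i)"
  and br: "!!i j. i < d ==> j < d ==> Y i * Y j - Y j * Y i = (\<Sum>k<d. c i j k *R Y k)"
  and c: "!!i j k. c j i k = - c i j k" "!!i j k. i < d ==> j < d ==> k < d ==> c i k j = - c i j k" by (rule Lie_basis[OF cmg_rep[OF r]]) blast
 interpret pr: bounded_linear pr by (rule bounded_linear_pr)
 define x where "x i = pr (Y i)" for i
 define b where "b i j = x i * x j - x j * x i" for i j
 have xL: "x i : Lie (rho0 ` cG)" if "i < d" for i unfolding x_def by (rule Lie_pr(3)[OF rho0 rho1 Y[OF that]])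
 have xx: "b i j = (\<Sum>k<d. c i j k *R x k)" if "i < d" "j < d" for i j using arg_cong[OF br[OF that], of pr] Lie_pr(1)[OF rho0 rho1 Y] that
  by (simp add: x_def b_def pr.diff pr.sum pr.scaleR pr_mult)
 have "mean (%w. \<Sum>i<d. \<Sum>j<d. \<Sum>k<d. c i j k * tr m ((ainv (pr (?rho w)) * pr (?rho w * Y i)) *
   (ainv (pr (?rho w)) * pr (?rho w * Y j)) * (ainv (pr (?rho w)) * pr (?rho w * Y k)))) =
  mean (%w. \<Sum>i<d. \<Sum>j<d. \<Sum>k<d. c i j k * tr m ((ainv (1::op) * 0) * (ainv (1::op) * 0) * (ainv (1::op) * 0)))"
  by (rule joinedD[OF chain Y br, where Phi = "%g g1. mean (%w. \<Sum>i<d. \<Sum>j<d. \<Sum>k<d. c i j k * tr m ((ainv (g (?rho w)) * g1 i (?rho w)) *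
   (ainv (g (?rho w)) * g1 j (?rho w)) * (ainv (g (?rho w)) * g1 k (?rho w))))"]) (assumption | rule form3_invariant[OF r _ c])+
 also have "... = 0" by (simp add: tr_def)
 also have "mean (%w. \<Sum>i<d. \<Sum>j<d. \<Sum>k<d. c i j k * tr m ((ainv (pr (?rho w)) * pr (?rho w * Y i)) *
   (ainv (pr (?rho w)) * pr (?rho w * Y j)) * (ainv (pr (?rho w)) * pr (?rho w * Y k)))) =
   mean (%w. \<Sum>i<d. \<Sum>j<d. \<Sum>k<d. c i j k * tr m (x i * x j * x k))" by (rule mean_cong) (simp only: pr_logarithmic_derivative x_def)
 also have "... = (\<Sum>i<d. \<Sum>j<d. tr m (x i * x j * b i j))" unfolding mean_const by (intro sum.cong refl) (simp add: xx sum_distrib_left)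
 finally have s: "(\<Sum>i<d. \<Sum>j<d. tr m (x i * x j * b i j)) = 0" .
 have "(\<Sum>i<d. \<Sum>j<d. tr m (x j * x i * b i j)) = (\<Sum>i<d. \<Sum>j<d. tr m (x i * x j * b j i))" by (rule sum.swap)
 also have "... = - (\<Sum>i<d. \<Sum>j<d. tr m (x i * x j * b i j))" unfolding sum_negf[symmetric] by (intro sum.cong refl) (simp add: b_def right_diff_distrib)
 finally have "(\<Sum>i<d. \<Sum>j<d. tr m (x i * x j * b i j)) - (\<Sum>i<d. \<Sum>j<d. tr m (x j * x i * b i j)) = 0" using s by simp
 moreover have bb: "tr m (b i j * b i j) = tr m (x i * x j * b i j) - tr m (x j * x i * b i j)" for i j by (subst (1) b_def) (simp add: left_diff_distrib)
 ultimately have "(\<Sum>i<d. \<Sum>j<d. tr m (b i j * b i j)) = 0" unfolding sum_subtractf[symmetric] by (simp only: bb)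
 moreover have bL: "b i j : Lie (rho0 ` cG)" if "i < d" "j < d" for i j unfolding b_def using that by (intro Lie_bracket[OF cmg_rep[OF rho0]] xL)
 hence bf: "tr m (b i j * b i j) = - fip m (b i j) (b i j)" if "i < d" "j < d" for i j
  using fip_skew[OF Lie_Mat[OF cmg_rep[OF rho0] bL[OF that]] Lie_skew[OF cmg_rep[OF rho0] bL[OF that]]] by simp
 ultimately have "(\<Sum>i<d. \<Sum>j<d. fip m (b i j) (b i j)) = 0" by (simp add: sum_negf)
 hence "fip m (b i j) (b i j) = 0" if "i < d" "j < d" for i j using that by (simp add: sum_nonneg_eq_0_iff sum_nonneg fip_nonneg)
 hence "b i j = 0" if "i < d" "j < d" for i j using fip_eq_0[OF Lie_Mat[OF cmg_rep[OF rho0] bL[OF that]]] that by blast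
 hence comm: "x i * x j = x j * x i" if "i < d" "j < d" for i j using that by (simp add: b_def)
 obtain a where a: "X = (\<Sum>i<d. a i *R x i)" unfolding x_def using Lie_pr_span[OF rho1 X span] by blast
 obtain a' where a': "Z = (\<Sum>i<d. a' i *R x i)" unfolding x_def using Lie_pr_span[OF rho1 Z span] by blast
 have "x i * Z = Z * x i" if "i < d" for i unfolding a' sum_distrib_left sum_distrib_right by (intro sum.cong refl) (simp add: comm that)
 thus ?thesis unfolding a sum_distrib_left sum_distrib_right by (intro sum.cong refl) simp
qed

text \<open>With \<open>V\<close> the centraliser of \<open>X\<close>, the degree-one form is
  \<open>tr m (X * pr (Y l))\<close> on the projection and 0 on the constant map. As the
  \<open>pr (Y l)\<close> span, \<open>tr m (X * X) = 0\<close>, and \<open>X\<close> is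
  skew.\<close>

lemma Lie_zero_if_centralising_null_homotopy:
 assumes X: "X : Lie (rho0 ` cG)" and comm: "!!g s. g : cG ==> s : {0..1} ==> f g s * X = X * f g s"
 shows "X = 0"
proof -
 define V where "V = {A : Mat m. A * X = X * A}"
 have XM: "X : Mat m" by (rule Lie_Mat[OF cmg_rep[OF rho0] X])
 have V: "subspace V" "closed V" "V <= Mat m" using subspace_Mat[of m] unfolding V_def by (auto simp: subspace_def algebra_simps Mat_add Mat_scale
    intro!: closed_Collect_conj closed_Collect_eq continuous_intros closed_Mat)
 have fV: "f g s - 1 : V" if "g : cG" "s : {0..1}" for g s using fM[OF that] comm[OF that] by (simp add: V_def algebra_simps)
 obtain n1 rho1 where rho1: "rep n1 rho1"
  and chain: "joined (2 * max m n1) ((%g. dsum (rho0 g) (rho1 g)) ` cG) m V (2 * bet)" using null_homotopy_chain[OF rho0 fc f0 f1 V fV fI bet] by blast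
 let ?rho = "%g. dsum (rho0 g) (rho1 g)" and ?K = "(%g. dsum (rho0 g) (rho1 g)) ` cG"
 have r: "rep (2 * max m n1) ?rho" by (rule rep_dsum[OF rho0 rho1])
 obtain d :: nat and Y :: "nat => op" and c :: "nat => nat => nat => real" where Y: "!!i. i < d ==> Y i : Lie ?K"
  and span: "!!X. X : Lie ?K ==> X = (\<Sum>i<d. fip (2 * max m n1) X (Y i) *R Y i)"
  and br: "!!i j. i < d ==> j < d ==> Y i * Y j - Y j * Y i = (\<Sum>k<d. c i j k *R Y k)" by (rule Lie_basis[OF cmg_rep[OF r]]) blast
 have "tr m (X * pr (Y l)) = 0" if l: "l < d" for l
 proof -
  have "mean (%w. tr m (X * (ainv (pr (?rho w)) * pr (?rho w * Y l)))) = mean (%w. tr m (X * (ainv (1::op) * 0)))"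
   by (rule joinedD[OF chain Y br, where Phi = "%g g1. mean (%w. tr m (X * (ainv (g (?rho w)) * g1 l (?rho w))))"])
    (assumption | rule form1_invariant[OF r _ l XM] | simp add: V_def)+
  also have "mean (%w. tr m (X * (ainv (pr (?rho w)) * pr (?rho w * Y l)))) = mean (%w. tr m (X * pr (Y l)))" by (rule mean_cong) (simp only: pr_logarithmic_derivative)
  finally show ?thesis by (simp add: tr_def)
 qed
 moreover obtain a where a: "X = (\<Sum>i<d. a i *R pr (Y i))" using Lie_pr_span[OF rho1 X span] by blast
 have "tr m (X * X) = (\<Sum>i<d. a i * tr m (X * pr (Y i)))" by (subst (2) a) (simp add: sum_distrib_left)
 ultimately have "tr m (X * X) = 0" by simp
 thus ?thesis using fip_skew[OF XM Lie_skew[OF cmg_rep[OF rho0] X]] fip_eq_0[OF XM] by simp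
qed

end

lemma compact_group_subgroup:
 assumes "subgroup N G" "closedin T N"
 shows "compact_group (G\<lparr>carrier := N\<rparr>) (subtop T N)"
proof -
 have Nc: "N <= cG" using subgroup.subset[OF assms(1)] .
 interpret H: group "G\<lparr>carrier := N\<rparr>" using subgroup.subgroup_is_group[OF assms(1) is_group] .
 have inv: "inv\<^bsub>G\<lparr>carrier := N\<rparr>\<^esub> x = inv x" if "x : N" for x by (rule m_inv_consistent[OF assms(1) that])
 show ?thesis
 proof
  show "tsp (subtop T N) = carrier (G\<lparr>carrier := N\<rparr>)" using Nc by auto
  have "ctm (subtop (ptop T T) (N \<times> N)) (subtop T N) (%(x, y). x ** y)" unfolding ctm_into
   using subgroup.m_closed[OF assms(1)] by (auto intro: continuous_map_from_subtopology[OF continuous_mult])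
  thus "ctm (ptop (subtop T N) (subtop T N)) (subtop T N) (%(x, y). x \<otimes>\<^bsub>G\<lparr>carrier := N\<rparr>\<^esub> y)" by (simp add: subtopology_Times)
  have "ctm (subtop T N) (subtop T N) (%x. inv x)" unfolding ctm_into
   using subgroup.m_inv_closed[OF assms(1)] by (auto intro: continuous_map_from_subtopology[OF continuous_inv])
  thus "ctm (subtop T N) (subtop T N) (%x. inv\<^bsub>G\<lparr>carrier := N\<rparr>\<^esub> x)" by (rule continuous_map_eq) (simp add: inv)
  show "compact_space (subtop T N)" using closedin_compact_space[OF compact assms(2)] by (simp add: compact_space_subtopology)
  show "Hausdorff_space (subtop T N)" by (rule Hausdorff_space_subtopology[OF Hausdorff])
 qed
qed

end

text \<open>The contraction takes place in \<open>G\<close>; the intermediate points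
  \<open>h x s\<close> need not lie in \<open>N\<close>.\<close>

locale null_homotopy = compact_group +
 fixes N :: "'a set" and h :: "'a => real => 'a"
 assumes nN: "normal N G" and cN: "closedin T N"
  and hc: "ctm (ptop (subtop T N) (top_of_set {0..1})) T (%z. h (fst z) (snd z))"
  and h0: "!!x. x : N ==> h x 0 = x" and h1: "!!x. x : N ==> h x 1 = \<one>"
begin

lemma sN: "subgroup N G" by (rule normal_imp_subgroup[OF nN])

lemma N_carrier: "x : N ==> x : cG" using subgroup.mem_carrier[OF sN] .

sublocale N: compact_group "G\<lparr>carrier := N\<rparr>" "subtop T N" by (rule compact_group_subgroup[OF sN cN])

lemma h_carrier: "x : N ==> s : {0..1} ==> h x s : cG" using continuous_map_image_subset_topspace[OF hc] N_carrier by force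

lemma continuous_map_rep_h:
 assumes "rep n rho"
 shows "ctm (ptop (subtop T N) (top_of_set {0..1})) euclidean (%z. rho (h (fst z) (snd z)))" using ctm_o[OF hc, of euclidean rho] assms by (simp add: o_def rep_def)

lemma continuous_on_rep_h:
 assumes "rep n rho" "x : N"
 shows "cton {0..1} (%s. rho (h x s))"
proof -
 have "ctm (top_of_set {0..1}) (ptop (subtop T N) (top_of_set {0..1::real})) (%s. (x, s))" using assms N_carrier by (simp add: continuous_map_paired)
 from ctm_o[OF this continuous_map_rep_h[OF assms(1)]] show ?thesis by (simp add: o_def)
qed

lemma Inv_rep: "rep n rho ==> EX bet>0. ALL g:cG. rho g : Inv bet"
proof -
 assume rho: "rep n rho"
 have "bounded (rho ` cG)" using cmg_rep[OF rho] by (simp add: cmg_def compact_imp_bounded)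
 then obtain b where "0 < b" "!!g. g : cG ==> norm (rho g) <= b" by (auto simp: bounded_pos)
 thus ?thesis using rep_inverse[OF rho] unfolding Inv_def by (intro exI[of _ b]) blast
qed

text \<open>Degree three makes this Lie algebra abelian. It is also an ideal in the Lie algebra of
  the whole image, hence central there, so its elements commute with all values of the homotopy and
  degree one applies.\<close>

lemma Lie_rep_N:
 assumes rho: "rep n rho"
 shows "Lie (rho ` N) = {0}"
proof -
 note K = cmg_rep[OF rho] and KN = cmg_rep_image[OF rho sN cN]
 have rhoN: "N.rep n rho" unfolding N.rep_def using rho N_carrier by (auto simp: rep_def m_inv_consistent[OF sN] intro: continuous_map_from_subtopology)
 obtain bet where bet: "0 < bet" "!!g. g : cG ==> rho g : Inv bet" using Inv_rep[OF rho] by blast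
 have abel: "X * Z = Z * X" if "X : Lie (rho ` N)" "Z : Lie (rho ` N)" for X Z by (rule N.Lie_abelian_if_null_homotopic[OF rhoN continuous_map_rep_h[OF rho], of bet])
   (use that bet rho h0 h1 h_carrier in "auto simp: rep_def")
 have ideal: "A * X * B : Lie (rho ` N)" if A: "A : rho ` cG" "A * B = 1" and X: "X : Lie (rho ` N)" for A B X
 proof -
  have BA: "B * A = 1" using cmg_inverse[OF K A] by simp
  obtain g where g: "g : cG" "A = rho g" using A(1) by blast
  have Bg: "B = rho (inv g)" using rep_inverse[OF rho g(1)] g(2) A(2) BA by (metis mult.assoc mult_1_left mult_1_right)
  have "exp (t *R (A * X * B)) : rho ` N" for t
  proof -
   have "(t *R (A * X * B)) * A = A * (t *R X)" by (simp add: mult.assoc BA)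
   hence "exp (t *R (A * X * B)) * A * B = A * exp (t *R X) * B" by (simp only: exp_intertwine)
   hence e: "exp (t *R (A * X * B)) = A * exp (t *R X) * B" by (simp add: mult.assoc A(2))
   obtain x where x: "x : N" "exp (t *R X) = rho x" using LieD[OF X, of t] by blast
   have "g ** x ** inv g : N" using normal.inv_op_closed2[OF nN g(1) x(1)] .
   moreover have "rho (g ** x ** inv g) = A * exp (t *R X) * B" using rho g(1) N_carrier[OF x(1)] unfolding x(2) g(2) Bg by (simp add: rep_def)
   ultimately show ?thesis unfolding e by (metis imageI)
  qed
  thus ?thesis by (simp add: Lie_def)
 qed
 \<comment> \<open>An abelian ideal is central: as \<open>B\<close> commutes with \<open>X\<close>,
   the trace of \<open>B * B\<close> vanishes by cyclicity, and \<open>B\<close> is skew.\<close>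
 have comm: "Y * X = X * Y" if X: "X : Lie (rho ` N)" and Y: "Y : Lie (rho ` cG)" for X Y
 proof -
  define B where "B = Y * X - X * Y"
  have BL: "B : Lie (rho ` N)" unfolding B_def by (rule bracket_in_closed_subspace[OF subspace_Lie[OF KN] closed_Lie[OF KN] X])
    (rule ideal[OF LieD[OF Y] exp_minus_cancel(1) X])
  have M: "B : Mat n" "X : Mat n" "Y : Mat n" using Lie_Mat[OF KN BL] Lie_Mat[OF KN X] Lie_Mat[OF K Y] .
  have "tr n (B * B) = tr n (Y * (X * B)) - tr n (X * (Y * B))" by (subst (1) B_def) (simp add: left_diff_distrib mult.assoc)
  also have "tr n (X * (Y * B)) = tr n (Y * (B * X))" using tr_commute[OF M(2), of "Y * B"] by (simp add: mult.assoc)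
  also have "B * X = X * B" by (rule abel[OF BL X])
  finally have "tr n (B * B) = 0" by simp
  hence "B = 0" using fip_skew[OF M(1) Lie_skew[OF KN BL]] fip_eq_0[OF M(1)] by simp
  thus ?thesis by (simp add: B_def)
 qed
 have "X = 0" if X: "X : Lie (rho ` N)" for X
 proof (rule N.Lie_zero_if_centralising_null_homotopy[OF rhoN continuous_map_rep_h[OF rho], of bet])
  obtain dlt where dlt: "0 < dlt" "!!g. g : rho ` cG ==> norm (g - 1) < dlt ==> EX Y:Lie (rho ` cG). norm Y < 1 & exp Y = g"
   using exp_Lie_neighbourhood[OF K, of 1] by auto
  have near: "A * X = X * A" if A: "A : rho ` cG" "norm (A - 1) < dlt" for A
  proof -
   obtain Y where Y: "Y : Lie (rho ` cG)" "exp Y = A" using dlt(2)[OF A] by blast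
   show ?thesis using exp_intertwine[OF comm[OF X Y(1)]] Y(2) by simp
  qed
  fix x s assume "x : carrier (G\<lparr>carrier := N\<rparr>)" and s: "s : {0..1::real}"
  hence x: "x : N" by simp
  let ?c = "%s. rho (h x s) * X = X * rho (h x s)"
  \<comment> \<open>For nearby parameters the values of \<open>rho (h x s)\<close> differ by a
    factor near 1, an exponential from the Lie algebra of the whole image, which commutes with
    \<open>X\<close>. So the truth value of \<open>?c\<close> is locally constant, and
    \<open>?c 1\<close> holds.\<close>
  have "?c s = ?c 1"
  proof (rule connected_local_const[of "{0..1::real}" s 1 ?c])
   show "ALL s:{0..1}. \<forall>\<^sub>F t in at s within {0..1}. ?c s = ?c t"
   proof
    fix s :: real assume s: "s : {0..1}"
    note hs = h_carrier[OF x s]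
    have "((%t. rho (h x t) * rho (inv h x s)) ---> rho (h x s) * rho (inv h x s)) (at s within {0..1})"
     using continuous_on_rep_h[OF rho x] s by (intro tendsto_intros) (simp add: continuous_on_def)
    from tendstoD[OF this dlt(1)] have "\<forall>\<^sub>F t in at s within {0..1}. norm (rho (h x t) * rho (inv h x s) - 1) < dlt"
     unfolding rep_inverse(2)[OF rho hs] by (simp add: dist_norm)
    moreover have "\<forall>\<^sub>F t in at s within {0..1}. t : {0..1}" by (simp add: eventually_at_filter)
    ultimately show "\<forall>\<^sub>F t in at s within {0..1}. ?c s = ?c t"
    proof eventually_elim
     fix t assume t: "norm (rho (h x t) * rho (inv h x s) - 1) < dlt" "t : {0..1}"
     define A where "A = rho (h x t) * rho (inv h x s)"
     have "A : rho ` cG" unfolding A_def using cmg_mult[OF K] h_carrier[OF x t(2)] hs by blast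
     from near[OF this] have AX: "A * X = X * A" using t(1) by (simp add: A_def)
     have "rho (h x t) = A * rho (h x s)" unfolding A_def using rep_inverse(1)[OF rho hs] by (simp add: mult.assoc)
     moreover have "rho (h x s) = rho (h x s) * rho (inv h x t) * rho (h x t)" using rep_inverse(1)[OF rho h_carrier[OF x t(2)]] by (simp add: mult.assoc)
     moreover have "rho (h x s) * rho (inv h x t) * A = 1" unfolding A_def using rep_inverse[OF rho h_carrier[OF x t(2)]] rep_inverse[OF rho hs]
      by (metis mult.assoc mult_1_left)
     ultimately show "?c s = ?c t" using AX by (metis mult.assoc mult_1_left)
    qed
   qed
  qed (use s in auto)
  also have "?c 1" using rho h1[OF x] by (simp add: rep_def)
  finally show "rho (h x s) * X = X * rho (h x s)" by simp
 qed (use X bet rho h0 h1 h_carrier in "auto simp: rep_def")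
 thus ?thesis using Lie_0[OF KN] by auto
qed

end

section \<open>Lifting paths and isolating 1 in the kernel\<close>

context compact_group
begin

lemma Lie_pr_bounded_below:
 assumes K: "cmg n K" and inj: "!!Y. Y : Lie K ==> pr Y = 0 ==> Y = 0"
 obtains b where "0 < b" "!!Y. Y : Lie K ==> norm Y <= b * norm (pr Y)"
proof -
 interpret pr: bounded_linear pr by (rule bounded_linear_pr)
 let ?S = "{Y : Lie K. norm Y = 1}"
 show ?thesis
 proof (cases "?S = {}")
  case True
  have "norm Y <= 1 * norm (pr Y)" if Y: "Y : Lie K" for Y
  proof (cases "Y = 0")
   case False
   hence "Y /R norm Y : ?S" using Lie_scale[OF Y] by simp
   thus ?thesis using True by blast
  qed simp
  thus ?thesis by (rule that[OF zero_less_one])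
 next
  case False
  have cl: "closed ?S" unfolding Collect_conj_eq Collect_mem_eq by (intro closed_Int closed_Lie[OF K] closed_Collect_eq continuous_intros)
  have "?S <= Mat n" "bounded ?S" using Lie_Mat[OF K] by (auto intro: boundedI[of _ 1])
  hence "compact ?S" using compact_Mat[OF _ cl] by blast
  moreover have "cton ?S (%Y. norm (pr Y))" by (intro continuous_on_norm pr.continuous_on continuous_on_id)
  ultimately obtain Z where Z: "Z : ?S" "!!Y. Y : ?S ==> norm (pr Z) <= norm (pr Y)" using continuous_attains_inf[OF _ False] by blast
  have p: "0 < norm (pr Z)" using inj[of Z] Z(1) by auto
  have "norm Y <= inverse (norm (pr Z)) * norm (pr Y)" if Y: "Y : Lie K" for Y
  proof (cases "Y = 0")
   case False
   hence "norm (pr Z) <= norm (pr (Y /R norm Y))" using Lie_scale[OF Y] by (intro Z(2)) simp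
   also have "... = norm (pr Y) / norm Y" by (simp add: pr.scaleR divide_inverse_commute)
   finally show ?thesis using p False by (simp add: field_simps)
  qed simp
  thus ?thesis using p by (intro that[of "inverse (norm (pr Z))"]) auto
 qed
qed

end

locale kernel_null_homotopy = null_homotopy +
 fixes n0 :: nat and sg :: "'a => op"
 assumes sg: "rep n0 sg" and N: "N = {g : cG. sg g = 1}" and h_one: "!!s. s : {0..1} ==> h \<one> s = \<one>"
begin

text \<open>If \<open>pr Y = 0\<close>, the one-parameter group of \<open>Y\<close> consists of
  images of elements of the kernel \<open>N\<close>, whose image has Lie algebra 0 by
  \<open>Lie_rep_N\<close>.\<close>

lemma Lie_pr_inj:
 assumes rho1: "rep n1 rho1" and Y: "Y : Lie ((%g. dsum (sg g) (rho1 g)) ` cG)" and 0: "pr Y = 0"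
 shows "Y = 0"
proof -
 have "exp (t *R Y) : (%g. dsum (sg g) (rho1 g)) ` N" for t
 proof -
  obtain g where g: "g : cG" "exp (t *R Y) = dsum (sg g) (rho1 g)" using LieD[OF Y, of t] by blast
  have "sg g = exp (pr (t *R Y))" using Lie_pr(2)[OF sg rho1 Lie_scale[OF Y]] g by simp
  also have "pr (t *R Y) = 0" using 0 by (simp add: pr_def)
  finally show ?thesis using g N by auto
 qed
 thus ?thesis using Lie_rep_N[OF rep_dsum[OF sg rho1]] by (auto simp: Lie_def)
qed

text \<open>
 Near \<open>1\<close>, the inverse of \<open>pr\<close> on Lie algebras lifts a path in the image of \<open>sg\<close> to a path in the
 image of \<open>dsum sg rho1\<close>; the quotient of \<open>h x\<close> by the lift is a path in the discrete group
 \<open>dsum sg rho1 ` N\<close>.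
\<close>

lemma rep_trivial_near_one:
 assumes rho1: "rep n1 rho1" and x: "x : N"
  and small: "!!s. s : {0..1} ==> EX X:Lie (sg ` cG). norm X < 1/4 & exp X = sg (h x s)"
 shows "rho1 x = 1"
proof -
 let ?rho = "%g. dsum (sg g) (rho1 g)"
 let ?K = "?rho ` cG"
 have r: "rep (2 * max n0 n1) ?rho" by (rule rep_dsum[OF sg rho1])
 note K = cmg_rep[OF r] and KN = cmg_rep_image[OF r sN cN]
 obtain X where X: "!!s. s : {0..1} ==> X s : Lie (sg ` cG)" "!!s. s : {0..1} ==> norm (X s) < 1/4"
  "!!s. s : {0..1} ==> exp (X s) = sg (h x s)" using small by metis
 have "EX Y. Y : Lie ?K & pr Y = X s" if "s : {0..1}" for s using Lie_pr_surjective[OF sg rho1 X(1)[OF that]] by blast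
 then obtain Y where Y: "!!s. s : {0..1} ==> Y s : Lie ?K" "!!s. s : {0..1} ==> pr (Y s) = X s" by metis
 obtain b where b: "0 < b" "!!Y. Y : Lie ?K ==> norm Y <= b * norm (pr Y)" using Lie_pr_bounded_below[OF K Lie_pr_inj[OF rho1]] by blast
 \<comment> \<open>Continuity of the lift: \<open>exp\<close> has a Lipschitz inverse near 0, and
   \<open>pr\<close> is bounded below on the Lie algebra by injectivity and compactness of the unit
   sphere.\<close>
 have Yc: "(Y ---> Y s) (at s within {0..1})" if s: "s : {0..1}" for s
 proof (rule LIM_zero_cancel, rule Lim_null_comparison)
  show "\<forall>\<^sub>F t in at s within {0..1}. norm (Y t - Y s) <= b * (2 * norm (sg (h x t) - sg (h x s)))" unfolding eventually_at_filter
  proof (intro always_eventually allI impI)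
   fix t :: real assume t: "t : {0..1}"
   have "norm (Y t - Y s) <= b * norm (pr (Y t - Y s))" by (rule b(2)[OF Lie_diff[OF K Y(1)[OF t] Y(1)[OF s]]])
   also have "pr (Y t - Y s) = X t - X s" using Y(2)[OF t] Y(2)[OF s] by (simp add: pr_def algebra_simps)
   also have "norm (X t - X s) <= 2 * norm (exp (X t) - exp (X s))" by (rule exp_inj_small) (use X(2)[OF t] X(2)[OF s] in auto)
   finally show "norm (Y t - Y s) <= b * (2 * norm (sg (h x t) - sg (h x s)))" using b(1) X(3) s t by simp
  qed
  have "((%t. sg (h x t)) ---> sg (h x s)) (at s within {0..1})" using continuous_on_rep_h[OF sg x] s by (simp add: continuous_on_def)
  hence "((%t. b * (2 * norm (sg (h x t) - sg (h x s)))) ---> b * (2 * norm (sg (h x s) - sg (h x s)))) (at s within {0..1})" by (intro tendsto_intros)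
  thus "((%t. b * (2 * norm (sg (h x t) - sg (h x s)))) ---> 0) (at s within {0..1})" by simp
 qed
 define c where "c s = ?rho (h x s) * exp (- Y s)" for s
 have cN: "c s : ?rho ` N" if s: "s : {0..1}" for s
 proof -
  have "c s : ?K" unfolding c_def using cmg_mult[OF K _ LieD1[OF Lie_minus[OF Y(1)[OF s]]]] h_carrier[OF x s] by blast
  then obtain g where g: "g : cG" "c s = ?rho g" by blast
  have "sg g = pr (c s)" using g by simp
  also have "... = sg (h x s) * pr (exp (- Y s))" by (simp add: c_def pr_dsum_mult)
  also have "pr (exp (- Y s)) = exp (pr (- Y s))" using Lie_pr(2)[OF sg rho1 Lie_minus[OF Y(1)[OF s]]] by simp
  also have "pr (- Y s) = - X s" using Y(2)[OF s] by (simp add: pr_def)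
  finally have "sg g = 1" using X(3)[OF s] by (metis exp_minus_cancel(1))
  thus ?thesis using g N by blast
 qed
 obtain dlt where dlt0: "0 < dlt" "!!A. A : ?rho ` N ==> norm (A - 1) < dlt ==> EX Y:Lie (?rho ` N). norm Y < 1 & exp Y = A"
  using exp_Lie_neighbourhood[OF KN, of 1] by auto
 have dlt: "0 < dlt" "A = 1" if "A : ?rho ` N" "norm (A - 1) < dlt" for A using dlt0(1) dlt0(2)[OF that] unfolding Lie_rep_N[OF r] by auto
 have "c 0 = c 1"
 proof (rule connected_local_const[of "{0..1::real}" 0 1 c])
  show "ALL s:{0..1}. \<forall>\<^sub>F t in at s within {0..1}. c s = c t"
  proof
   fix s :: real assume s: "s : {0..1}"
   obtain B where B: "B : ?rho ` N" "c s * B = 1" "B * c s = 1" using KN cN[OF s] unfolding cmg_def by meson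
   have "((%t. c t * B) ---> c s * B) (at s within {0..1})" unfolding c_def using continuous_on_rep_h[OF r x] s
    by (intro tendsto_intros tendsto_exp_algebra Yc) (simp_all add: continuous_on_def)
   from tendstoD[OF this dlt0(1)] have "\<forall>\<^sub>F t in at s within {0..1}. norm (c t * B - 1) < dlt" unfolding B(2) by (simp add: dist_norm)
   moreover have "\<forall>\<^sub>F t in at s within {0..1}. t : {0..1}" by (simp add: eventually_at_filter)
   ultimately show "\<forall>\<^sub>F t in at s within {0..1}. c s = c t"
   proof eventually_elim
    fix t assume t: "norm (c t * B - 1) < dlt" "t : {0..1}"
    have "c t * B = 1" by (rule dlt(2)[OF cmg_mult[OF KN cN[OF t(2)] B(1)] t(1)])
    thus "c s = c t" using B(3) by (metis mult.assoc mult_1_left mult_1_right)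
   qed
  qed
 qed auto
 \<comment> \<open>At both ends the path lies in the kernel of \<open>sg\<close>, so the lift is 0
   there, and equality of the ends of \<open>c\<close> says that the block sum is 1 at
   \<open>x\<close>.\<close>
 moreover have Y0: "Y s = 0" if s: "s : {0..1}" "sg (h x s) = 1" for s
 proof -
  have "X s = 0" using exp_inj_small[of "X s" 0] X(2,3)[OF s(1)] s(2) by simp
  thus ?thesis using Lie_pr_inj[OF rho1 Y(1)[OF s(1)]] Y(2)[OF s(1)] by simp
 qed
 have "c 1 = 1" using Y0[of 1] h1[OF x] sg rho1 by (simp add: c_def rep_def dsum_1)
 moreover have "c 0 = ?rho x" using Y0[of 0] h0[OF x] x N by (simp add: c_def)
 ultimately show ?thesis by (simp add: dsum_eq_1)
qed

text \<open>The neighbourhood \<open>U\<close> depends on \<open>sg\<close> alone, and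
  \<open>rep_trivial_near_one\<close> makes every further representation trivial on it. By
  Peter-Weyl it is the single point \<open>\<one>\<close>, and one representation nontrivial on the
  rest of \<open>N\<close> completes \<open>sg\<close> to a faithful one.\<close>

lemma faithful_rep_exists: "EX n rho. rep n rho & faithful rho"
proof -
 let ?I = "top_of_set {0..1::real}"
 obtain dlt where dlt: "0 < dlt" "!!g. g : sg ` cG ==> norm (g - 1) < dlt ==> EX X:Lie (sg ` cG). norm X < 1/4 & exp X = g"
  using exp_Lie_neighbourhood[OF cmg_rep[OF sg], of "1/4"] by auto
 have one: "\<one> : N" by (rule subgroup.one_closed[OF sN])
 have "ctm (ptop ?I (subtop T N)) (ptop (subtop T N) ?I) (%z. (snd z, fst z))" by (simp add: continuous_map_paired continuous_map_fst continuous_map_snd)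
 from ctm_o[OF this continuous_map_rep_h[OF sg]]
 have F: "ctm (ptop ?I (subtop T N)) euclidean (%z. sg (h (snd z) (fst z)))" (is "ctm _ _ ?F") by (simp add: o_def)
 have cI: "compact_space ?I" by (simp add: compact_space_subtopology)
 have "\<one> : tsp (subtop T N)" using one by simp
 obtain U where U: "openin (subtop T N) U" "\<one> : U"
  "!!s x. s : tsp ?I ==> x : U ==> dist (?F (s, x)) (?F (s, \<one>)) < dlt" by (rule compact_uniform[OF cI F `\<one> : tsp (subtop T N)` dlt(1)]) blast
 have UN: "x : N" if "x : U" for x using openin_subset[OF U(1)] that by auto
 have U1: "x = \<one>" if x: "x : U" for x
 proof (rule ccontr)
  assume "x ~= \<one>"
  then obtain n1 rho1 where rho1: "rep n1 rho1" "rho1 x ~= 1" using Peter_Weyl[of x] N_carrier[OF UN[OF x]] by blast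
  have "EX X:Lie (sg ` cG). norm X < 1/4 & exp X = sg (h x s)" if s: "s : {0..1}" for s
  proof (rule dlt(2))
   show "sg (h x s) : sg ` cG" using h_carrier[OF UN[OF x] s] by blast
   show "norm (sg (h x s) - 1) < dlt" using U(3)[OF _ x, of s] s h_one[OF s] sg by (simp add: dist_norm rep_def)
  qed
  from rep_trivial_near_one[OF rho1(1) UN[OF x] this] rho1(2) show False by simp
 qed
 obtain W where W: "openin T W" "U = W Int N" using U(1) by (auto simp: openin_subtopology)
 have "closedin T (N - W)" by (rule closedin_diff[OF cN W(1)])
 moreover have "\<one> \<notin> N - W" using W U(2) by blast
 ultimately obtain n1 rho1 where rho1: "rep n1 rho1" "!!x. x : N - W ==> rho1 x ~= 1" by (rule rep_cover) blast
 have "faithful (%g. dsum (sg g) (rho1 g))" unfolding faithful_def dsum_eq_1 using rho1(2) U1 W(2) N by blast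
 thus ?thesis using rep_dsum[OF sg rho1(1)] by blast
qed

end

section \<open>The test space: a product of joins\<close>

lemma group_action_restrict:
 assumes "group G" and cl: "!!g x. g : carrier G ==> x : S ==> psi g x : S"
  and one: "!!x. x : S ==> psi \<one>\<^bsub>G\<^esub> x = x"
  and comp: "!!g h x. g : carrier G ==> h : carrier G ==> x : S ==> psi (g \<otimes>\<^bsub>G\<^esub> h) x = psi g (psi h x)"
 shows "group_action G S (%g. restrict (psi g) S)"
proof -
 interpret group G by fact
 have bij: "restrict (psi g) S : Bij S" if g: "g : carrier G" for g
 proof -
  have "psi (inv\<^bsub>G\<^esub> g) (psi g x) = x" "psi g (psi (inv\<^bsub>G\<^esub> g) x) = x" if "x : S" for x
   using comp[of "inv\<^bsub>G\<^esub> g" g x] comp[of g "inv\<^bsub>G\<^esub> g" x] g that one by simp_all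
  hence "bij_betw (psi g) S S" by (intro bij_betw_byWitness[where f' = "psi (inv\<^bsub>G\<^esub> g)"]) (use g cl in auto)
  thus ?thesis by (simp add: Bij_def)
 qed
 have "(%g. restrict (psi g) S) : hom G (BijGroup S)" by (rule homI) (simp_all add: BijGroup_def bij compose_def comp cl fun_eq_iff)
 thus ?thesis by (simp add: group_action_def group_hom_def group_hom_axioms_def group_BijGroup is_group)
qed

definition local_slice :: "('a, 'm) monoid_scheme => 'a topology => 'x topology => ('a => 'x => 'x) => 'x => bool" where
 "local_slice G T X phi x <-> (EX P kap. openin X P & x : P & ctm (subtop X P) T kap &
  (ALL g:carrier G. ALL y:P. phi g y : P & kap (phi g y) = g \<otimes>\<^bsub>G\<^esub> kap y))"

context compact_group
begin

text \<open>A compact free \<open>G\<close>-space that injects into the type of the hypothesis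
  inherits its slices, by transport of topology and action along the injection.\<close>

lemma local_slice_transport:
 fixes X :: "'z topology" and iot :: "'z => 'y"
 assumes slice: "!!(Y :: 'y topology) phi y. compact_space Y ==> Hausdorff_space Y ==> continuous_action G T Y phi ==>
   free_action G Y phi ==> y : tsp Y ==> local_slice G T Y phi y"
  and X: "compact_space X" "Hausdorff_space X" and iot: "inj_on iot (tsp X)"
  and psi: "ctm (ptop T X) X (%z. psi (fst z) (snd z))" "!!x. x : tsp X ==> psi \<one> x = x"
   "!!g h x. g : cG ==> h : cG ==> x : tsp X ==> psi (g ** h) x = psi g (psi h x)"
  and free: "!!g x. g : cG ==> x : tsp X ==> psi g x = x ==> g = \<one>" and x0: "x0 : tsp X"
 shows "local_slice G T X psi x0"
proof -
 define Y where "Y = quotient_topology X iot"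

 have cl: "psi g x : tsp X" if "g : cG" "x : tsp X" for g x using continuous_map_image_subset_topspace[OF psi(1)] that by force
 have hm: "homeomorphic_map X Y iot" unfolding homeomorphic_map_def Y_def using quotient_map_quotient_topology iot by blast
 have tY: "tsp Y = iot ` tsp X" by (simp add: Y_def)
 obtain j where cj: "ctm Y X j" and j: "!!x. x : tsp X ==> j (iot x) = x" using hm unfolding homeomorphic_map_maps homeomorphic_maps_def by blast
 have ciot: "ctm X Y iot" by (rule homeomorphic_imp_continuous_map[OF hm])
 have sp: "X homeomorphic_space Y" by (rule homeomorphic_map_imp_homeomorphic_space[OF hm])
 define phi where "phi g = restrict (%y. iot (psi g (j y))) (tsp Y)" for g
 have ga: "group_action G (tsp Y) phi" unfolding phi_def[abs_def] by (rule group_action_restrict) (auto simp: tY j psi cl is_group)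
 have "ctm (ptop T Y) (ptop T X) (%z. (fst z, j (snd z)))" using ctm_o[OF continuous_map_snd cj, of T] by (simp add: continuous_map_paired continuous_map_fst o_def)
 from ctm_o[OF ctm_o[OF this psi(1)] ciot]
 have "ctm (ptop T Y) Y (%(g, y). phi g y)" by (rule continuous_map_eq) (auto simp: phi_def)
 hence act: "continuous_action G T Y phi" using ga by (simp add: continuous_action_def)
 have fr: "free_action G Y phi" unfolding free_action_def stabilizer_def tY using psi(2) free by (auto simp: phi_def tY j cl inj_on_eq_iff[OF iot])
 have "local_slice G T Y phi (iot x0)" using slice[OF _ _ act fr] X x0 homeomorphic_compact_space[OF sp] homeomorphic_Hausdorff_space[OF sp] by (simp add: tY)
 then obtain P kap where P: "openin Y P" "iot x0 : P" "ctm (subtop Y P) T kap"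
  "!!g y. g : cG ==> y : P ==> phi g y : P & kap (phi g y) = g ** kap y" unfolding local_slice_def by blast
 let ?Q = "{x : tsp X. iot x : P}"
 have "ctm (subtop X ?Q) (subtop Y P) iot" using continuous_map_from_subtopology[OF ciot] by (auto simp: ctm_into)
 from ctm_o[OF this P(3)] have "ctm (subtop X ?Q) T (%x. kap (iot x))" by (simp add: o_def)
 moreover have "psi g y : ?Q & kap (iot (psi g y)) = g ** kap (iot y)" if "g : cG" "y : ?Q" for g y
  using P(4)[OF that(1), of "iot y"] that by (simp add: phi_def tY j cl)
 ultimately show ?thesis unfolding local_slice_def using open_vim[OF ciot P(1)] x0 P(2) by (intro exI[of _ ?Q] exI[of _ "%x. kap (iot x)"]) blast
qed

lemma rep_common_kernel:
 assumes "finite F" "!!K. K : F ==> rep (n K) (rho K)"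
 shows "EX m sg. rep m sg & (ALL g. sg g = 1 <-> (ALL K:F. rho K g = (1::op)))" using assms
proof induction
 case empty
 show ?case using rep_trivial by auto
next
 case (insert K F)
 then obtain m sg where sg: "rep m sg" "ALL g. sg g = 1 <-> (ALL K:F. rho K g = 1)" by auto
 have "rep (2 * max (n K) m) (%x. dsum (rho K x) (sg x))" by (rule rep_dsum[OF _ sg(1)]) (simp add: insert)
 thus ?case using sg(2) dsum_eq_1 by (intro exI conjI) auto
qed

lemma kernel_normal_closed:
 assumes rho: "rep n rho"
 shows "normal {g : cG. rho g = 1} G" "closedin T {g : cG. rho g = 1}"
proof -
 have "rho (inv x) = 1" if "x : cG" "rho x = 1" for x using rep_inverse(1)[OF rho that(1)] that(2) by simp
 hence "subgroup {g : cG. rho g = 1} G" using rho by unfold_locales (auto simp: rep_def)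
 thus "normal {g : cG. rho g = 1} G" using rho rep_inverse(2)[OF rho] by (simp add: normal_inv_iff rep_def)
 show "closedin T {g : cG. rho g = 1}" using closedin_subset_preimage[of rho "{1}"] rho by (simp add: rep_def)
qed

end

lemma Pr_Mat: "Pr n : Mat n" using E_in_Mat unfolding Pr_def by (intro Mat_sum) auto

lemma real_eq_if_same_rationals_above:
 assumes "!!q::rat. x < of_rat q <-> y < (of_rat q :: real)"
 shows "x = y"
proof (rule ccontr)
 assume "x ~= y"
 then obtain q :: rat where "x < of_rat q & of_rat q < y \<or> y < of_rat q & of_rat q < x"
  using of_rat_dense[of x y] of_rat_dense[of y x] by (cases x y rule: linorder_cases) auto
 thus False using assms[of q] by auto
qed

text \<open>An infinite cardinal absorbs a countable factor; this codes an index together with a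
  rational cut of one matrix entry as a single set.\<close>

lemma injection_into_set_type:
 assumes "infinite (UNIV :: 'a set)"
 obtains e :: "'a set \<times> nat => 'a set" where "inj e"
proof -
 have "infinite (UNIV :: 'a set set)" using assms by (simp add: Finite_Set.finite_set)
 note card_of_Times_infinite_simps(1)[OF this UNIV_not_empty iffD1[OF infinite_iff_card_of_nat this]]
 thus ?thesis using that unfolding card_of_ordIso[symmetric] bij_betw_def UNIV_Times_UNIV by blast
qed

context compact_group
begin

context
 fixes KK :: "'a set set" and n :: "'a set => nat" and rho :: "'a set => 'a => op"
 assumes rep: "!!K. K : KK ==> rep (n K) (rho K)"
  and separating: "!!g. g : cG ==> (!!K. K : KK ==> rho K g = 1) ==> g = \<one>"
begin

text \<open>The join of two copies of \<open>rho K ` carrier G\<close>.\<close>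

definition jpt :: "'a set => real => 'a => 'a => op \<times> op" where
 "jpt K t x y = ((1 - t) *R (rho K x * Pr (n K)), t *R (rho K y * Pr (n K)))"

definition join :: "'a set => (op \<times> op) set" where
 "join K = {jpt K t x y |t x y. t : {0..1} & x : cG & y : cG}"

definition jact :: "'a set => 'a => op \<times> op => op \<times> op" where
 "jact K g z = (rho K g * fst z, rho K g * snd z)"

definition joins :: "('a set => op \<times> op) topology" where
 "joins = product_topology (%K. top_of_set (join K)) KK"

definition jacts :: "'a => ('a set => op \<times> op) => 'a set => op \<times> op" where
 "jacts g z = (\<lambda>K\<in>KK. jact K g (z K))"

lemma topspace_joins: "tsp joins = PiE KK join" by (simp add: joins_def)

lemma jact_jpt: "K : KK ==> g : cG ==> x : cG ==> y : cG ==> jact K g (jpt K t x y) = jpt K t (g ** x) (g ** y)"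
 using rep[of K] by (simp add: jact_def jpt_def rep_def mult.assoc)

lemma jpt_join: "t : {0..1} ==> x : cG ==> y : cG ==> jpt K t x y : join K" unfolding join_def by blast

lemma jact_join: "K : KK ==> g : cG ==> z : join K ==> jact K g z : join K" unfolding join_def by (auto simp: jact_jpt) blast

lemma continuous_map_jpt:
 assumes "K : KK" "ctm Z euclideanreal t" "ctm Z T x" "ctm Z T y"
 shows "ctm Z euclidean (%z. jpt K (t z) (x z) (y z))"
proof -
 have c: "ctm Z euclidean (%z. rho K (u z))" if "ctm Z T u" for u using ctm_o[OF that, of euclidean "rho K"] rep[OF assms(1)] by (simp add: rep_def o_def)
 have eq: "(euclidean :: (op \<times> op) topology) = ptop euclidean euclidean" by simp
 show ?thesis unfolding jpt_def eq continuous_map_paired by (intro conjI continuous_map_binop[OF assms(2) c[OF assms(3)], of "%t A. (1 - t) *R (A * Pr (n K))"]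
    continuous_map_binop[OF assms(2) c[OF assms(4)], of "%t A. t *R (A * Pr (n K))"] continuous_intros)
qed

lemma compact_join:
 assumes "K : KK"
 shows "compact (join K)"
proof -
 let ?Z = "ptop (top_of_set {0..1::real}) (ptop T T)"
 have fst: "ctm ?Z (top_of_set {0..1::real}) fst" and snd: "ctm ?Z (ptop T T) snd" by (rule continuous_map_fst continuous_map_snd)+
 have "ctm ?Z euclidean (%z. jpt K (fst z) (fst (snd z)) (snd (snd z)))" using ctm_o[OF snd continuous_map_fst] ctm_o[OF snd continuous_map_snd] fst
  by (intro continuous_map_jpt[OF assms]) (simp_all add: o_def ctm_into)
 moreover have "compactin ?Z (tsp ?Z)" using compact unfolding compact_space_def[symmetric] compact_space_prod_topology by (simp add: compact_space_subtopology)
 ultimately have "compact ((%z. jpt K (fst z) (fst (snd z)) (snd (snd z))) ` tsp ?Z)" using image_compactin by fastforce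
 also have "(%z. jpt K (fst z) (fst (snd z)) (snd (snd z))) ` tsp ?Z = join K" by (force simp: join_def)
 finally show ?thesis .
qed

lemma joins_space: "compact_space joins" "Hausdorff_space joins" unfolding joins_def compact_space_product_topology Hausdorff_space_product_topology
 using compact_join by (auto simp: compact_space_subtopology Hausdorff_space_subtopology)

text \<open>Freeness: a point of a join has a component that is a nonzero multiple of some
  \<open>rho K w * Pr (n K)\<close>. If \<open>g\<close> fixes it, cancelling \<open>rho K w\<close>
  gives \<open>rho K g = 1\<close>; this for all \<open>K\<close> forces \<open>g = \<one>\<close>
  by \<open>separating\<close>.\<close>

lemma joins_action:
 shows "ctm (ptop T joins) joins (%z. jacts (fst z) (snd z))"
  and "x : tsp joins ==> jacts \<one> x = x"
  and "g : cG ==> h : cG ==> x : tsp joins ==> jacts (g ** h) x = jacts g (jacts h x)"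
  and "g : cG ==> x : tsp joins ==> jacts g x = x ==> g = \<one>"
proof -
 show "ctm (ptop T joins) joins (%z. jacts (fst z) (snd z))" unfolding joins_def continuous_map_componentwise
 proof (intro conjI ballI)
  show "(%z. jacts (fst z) (snd z)) ` tsp (ptop T (product_topology (%K. top_of_set (join K)) KK)) <= extensional KK" by (auto simp: jacts_def)
  fix K assume K: "K : KK"
  let ?J = "product_topology (%K. top_of_set (join K)) KK"
  let ?Z = "ptop T ?J"
  have 1: "ctm ?Z euclidean (%z. rho K (fst z))" using ctm_o[OF continuous_map_fst[of T ?J], of euclidean "rho K"] rep[OF K] by (simp add: rep_def o_def)
  have "ctm ?Z (top_of_set (join K)) (%z. snd z K)" using ctm_o[OF continuous_map_snd[of T ?J] continuous_map_product_projection[OF K]] by (simp add: o_def)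
  hence 2: "ctm ?Z euclidean (%z. snd z K)" by (simp add: ctm_into)
  have "ctm ?Z euclidean (%z. jact K (fst z) (snd z K))"
   unfolding jact_def by (rule continuous_map_binop[OF 1 2, of "%A w. (A * fst w, A * snd w)"]) (intro continuous_intros)
  thus "ctm ?Z (top_of_set (join K)) (%z. jacts (fst z) (snd z) K)" using K by (auto simp: jacts_def ctm_into jact_join PiE_iff)
 qed
 show "jacts \<one> x = x" if "x : tsp joins" using that rep by (auto simp: jacts_def jact_def topspace_joins PiE_iff extensional_def rep_def fun_eq_iff)
 show "jacts (g ** h) x = jacts g (jacts h x)" if "g : cG" "h : cG" "x : tsp joins" using that rep by (auto simp: jacts_def jact_def rep_def fun_eq_iff mult.assoc)
 assume g: "g : cG" and x: "x : tsp joins" and fx: "jacts g x = x"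
 show "g = \<one>"
 proof (rule separating[OF g])
  fix K assume K: "K : KK"
  note r = rep[OF K]
  obtain t u v where t: "u : cG" "v : cG" "x K = jpt K t u v" using x K by (auto simp: topspace_joins join_def PiE_iff)
  have "jact K g (x K) = x K" using fun_cong[OF fx, of K] K by (simp add: jacts_def)
  hence e: "(1 - t) *R (rho K g * (rho K u * Pr (n K)) - rho K u * Pr (n K)) = 0" "t *R (rho K g * (rho K v * Pr (n K)) - rho K v * Pr (n K)) = 0"
   unfolding t(3) jpt_def jact_def by (simp_all add: right_diff_distrib scaleR_diff_right)
  have "EX w:cG. rho K g * (rho K w * Pr (n K)) = rho K w * Pr (n K)"
  proof (cases "t = 0")
   case True
   thus ?thesis using e(1) t(1) by auto
  qed (use e(2) t(2) in auto)
  then obtain w where w: "w : cG" "(rho K g - 1) * (rho K w * Pr (n K)) = 0" by (auto simp: left_diff_distrib)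
  define D where "D = rho K g - 1"
  have D: "D : Mat (n K)" "rho K w - 1 : Mat (n K)" using r g w(1) by (auto simp: rep_def D_def)
  have "D * rho K w = D + D * (rho K w - 1)" by (simp add: algebra_simps)
  hence "D * rho K w : Mat (n K)" using Mat_add[OF D(1) Mat_mult[OF D]] by simp
  hence "D * rho K w = D * rho K w * Pr (n K)" by (simp add: Mat_def)
  also have "... = 0" using w(2) by (simp add: D_def mult.assoc)
  finally have "D * (rho K w * rho K (inv w)) = 0" by (simp add: mult.assoc[symmetric])
  thus "rho K g = 1" using rep_inverse(2)[OF r w(1)] by (simp add: D_def)
 qed
qed

text \<open>The points of \<open>joins\<close> are determined by countably many rational cuts for each \<open>K\<close>.\<close>

lemma joins_injection:
 assumes "infinite cG"
 obtains iot :: "('a set => op \<times> op) => 'a set set" where "inj_on iot (tsp joins)"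
proof -
 have "infinite (UNIV :: 'a set)" using infinite_super[OF subset_UNIV assms] .
 then obtain e :: "'a set \<times> nat => 'a set" where e: "inj e" using injection_into_set_type by blast
 define c where "c z b i j = entry (if b then fst z else snd z) i j" for z :: "op \<times> op" and b i j
 define iot where "iot z = {e (K, to_nat (b, i, j, q)) |K b i j (q::rat). K : KK & c (z K) b i j < of_rat q}" for z
 have mem: "e (K, to_nat (b, i, j, q)) : iot z <-> K : KK & c (z K) b i j < of_rat q" for z K b i j and q :: rat by (auto simp: iot_def inj_eq[OF e])
 have jM: "fst w : Mat (n K) & snd w : Mat (n K)" if K: "K : KK" and w: "w : join K" for w K
 proof -
  have "rho K x * Pr (n K) : Mat (n K)" if "x : cG" for x using rep[OF K] that by (intro Mat_one_mult Pr_Mat) (simp add: rep_def)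
  thus ?thesis using w by (auto simp: join_def jpt_def intro!: Mat_scale)
 qed
 have "inj_on iot (tsp joins)"
 proof (rule inj_onI)
  fix z z' assume z: "z : tsp joins" "z' : tsp joins" and eq: "iot z = iot z'"
  have "z K = z' K" if K: "K : KK" for K
  proof -
   have ce: "c (z K) b i j = c (z' K) b i j" for b i j using mem[of K b i j _ z] mem[of K b i j _ z'] eq K by (intro real_eq_if_same_rationals_above) simp
   have m: "z K : join K" "z' K : join K" using z K by (auto simp: topspace_joins)
   show ?thesis
   proof (rule prod_eqI)
    show "fst (z K) = fst (z' K)" using ce[of True] jM[OF K] m by (intro Mat_eqI[of _ "n K"]) (auto simp: c_def)
    show "snd (z K) = snd (z' K)" using ce[of False] jM[OF K] m by (intro Mat_eqI[of _ "n K"]) (auto simp: c_def)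
   qed
  qed
  thus "z = z'" using z by (intro PiE_ext[of z KK join z']) (auto simp: topspace_joins)
 qed
 thus ?thesis by (rule that)
qed

text \<open>
 A neighbourhood of a base point in the product of joins restricts only finitely many factors
 \<open>F\<close>; in the other factors the point can be moved along the join, which contracts the common
 kernel \<open>N\<close> of the representations in \<open>F\<close> to a point inside \<open>G\<close>.
\<close>

lemma faithful_rep_if_local_slice:
 assumes slice: "local_slice G T joins jacts (\<lambda>K\<in>KK. jpt K 0 \<one> \<one>)"
 shows "EX m sg. rep m sg & faithful sg"
proof -
 let ?I = "top_of_set {0..1::real}"
 define z0 where "z0 = (\<lambda>K\<in>KK. jpt K 0 \<one> \<one>)"
 obtain P kap where P: "openin joins P" "z0 : P" "ctm (subtop joins P) T kap"
  "!!g y. g : cG ==> y : P ==> kap (jacts g y) = g ** kap y" using slice unfolding local_slice_def z0_def by blast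
 obtain U where U: "finite {K : KK. U K ~= join K}" "z0 : PiE KK U" "PiE KK U <= P" using P(1,2) unfolding joins_def openin_product_topology_alt by fastforce
 define F where "F = {K : KK. U K ~= join K}"
 have F: "finite F" "F <= KK" using U(1) by (auto simp: F_def)
 obtain m sg where sg: "rep m sg" "!!g. sg g = 1 <-> (ALL K:F. rho K g = 1)" using rep_common_kernel[OF F(1), of n rho] rep F(2) by blast
 define N where "N = {g : cG. sg g = 1}"
 note N = kernel_normal_closed[OF sg(1), folded N_def]
 have one: "\<one> : N" using sg(1) by (simp add: N_def rep_def)
 \<comment> \<open>In the moving factors only \<open>x\<close> is visible at parameter 0, and only
   the constant point of the second copy at parameter 1.\<close>
 define p where "p x s = (\<lambda>K\<in>KK. if K : F then jpt K 0 \<one> \<one> else jpt K s x \<one>)" for x s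
 have pP: "p x s : P" if "x : cG" "s : {0..1}" for x s
 proof -
  have "p x s : PiE KK U" using U(2) jpt_join[OF that(2,1) one_closed] by (auto simp: p_def z0_def PiE_iff F_def)
  thus ?thesis using U(3) by blast
 qed
 \<comment> \<open>The representations in \<open>F\<close> do not see elements of \<open>N\<close>,
   so the start of the path is the translate of \<open>z0\<close> by \<open>x\<close> in every
   factor, and the equivariance of \<open>kap\<close> applies.\<close>
 have p0: "p x 0 = jacts x z0" if "x : N" for x
  using that sg(2)[of x] F(2) rep by (auto simp: p_def jacts_def z0_def N_def fun_eq_iff jact_jpt) (auto simp: jpt_def rep_def)
 have p1: "p x 1 = p \<one> 1" for x by (auto simp: p_def jpt_def fun_eq_iff)
 have p01: "p \<one> 0 = z0" by (auto simp: p_def z0_def fun_eq_iff)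
 have kapc: "kap y : cG" if "y : P" for y using continuous_map_image_subset_topspace[OF P(3)] openin_subset[OF P(1)] that by force
 have "ctm (ptop (subtop T N) ?I) joins (%z. p (fst z) (snd z))" unfolding joins_def continuous_map_componentwise
 proof (intro conjI ballI)
  fix K assume K: "K : KK"
  let ?Z = "ptop (subtop T N) ?I"
  have x: "ctm ?Z T fst" "ctm ?Z euclideanreal snd" using continuous_map_fst[of "subtop T N" ?I] continuous_map_snd[of "subtop T N" ?I] by (simp_all add: ctm_into)
  have "ctm ?Z euclidean (%z. if K : F then jpt K 0 \<one> \<one> else jpt K (snd z) (fst z) \<one>)" using continuous_map_jpt[OF K x(2,1)] by (cases "K : F") simp_all
  thus "ctm ?Z (top_of_set (join K)) (%z. p (fst z) (snd z) K)" using K by (auto simp: p_def ctm_into intro!: jpt_join)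
 qed (auto simp: p_def)
 hence "ctm (ptop (subtop T N) ?I) (subtop joins P) (%z. p (fst z) (snd z))" using pP by (auto simp: ctm_into)
 from ctm_o[OF this P(3)]
 have c1: "ctm (ptop (subtop T N) ?I) T (%z. kap (p (fst z) (snd z)))" by (simp add: o_def)
 have "ctm (ptop (subtop T N) ?I) (ptop (subtop T N) ?I) (%z. (\<one>, snd z))" using one by (simp add: continuous_map_paired continuous_map_snd)
 from ctm_o[OF ctm_o[OF this c1] continuous_inv]
 have c2: "ctm (ptop (subtop T N) ?I) T (%z. inv kap (p \<one> (snd z)))" by (simp add: o_def)
 have "ctm (ptop (subtop T N) ?I) (ptop T T) (%z. (kap (p (fst z) (snd z)), inv kap (p \<one> (snd z))))" using c1 c2 by (simp add: continuous_map_paired)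
 from ctm_o[OF this continuous_mult]
 have hc: "ctm (ptop (subtop T N) ?I) T (%z. kap (p (fst z) (snd z)) ** inv kap (p \<one> (snd z)))" by (simp add: o_def)
 \<comment> \<open>Dividing by the path of \<open>\<one>\<close> normalises the homotopy: it starts
   at \<open>x\<close>, ends at \<open>\<one>\<close> and keeps \<open>\<one>\<close> fixed.\<close>
 interpret kernel_null_homotopy G T N "%x s. kap (p x s) ** inv kap (p \<one> s)" m sg
 proof (intro kernel_null_homotopy.intro null_homotopy.intro null_homotopy_axioms.intro kernel_null_homotopy_axioms.intro)
  fix x assume x: "x : N"
  hence xc: "x : cG" by (simp add: N_def)
  show "kap (p x 0) ** inv kap (p \<one> 0) = x" using P(4)[OF xc P(2)] kapc[OF P(2)] xc by (simp add: p0[OF x] p01 m_assoc)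
  show "kap (p x 1) ** inv kap (p \<one> 1) = \<one>" using kapc[OF pP[of \<one> 1]] by (simp add: p1[of x])
 qed (use N hc sg(1) kapc pP compact_group_axioms in "auto simp: N_def[symmetric]")
 show ?thesis by (rule faithful_rep_exists)
qed

end

end

section \<open>Charts of compact matrix groups\<close>

abbreviation "Rn n \<equiv> {x :: nat => real. ALL i>=n. x i = 0}"

lemma Euclidean_space_eq: "Euclidean_space n = top_of_set (Rn n)" by (simp add: Euclidean_space_def euclidean_product_topology)

lemma bounded_linear_fip: "bounded_linear (%A. fip n A B)" unfolding fip_def by (intro bounded_linear_sum bounded_linear_mult_const[OF bounded_linear_entry])

text \<open>The chart \<open>kap\<close> takes the coordinates of \<open>g - 1\<close> projected to
  the Lie algebra. It is affine in \<open>g\<close>, so only its inverse has to be differentiated.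
  \<open>jac g\<close> is the matrix of its differential in the frame \<open>g * Y j\<close>; the
  assumption \<open>inv\<close> makes it invertible.\<close>

locale matrix_chart =
 fixes n d :: nat and K :: "op set" and Y :: "nat => op" and C dlt :: real
 assumes K: "cmg n K" and Y: "!!i. i < d ==> Y i : Lie K"
  and ON: "!!i j. i < d ==> j < d ==> fip n (Y i) (Y j) = (if i = j then 1 else 0)"
  and span: "!!X. X : Lie K ==> X = (\<Sum>i<d. fip n X (Y i) *R Y i)"
  and C: "1 <= C" "!!A. norm (\<Sum>i<d. fip n A (Y i) *R Y i) <= C * norm A"
  and dlt: "0 < dlt" "dlt <= 1 / (4 * C)"
  and log: "!!g. g : K ==> norm (g - 1) < 4 * dlt ==> EX X:Lie K. norm X < 1 / (16 * C) & exp X = g"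
  and inv: "!!g. norm (g - 1) < dlt ==> 1 + (\<Sum>i<d. \<Sum>j<d. fip n ((g - 1) * Y j) (Y i) *R E i j) : Inv 2"
begin

definition "W = {g : K. norm (g - 1) < dlt}"
definition "pj A = (\<Sum>i<d. fip n A (Y i) *R Y i)"
definition "kap g = (%i. if i < d then fip n (g - 1) (Y i) else 0)"
definition "jac g = 1 + (\<Sum>i<d. \<Sum>j<d. fip n ((g - 1) * Y j) (Y i) *R E i j)"
definition "D g j = (\<Sum>i<d. entry (ainv (jac g)) i j *R Y i)"

lemma pj_linear: "pj (A + B) = pj A + pj B" "pj (A - B) = pj A - pj B" "pj (r *R A) = r *R pj A"
 by (simp_all add: pj_def fip_simps scaleR_add_left scaleR_diff_left sum.distrib sum_subtractf scaleR_sum_right)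

lemma pj_0: "pj 0 = 0" using pj_linear(3)[of 0 0] by simp

lemma pj_Lie: "X : Lie K ==> pj X = X" unfolding pj_def by (rule span[symmetric])

lemma sum_Lie: "(\<Sum>i<d. c i *R Y i) : Lie K" using Y by (intro subspace_sum[OF subspace_Lie[OF K]] subspace_scale[OF subspace_Lie[OF K]]) auto

lemma fip_comb: "i < d ==> fip n (\<Sum>j<d. c j *R Y j) (Y i) = c i" unfolding fip_sum_left fip_simps by (simp add: ON if_distrib[of "%x. _ * x"] cong: if_cong)

lemma pj_diff: "pj (g' - g) = (\<Sum>i<d. (kap g' i - kap g i) *R Y i)" unfolding pj_def by (intro sum.cong refl) (simp add: kap_def fip_simps)

lemma W_norm: "g : W ==> norm g <= 2" "g : W ==> g : Inv 2"
proof -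
 assume g: "g : W"
 have "1 / (4 * C) <= 1/4" using C(1) by simp
 hence d: "norm (g - 1) <= 1/4" using g dlt by (simp add: W_def)
 show "norm g <= 2" using norm_triangle_ineq[of "g - 1" 1] d by simp
 have "1 : Inv 1" unfolding Inv_def by (auto intro: exI[of _ 1])
 from Inv_perturb[OF this, of g] d show "g : Inv 2" by simp
qed

text \<open>The map sending \<open>Z\<close> to \<open>pj (g * exp Z)\<close> differs from the
  identity by a map with Lipschitz constant 1/2: a quarter comes from \<open>g - 1\<close>, a
  quarter from the remainder of \<open>exp\<close>, by the choice of the bounds
  \<open>1 / (4 * C)\<close> and \<open>1 / (16 * C)\<close>.\<close>

lemma pj_exp_lipschitz:
 assumes g: "g : W" and Z: "Z : Lie K" "Z' : Lie K" "norm Z <= 1 / (16 * C)" "norm Z' <= 1 / (16 * C)"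
 shows "norm (pj (g * (exp Z - exp Z')) - (Z - Z')) <= norm (Z - Z') / 2"
proof -
 let ?X = "Z - Z'" and ?R = "exp Z - exp Z' - (Z - Z')"
 have C1: "1 / (16 * C) <= 1" using C(1) by (simp add: divide_le_eq)
 have "pj (g * (exp Z - exp Z')) - ?X = pj (g * (exp Z - exp Z')) - pj ?X" using pj_Lie[OF Lie_diff[OF K Z(1,2)]] by simp
 also have "... = pj ((g - 1) * ?X) + pj (g * ?R)" unfolding pj_linear(1,2)[symmetric] by (rule arg_cong[of _ _ pj]) (simp add: algebra_simps)
 also have "norm ... <= C * norm ((g - 1) * ?X) + C * norm (g * ?R)" using C(2)[folded pj_def] by (intro order_trans[OF norm_triangle_ineq] add_mono) auto
 also have "... <= C * (1 / (4 * C) * norm ?X) + C * (2 * (2 * (1 / (16 * C)) * norm ?X))"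
 proof (intro add_mono mult_left_mono)
  have "norm (g - 1) <= 1 / (4 * C)" using g dlt(2) by (simp add: W_def)
  thus "norm ((g - 1) * ?X) <= 1 / (4 * C) * norm ?X" by (intro order_trans[OF norm_mult_ineq] mult_right_mono) auto
  show "norm (g * ?R) <= 2 * (2 * (1 / (16 * C)) * norm ?X)" using W_norm(1)[OF g] exp_lipschitz[OF Z(3,4) C1] by (intro order_trans[OF norm_mult_ineq] mult_mono) auto
 qed (use C in auto)
 also have "... = norm ?X / 2" using C(1) by (simp add: field_simps)
 finally show ?thesis .
qed

lemma log_difference:
 assumes g: "g : W" and g': "g' : W"
 obtains Z where "Z : Lie K" "g' = g * exp Z" "norm Z <= 1 / (16 * C)" "norm Z <= 2 * norm (pj (g' - g))"
proof -
 note I = Inv_ainv[OF W_norm(2)[OF g]]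
 have gK: "g : K" "g' : K" using g g' by (auto simp: W_def)
 have "norm (ainv g * (g' - g)) <= 2 * norm (g' - g)" using I(3) by (intro order_trans[OF norm_mult_ineq] mult_right_mono) auto
 also have "norm (g' - g) < 2 * dlt" using g g' norm_triangle_ineq4[of "g' - 1" "g - 1"] by (simp add: W_def)
 finally have "norm (ainv g * g' - 1) < 4 * dlt" using I(2) by (simp add: right_diff_distrib)
 moreover have "ainv g * g' : K" using cmg_mult[OF K cmg_inverse(1)[OF K gK(1) I(1)] gK(2)] .
 ultimately obtain Z where Z: "Z : Lie K" "norm Z < 1 / (16 * C)" "exp Z = ainv g * g'" using log by blast
 have gZ: "g' = g * exp Z" using I(1) by (simp add: Z(3) mult.assoc[symmetric])
 hence e: "g * (exp Z - exp 0) = g' - g" by (simp add: right_diff_distrib)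
 have "norm (pj (g' - g) - Z) <= norm Z / 2" using pj_exp_lipschitz[OF g Z(1) Lie_0[OF K]] Z(2) C(1) unfolding e by simp
 hence "norm Z <= 2 * norm (pj (g' - g))" using norm_triangle_ineq2[of Z "pj (g' - g)"] by (simp add: norm_minus_commute)
 with Z(1,2) gZ show ?thesis using that by simp
qed

lemma inj_kap: "inj_on kap W"
proof (rule inj_onI)
 fix g g' assume g: "g : W" "g' : W" and e: "kap g = kap g'"
 obtain Z where "g' = g * exp Z" "norm Z <= 2 * norm (pj (g' - g))" using log_difference[OF g] by blast
 thus "g = g'" unfolding pj_diff e by simp
qed

text \<open>The equation \<open>kap g = x\<close> near \<open>kap g0\<close> is solved by the contraction principle on the Lie algebra.\<close>

lemma kap_open_at:
 assumes g0: "g0 : W" and e: "0 < e"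
 obtains eta where "0 < eta" "!!x. x : Rn d ==> (!!i. i < d ==> abs(x i - kap g0 i) < eta) ==> x : kap ` (W Int ball g0 e)"
proof -
 \<comment> \<open>The three bounds keep \<open>Z\<close> in the range of
   \<open>pj_exp_lipschitz\<close>, and the solution in the ball of radius \<open>e\<close> and in
   \<open>W\<close>; the divisor 10 leaves room for the displacement \<open>6 * s\<close>.\<close>
 define s where "s = min (1 / (16 * C)) (min (e / 10) ((dlt - norm (g0 - 1)) / 10))"
 have s: "0 < s" "s <= 1 / (16 * C)" "s <= e / 10" "s <= (dlt - norm (g0 - 1)) / 10"
  subgoal using C(1) e g0 by (simp add: s_def W_def) unfolding s_def by (rule min.cobounded1 min.coboundedI2[OF min.cobounded1] min.coboundedI2[OF min.cobounded2])+
 define M where "M = 1 + (\<Sum>i<d. norm (Y i))"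
 have M: "1 <= M" by (simp add: M_def sum_nonneg)
 show ?thesis
 proof (rule that[of "s / (2 * M)"])
  show "0 < s / (2 * M)" using s M by simp
  fix x assume x: "x : Rn d" and near: "!!i. i < d ==> abs(x i - kap g0 i) < s / (2 * M)"
  define v where "v = (\<Sum>i<d. (x i - kap g0 i) *R Y i)"
  have vL: "v : Lie K" unfolding v_def by (rule sum_Lie)
  have "norm v <= (\<Sum>i<d. s / (2 * M) * norm (Y i))" unfolding v_def
  proof (rule sum_norm_le)
   fix i assume "i : {..<d}"
   hence "abs(x i - kap g0 i) <= s / (2 * M)" using near[of i] by simp
   thus "norm ((x i - kap g0 i) *R Y i) <= s / (2 * M) * norm (Y i)" unfolding norm_scaleR real_norm_def by (rule mult_right_mono) simp
  qed
  also have "... = s / (2 * M) * (M - 1)" by (simp add: M_def sum_distrib_left)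
  also have "... <= s / 2" using s M by (simp add: field_simps)
  finally have v: "norm v <= s / 2" .
  \<comment> \<open>Its fixed points satisfy \<open>pj (g0 * exp Z - g0) = v\<close>, that is,
    \<open>g0 * exp Z\<close> has the chart coordinates \<open>x\<close>.\<close>
  define Tht where "Tht Z = Z - pj (g0 * (exp Z - 1)) + v" for Z
  let ?B = "Lie K Int cball 0 s"
  have lip: "norm (Tht Z - Tht Z') <= 1/2 * norm (Z - Z')" if "Z : ?B" "Z' : ?B" for Z Z'
  proof -
   have "Tht Z - Tht Z' = - (pj (g0 * (exp Z - exp Z')) - (Z - Z'))" by (simp add: Tht_def right_diff_distrib pj_linear)
   thus ?thesis using pj_exp_lipschitz[OF g0, of Z Z'] that s(2) by (simp add: norm_minus_commute)
  qed
  have 0: "Tht 0 = v" by (simp add: Tht_def pj_0)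
  have "EX! Z:?B. Tht Z = Z"
  proof (rule Banach_fix[of ?B "1/2" Tht])
   show "complete ?B" using closed_Int[OF closed_Lie[OF K] closed_cball] by (simp add: complete_eq_closed)
   show "?B ~= {}" using Lie_0[OF K] s(1) by auto
   show "Tht ` ?B <= ?B"
   proof
    fix A assume "A : Tht ` ?B"
    then obtain Z where Z: "Z : ?B" "A = Tht Z" by blast
    have "norm (Tht Z - Tht 0) <= 1/2 * norm Z" using lip[OF Z(1), of 0] Lie_0[OF K] s(1) by simp
    hence "norm A <= s" using norm_triangle_ineq[of "Tht Z - v" v] v Z by (simp add: 0)
    moreover have "A : Lie K" unfolding Z(2) Tht_def pj_def using Z(1) vL by (intro Lie_add[OF K] Lie_diff[OF K] sum_Lie) auto
    ultimately show "A : ?B" by simp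
   qed
  qed (use lip in "auto simp: dist_norm")
  then obtain Z where Z: "Z : Lie K" "norm Z <= s" "Tht Z = Z" by auto
  define g where "g = g0 * exp Z"
  have gK: "g : K" unfolding g_def using g0 by (intro cmg_mult[OF K _ LieD1[OF Z(1)]]) (simp add: W_def)
  have s1: "s <= 1" using s(2) C(1) order_trans[of s "1 / (16 * C)" 1] by (simp add: divide_le_eq)
  have "norm (exp Z - 1) <= 3 * s"
  proof -
   have "norm (exp Z - 1 - Z) <= 2 * s * norm Z" using exp_lipschitz[of Z s 0] Z(2) s(1) s1 by simp
   also have "... <= 2 * 1 * s" using s(1) s1 Z(2) by (intro mult_mono) auto
   finally show ?thesis using norm_triangle_ineq[of "exp Z - 1 - Z" Z] Z(2) by simp
  qed
  hence "norm g0 * norm (exp Z - 1) <= 2 * (3 * s)" using W_norm(1)[OF g0] s(1) by (intro mult_mono) auto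
  moreover have "g - g0 = g0 * (exp Z - 1)" by (simp add: g_def right_diff_distrib)
  ultimately have gg: "norm (g - g0) <= 6 * s" using norm_mult_ineq[of g0 "exp Z - 1"] by simp
  have "norm (g - 1) < dlt" using norm_triangle_ineq[of "g - g0" "g0 - 1"] gg s(1,4) by simp
  moreover have "norm (g - g0) < e" using gg s(1,3) by simp
  ultimately have gW: "g : W Int ball g0 e" using gK by (simp add: W_def dist_norm norm_minus_commute)
  have pv: "pj (g - g0) = v" using Z(3) by (simp add: Tht_def g_def right_diff_distrib algebra_simps)
  have "kap g i = x i" for i
  proof (cases "i < d")
   case True
   have "kap g i - kap g0 i = x i - kap g0 i" using fip_comb[OF True, of "%i. kap g i - kap g0 i"] fip_comb[OF True, of "%i. x i - kap g0 i"]
     pv[unfolded pj_diff v_def] by simp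
   thus ?thesis by simp
  qed (use x in "simp add: kap_def")
  thus "x : kap ` (W Int ball g0 e)" using gW by (intro image_eqI[of _ _ g]) auto
 qed
qed

lemma jac_Mat: "jac g - 1 : Mat d" unfolding jac_def by (simp add: Mat_comb)

text \<open>\<open>D g j\<close> solves the linear system with matrix \<open>jac g\<close>, so that
  \<open>g * D g j\<close> is the tangent vector at \<open>g\<close> whose chart image is the j-th
  unit vector.\<close>

lemma pj_D:
 assumes g: "g : W" and j: "j < d"
 shows "pj (g * D g j) = Y j"
proof -
 let ?w = "ainv (jac g)"
 have I: "jac g : Inv 2" unfolding jac_def using g by (intro inv) (simp add: W_def)
 have ent: "entry (jac g) k i = fip n (g * Y i) (Y k)" if "k < d" "i < d" for k i
 proof -
  have "entry (jac g) k i = (if k = i then 1 else 0) + fip n ((g - 1) * Y i) (Y k)"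
  proof -
   have "(\<Sum>j<d. if k = l & j = i then c else 0) = (if k = l then c else 0)" for c :: real and l using that by (cases "k = l") auto
   thus ?thesis using that by (simp add: jac_def entry_E if_distrib[of "%x. _ * x"] cong: if_cong)
  qed
  thus ?thesis using ON[OF that(2,1)] by (auto simp: left_diff_distrib fip_simps)
 qed
 have "fip n (g * D g j) (Y k) = (if k = j then 1 else 0)" if k: "k < d" for k
 proof -
  have "g * D g j = (\<Sum>i<d. entry ?w i j *R (g * Y i))" by (simp add: D_def sum_distrib_left)
  hence "fip n (g * D g j) (Y k) = (\<Sum>i<d. entry (jac g) k i * entry ?w i j)" by (simp add: fip_sum_left fip_simps ent k mult.commute)
  also have "... = entry (jac g * ?w) k j" by (rule entry_one_mult[OF jac_Mat k j, symmetric])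
  finally show ?thesis using Inv_ainv(1)[OF I] by simp
 qed
 hence "pj (g * D g j) = (\<Sum>k<d. (if k = j then 1 else 0) *R Y k)" unfolding pj_def by simp
 also have "... = (\<Sum>k<d. if k = j then Y j else 0)" by (intro sum.cong) auto
 finally show ?thesis using j by simp
qed

text \<open>With \<open>g' = g * exp Z\<close>, the projection annihilates the error of the linear
  approximation. As \<open>pj (g * X)\<close> is close to \<open>X\<close> on the Lie algebra, the
  deviation of \<open>Z\<close> from \<open>t *R D g j\<close> is of the order of the quadratic
  remainder of \<open>exp\<close>.\<close>

lemma kap_inverse_derivative:
 assumes g: "g : W" and g': "g' : W" and j: "j < d" and t: "pj (g' - g) = t *R Y j"
 shows "norm (g' - g - t *R (g * D g j)) <= (80 * C * (norm (Y j))\<^sup>2) * t\<^sup>2"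
proof -
 obtain Z where Z: "Z : Lie K" "g' = g * exp Z" "norm Z <= 1 / (16 * C)" "norm Z <= 2 * norm (pj (g' - g))" using log_difference[OF g g'] by blast
 define R where "R = exp Z - 1 - Z"
 define X where "X = Z - t *R D g j"
 have DL: "D g j : Lie K" unfolding D_def by (rule sum_Lie)
 have XL: "X : Lie K" unfolding X_def by (intro Lie_diff[OF K] Lie_scale Z(1) DL)
 have "1 / (16 * C) <= 1" using C(1) by (simp add: divide_le_eq)
 hence R: "norm R <= 2 * (norm Z)\<^sup>2" using exp_minus_one_bound[of Z] Z(3) by (simp add: R_def power2_eq_square)
 have gR: "norm (g * R) <= 4 * (norm Z)\<^sup>2" using mult_mono[OF W_norm(1)[OF g] R] norm_mult_ineq[of g R] by simp
 have dec: "g' - g - t *R (g * D g j) = g * X + g * R" by (simp add: Z(2) X_def R_def algebra_simps)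
 have "pj (g' - g - t *R (g * D g j)) = 0"     unfolding pj_linear(2)[of "g' - g"] pj_linear(3) t pj_D[OF g j] by simp
 hence "pj (g * X) = - pj (g * R)" unfolding dec pj_linear by (simp add: add_eq_0_iff2)
 moreover have "pj (g * X) = X + pj ((g - 1) * X)" using pj_Lie[OF XL] by (simp add: left_diff_distrib pj_linear)
 ultimately have "X = - pj (g * R) - pj ((g - 1) * X)" by (simp only: eq_diff_eq)
 hence "norm X <= norm (pj ((g - 1) * X)) + norm (pj (g * R))" using norm_triangle_ineq4[of "- pj (g * R)" "pj ((g - 1) * X)"] by simp
 also have "norm (pj ((g - 1) * X)) <= C * (1 / (4 * C) * norm X)"
 proof (rule order_trans[OF C(2)[folded pj_def]], rule mult_left_mono)
  have "norm (g - 1) <= 1 / (4 * C)" using g dlt(2) by (simp add: W_def)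
  thus "norm ((g - 1) * X) <= 1 / (4 * C) * norm X" by (intro order_trans[OF norm_mult_ineq] mult_right_mono) auto
 qed (use C in auto)
 also have "norm (pj (g * R)) <= C * (4 * (norm Z)\<^sup>2)" using C(1) by (intro order_trans[OF C(2)[folded pj_def]] mult_left_mono gR) auto
 also have "C * (1 / (4 * C) * norm X) = norm X / 4" using C(1) by simp
 finally have "norm X <= norm X / 4 + 4 * (C * (norm Z)\<^sup>2)" by simp
 moreover have "0 <= C * (norm Z)\<^sup>2" using C(1) by simp
 ultimately have X: "norm X <= 8 * C * (norm Z)\<^sup>2" by simp
 have Zt: "(norm Z)\<^sup>2 <= (2 * norm (t *R Y j))\<^sup>2" using Z(4) unfolding t by (rule power_mono) simp
 have "norm (g' - g - t *R (g * D g j)) <= norm (g * X) + norm (g * R)" unfolding dec by (rule norm_triangle_ineq)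
 also have "... <= 2 * (8 * C * (norm Z)\<^sup>2) + 4 * (norm Z)\<^sup>2" using mult_mono[OF W_norm(1)[OF g] X] norm_mult_ineq[of g X] gR by (intro add_mono) auto
 also have "... <= 20 * C * (norm Z)\<^sup>2" using C(1) mult_right_mono[OF C(1), of "4 * (norm Z)\<^sup>2"] by simp
 also have "... <= 20 * C * (2 * norm (t *R Y j))\<^sup>2" using Zt C(1) by (intro mult_left_mono) auto
 also have "... = (80 * C * (norm (Y j))\<^sup>2) * t\<^sup>2" by (simp add: power_mult_distrib mult_ac)
 finally show ?thesis .
qed

end

lemma matrix_chart_exists:
 assumes K: "cmg n K"
 obtains d Y C dlt where "matrix_chart n d K Y C dlt"
proof -
 have LM: "Lie K <= Mat n" using Lie_Mat[OF K] by blast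
 obtain d :: nat and Y where Y: "!!i. i < d ==> Y i : Lie K" "!!i j. i < d ==> j < d ==> fip n (Y i) (Y j) = (if i = j then 1 else 0)"
  "!!X. X : Lie K ==> X = (\<Sum>i<d. fip n X (Y i) *R Y i)" using orthonormal_basis_exists[OF subspace_Lie[OF K] LM] by blast
 have "bounded_linear (%A. \<Sum>i<d. fip n A (Y i) *R Y i)" by (intro bounded_linear_sum bounded_linear_scaleR_const[OF bounded_linear_fip])
 then obtain C0 where C0: "!!A. norm (\<Sum>i<d. fip n A (Y i) *R Y i) <= norm A * C0" using bounded_linear.bounded by blast
 define C where "C = max 1 C0"
 have C: "1 <= C" "norm (\<Sum>i<d. fip n A (Y i) *R Y i) <= C * norm A" for A
 proof -
  show "norm (\<Sum>i<d. fip n A (Y i) *R Y i) <= C * norm A" using C0[of A] mult_left_mono[of C0 C "norm A"] by (simp add: C_def mult.commute)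
 qed (simp add: C_def)
 obtain dlt1 where dlt1: "0 < dlt1" "!!g. g : K ==> norm (g - 1) < dlt1 ==> EX X:Lie K. norm X < 1 / (16 * C) & exp X = g"
  using exp_Lie_neighbourhood[OF K, of "1 / (16 * C)"] C(1) by auto
 let ?S = "%g. 1 + (\<Sum>i<d. \<Sum>j<d. fip n ((g - 1) * Y j) (Y i) *R E i j)"
 have "cton UNIV ?S" by (intro continuous_intros)
 from this[unfolded continuous_on_def, rule_format, OF UNIV_I, of 1] have lim: "(?S ---> ?S 1) (at 1)" .
 have S1: "?S 1 = 1" by (simp add: fip_def)
 obtain dlt2 where dlt2: "0 < dlt2" "!!g. g ~= 1 ==> dist g 1 < dlt2 ==> dist (?S g) 1 < 1/2"
  using tendstoD[OF lim[unfolded S1], of "1/2"] unfolding eventually_at by auto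
 have i1: "1 : Inv 1" unfolding Inv_def by (auto intro: exI[of _ 1])
 have inv: "?S g : Inv 2" if "norm (g - 1) < dlt2" for g
 proof (cases "g = 1")
  case True
  thus ?thesis unfolding True S1 using Inv_perturb[OF i1, of 1] by simp
 next
  case False
  from dlt2(2)[OF False] that have "norm (?S g - 1) < 1/2" by (simp add: dist_norm)
  thus ?thesis using Inv_perturb[OF i1, of "?S g"] by simp
 qed
 define dlt where "dlt = min (dlt1 / 4) (min dlt2 (1 / (4 * C)))"
 have "matrix_chart n d K Y C dlt"
 proof
  show "0 < dlt" "dlt <= 1 / (4 * C)" using dlt1 dlt2 C by (auto simp: dlt_def)
  show "EX X:Lie K. norm X < 1 / (16 * C) & exp X = g" if "g : K" "norm (g - 1) < 4 * dlt" for g using that by (intro dlt1(2)) (auto simp: dlt_def)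
  show "?S g : Inv 2" if "norm (g - 1) < dlt" for g using that by (intro inv) (auto simp: dlt_def)
 qed (rule K Y C; assumption)+
 thus ?thesis by (rule that)
qed

text \<open>The vector-valued counterpart of \<open>C_k\<close>, to which it reduces for real
  functions on subsets of \<open>Rn n\<close> (\<open>C_k_eq_Ck\<close>). The inverse chart has
  values in \<open>op\<close> and is differentiated in this sense.\<close>

primrec Ck :: "nat => nat => (nat => real) set => ((nat => real) => 'v::real_normed_vector) => bool" where
 "Ck 0 n U f <-> cton U f"
| "Ck (Suc k) n U f <-> cton U f &
  (ALL i<n. EX g. (ALL x:U. ((%t. f (x(i := t))) hvd g x) (at (x i))) & Ck k n U g)"

lemma Ck_SucI:
 assumes "cton U f" "!!i x. i < n ==> x : U ==> ((%t. f (x(i := t))) hvd g i x) (at (x i))"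
  "!!i. i < n ==> Ck k n U (g i)"
 shows "Ck (Suc k) n U f" using assms by auto

lemma Ck_SucE:
 assumes "Ck (Suc k) n U f"
 obtains g where "!!i x. i < n ==> x : U ==> ((%t. f (x(i := t))) hvd g i x) (at (x i))"
  "!!i. i < n ==> Ck k n U (g i)"
proof -
 have "ALL i. EX g. i < n --> (ALL x:U. ((%t. f (x(i := t))) hvd g x) (at (x i))) & Ck k n U g" using assms by auto
 thus ?thesis using that by metis
qed

lemma C_k_eq_Ck:
 assumes "U <= Rn n"
 shows "C_k k n U f <-> Ck k n U f"
proof (induction k arbitrary: f)
 have c: "subtop (Euclidean_space n) U = top_of_set U" using assms by (simp add: Euclidean_space_eq subtopology_subtopology Int_absorb1)
 case 0
 show ?case by (simp add: c)
 case (Suc k)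
 thus ?case by (simp add: c has_real_derivative_iff_has_vector_derivative)
qed

lemma Ck_cont: "Ck k n U f ==> cton U f" by (cases k) auto

lemma Ck_SucD: "Ck (Suc k) n U f ==> Ck k n U f"
proof (induction k arbitrary: f)
 case (Suc k)
 thus ?case unfolding Ck.simps(2)[of "Suc k"] Ck.simps(2)[of k n U f] by blast
qed simp

lemma Ck_subset: "Ck k n U f ==> V <= U ==> Ck k n V f"
proof (induction k arbitrary: f)
 case (Suc k)
 thus ?case by (simp add: subset_iff) (metis continuous_on_subset subsetI)
qed (simp add: continuous_on_subset)

lemma open_line:
 assumes U: "openin (Euclidean_space n) U" and x: "x : U" and i: "i < n"
 shows "open {t. x(i := t) : U}"
proof -
 obtain V where V: "open V" "U = Rn n Int V" using U unfolding Euclidean_space_eq openin_open by blast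
 have "cton UNIV (%t::real. x(i := t))"
 proof (rule continuous_on_coordinatewise_then_product)
  show "cton UNIV (%t. (x(i := t)) j)" for j by (cases "j = i") auto
 qed
 hence "open ((%t. x(i := t)) -` V)" using V(1) by (simp add: open_vimage)
 also have "(%t. x(i := t)) -` V = {t. x(i := t) : U}" using V(2) x i by auto
 finally show ?thesis .
qed

lemma Ck_cong:
 assumes U: "openin (Euclidean_space n) U" and e: "!!x. x : U ==> f x = f' x" and f: "Ck k n U f"
 shows "Ck k n U f'"
proof (cases k)
 case 0
 thus ?thesis using f e continuous_on_cong[of U U f f'] by simp
next
 case (Suc l)
 obtain g where g: "!!i x. i < n ==> x : U ==> ((%t. f (x(i := t))) hvd g i x) (at (x i))"
  "!!i. i < n ==> Ck l n U (g i)" using f Suc Ck_SucE by metis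
 show ?thesis unfolding Suc
 proof (rule Ck_SucI[OF _ _ g(2)])
  show "cton U f'" using Ck_cont[OF f] e continuous_on_cong[of U U f f'] by simp
  fix i x assume i: "i < n" and x: "x : U"
  show "((%t. f' (x(i := t))) hvd g i x) (at (x i))" by (rule has_vector_derivative_transform_within_open[OF g(1)[OF i x] open_line[OF U x i]]) (use x e in auto)
 qed
qed

lemma Ck_const: "Ck k n U (%_. c)" by (induction k arbitrary: c) (auto intro!: exI[of _ "%_. 0"])

lemma Ck_linear:
 assumes L: "bounded_linear L"
 shows "Ck k n U f ==> Ck k n U (%x. L (f x))"
proof (induction k arbitrary: f)
 case (Suc k)
 obtain g where g: "!!i x. i < n ==> x : U ==> ((%t. f (x(i := t))) hvd g i x) (at (x i))"
  "!!i. i < n ==> Ck k n U (g i)" using Ck_SucE[OF Suc.prems] by metis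
 show ?case by (rule Ck_SucI[OF bounded_linear.continuous_on[OF L Ck_cont[OF Suc.prems]] bounded_linear.has_vector_derivative[OF L g(1)] Suc.IH[OF g(2)]])
qed (simp add: bounded_linear.continuous_on[OF L])

lemma Ck_add: "Ck k n U f ==> Ck k n U g ==> Ck k n U (%x. f x + g x)"
proof (induction k arbitrary: f g)
 case (Suc k)
 obtain f' where f': "!!i x. i < n ==> x : U ==> ((%t. f (x(i := t))) hvd f' i x) (at (x i))"
  "!!i. i < n ==> Ck k n U (f' i)" using Ck_SucE[OF Suc.prems(1)] by metis
 obtain g' where g': "!!i x. i < n ==> x : U ==> ((%t. g (x(i := t))) hvd g' i x) (at (x i))"
  "!!i. i < n ==> Ck k n U (g' i)" using Ck_SucE[OF Suc.prems(2)] by metis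
 show ?case by (rule Ck_SucI[OF continuous_on_add has_vector_derivative_add[OF f'(1) g'(1)] Suc.IH[OF f'(2) g'(2)]])
   (use Suc.prems Ck_cont in auto)
qed (simp add: continuous_on_add)

lemma Ck_mult:
 fixes f g :: "(nat => real) => op"
 shows "Ck k n U f ==> Ck k n U g ==> Ck k n U (%x. f x * g x)"
proof (induction k arbitrary: f g)
 case (Suc k)
 obtain f' where f': "!!i x. i < n ==> x : U ==> ((%t. f (x(i := t))) hvd f' i x) (at (x i))"
  "!!i. i < n ==> Ck k n U (f' i)" using Ck_SucE[OF Suc.prems(1)] by metis
 obtain g' where g': "!!i x. i < n ==> x : U ==> ((%t. g (x(i := t))) hvd g' i x) (at (x i))"
  "!!i. i < n ==> Ck k n U (g' i)" using Ck_SucE[OF Suc.prems(2)] by metis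
 show ?case
 proof (rule Ck_SucI[where g = "%i x. f x * g' i x + f' i x * g x"])
  show "cton U (%x. f x * g x)" using Suc.prems Ck_cont by (auto intro: continuous_on_mult)
  show "((%t. f (x(i := t)) * g (x(i := t))) hvd f x * g' i x + f' i x * g x) (at (x i))"
   if "i < n" "x : U" for i x using has_vector_derivative_mult[OF f'(1)[OF that] g'(1)[OF that]] by simp
  show "Ck k n U (%x. f x * g' i x + f' i x * g x)" if "i < n" for i by (intro Ck_add Suc.IH f'(2) g'(2) that Ck_SucD[OF Suc.prems(1)] Ck_SucD[OF Suc.prems(2)])
 qed
qed (simp add: continuous_on_mult)

lemma Ck_ainv:
 assumes U: "openin (Euclidean_space n) U" and I: "!!x. x : U ==> f x : Inv bet"
 shows "Ck k n U f ==> Ck k n U (%x. ainv (f x))"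
proof (induction k)
 case 0
 thus ?case using continuous_on_ainv_comp[of U f bet] I by simp
next
 case (Suc k)
 obtain f' where f': "!!i x. i < n ==> x : U ==> ((%t. f (x(i := t))) hvd f' i x) (at (x i))"
  "!!i. i < n ==> Ck k n U (f' i)" using Ck_SucE[OF Suc.prems] by metis
 note IH = Suc.IH[OF Ck_SucD[OF Suc.prems]]
 show ?case
 proof (rule Ck_SucI[where g = "%i x. (- 1) *R (ainv (f x) * f' i x * ainv (f x))"])
  show "cton U (%x. ainv (f x))" using continuous_on_ainv_comp[OF Ck_cont[OF Suc.prems] I] by simp
  fix i x assume i: "i < n" and x: "x : U"
  let ?S = "{t. x(i := t) : U}"
  have "((%t. ainv (f (x(i := t)))) hvd - (ainv (f (x(i := x i))) * f' i x * ainv (f (x(i := x i))))) (at (x i) within ?S)"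
   by (rule has_vector_derivative_ainv[of "%t. f (x(i := t))" _ _ _ bet])
    (use has_vector_derivative_at_within[OF f'(1)[OF i x]] I x in auto)
  thus "((%t. ainv (f (x(i := t)))) hvd (- 1) *R (ainv (f x) * f' i x * ainv (f x))) (at (x i))" using at_within_open[OF _ open_line[OF U x i], of "x i"] x by simp
 qed (intro Ck_linear[OF bounded_linear_scaleR_right] Ck_mult IH f'(2))
qed

lemma Ck_reindex:
 assumes e: "inj_on e {..<d}" "e ` {..<d} <= {..<m}"
 defines "p \<equiv> %x i. if i < d then x (e i) else (0::real)"
 assumes U: "p ` U <= V"
 shows "Ck k d V f ==> Ck k m U (%x. f (p x))"
proof -
 have "cton U (%x. p x i)" for i unfolding p_def by (cases "i < d") (simp_all add: continuous_on_subset[OF continuous_on_product_coordinates subset_UNIV])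
 hence "cton U p" by (rule continuous_on_coordinatewise_then_product)
 hence c: "cton U (%x. f (p x))" if "cton V f" for f :: "(nat => real) => 'a" using continuous_on_compose2[OF that _ U] by blast
 show "Ck k d V f ==> Ck k m U (%x. f (p x))"
 proof (induction k arbitrary: f)
 case 0
 thus ?case by (simp add: c)
next
 case (Suc k)
 obtain g where g: "!!i x. i < d ==> x : V ==> ((%t. f (x(i := t))) hvd g i x) (at (x i))"
  "!!i. i < d ==> Ck k d V (g i)" using Ck_SucE[OF Suc.prems] by metis
 show ?case unfolding Ck.simps
 proof (intro conjI allI impI)
  show "cton U (%x. f (p x))" by (rule c[OF Ck_cont[OF Suc.prems]])
  fix j assume "j < m"
  show "EX h. (ALL x:U. ((%t. f (p (x(j := t)))) hvd h x) (at (x j))) & Ck k m U h"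
  proof (cases "j : e ` {..<d}")
   case True
   then obtain i where i: "i < d" "j = e i" by blast
   have px: "p (x(j := t)) = (p x)(i := t)" for x t using i e(1) by (auto simp: p_def fun_eq_iff inj_on_eq_iff)
   have "((%t. f (p (x(j := t)))) hvd g i (p x)) (at (x j))" if "x : U" for x using g(1)[OF i(1), of "p x"] that U unfolding px by (auto simp: p_def i)
   thus ?thesis using Suc.IH[OF g(2)[OF i(1)]] by (intro exI[of _ "%x. g i (p x)"]) blast
  next
   case False
   hence "p (x(j := t)) = p x" for x t by (auto simp: p_def fun_eq_iff)
   thus ?thesis using Ck_const[of k m U 0] by (intro exI[of _ "%_. 0"]) simp
  qed
 qed
qed
qed

context matrix_chart
begin

definition "psi = inv_into W kap"

lemma psi: "g : W ==> psi (kap g) = g" "x : kap ` W ==> psi x : W" "x : kap ` W ==> kap (psi x) = x" unfolding psi_def by (auto simp: inv_into_f_f[OF inj_kap])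

lemma kap_Rn: "kap g : Rn d" by (simp add: kap_def)

lemma continuous_on_kap: "cton S kap"
proof (rule continuous_on_coordinatewise_then_product)
 show "cton S (%g. kap g i)" for i unfolding kap_def by (cases "i < d") (auto intro!: continuous_intros)
qed

lemma openin_kap:
 assumes "open V"
 shows "openin (Euclidean_space d) (kap ` (W Int V))"
proof (subst openin_subopen, intro ballI)
 fix y assume "y : kap ` (W Int V)"
 then obtain g0 where g0: "g0 : W" "g0 : V" "y = kap g0" by blast
 obtain e where e: "0 < e" "ball g0 e <= V" using assms g0(2) openE by blast
 obtain eta where eta: "0 < eta" "!!x. x : Rn d ==> (!!i. i < d ==> abs(x i - kap g0 i) < eta) ==> x : kap ` (W Int ball g0 e)"
  using kap_open_at[OF g0(1) e(1)] by blast
 let ?N = "\<Inter>i\<in>{..<d}. {x :: nat => real. abs(x i - kap g0 i) < eta}"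
 have "open ?N" by (intro open_INT open_Collect_less ballI continuous_intros) auto
 hence "openin (Euclidean_space d) (Rn d Int ?N)" unfolding Euclidean_space_eq by (rule openin_open_Int)
 moreover have "y : Rn d Int ?N" using kap_Rn eta(1) by (simp add: g0(3))
 moreover have "Rn d Int ?N <= kap ` (W Int V)"
 proof
  fix x assume "x : Rn d Int ?N"
  hence "x : kap ` (W Int ball g0 e)" by (intro eta(2)) auto
  thus "x : kap ` (W Int V)" using e(2) by blast
 qed
 ultimately show "EX T. openin (Euclidean_space d) T & y : T & T <= kap ` (W Int V)" by blast
qed

lemma open_kapW: "openin (Euclidean_space d) (kap ` W)" using openin_kap[of UNIV] by simp

lemma continuous_on_psi: "cton (kap ` W) psi"
proof (rule continuous_on_inverse_open_map[OF continuous_on_kap[of W] refl])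
 show "openin (top_of_set (kap ` W)) (kap ` U)" if U: "openin (top_of_set W) U" for U
 proof -
  obtain V where "open V" "U = W Int V" using U unfolding openin_open by blast
  hence "openin (Euclidean_space d) (kap ` U)" using openin_kap by simp
  moreover have "kap ` U <= kap ` W" using openin_subset[OF U] by auto
  ultimately show ?thesis using kap_Rn unfolding Euclidean_space_eq by (auto intro: openin_subset_trans)
 qed
qed (use psi in auto)

lemma psi_derivative:
 assumes x: "x : kap ` W" and j: "j < d"
 shows "((%t. psi (x(j := t))) hvd psi x * D (psi x) j) (at (x j))" unfolding has_vector_derivative_iff_quotient
proof (rule LIM_zero_cancel, rule Lim_null_comparison)
 define c where "c = 80 * C * (norm (Y j))\<^sup>2"
 let ?S = "{t. x(j := t) : kap ` W}"
 have "\<forall>\<^sub>F t in at (x j). t : ?S & t ~= x j"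
  using open_line[OF open_kapW x j] x by (intro eventually_conj eventually_at_in_open') (auto simp: eventually_at_filter)
 thus "\<forall>\<^sub>F t in at (x j). norm ((psi (x(j := t)) - psi (x(j := x j))) /R (t - x j) - psi x * D (psi x) j) <= c * abs(t - x j)"
 proof eventually_elim
  case (elim t)
  hence xt: "x(j := t) : kap ` W" and ne: "t ~= x j" by auto
  define s where "s = t - x j"
  have s: "s ~= 0" using ne by (simp add: s_def)
  have "pj (psi (x(j := t)) - psi x) = (\<Sum>i<d. if i = j then s *R Y j else 0)" unfolding pj_diff psi(3)[OF x] psi(3)[OF xt] by (intro sum.cong) (auto simp: s_def)
  hence "pj (psi (x(j := t)) - psi x) = s *R Y j" using j by simp
  from kap_inverse_derivative[OF psi(2)[OF x] psi(2)[OF xt] j this]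
  have b: "norm (psi (x(j := t)) - psi x - s *R (psi x * D (psi x) j)) <= c * s\<^sup>2" by (simp add: c_def)
  have "norm ((psi (x(j := t)) - psi x) /R s - psi x * D (psi x) j) = norm ((psi (x(j := t)) - psi x - s *R (psi x * D (psi x) j)) /R s)"
   using s by (simp add: scaleR_diff_right)
  also have "... = inverse (abs(s)) * norm (psi (x(j := t)) - psi x - s *R (psi x * D (psi x) j))" by simp
  also have "... <= inverse (abs(s)) * (c * s\<^sup>2)" by (intro mult_left_mono b) simp
  also have "... = c * abs(s)" using s by (cases "0 < s") (simp_all add: power2_eq_square field_simps)
  finally show ?case by (simp add: s_def)
 qed
 have "((%t. c * abs(t - x j)) ---> c * abs(x j - x j)) (at (x j))" by (intro tendsto_intros)
 thus "((%t. c * abs(t - x j)) ---> 0) (at (x j))" by simp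
qed

text \<open>Bootstrapping: the partial derivatives of \<open>psi\<close> arise from
  \<open>psi\<close> itself by products, linear maps and \<open>ainv\<close>, so class
  \<open>k\<close> implies class \<open>Suc k\<close>.\<close>

lemma Ck_psi: "Ck k d (kap ` W) psi"
proof (induction k)
 case 0
 show ?case by (simp add: continuous_on_psi)
next
 case (Suc k)
 show ?case
 proof (rule Ck_SucI[OF continuous_on_psi psi_derivative])
  fix j assume "j < d"
  have L: "bounded_linear (%A. \<Sum>i<d. \<Sum>j<d. fip n (A * Y j) (Y i) *R E i j)"
   by (intro bounded_linear_sum bounded_linear_scaleR_const[OF bounded_linear_compose[OF bounded_linear_fip bounded_linear_mult_left]])
  have "Ck k d (kap ` W) (%x. 1 + (\<Sum>i<d. \<Sum>j<d. fip n ((psi x + (- 1)) * Y j) (Y i) *R E i j))"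
   by (intro Ck_add Ck_const Ck_linear[OF L, of k d "kap ` W" "%x. psi x + (- 1)"] Suc.IH)
  hence "Ck k d (kap ` W) (%x. jac (psi x))" by (simp add: jac_def)
  moreover have "jac (psi x) : Inv 2" if "x : kap ` W" for x unfolding jac_def using psi(2)[OF that] by (intro inv) (simp add: W_def)
  ultimately have w: "Ck k d (kap ` W) (%x. ainv (jac (psi x)))" by (intro Ck_ainv[OF open_kapW, where bet = 2]) auto
  have "bounded_linear (%A. \<Sum>i<d. entry A i j *R Y i)" by (intro bounded_linear_sum bounded_linear_scaleR_const[OF bounded_linear_entry])
  from Ck_linear[OF this w] have "Ck k d (kap ` W) (%x. D (psi x) j)" by (simp add: D_def)
  thus "Ck k d (kap ` W) (%x. psi x * D (psi x) j)" by (intro Ck_mult Suc.IH)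
 qed
qed

lemma smooth_kap:
 assumes U: "openin (Euclidean_space m) U" and F: "!!k. Ck k m U F" and f: "!!x. x : U ==> norm (F x - 1) < dlt ==> f x = kap (F x)"
 shows "smooth_on m d {x : U. norm (F x - 1) < dlt} f" unfolding smooth_on_def
proof (intro allI impI)
 let ?S = "{x : U. norm (F x - 1) < dlt}"
 have UR: "U <= Rn m" using openin_subset[OF U] by (simp add: Euclidean_space_eq)
 obtain V where V: "open V" "U = Rn m Int V" using U unfolding Euclidean_space_eq openin_open by blast
 have "openin (top_of_set U) (U Int F -` ball 1 dlt)" by (rule continuous_openin_preimage_gen[OF Ck_cont[OF F]]) simp
 also have "U Int F -` ball 1 dlt = ?S" by (auto simp: dist_norm norm_minus_commute)
 finally have S: "openin (Euclidean_space m) ?S" using U unfolding Euclidean_space_eq by (rule openin_trans)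
 fix j k assume j: "j < d"
 have "Ck k m ?S (%x. fip n (F x + (- 1)) (Y j))" by (intro Ck_linear[OF bounded_linear_fip, of k m ?S "%x. F x + (- 1)"] Ck_add Ck_const Ck_subset[OF F]) auto
 hence "Ck k m ?S (%x. f x j)" by (rule Ck_cong[OF S, rotated]) (use f j in "auto simp: kap_def")
 thus "C_k k m ?S (%x. f x j)" using UR by (subst C_k_eq_Ck) auto
qed

end

section \<open>The atlas of left translated charts\<close>

context compact_group
begin

context
 fixes n rho d Y C dlt
 assumes rho: "rep n rho" "faithful rho" and chart: "matrix_chart n d (rho ` cG) Y C dlt"
begin

interpretation matrix_chart n d "rho ` cG" Y C dlt by (rule chart)

definition cdom :: "'a => 'a set" where "cdom c = {g : cG. norm (rho (inv c ** g) - 1) < dlt}"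
definition cmap :: "'a => 'a => nat => real" where "cmap c g = kap (rho (inv c ** g))"
definition cinv :: "'a => (nat => real) => 'a" where "cinv c x = c ** inv_into cG rho (psi x)"
definition charts :: "'a chart set" where "charts = {(cdom c, cmap c) |c. c : cG}"

lemma rhom: "x : cG ==> y : cG ==> rho (x ** y) = rho x * rho y" using rho(1) by (simp add: rep_def)

lemma cdom_W: "c : cG ==> g : cdom c ==> rho (inv c ** g) : W" unfolding cdom_def W_def by auto

lemma cdom_carrier: "g : cdom c ==> g : cG" by (simp add: cdom_def)

lemma cinv:
 assumes c: "c : cG"
 shows "x : kap ` W ==> rho (inv c ** cinv c x) = psi x" "x : kap ` W ==> cinv c x : cdom c"
  "x : kap ` W ==> cmap c (cinv c x) = x" "g : cdom c ==> cmap c g : kap ` W" "g : cdom c ==> cinv c (cmap c g) = g"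
  "x : kap ` W ==> rho (cinv c x) = rho c * psi x"
proof -
 note inj = faithful_inj[OF rho]
 have *: "rho (inv c ** cinv c x) = psi x & cinv c x : cdom c & rho (cinv c x) = rho c * psi x" if x: "x : kap ` W"
 proof -
  have K: "psi x : rho ` cG" "norm (psi x - 1) < dlt" using psi(2)[OF x] by (auto simp: W_def)
  define y where "y = inv_into cG rho (psi x)"
  have y: "y : cG" "rho y = psi x" unfolding y_def using inv_into_into[OF K(1)] f_inv_into_f[OF K(1)] .
  have "inv c ** cinv c x = y" using c y by (simp add: cinv_def y_def[symmetric] m_assoc[symmetric])
  thus ?thesis using c y K(2) by (simp add: cdom_def cinv_def y_def[symmetric] rhom)
 qed
 thus "x : kap ` W ==> rho (inv c ** cinv c x) = psi x" "x : kap ` W ==> cinv c x : cdom c"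
  "x : kap ` W ==> rho (cinv c x) = rho c * psi x" by auto
 show "x : kap ` W ==> cmap c (cinv c x) = x" using * psi(3) by (simp add: cmap_def)
 assume g: "g : cdom c"
 note gW = cdom_W[OF c g]
 show "cmap c g : kap ` W" unfolding cmap_def using gW by blast
 have "inv_into cG rho (rho (inv c ** g)) = inv c ** g" using c cdom_carrier[OF g] by (intro inv_into_f_f[OF inj]) simp
 thus "cinv c (cmap c g) = g" using c cdom_carrier[OF g] by (simp add: cinv_def cmap_def psi(1)[OF gW] m_assoc[symmetric])
qed

lemma cmap_image: "c : cG ==> cmap c ` cdom c = kap ` W" using cinv(2,3,4) by (auto simp: image_iff) metis

lemma continuous_left: "c : cG ==> ctm T T (%g. c ** g)" by (intro cont_T)

lemma chart_on_cdom:
 assumes c: "c : cG"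
 shows "chart_on d T (cdom c, cmap c)"
proof -
 have rhoc: "ctm T euclidean (%g. rho (inv c ** g))" using ctm_o[OF continuous_left[of "inv c"], of euclidean rho] c rho(1) by (simp add: rep_def o_def)
 have "cdom c = {g : tsp T. rho (inv c ** g) : ball 1 dlt}" by (auto simp: cdom_def dist_norm norm_minus_commute)
 hence op: "openin T (cdom c)" using open_vim[OF rhoc, of "ball 1 dlt"] by simp
 have sub: "subtop (Euclidean_space d) (kap ` W) = top_of_set (kap ` W)"
  unfolding Euclidean_space_eq using kap_Rn by (auto simp: subtopology_subtopology Int_absorb1 image_subset_iff)
 have "homeomorphic_maps (subtop T (cdom c)) (top_of_set (kap ` W)) (cmap c) (cinv c)" unfolding homeomorphic_maps_def
 proof (intro conjI ballI)
  have "ctm T euclidean kap'" if "kap' = (%g. kap (rho (inv c ** g)))" for kap'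
   unfolding that using ctm_o[OF rhoc, of euclidean kap] continuous_on_kap[of UNIV] by (simp add: o_def)
  hence "ctm T euclidean (cmap c)" unfolding cmap_def[abs_def] by blast
  thus "ctm (subtop T (cdom c)) (top_of_set (kap ` W)) (cmap c)" using cinv(4)[OF c] by (auto simp: ctm_into intro: continuous_map_from_subtopology)
  obtain r where r: "ctm (top_of_set (rho ` cG)) T r" "!!x. x : cG ==> r (rho x) = x" using faithful_homeomorphic[OF rho] by blast
  have "ctm (top_of_set (kap ` W)) (top_of_set (rho ` cG)) psi" using continuous_on_psi psi(2) by (auto simp: ctm_into W_def)
  from ctm_o[OF ctm_o[OF this r(1)] continuous_left[OF c]]
  have "ctm (top_of_set (kap ` W)) T (%x. c ** r (psi x))" by (simp add: o_def)
  moreover have "c ** r (psi x) = cinv c x" if "x : kap ` W" for x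
  proof -
   have "psi x : rho ` cG" using psi(2)[OF that] by (simp add: W_def)
   then obtain y where "y : cG" "psi x = rho y" by blast
   thus ?thesis by (simp add: cinv_def r(2) inv_into_f_f[OF faithful_inj[OF rho]])
  qed
  ultimately have "ctm (top_of_set (kap ` W)) T (cinv c)" by (rule continuous_map_eq) simp
  thus "ctm (top_of_set (kap ` W)) (subtop T (cdom c)) (cinv c)" using cinv(2)[OF c] by (auto simp: ctm_into)
 qed (use cinv[OF c] in auto)
 thus ?thesis unfolding chart_on_def prod.case cmap_image[OF c] sub using op open_kapW homeomorphic_map_maps by blast
qed

text \<open>In all three uses \<open>f\<close> is a group operation, \<open>Phi\<close> a chart and \<open>gam\<close> its inverse.\<close>

lemma smooth_in_charts:
 assumes c: "c : cG" and Q: "openin (Euclidean_space m) Q" "!!k. Ck k m Q F"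
  and gam: "!!z. z : Q ==> gam z : S & Phi (gam z) = z" "!!x. x : S ==> Phi x : Q & gam (Phi x) = x"
  and f: "!!x. x : S ==> f x : cG" "!!z. z : Q ==> rho (inv c ** f (gam z)) = F z"
 shows "smooth_on m d (Phi ` {x : S. f x : cdom c}) (cmap c o f o inv_into S Phi)"
proof -
 have inj: "inj_on Phi S" by (rule inj_on_inverseI[of _ gam]) (use gam(2) in blast)
 have e: "Phi ` {x : S. f x : cdom c} = {z : Q. norm (F z - 1) < dlt}"
 proof (intro equalityI subsetI)
  fix z assume "z : Phi ` {x : S. f x : cdom c}"
  then obtain x where x: "x : S" "f x : cdom c" "z = Phi x" by blast
  thus "z : {z : Q. norm (F z - 1) < dlt}" using gam(2)[OF x(1)] f(2)[of z] by (simp add: cdom_def)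
 next
  fix z assume z: "z : {z : Q. norm (F z - 1) < dlt}"
  hence "gam z : {x : S. f x : cdom c}" using gam(1)[of z] f(1)[of "gam z"] f(2)[of z] by (simp add: cdom_def)
  moreover have "z = Phi (gam z)" using gam(1)[of z] z by simp
  ultimately show "z : Phi ` {x : S. f x : cdom c}" by blast
 qed
 show ?thesis unfolding e
 proof (rule smooth_kap[OF Q])
  fix z assume z: "z : Q"
  have "inv_into S Phi z = gam z" using inv_into_f_f[OF inj, of "gam z"] gam(1)[OF z] by simp
  thus "(cmap c o f o inv_into S Phi) z = kap (F z)" by (simp add: cmap_def f(2)[OF z])
 qed
qed

text \<open>Listing all entries of \<open>rho g\<close> embeds the group into the second countable
  space of real sequences.\<close>

lemma second_countable_T: "second_countable T"
proof -
 define eps where "eps g = (%k. entry (rho g) (fst (prod_decode k)) (snd (prod_decode k)))" for g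
 have "ctm T euclidean (%g. (%A k. entry A (fst (prod_decode k)) (snd (prod_decode k))) (rho g))"
  by (rule continuous_map_unop[of T rho], use rho(1) in "simp add: rep_def")
   (rule continuous_on_coordinatewise_then_product, intro continuous_intros)
 hence c: "ctm T euclidean eps" by (simp add: eps_def[abs_def])
 have "inj_on eps cG"
 proof (rule inj_onI)
  fix x y assume xy: "x : cG" "y : cG" and e: "eps x = eps y"
  have "entry (rho x) i j = entry (rho y) i j" for i j using fun_cong[OF e, of "prod_encode (i, j)"] by (simp add: eps_def)
  hence "rho x - 1 = rho y - 1" using xy rho(1) by (intro Mat_eqI[of _ n]) (auto simp: rep_def)
  thus "x = y" using inj_onD[OF faithful_inj[OF rho]] xy by simp
 qed
 hence "homeomorphic_map T (top_of_set (eps ` cG)) eps" using c compact by (intro continuous_imp_homeomorphic_map) (auto simp: ctm_into Hausdorff_space_subtopology)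
 hence "T homeomorphic_space top_of_set (eps ` cG)" by (rule homeomorphic_map_imp_homeomorphic_space)
 moreover have "second_countable (euclidean :: (nat => real) topology)"
 proof -
  obtain B :: "(nat => real) set set" where "countable B" "topological_basis B" using ex_countable_basis by blast
  thus ?thesis unfolding second_countable_def by (intro exI[of _ B]) (metis open_openin topological_basisE topological_basis_open)
 qed
 ultimately show ?thesis using second_countable_subtopology homeomorphic_space_second_countability by blast
qed

lemma Lie_group_if_chart: "Lie_group G T" unfolding Lie_group_def
proof (intro conjI exI[of _ d] exI[of _ charts])
 show "topological_group G T" by (rule topological_group_axioms)
 show "smooth_manifold d T charts" unfolding smooth_manifold_def smooth_atlas_def
 proof (intro conjI ballI)
  show "Hausdorff_space T" by (rule Hausdorff)
  show "second_countable T" by (rule second_countable_T)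
  show "chart_on d T c" if "c : charts" for c using that chart_on_cdom by (auto simp: charts_def)
  have "g : cdom g" if "g : cG" for g using that dlt(1) rho(1) by (simp add: cdom_def rep_def)
  thus "\<Union> (fst ` charts) = tsp T" by (force simp: charts_def cdom_def)
  fix v assume "v : charts"
  then obtain a where a: "a : cG" "v = (cdom a, cmap a)" by (auto simp: charts_def)
  have "smooth_on d d (cmap a ` {x : cdom a. (%x. x) x : cdom c}) (cmap c o (%x. x) o inv_into (cdom a) (cmap a))" if c: "c : cG" for c
  proof (rule smooth_in_charts[OF c open_kapW, where F = "%x. rho (inv c) * (rho a * psi x)" and gam = "cinv a"])
   show "rho (inv c ** cinv a z) = rho (inv c) * (rho a * psi z)" if z: "z : kap ` W" for z
    using a c cdom_carrier[OF cinv(2)[OF a(1) z]] by (simp add: rhom cinv(6)[OF a(1) z])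
  qed (use a c cinv cdom_carrier in "auto intro!: Ck_mult Ck_const Ck_psi")
  thus "case v of (U, phi) => \<forall>(V, tht)\<in>charts. smooth_on d d (phi ` (U Int V)) (tht o inv_into U phi)" by (auto simp: a charts_def comp_def Int_def)
 qed
 show "smooth_map d T charts d T charts (%x. inv x)" unfolding smooth_map_def
 proof (intro conjI ballI)
  show "ctm T T (%x. inv x)" by (rule continuous_inv)
  fix v assume "v : charts"
  then obtain a where a: "a : cG" "v = (cdom a, cmap a)" by (auto simp: charts_def)
  have inv: "rho (inv g) = ainv (rho g)" if "g : cG" for g using ainv_rep[OF rho(1) that] by simp
  have "smooth_on d d (cmap a ` {x : cdom a. (%x. inv x) x : cdom c}) (cmap c o (%x. inv x) o inv_into (cdom a) (cmap a))" if c: "c : cG" for c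
  proof (rule smooth_in_charts[OF c open_kapW, where F = "%x. rho (inv c) * (ainv (psi x) * rho (inv a))" and gam = "cinv a"])
   show "Ck k d (kap ` W) (%x. rho (inv c) * (ainv (psi x) * rho (inv a)))" for k
    by (intro Ck_mult Ck_const Ck_ainv[OF open_kapW, where bet = 2] Ck_psi W_norm(2) psi(2))
   show "rho (inv c ** inv cinv a z) = rho (inv c) * (ainv (psi z) * rho (inv a))" if z: "z : kap ` W" for z
   proof -
    note g = cdom_carrier[OF cinv(2)[OF a(1) z]]
    have "inv c ** inv cinv a z = inv c ** (inv (inv a ** cinv a z) ** inv a)" using a c g by (simp add: inv_mult_group m_assoc)
    thus ?thesis using a c g by (simp add: rhom inv cinv(1)[OF a(1) z, symmetric])
   qed
  qed (use a c cinv cdom_carrier in auto)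
  thus "case v of (U, phi) => \<forall>(V, tht)\<in>charts. smooth_on d d (phi ` {x : U. inv x : V}) (tht o (%x. inv x) o inv_into U phi)" by (auto simp: a charts_def)
 qed
 show "smooth_map (d + d) (ptop T T) (prod_atlas d charts charts) d T charts (%(x, y). x ** y)" unfolding smooth_map_def
 proof (intro conjI ballI)
  show "ctm (ptop T T) T (%(x, y). x ** y)" by (rule continuous_mult)
  fix v assume "v : prod_atlas d charts charts"
  then obtain a b where ab: "a : cG" "b : cG"
   and v: "v = (cdom a \<times> cdom b, %(x, y) i. if i < d then cmap a x i else cmap b y (i - d))" by (auto simp: charts_def prod_atlas_def)
  define p where "p e x = (%i. if i < d then x (e i) else (0::real))" for e :: "nat => nat" and x
  define Q where "Q = {z : Rn (d + d). p (%i. i) z : kap ` W & p (%i. i + d) z : kap ` W}"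
  have pc: "cton S (p e)" for e S
  proof (rule continuous_on_coordinatewise_then_product)
   show "cton S (%x. p e x i)" for i unfolding p_def by (cases "i < d") (simp_all add: continuous_on_subset[OF continuous_on_product_coordinates subset_UNIV])
  qed
  obtain V where V: "open V" "kap ` W = Rn d Int V" using open_kapW unfolding Euclidean_space_eq openin_open by blast
  have "Q = Rn (d + d) Int (p (%i. i) -` V Int p (%i. i + d) -` V)" unfolding Q_def V(2) by (auto simp: p_def)
  moreover have "open (p (%i. i) -` V Int p (%i. i + d) -` V)" using V(1) pc by (intro open_Int open_vimage pc)
  ultimately have Q: "openin (Euclidean_space (d + d)) Q" unfolding Euclidean_space_eq openin_open by blast
  have pQ: "p (%i. i) ` Q <= kap ` W" "p (%i. i + d) ` Q <= kap ` W" by (auto simp: Q_def)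
  let ?Phi = "%(x, y) i. if i < d then cmap a x i else cmap b y (i - d)"
  have "smooth_on (d + d) d (?Phi ` {z : cdom a \<times> cdom b. (%(x, y). x ** y) z : cdom c}) (cmap c o (%(x, y). x ** y) o inv_into (cdom a \<times> cdom b) ?Phi)"
   if c: "c : cG" for c
  proof (rule smooth_in_charts[OF c Q, where F = "%z. rho (inv c) * ((rho a * psi (p (%i. i) z)) * (rho b * psi (p (%i. i + d) z)))"
     and gam = "%z. (cinv a (p (%i. i) z), cinv b (p (%i. i + d) z))"])
   fix k
   have "Ck k (d + d) Q (%z. psi (p e z))" if "inj_on e {..<d}" "e ` {..<d} <= {..<d + d}" "p e ` Q <= kap ` W" for e
    using Ck_reindex[OF that(1,2), of Q "kap ` W" k psi] that(3) Ck_psi by (simp add: p_def)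
   from this[of "%i. i", OF _ _ pQ(1)] this[of "%i. i + d", OF _ _ pQ(2)]
   have "Ck k (d + d) Q (%z. psi (p (%i. i) z))" "Ck k (d + d) Q (%z. psi (p (%i. i + d) z))" by (auto simp: image_subset_iff)
   thus "Ck k (d + d) Q (%z. rho (inv c) * ((rho a * psi (p (%i. i) z)) * (rho b * psi (p (%i. i + d) z))))" by (intro Ck_mult Ck_const)
  next
   fix z assume z: "z : Q"
   hence z12: "p (%i. i) z : kap ` W" "p (%i. i + d) z : kap ` W" and zR: "!!i. d + d <= i ==> z i = 0" by (auto simp: Q_def)
   have "?Phi (cinv a (p (%i. i) z), cinv b (p (%i. i + d) z)) = z"
    using zR by (simp add: cinv(3)[OF ab(1) z12(1)] cinv(3)[OF ab(2) z12(2)] fun_eq_iff) (auto simp: p_def)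
   thus "(cinv a (p (%i. i) z), cinv b (p (%i. i + d) z)) : cdom a \<times> cdom b & ?Phi (cinv a (p (%i. i) z), cinv b (p (%i. i + d) z)) = z"
    using cinv(2) ab c z12 by blast
   show "rho (inv c ** (%(x, y). x ** y) (cinv a (p (%i. i) z), cinv b (p (%i. i + d) z))) =
     rho (inv c) * ((rho a * psi (p (%i. i) z)) * (rho b * psi (p (%i. i + d) z)))"
    using ab c cdom_carrier[OF cinv(2)[OF ab(1) z12(1)]] cdom_carrier[OF cinv(2)[OF ab(2) z12(2)]] z12 by (simp add: rhom cinv(6))
  next
   fix u assume "u : cdom a \<times> cdom b"
   then obtain x y where u: "u = (x, y)" "x : cdom a" "y : cdom b" by blast
   have R: "cmap a x : Rn d" "cmap b y : Rn d" unfolding cmap_def by (rule kap_Rn)+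
   hence e: "p (%i. i) (?Phi u) = cmap a x" "p (%i. i + d) (?Phi u) = cmap b y" by (auto simp: u p_def fun_eq_iff)
   have "?Phi u : Rn (d + d)" using R by (auto simp: u)
   thus "?Phi u : Q & (cinv a (p (%i. i) (?Phi u)), cinv b (p (%i. i + d) (?Phi u))) = u" unfolding Q_def mem_Collect_eq e using cinv(4,5) ab c u by simp
   show "(%(x, y). x ** y) u : cG" using u cdom_carrier by simp
  qed
  thus "case v of (U, phi) => \<forall>(V, tht)\<in>charts. smooth_on (d + d) d (phi ` {x : U. (case x of (x, y) => x ** y) : V}) (tht o (%(x, y). x ** y) o inv_into U phi)"
   by (auto simp: v charts_def)
 qed
qed

end

lemma Lie_group_if_faithful_rep:
 assumes "rep n rho" "faithful rho"
 shows "Lie_group G T"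
proof -
 obtain d Y C dlt where "matrix_chart n d (rho ` cG) Y C dlt" using matrix_chart_exists[OF cmg_rep[OF assms(1)]] by blast
 thus ?thesis by (rule Lie_group_if_chart[OF assms])
qed

end

section \<open>Faithful representations of Lie groups\<close>

lemma box_in_open:
 assumes S: "openin (Euclidean_space m) S" and P: "P : S"
 obtains r where "0 < r" "!!z. z : Rn m ==> (!!i. i < m ==> abs(z i - P i) < r) ==> z : S"
proof -
 obtain V where V: "open V" "S = Rn m Int V" using S unfolding Euclidean_space_eq openin_open by blast
 have "P : V" using V P by blast
 have "openin (powertop_real UNIV) V" unfolding euclidean_product_topology open_openin[symmetric] by (rule V(1))
 from product_topology_open_contains_basis[OF this `P : V`]
 obtain X where X: "P : PiE UNIV X" "!!i. openin euclideanreal (X i)" "PiE UNIV X <= V" by blast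
 have "EX e>0. ball (P i) e <= X i" for i using openE[of "X i" "P i"] X(1,2) by (metis PiE_mem UNIV_I open_openin)
 then obtain e where e: "!!i. 0 < e i" "!!i. ball (P i) (e i) <= X i" by metis
 define r where "r = Min (insert 1 (e ` {..<m}))"
 have r: "0 < r" "!!i. i < m ==> r <= e i" using e(1) by (auto simp: r_def)
 show ?thesis
 proof (rule that[OF r(1)])
  fix z assume z: "z : Rn m" "!!i. i < m ==> abs(z i - P i) < r"
  have "z i : X i" for i
  proof (cases "i < m")
   case True
   hence "z i : ball (P i) (e i)" using z(2)[of i] r(2)[of i] by (simp add: dist_real_def abs_minus_commute)
   thus ?thesis using e(2) by blast
  next
   case False
   hence "z i = P i" using z(1) P V(2) by auto
   thus ?thesis using X(1) by auto
  qed
  thus "z : S" using X(3) V(2) z(1) by (auto simp: PiE_UNIV_domain)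
 qed
qed

context compact_group
begin

text \<open>
 In a chart at \<open>1\<close> with \<open>p = phi 1\<close> the derivative of \<open>y \<mapsto> x \<otimes> y\<close> is close to the identity, so squaring
 expands the distance from \<open>p\<close> (in the \<open>l\<^sup>1\<close> norm) by a factor close to \<open>2\<close>.
\<close>

lemma squaring_expands:
 assumes U: "openin T U" "\<one> : U" and phiU: "openin (Euclidean_space d) (phi ` U)"
  and hm: "homeomorphic_map (subtop T U) (subtop (Euclidean_space d) (phi ` U)) phi"
  and smooth: "smooth_on (d + d) d ((%(x, y) i. if i < d then phi x i else phi y (i - d)) ` {x : U \<times> U. (%(x, y). x ** y) x : U})
   (phi o (%(x, y). x ** y) o inv_into (U \<times> U) (%(x, y) i. if i < d then phi x i else phi y (i - d)))"
 obtains r where "0 < r" "!!x. x : U ==> (!!i. i < d ==> abs(phi x i - phi \<one> i) < r) ==>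
   3/2 * (\<Sum>i<d. abs(phi x i - phi \<one> i)) <= (\<Sum>i<d. abs(phi (x ** x) i - phi \<one> i))"
proof -
 let ?Phi = "%(x, y) i. if i < d then phi x i else phi y (i - d)"
 have UT: "U <= cG" using openin_subset[OF U(1)] by simp
 have phiR: "phi x : Rn d" if "x : U" for x using openin_subset[OF phiU] that by (auto simp: Euclidean_space_eq)
 have inj: "inj_on phi U" using homeomorphic_imp_injective_map[OF hm] UT by (simp add: Int_absorb1)
 define p where "p = phi \<one>"
 define Z where "Z u v = (%i. if i < d then u i else v (i - d) :: real)" for u v
 have PhiZ: "?Phi (x, y) = Z (phi x) (phi y)" for x y by (simp add: Z_def fun_eq_iff)
 have ZE: "u = u' & v = v'" if "Z u v = Z u' v'" "u : Rn d" "u' : Rn d" for u v u' v'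
 proof -
  have "u i = u' i" for i using fun_cong[OF that(1), of i] that(2,3) by (cases "i < d") (auto simp: Z_def)
  moreover have "v i = v' i" for i using fun_cong[OF that(1), of "i + d"] by (simp add: Z_def)
  ultimately show ?thesis by auto
 qed
 have injPhi: "inj_on ?Phi (U \<times> U)"
 proof (rule inj_onI)
  fix a b assume ab: "a : U \<times> U" "b : U \<times> U" "?Phi a = ?Phi b"
  obtain x y x' y' where xy: "a = (x, y)" "b = (x', y')" by (metis surj_pair)
  have "phi x = phi x' & phi y = phi y'" using ZE[OF ab(3)[unfolded xy PhiZ] phiR phiR] ab xy by simp
  thus "a = b" using inj_onD[OF inj] ab xy by auto
 qed
 define S where "S = ?Phi ` {x : U \<times> U. (%(x, y). x ** y) x : U}"
 define f where "f = phi o (%(x, y). x ** y) o inv_into (U \<times> U) ?Phi"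
 have fZ: "f (Z (phi x) (phi y)) = phi (x ** y)" if "x : U" "y : U" for x y using inv_into_f_f[OF injPhi, of "(x, y)"] that by (simp add: f_def PhiZ[symmetric])
 have SU: "x ** y : U" if xy: "Z (phi x) (phi y) : S" "x : U" "y : U" for x y
 proof -
  obtain a b where ab: "a : U" "b : U" "a ** b : U" "Z (phi x) (phi y) = Z (phi a) (phi b)" using xy(1) unfolding S_def by (auto simp: Z_def)
  have "x = a & y = b" using ZE[OF ab(4) phiR phiR] inj_onD[OF inj] ab xy by auto
  thus ?thesis using ab by simp
 qed
 have S1: "Z u v : S" if "u = phi x" "v = phi y" "x : U" "y : U" "x ** y : U" for u v x y unfolding S_def that(1,2) PhiZ[symmetric] using that by (intro imageI) simp
 obtain gam where gamc: "ctm (top_of_set (phi ` U)) T gam" and gam: "!!x. x : U ==> gam (phi x) = x"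
 proof -
  have "subtop (Euclidean_space d) (phi ` U) = top_of_set (phi ` U)" using phiR by (auto simp: Euclidean_space_eq subtopology_subtopology Int_absorb1 image_subset_iff)
  thus ?thesis using hm that UT unfolding homeomorphic_map_maps homeomorphic_maps_def by (auto simp: ctm_into Int_absorb1)
 qed
 define q1 q2 where "q1 z = (%i. if i < d then z i else (0::real))" and "q2 z = (%i. if i < d then z (i + d) else (0::real))" for z
 have Zq: "z = Z (q1 z) (q2 z)" if "z : Rn (d + d)" for z using that by (auto simp: Z_def q1_def q2_def fun_eq_iff)
 have qZ: "q1 (Z u v) = u" "q2 (Z u v) = v" if "u : Rn d" "v : Rn d" for u v using that by (auto simp: Z_def q1_def q2_def fun_eq_iff)
 have qc: "cton A q1" "cton A q2" for A
 proof -
  have "cton A (%z. q1 z i)" "cton A (%z. q2 z i)" for i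
   unfolding q1_def q2_def by (cases "i < d"; simp add: continuous_on_subset[OF continuous_on_product_coordinates subset_UNIV])+
  thus "cton A q1" "cton A q2" using continuous_on_coordinatewise_then_product by blast+
 qed
 have So: "openin (Euclidean_space (d + d)) S"
 proof -
  obtain V where V: "open V" "phi ` U = Rn d Int V" using phiU unfolding Euclidean_space_eq openin_open by blast
  define Q where "Q = {z : Rn (d + d). q1 z : phi ` U & q2 z : phi ` U}"
  have "Q = Rn (d + d) Int (q1 -` V Int q2 -` V)" unfolding Q_def V(2) by (auto simp: q1_def q2_def)
  moreover have "open (q1 -` V Int q2 -` V)" using V(1) qc by (intro open_Int open_vimage qc)
  ultimately have Q: "openin (top_of_set (Rn (d + d))) Q" by (auto simp: openin_open)
  have "ctm (top_of_set Q) (top_of_set (phi ` U)) q1" "ctm (top_of_set Q) (top_of_set (phi ` U)) q2" using qc by (auto simp: ctm_into Q_def)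
  from continuous_map_mult[OF this[THEN ctm_o[OF _ gamc]]]
  have "ctm (top_of_set Q) T (%z. gam (q1 z) ** gam (q2 z))" by (simp add: o_def)
  from open_vim[OF this U(1)]
  have o: "openin (top_of_set Q) {z : Q. gam (q1 z) ** gam (q2 z) : U}" by simp
  have "S = {z : Q. gam (q1 z) ** gam (q2 z) : U}"
  proof (intro equalityI subsetI)
   fix z assume "z : S"
   then obtain x y where xy: "x : U" "y : U" "x ** y : U" "z = Z (phi x) (phi y)" unfolding S_def by (auto simp: Z_def)
   moreover have "z : Rn (d + d)" using xy phiR[OF xy(2)] by (auto simp: Z_def)
   ultimately show "z : {z : Q. gam (q1 z) ** gam (q2 z) : U}" using qZ[OF phiR phiR] gam by (simp add: Q_def)
  next
   fix z assume z: "z : {z : Q. gam (q1 z) ** gam (q2 z) : U}"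
   then obtain x y where xy: "x : U" "y : U" "q1 z = phi x" "q2 z = phi y" by (auto simp: Q_def)
   have "Z (q1 z) (q2 z) : S" using xy z gam by (intro S1[of _ x _ y]) auto
   thus "z : S" using Zq[of z] z by (simp add: Q_def)
  qed
  thus ?thesis using openin_trans[OF o Q] unfolding Euclidean_space_eq by simp
 qed
 have SR: "S <= Rn (d + d)" using openin_subset[OF So] by (simp add: Euclidean_space_eq)
 have "EX g. (ALL z:S. ((%t. f (z(d + i := t)) j) hvd g z) (at (z (d + i)))) & cton S g"
  if "i < d" "j < d" for i j
 proof -
  have "C_k (Suc 0) (d + d) S (%z. f z j)" using smooth that(2) unfolding smooth_on_def S_def f_def by blast
  thus ?thesis unfolding C_k_eq_Ck[OF SR] using that(1) by simp
 qed
 then obtain g where g: "!!i j z. i < d ==> j < d ==> z : S ==> ((%t. f (z(d + i := t)) j) hvd g i j z) (at (z (d + i)))"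
  "!!i j. i < d ==> j < d ==> cton S (g i j)" by metis
 have pR: "p : Rn d" unfolding p_def by (rule phiR[OF U(2)])
 define P where "P = Z p p"
 have PS: "P : S" unfolding P_def p_def using U(2) UT by (intro S1[of _ \<one> _ \<one>]) auto
 \<comment> \<open>The partial derivatives in the second factor at \<open>(p, p)\<close> form the
   identity matrix, because multiplication by \<open>\<one>\<close> on the left is the
   identity.\<close>
 have gP: "g i j P = (if i = j then 1 else 0)" if ij: "i < d" "j < d" for i j
 proof -
  let ?A = "{t. P(d + i := t) : S}"
  have oA: "open ?A" using open_line[OF So PS, of "d + i"] ij by simp
  have "((%t. if i = j then t else p j) hvd g i j P) (at (P (d + i)))"
  proof (rule has_vector_derivative_transform_within_open[OF g(1)[OF ij PS] oA])
   fix t assume t: "t : ?A"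
   have Pt: "P(d + i := t) = Z p (p(i := t))" using ij by (auto simp: P_def Z_def fun_eq_iff)
   then obtain x y where xy: "x : U" "y : U" "Z p (p(i := t)) = Z (phi x) (phi y)" using t unfolding S_def by (auto simp: Z_def)
   have e: "p = phi x" "p(i := t) = phi y" using ZE[OF xy(3) pR phiR[OF xy(1)]] by auto
   have "f (Z p (phi y)) = phi y" using fZ[OF U(2) xy(2)] l_one[of y] xy(2) UT unfolding p_def by auto
   hence "f (P(d + i := t)) = p(i := t)" unfolding Pt e(2) .
   thus "f (P(d + i := t)) j = (if i = j then t else p j)" by auto
  qed (use PS in auto)
  moreover have "((%t. if i = j then t else p j) hvd (if i = j then 1 else 0)) (at (P (d + i)))"
   by (cases "i = j") (auto intro: has_vector_derivative_id[unfolded id_def])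
  ultimately show ?thesis by (rule vector_derivative_unique_at)
 qed
 \<comment> \<open>Each of the \<open>d\<close> coordinates may err by \<open>eps\<close> times the
   total distance; \<open>real d * eps <= 1/2\<close> lowers the expansion factor from 2 to no less
   than 3/2.\<close>
 define eps where "eps = 1 / (2 * real d + 2)"
 have eps: "0 < eps" "real d * eps <= 1/2" by (simp_all add: eps_def field_simps)
 define B where "B = S Int (\<Inter>i\<in>{..<d}. \<Inter>j\<in>{..<d}. {z : S. abs(g i j z - g i j P) < eps})"
 have gB: "openin (top_of_set S) {z : S. abs(g i j z - g i j P) < eps}" if "i < d" "j < d" for i j
  using continuous_openin_preimage_gen[OF g(2)[OF that], of "ball (g i j P) eps"] by (simp add: vimage_def Int_def dist_real_def abs_minus_commute)
 have "openin (top_of_set S) B"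
 proof (cases "d = 0")
  case False
  hence ne: "{..<d} ~= {}" by auto
  show ?thesis unfolding B_def by (rule openin_Int[OF openin_subtopology_self openin_INT2[OF finite_lessThan ne openin_INT2[OF finite_lessThan ne gB]]]) auto
 qed (simp add: B_def)
 from openin_trans[OF this So[unfolded Euclidean_space_eq]] have "openin (Euclidean_space (d + d)) B" by (simp add: Euclidean_space_eq)
 moreover have "P : B" using PS eps by (simp add: B_def)
 ultimately obtain r where r: "0 < r" "!!z. z : Rn (d + d) ==> (!!i. i < d + d ==> abs(z i - P i) < r) ==> z : B" using box_in_open by blast
 show ?thesis
 proof (rule that[OF r(1)])
  fix x assume x: "x : U" and near: "!!i. i < d ==> abs(phi x i - phi \<one> i) < r"
  define u where "u = phi x"
  have uR: "u : Rn d" unfolding u_def by (rule phiR[OF x])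
  \<comment> \<open>The second argument is changed from \<open>p\<close> to \<open>u\<close> one
    coordinate at a time, by the mean value inequality in one variable. The first stays at
    \<open>u\<close>, and \<open>f (Z u p) = u\<close> since \<open>x ** \<one> = x\<close>.\<close>
  define w where "w k = (%i. if i < k then u i else p i)" for k
  have box: "Z u v : B" if "v : Rn d" "!!i. i < d ==> abs(v i - p i) < r" for v
  proof (rule r(2))
   show "Z u v : Rn (d + d)" using that(1) by (auto simp: Z_def)
   show "abs(Z u v i - P i) < r" if "i < d + d" for i
    using that near[of i] `!!i. i < d ==> \<bar>v i - p i\<bar> < r`[of "i - d"] by (auto simp: Z_def P_def u_def p_def)
  qed
  have step: "abs(f (Z u (w (Suc i))) j - f (Z u (w i)) j - (if i = j then u i - p i else 0)) <= eps * abs(u i - p i)"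
   if ij: "i < d" "j < d" for i j
  proof -
   let ?z = "%t. Z u ((w i)(i := t))" and ?dlt = "if i = j then 1 else 0 :: real"
   let ?I = "{min (p i) (u i)..max (p i) (u i)}"
   have zz: "(?z t)(d + i := s) = ?z s" for s t using ij by (auto simp: Z_def fun_eq_iff)
   have zB: "?z t : B" if t: "t : ?I" for t
   proof (rule box)
    show "(w i)(i := t) : Rn d" using pR uR ij by (auto simp: w_def)
    show "abs(((w i)(i := t)) l - p l) < r" if "l < d" for l
     using near[of l] near[of i] that ij t r(1) by (auto simp: w_def u_def[symmetric] p_def[symmetric] min_def max_def split: if_splits)
   qed
   have "norm ((%t. f (?z t) j - ?dlt * t) (u i) - (%t. f (?z t) j - ?dlt * t) (p i)) <= eps * norm (u i - p i)"
   proof (rule field_differentiable_bound[of ?I _ "%t. g i j (?z t) - ?dlt"])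
    fix t assume t: "t : ?I"
    have zS: "?z t : S" using zB[OF t] by (simp add: B_def)
    have "?z t (d + i) = t" using ij by (simp add: Z_def)
    hence "((%t. f (?z t) j) has_real_derivative g i j (?z t)) (at t)" using g(1)[OF ij zS] unfolding zz by (simp add: has_real_derivative_iff_has_vector_derivative)
    hence "((%t. f (?z t) j - ?dlt * t) has_real_derivative g i j (?z t) - ?dlt) (at t)" by (intro derivative_eq_intros) auto
    thus "((%t. f (?z t) j - ?dlt * t) has_field_derivative g i j (?z t) - ?dlt) (at t within ?I)" by (rule has_field_derivative_at_within)
    have "abs(g i j (?z t) - g i j P) < eps" using zB[OF t] ij by (simp add: B_def)
    thus "norm (g i j (?z t) - ?dlt) <= eps" unfolding gP[OF ij] by simp
   qed auto
   moreover have "(w i)(i := u i) = w (Suc i)" "(w i)(i := p i) = w i" by (auto simp: w_def fun_eq_iff)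
   ultimately show ?thesis by (auto simp: algebra_simps)
  qed
  have w: "w 0 = p" "w d = u" using uR pR by (auto simp: w_def fun_eq_iff)
  have "Z u u : B" using uR near by (intro box) (auto simp: u_def p_def)
  hence xx: "x ** x : U" using SU[of x x] x by (simp add: u_def B_def)
  have comp: "abs(phi (x ** x) j - p j - 2 * (u j - p j)) <= eps * (\<Sum>i<d. abs(u i - p i))" if j: "j < d" for j
  proof -
   have "f (Z u (w d)) j - f (Z u (w 0)) j = (\<Sum>i<d. f (Z u (w (Suc i))) j - f (Z u (w i)) j)" by (rule sum_lessThan_telescope[symmetric])
   moreover have "(\<Sum>i<d. if i = j then u i - p i else 0) = u j - p j" using j by simp
   ultimately have "f (Z u u) j - f (Z u p) j - (u j - p j) =
     (\<Sum>i<d. f (Z u (w (Suc i))) j - f (Z u (w i)) j - (if i = j then u i - p i else 0))" by (simp add: w sum_subtractf)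
   also have "abs(...) <= (\<Sum>i<d. eps * abs(u i - p i))" by (rule order_trans[OF sum_abs sum_mono]) (use step j in auto)
   finally have "abs(f (Z u u) j - f (Z u p) j - (u j - p j)) <= eps * (\<Sum>i<d. abs(u i - p i))" by (simp add: sum_distrib_left)
   moreover have "f (Z u u) = phi (x ** x)" "f (Z u p) = u" using fZ[OF x x] fZ[OF x U(2)] x UT by (auto simp: u_def p_def)
   ultimately show ?thesis by (simp add: algebra_simps)
  qed
  define M where "M = (\<Sum>i<d. abs(u i - p i))"
  have "2 * M - (\<Sum>j<d. eps * M) = (\<Sum>j<d. 2 * abs(u j - p j) - eps * M)" by (simp add: M_def sum_subtractf sum_distrib_left)
  also have "... <= (\<Sum>j<d. abs(phi (x ** x) j - p j))"
  proof (rule sum_mono)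
   fix j assume "j : {..<d}"
   hence "abs(phi (x ** x) j - p j - 2 * (u j - p j)) <= eps * M" unfolding M_def by (intro comp) simp
   thus "2 * abs(u j - p j) - eps * M <= abs(phi (x ** x) j - p j)" by linarith
  qed
  also have "(\<Sum>j<d. eps * M) = (real d * eps) * M" by simp
  finally have "2 * M - (real d * eps) * M <= (\<Sum>j<d. abs(phi (x ** x) j - p j))" .
  moreover have "(real d * eps) * M <= 1/2 * M" by (intro mult_right_mono eps(2)) (simp add: M_def sum_nonneg)
  ultimately show "3/2 * (\<Sum>i<d. abs(phi x i - phi \<one> i)) <= (\<Sum>i<d. abs(phi (x ** x) i - phi \<one> i))" by (simp add: M_def u_def p_def)
 qed
qed

text \<open>A representation whose kernel lies in a neighbourhood of \<open>\<one>\<close> where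
  squaring expands distances is faithful: the iterated squares of a kernel element stay in that
  neighbourhood, so its distance to \<open>\<one>\<close> in the chart is 0.\<close>

lemma faithful_rep_if_Lie_group:
 assumes "Lie_group G T"
 shows "EX n rho. rep n rho & faithful rho"
proof -
 obtain d A where A: "smooth_atlas d T A"
  and m: "smooth_map (d + d) (ptop T T) (prod_atlas d A A) d T A (%(x, y). x ** y)" using assms unfolding Lie_group_def smooth_manifold_def by blast
 have "\<one> : \<Union> (fst ` A)" using A by (simp add: smooth_atlas_def)
 then obtain U phi where Uphi: "(U, phi) : A" "\<one> : U" by auto
 have "chart_on d T (U, phi)" using A Uphi(1) by (auto simp: smooth_atlas_def)
 hence U: "openin T U" and phiU: "openin (Euclidean_space d) (phi ` U)"
  and hm: "homeomorphic_map (subtop T U) (subtop (Euclidean_space d) (phi ` U)) phi" by (auto simp: chart_on_def)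
 have UT: "U <= cG" using openin_subset[OF U(1)] by simp
 let ?Phi = "%(x, y) i. if i < d then phi x i else phi y (i - d)"
 have "(U \<times> U, ?Phi) : prod_atlas d A A" using Uphi(1) unfolding prod_atlas_def by blast
 hence "smooth_on (d + d) d (?Phi ` {x : U \<times> U. (%(x, y). x ** y) x : U}) (phi o (%(x, y). x ** y) o inv_into (U \<times> U) ?Phi)"
  using m Uphi(1) unfolding smooth_map_def by fast
 then obtain r where r: "0 < r" "!!x. x : U ==> (!!i. i < d ==> abs(phi x i - phi \<one> i) < r) ==>
   3/2 * (\<Sum>i<d. abs(phi x i - phi \<one> i)) <= (\<Sum>i<d. abs(phi (x ** x) i - phi \<one> i))" using squaring_expands[OF U Uphi(2) phiU hm] by blast
 define V where "V = {x : U. ALL i:{..<d}. abs(phi x i - phi \<one> i) < r}"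
 have "ctm (subtop T U) (subtop (Euclidean_space d) (phi ` U)) phi" by (rule homeomorphic_imp_continuous_map[OF hm])
 hence phic: "ctm (subtop T U) euclidean phi" by (simp add: Euclidean_space_eq ctm_into)
 have "open (\<Inter>i\<in>{..<d}. {y :: nat => real. abs(y i - phi \<one> i) < r})" by (intro open_INT open_Collect_less ballI continuous_intros) auto
 from open_vim[OF phic, of "\<Inter>i\<in>{..<d}. {y. abs(y i - phi \<one> i) < r}"] this
 have "openin (subtop T U) V" using UT by (simp add: V_def Int_absorb1)
 hence V: "openin T V" using U(1) by (simp add: openin_open_subtopology)
 obtain n rho where rho: "rep n rho" "!!x. x : cG - V ==> rho x ~= 1"
  by (rule rep_cover[of "cG - V"]) (use V closedin_diff[OF closedin_topspace V] Uphi(2) r(1) in "auto simp: V_def")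
 have "x = \<one>" if x: "x : cG" "rho x = 1" for x
 proof -
  define D where "D x = (\<Sum>i<d. abs(phi x i - phi \<one> i))" for x
  define q where "q k = ((%y. y ** y) ^^ k) x" for k :: nat
  have q: "q k : cG & rho (q k) = 1" for k by (induction k) (use x rho(1) in "auto simp: q_def rep_def")
  hence qV: "q k : V" for k using rho(2)[of "q k"] by blast
  have "(3/2) ^ k * D x <= D (q k)" for k
  proof (induction k)
   case (Suc k)
   have "3/2 * D (q k) <= D (q (Suc k))" using r(2)[of "q k"] qV[of k] by (simp add: V_def D_def q_def)
   thus ?case using Suc by simp
  qed (simp add: q_def)
  moreover have "D (q k) <= real d * r" for k
   unfolding D_def using qV[of k] sum_bounded_above[of "{..<d}" "%i. abs(phi (q k) i - phi \<one> i)" r] by (auto simp: V_def less_imp_le)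
  ultimately have b: "(3/2) ^ k * D x <= real d * r" for k using order_trans by blast
  have D0: "0 <= D x" by (simp add: D_def sum_nonneg)
  have "D x = 0"
  proof (rule ccontr)
   assume "D x ~= 0"
   hence "0 < D x" using D0 by simp
   moreover obtain k where "real d * r / D x < (3/2) ^ k" using real_arch_pow[of "3/2"] by auto
   ultimately show False using b[of k] by (simp add: pos_divide_less_eq)
  qed
  hence e: "phi x i = phi \<one> i" if "i < d" for i using that by (simp add: D_def sum_nonneg_eq_0_iff)
  have xU: "x : U" using qV[of 0] by (simp add: V_def q_def)
  have "phi y i = 0" if "y : U" "d <= i" for y i using openin_subset[OF phiU] that by (auto simp: Euclidean_space_eq)
  hence "phi x = phi \<one>" using e xU Uphi(2) by (metis ext not_le)
  thus ?thesis using inj_onD[OF homeomorphic_imp_injective_map[OF hm]] xU Uphi(2) UT by (simp add: Int_absorb1)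
 qed
 thus ?thesis using rho(1) unfolding faithful_def by blast
qed

end

section \<open>From local slices to faithful representations\<close>

lemma compact_action_if_continuous_action:
 "compact_group G T ==> continuous_action G T X phi ==> compact_action G T X phi" by (simp add: compact_action_def continuous_action_def compact_action_axioms_def)

context compact_group
begin

lemma faithful_rep_if_local_slices:
 assumes slice: "!!(X :: ('a set set + 'x) topology) phi x. compact_space X ==> Hausdorff_space X ==>
   continuous_action G T X phi ==> free_action G X phi ==> x : tsp X ==> local_slice G T X phi x"
 shows "EX n rho. rep n rho & faithful rho"
proof (cases "finite cG")
 \<comment> \<open>In a finite group the complement of \<open>\<one>\<close> is closed and one
   representation detects it; the coding of the test space below asks for an infinite group.\<close>
 case True
 hence "closedin T (cG - {\<one>})" using Hausdorff by (intro closedin_Hausdorff_finite) auto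
 then obtain n rho where "rep n rho" "!!x. x : cG - {\<one>} ==> rho x ~= 1" by (rule rep_cover) auto
 thus ?thesis unfolding faithful_def by blast
next
 case False
 \<comment> \<open>One representation is chosen for each kernel. The factors of the test space are
   thereby indexed by subsets of the group, which bounds its cardinality.\<close>
 define KK where "KK = {K. EX n rho. rep n rho & K = {g : cG. rho g = 1}}"
 hence "ALL K:KK. EX q. rep (fst q) (snd q) & K = {g : cG. snd q g = 1}" by simp
 from bchoice[OF this] obtain q where q: "!!K. K : KK ==> rep (fst (q K)) (snd (q K)) & K = {g : cG. snd (q K) g = 1}" by blast
 define n rho where "n K = fst (q K)" and "rho K = snd (q K)" for K
 have rho: "rep (n K) (rho K)" "K = {g : cG. rho K g = 1}" if "K : KK" for K using q[OF that] by (simp_all add: n_def rho_def)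
 have sep: "g = \<one>" if g: "g : cG" "!!K. K : KK ==> rho K g = 1" for g
 proof (rule ccontr)
  assume "g ~= \<one>"
  then obtain m sg where sg: "rep m sg" "sg g ~= 1" using Peter_Weyl[of g] g(1) by blast
  define K where "K = {g : cG. sg g = 1}"
  have "K : KK" unfolding KK_def K_def using sg(1) by blast
  hence "g : K" using rho(2) g by blast
  thus False using sg(2) by (simp add: K_def)
 qed
 obtain iot :: "('a set => op \<times> op) => 'a set set" where iot: "inj_on iot (tsp (joins KK n rho))"
 proof (rule joins_injection[of KK n rho])
  show "g = \<one>" if "g : cG" "!!K. K : KK ==> rho K g = 1" for g using that by (rule sep)
 qed (use rho(1) False in auto)
 have "inj_on (%z. Inl (iot z) :: 'a set set + 'x) (tsp (joins KK n rho))" using iot by (simp add: inj_on_def)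
 hence "local_slice G T (joins KK n rho) (jacts KK rho) (\<lambda>K\<in>KK. jpt n rho K 0 \<one> \<one>)"
  using joins_space[OF rho(1) sep] joins_action[OF rho(1) sep] jpt_join[OF rho(1) sep]
  by (intro local_slice_transport[OF slice]) (auto simp: topspace_joins[OF rho(1) sep])
 from faithful_rep_if_local_slice[OF rho(1) sep this] show ?thesis .
qed

lemma local_slice_if_locally_trivial:
 assumes "continuous_action G T X phi" "ltpb G T X phi" "x : tsp X"
 shows "local_slice G T X phi x"
proof -
 interpret compact_action G T X phi by (rule compact_action_if_continuous_action[OF compact_group_axioms assms(1)])
 show ?thesis using equivariant_map_if_locally_trivial[OF assms(2,3)] unfolding local_slice_def by metis
qed

text \<open>For the trivial subgroup all cosets are singletons, and \<open>the_elem\<close> is a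
  continuous identification of the quotient group with \<open>G\<close>; composing with it turns
  slices for the quotient action into slices for the original one.\<close>

lemma local_slice_if_trivial_quotient:
 assumes act: "continuous_action G T X phi" and fr: "free_action G X phi" and x: "x : tsp X"
  and lt: "ltpb (G Mod {\<one>}) (coset_topology G T {\<one>}) X (quotient_action phi)"
 shows "local_slice G T X phi x"
proof -
 let ?C = "coset_topology G T {\<one>}"
 have n: "normal {\<one>} G" "closedin T {\<one>}" using one_is_normal closedin_Hausdorff_singleton[OF Hausdorff, of \<one>] by simp_all
 have stab: "stabilizer G phi y = {\<one>}" if "y : tsp X" for y using fr that by (simp add: free_action_def)
 interpret Q: compact_action "G Mod {\<one>}" ?C X "quotient_action phi" by (rule compact_action_quotient(1)[OF n act]) (rule stab)
 have cos: "{\<one>} #> g = {g}" if "g : cG" for g using that by (simp add: r_coset_def)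
 have "ctm T T (the_elem o (%g. {\<one>} #> g))" by (rule continuous_map_eq[OF continuous_map_id]) (auto simp: cos)
 from continuous_compose_quotient_map[OF quotient_map_quotient_topology this]
 have ce: "ctm ?C T the_elem" by (simp add: coset_topology_def)
 obtain P kap where P: "openin X P" "x : P" "ctm (subtop X P) ?C kap"
  "!!g y. g : carrier (G Mod {\<one>}) ==> y : P ==> quotient_action phi g y : P & kap (quotient_action phi g y) = g \<otimes>\<^bsub>G Mod {\<one>}\<^esub> kap y"
  by (rule Q.equivariant_map_if_locally_trivial[OF lt x]) blast
 have PX: "y : tsp X" if "y : P" for y using openin_subset[OF P(1)] that by blast
 have "phi g y : P & the_elem (kap (phi g y)) = g ** the_elem (kap y)" if g: "g : cG" and y: "y : P" for g y
 proof -
  have "kap y : tsp ?C" using continuous_map_image_subset_topspace[OF P(3)] PX[OF y] y by force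
  then obtain k where k: "k : cG" "kap y = {\<one>} #> k" by (auto simp: coset_topology_def)
  have q: "quotient_action phi ({\<one>} #> g) y = phi g y"
   using act stab by (intro quotient_action_coset[OF _ triv_subgroup g PX[OF y]]) (auto simp: continuous_action_def)
  have "{\<one>} #> g : carrier (G Mod {\<one>})" using g by (auto simp: carrier_quotient[OF n])
  from P(4)[OF this y] have "phi g y : P & kap (phi g y) = ({\<one>} #> g) <#> ({\<one>} #> k)" by (simp add: q k(2))
  thus ?thesis using g k by (simp add: set_mult_def cos)
 qed
 moreover have "ctm (subtop X P) T (%y. the_elem (kap y))" using ctm_o[OF P(3) ce] by (simp add: o_def)
 ultimately show ?thesis unfolding local_slice_def using P(1,2) by blast
qed

end

theorem theoremA:
  fixes G :: "('a, 'm) monoid_scheme" and T :: "'a topology"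
  assumes "compact_group G T"
  shows
    "(metrizable_space (abelianized_component_topology G T) \<longrightarrow>
       (Lie_group G T \<longleftrightarrow>
          (\<forall>(X :: ('a set set + 'x) topology) \<phi>.
             completely_regular_space X \<and> Hausdorff_space X \<and>
             continuous_action G T X \<phi> \<and> free_action G X \<phi> \<longrightarrow>
             locally_trivial_principal_bundle G T X \<phi>)) \<and>
       (Lie_group G T \<longleftrightarrow>
          (\<forall>(X :: ('a set set + 'x) topology) \<phi>.
             compact_space X \<and> Hausdorff_space X \<and>
             continuous_action G T X \<phi> \<and> free_action G X \<phi> \<longrightarrow>
             locally_trivial_principal_bundle G T X \<phi>))) \<and>
     (connected_space T \<longrightarrow>
       (Lie_group G T \<longleftrightarrow>
          (\<forall>H (X :: ('a set set + 'x) topology) \<phi>.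
             closedin T H \<and> central_subgroup H G \<and>
             completely_regular_space X \<and> Hausdorff_space X \<and>
             continuous_action G T X \<phi> \<and>
             (\<forall>x\<in>topspace X. stabilizer G \<phi> x = H) \<longrightarrow>
             locally_trivial_principal_bundle (G Mod H) (coset_topology G T H) X
               (quotient_action \<phi>))) \<and>
       (Lie_group G T \<longleftrightarrow>
          (\<forall>H (X :: ('a set set + 'x) topology) \<phi>.
             closedin T H \<and> central_subgroup H G \<and>
             compact_space X \<and> Hausdorff_space X \<and>
             continuous_action G T X \<phi> \<and>
             (\<forall>x\<in>topspace X. stabilizer G \<phi> x = H) \<longrightarrow>
             locally_trivial_principal_bundle (G Mod H) (coset_topology G T H) X
               (quotient_action \<phi>))))"
proof -
 interpret compact_group G T by (rule assms)
 note cr = compact_Hausdorff_imp_completely_regular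
 \<comment> \<open>All four equivalences are reduced to the existence of a faithful
   representation.\<close>
 have lie: "Lie_group G T <-> (EX n rho. rep n rho & faithful rho)" using faithful_rep_if_Lie_group Lie_group_if_faithful_rep by blast
 have free: "ltpb G T X phi"
  if "Lie_group G T" "completely_regular_space X" "Hausdorff_space X" "continuous_action G T X phi" "free_action G X phi"
  for X :: "('a set set + 'x) topology" and phi
 proof -
  interpret A: compact_action G T X phi by (rule compact_action_if_continuous_action[OF assms that(4)])
  show ?thesis using that(1) A.faithful_rep_imp_principal[OF _ _ that(5,2,3)] unfolding lie by blast
 qed
 have quotient: "ltpb (G Mod H) (coset_topology G T H) X (quotient_action phi)"
  if "Lie_group G T" "closedin T H" "central_subgroup H G" "completely_regular_space X" "Hausdorff_space X"
   "continuous_action G T X phi" "ALL x:tsp X. stabilizer G phi x = H"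
  for H and X :: "('a set set + 'x) topology" and phi using that lie faithful_rep_imp_quotient_principal by blast
 have slices: "Lie_group G T"
  if "ALL (X :: ('a set set + 'x) topology) phi. compact_space X & Hausdorff_space X & continuous_action G T X phi &
   free_action G X phi --> ltpb G T X phi" unfolding lie by (rule faithful_rep_if_local_slices[where 'x = 'x], rule local_slice_if_locally_trivial) (use that in auto)
 have quotient_slices: "Lie_group G T"
  if q: "ALL H (X :: ('a set set + 'x) topology) phi. closedin T H & central_subgroup H G & compact_space X & Hausdorff_space X &
   continuous_action G T X phi & (ALL x:tsp X. stabilizer G phi x = H) -->
   ltpb (G Mod H) (coset_topology G T H) X (quotient_action phi)" unfolding lie
 proof (rule faithful_rep_if_local_slices[where 'x = 'x], rule local_slice_if_trivial_quotient, assumption+)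
  fix X :: "('a set set + 'x) topology" and phi
  assume "compact_space X" "Hausdorff_space X" "continuous_action G T X phi" "free_action G X phi"
  moreover have "closedin T {\<one>\<^bsub>G\<^esub>}" using closedin_Hausdorff_singleton[OF Hausdorff, of "\<one>\<^bsub>G\<^esub>"] by simp
  moreover have "central_subgroup {\<one>\<^bsub>G\<^esub>} G" using triv_subgroup by (simp add: central_subgroup_def)
  ultimately show "ltpb (G Mod {\<one>\<^bsub>G\<^esub>}) (coset_topology G T {\<one>\<^bsub>G\<^esub>}) X (quotient_action phi)"
   by (intro q[rule_format]) (auto simp: free_action_def)
 qed
 show ?thesis
  by (intro conjI impI iffI allI, (rule free; use cr in blast), (rule slices; use cr in blast), (rule free; use cr in blast), (rule slices; use cr in blast),
   (rule quotient; use cr in blast), (rule quotient_slices; use cr in blast), (rule quotient; use cr in blast), (rule quotient_slices; use cr in blast))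
qed

end
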